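(* Each of the following dynamic problems on directed graphs with $n$ vertices: (1) incremental transitive closure, (2) decremental transitive closure, (3) incremental $(1+\epsilon)$-approximate unweighted all-pairs shortest paths, (4) decremental $(1+\epsilon)$-approximate unweighted all-pairs shortest paths, each with a predicted sequence of edge updates, can be solved by a deterministic algorithm with $\tilde{O}(n^{(3+\omega)/2})$ preprocessing time, $\tilde{O}(1)$ worst-case edge update time, and $\tilde{O}(\eta^2)$ query time, where $\eta$ is the prediction error at the time of the query (defined below), which satisfies $\eta\le\eta_\infty$.
   Context: $\omega$ is the matrix multiplication exponent and $\tilde O$ hides polylogarithmic factors in $n$. Incremental version: the algorithm first receives (offline) a predicted sequence $\hat e_1,\dots,\hat e_m$ of distinct directed edges on vertex set $V$, $|V|=n$; starting from the empty graph, it then receives online an interleaved sequence of edge insertions $e_1,\dots,e_m$ (the same set of edges, in some order) and queries $(s,t)\in V\times V$. Decremental version: the predicted sequence $\hat e_1,\dots,\hat e_m$ is the predicted order of deletion, the initial graph has edge set $\{\hat e_1,\dots,\hat e_m\}$, and the online updates are edge deletions $e_1,\dots,e_m$ (the same set of edges in some order) interleaved with queries. For transitive closure, a query $(s,t)$ must answer whether there is a directed path from $s$ to $t$ in the current graph; for $(1+\epsilon)$-approximate unweighted APSP, it must output a number in $[d(s,t),(1+\epsilon)d(s,t)]$, where $d(s,t)$ is the current shortest-path length (number of edges). Let $t(e)=i$ if $e=e_i$ and $\hat t(e)=j$ if $e=\hat e_j$, and $\eta_\infty=\max_e |t(e)-\hat t(e)|$. The prediction error $\eta$ for a query asked between the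 $i$-th and $(i+1)$-th update is: in the incremental case $\eta=i-\max\{j : \{\hat e_1,\dots,\hat e_j\}\subseteq\{e_1,\dots,e_i\}\}$; in the decremental case $\eta=\min\{j : \{\hat e_j,\dots,\hat e_m\}\cap\{e_1,\dots,e_i\}=\emptyset\}-i-1$. *)

theory Defs
  imports Complex_Main
begin

unbundle bit_operations_syntax

section \<open>Word RAM\<close>

text \<open>
  Deterministic word RAM in structured form. A program mentions finitely many registers and finitely
  many memory banks, each an array addressed by machine words; several banks instead of one memory
  change running times by a constant factor only. Every value is a \<open>w\<close>-bit word, arithmetic is modulo
  \<open>2 ^ w\<close>, and every elementary operation and every branching test takes unit time.
\<close>

datatype binop = Add | Sub | Mul | Div | Mod | And | Or | Xor | Shl | Shr | Less | Eq

datatype prog =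
    Skip
  | Imm nat nat
  | Move nat nat
  | Bin binop nat nat nat
  | Load nat nat nat
  | Store nat nat nat
  | Seq prog prog
  | Cond nat prog prog
  | Loop nat prog

record state =
  reg :: "nat \<Rightarrow> nat"
  mem :: "nat \<Rightarrow> nat \<Rightarrow> nat"

fun binop_val :: "nat \<Rightarrow> binop \<Rightarrow> nat \<Rightarrow> nat \<Rightarrow> nat" where
  "binop_val w Add x y = (x + y) mod 2 ^ w"
| "binop_val w Sub x y = nat ((int x - int y) mod 2 ^ w)"
| "binop_val w Mul x y = (x * y) mod 2 ^ w"
| "binop_val w Div x y = x div y"
| "binop_val w Mod x y = x mod y"
| "binop_val w And x y = x AND y"
| "binop_val w Or x y = x OR y"
| "binop_val w Xor x y = x XOR y"
| "binop_val w Shl x y = (x * 2 ^ y) mod 2 ^ w"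
| "binop_val w Shr x y = x div 2 ^ y"
| "binop_val w Less x y = of_bool (x < y) mod 2 ^ w"
| "binop_val w Eq x y = of_bool (x = y) mod 2 ^ w"

definition set_reg :: "nat \<Rightarrow> nat \<Rightarrow> state \<Rightarrow> state" where
  "set_reg r v s = s\<lparr>reg := (reg s)(r := v)\<rparr>"

definition set_mem :: "nat \<Rightarrow> nat \<Rightarrow> nat \<Rightarrow> state \<Rightarrow> state" where
  "set_mem b i v s = s\<lparr>mem := (mem s)(b := (mem s b)(i := v))\<rparr>"

text \<open>
  \<open>exec w p s t s'\<close>: with word size \<open>w\<close>, program \<open>p\<close> started in \<open>s\<close> halts in \<open>s'\<close> after \<open>t\<close> steps.
\<close>

inductive exec :: "nat \<Rightarrow> prog \<Rightarrow> state \<Rightarrow> nat \<Rightarrow> state \<Rightarrow> bool" for w :: nat where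
  "exec w Skip s 1 s"
| "exec w (Imm r k) s 1 (set_reg r (k mod 2 ^ w) s)"
| "exec w (Move r x) s 1 (set_reg r (reg s x) s)"
| "exec w (Bin f r x y) s 1 (set_reg r (binop_val w f (reg s x) (reg s y)) s)"
| "exec w (Load r b i) s 1 (set_reg r (mem s b (reg s i)) s)"
| "exec w (Store b i x) s 1 (set_mem b (reg s i) (reg s x) s)"
| "exec w p s t s' \<Longrightarrow> exec w q s' t' s'' \<Longrightarrow> exec w (Seq p q) s (t + t') s''"
| "reg s x \<noteq> 0 \<Longrightarrow> exec w p s t s' \<Longrightarrow> exec w (Cond x p q) s (t + 1) s'"
| "reg s x = 0 \<Longrightarrow> exec w q s t s' \<Longrightarrow> exec w (Cond x p q) s (t + 1) s'"
| "reg s x = 0 \<Longrightarrow> exec w (Loop x p) s 1 s"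
| "reg s x \<noteq> 0 \<Longrightarrow> exec w p s t s' \<Longrightarrow> exec w (Loop x p) s' t' s''
     \<Longrightarrow> exec w (Loop x p) s (t + t' + 1) s''"

inductive_cases exec_SkipE: "exec w Skip s t s'"
inductive_cases exec_ImmE: "exec w (Imm r k) s t s'"
inductive_cases exec_MoveE: "exec w (Move r x) s t s'"
inductive_cases exec_BinE: "exec w (Bin f r x y) s t s'"
inductive_cases exec_LoadE: "exec w (Load r b i) s t s'"
inductive_cases exec_StoreE: "exec w (Store b i x) s t s'"
inductive_cases exec_SeqE: "exec w (Seq p q) s t s'"
inductive_cases exec_CondE: "exec w (Cond x p q) s t s'"
inductive_cases exec_LoopE: "exec w (Loop x p) s t s'"

lemma exec_deterministic:
  "exec w p s t s' \<Longrightarrow> exec w p s u s'' \<Longrightarrow> u = t \<and> s'' = s'"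
proof (induction arbitrary: u s'' rule: exec.induct)
  case (7 p s t s' q t' s''')
  from 7(5) obtain t1 s1 t2 where e: "exec w p s t1 s1" "exec w q s1 t2 s''" "u = t1 + t2"
    by (rule exec_SeqE)
  from 7(3)[OF e(1)] have "t1 = t" "s1 = s'" by simp_all
  with 7(4)[of t2 s''] e show ?case by simp
next
  case (8 s x p t s' q)
  from 8(4) show ?case
    by (rule exec_CondE) (use 8(1,3) in auto)
next
  case (9 s x q t s' p)
  from 9(4) show ?case
    by (rule exec_CondE) (use 9(1,3) in auto)
next
  case (10 s x p)
  from 10(2) show ?case
    by (rule exec_LoopE) (use 10(1) in auto)
next
  case (11 s x p t s' t' s''')
  from 11(6) obtain t1 s1 t2 where
    e: "exec w p s t1 s1" "exec w (Loop x p) s1 t2 s''" "u = t1 + t2 + 1"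
    by (rule exec_LoopE) (use 11(1) in auto)
  from 11(4)[OF e(1)] have "t1 = t" "s1 = s'" by simp_all
  with 11(5)[of t2 s''] e show ?case by simp
qed (auto elim: exec_SkipE exec_ImmE exec_MoveE exec_BinE exec_LoadE exec_StoreE)

definition word_state :: "nat \<Rightarrow> state \<Rightarrow> bool" where
  "word_state w s \<longleftrightarrow> (\<forall>r. reg s r < 2 ^ w) \<and> (\<forall>b i. mem s b i < 2 ^ w)"

text \<open>
  \<open>soft_O C c n x\<close> is the bound \<open>C \<cdot> x \<cdot> polylog n\<close>; the summand 1 keeps the logarithmic factor
  positive at \<open>n = 1\<close>.
\<close>

definition soft_O :: "real \<Rightarrow> nat \<Rightarrow> nat \<Rightarrow> real \<Rightarrow> real" where
  "soft_O C c n x = C * x * (1 + log 2 (real n)) ^ c"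

text \<open>
  Word size of order at least \<open>log n\<close>, with a constant \<open>\<kappa>\<close> that may depend on the program. Programs
  below are required to work for all such word sizes, and memory outside the input is uninitialised
  (arbitrary).
\<close>

definition word_size_ok :: "real \<Rightarrow> nat \<Rightarrow> nat \<Rightarrow> bool" where
  "word_size_ok \<kappa> n w \<longleftrightarrow> \<kappa> * (1 + log 2 (real n)) \<le> real w"


section \<open>The matrix multiplication exponent\<close>

text \<open>
  Integers are stored in two's complement, matrices row by row.
\<close>

definition stores_matrix :: "nat \<Rightarrow> nat \<Rightarrow> nat \<Rightarrow> (nat \<Rightarrow> nat \<Rightarrow> int) \<Rightarrow> state \<Rightarrow> bool" where
  "stores_matrix w n b A s \<longleftrightarrow> (\<forall>i<n. \<forall>j<n. mem s b (i * n + j) = nat (A i j mod 2 ^ w))"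

definition matmul_time :: "real \<Rightarrow> bool" where
  "matmul_time \<tau> \<longleftrightarrow>
     (\<forall>k::nat. \<exists>P \<kappa> C c. \<forall>n\<ge>1. \<forall>w. word_size_ok \<kappa> n w \<longrightarrow>
        (\<forall>A B s. word_state w s \<and> reg s 0 = n
            \<and> (\<forall>i<n. \<forall>j<n. \<bar>A i j\<bar> \<le> int n ^ k \<and> \<bar>B i j\<bar> \<le> int n ^ k)
            \<and> stores_matrix w n 0 A s \<and> stores_matrix w n 1 B s \<longrightarrow>
          (\<exists>t s'. exec w P s t s' \<and> real t \<le> soft_O C c n (real n powr \<tau>)
            \<and> stores_matrix w n 2 (\<lambda>i j. \<Sum>l<n. A i l * B l j) s')))"

text \<open>
  The infimum need not be attained, so multiplication in \<open>n\<^sup>\<omega> polylog n\<close> steps for \<open>\<omega> = matmul_exponent\<close>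
  itself means \<open>matmul_time matmul_exponent\<close>, while \<open>n\<^sup>\<tau> polylog n\<close> steps suffice for every \<open>\<tau> > \<omega>\<close>.
\<close>

definition matmul_exponent :: real where
  "matmul_exponent = Inf {\<tau>. matmul_time \<tau>}"


section \<open>Partially dynamic graph problems with predicted updates\<close>

type_synonym edge = "nat \<times> nat"

datatype update_mode = Incremental | Decremental

fun current_graph :: "update_mode \<Rightarrow> edge list \<Rightarrow> edge list \<Rightarrow> edge set" where
  "current_graph Incremental pred es = set es"
| "current_graph Decremental pred es = set pred - set es"

text \<open>
  Here \<open>es\<close> is the list of the updates \<open>e\<^sub>1, \<dots>, e\<^sub>i\<close> made so far, and the lists are indexed from 0, so
  \<open>drop (j - 1) pred\<close> consists of the predicted updates from the \<open>j\<close>-th one on.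
\<close>

fun prediction_error :: "update_mode \<Rightarrow> edge list \<Rightarrow> edge list \<Rightarrow> int" where
  "prediction_error Incremental pred es =
     int (length es) - int (Max {j. j \<le> length pred \<and> set (take j pred) \<subseteq> set es})"
| "prediction_error Decremental pred es =
     int (Min {j. 1 \<le> j \<and> j \<le> length pred + 1 \<and> set (drop (j - 1) pred) \<inter> set es = {}})
       - int (length es) - 1"

text \<open>The element 0 matters only when there are no edges at all.\<close>

definition eta_infinity :: "edge list \<Rightarrow> edge list \<Rightarrow> int" where
  "eta_infinity pred es =
     Max (insert 0 {\<bar>int i - int j\<bar> | i j. i < length es \<and> j < length pred \<and> es ! i = pred ! j})"

definition distance :: "edge set \<Rightarrow> nat \<Rightarrow> nat \<Rightarrow> nat" where
  "distance G u v = (LEAST k. (u, v) \<in> G ^^ k)"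

text \<open>
  Query answers are returned in registers 0 and 1. For distances, register 0 tells whether the
  answer is finite. Integral answers are no restriction, as rounding down an admissible real answer
  yields an admissible integer.
\<close>

definition transitive_closure_answer :: "edge set \<Rightarrow> nat \<Rightarrow> nat \<Rightarrow> state \<Rightarrow> bool" where
  "transitive_closure_answer G u v s \<longleftrightarrow> reg s 0 = of_bool ((u, v) \<in> G\<^sup>*)"

definition approx_apsp_answer :: "real \<Rightarrow> edge set \<Rightarrow> nat \<Rightarrow> nat \<Rightarrow> state \<Rightarrow> bool" where
  "approx_apsp_answer \<epsilon> G u v s \<longleftrightarrow>
     reg s 0 = of_bool ((u, v) \<in> G\<^sup>*) \<and>
     ((u, v) \<in> G\<^sup>* \<longrightarrow>
        real (reg s 1) \<in> {real (distance G u v) .. (1 + \<epsilon>) * real (distance G u v)})"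

datatype request = Update edge | Query nat nat

fun updates :: "request list \<Rightarrow> edge list" where
  "updates [] = []"
| "updates (Update e # rs) = e # updates rs"
| "updates (Query u v # rs) = updates rs"

definition pass_args :: "nat \<Rightarrow> nat \<Rightarrow> state \<Rightarrow> state" where
  "pass_args u v s = set_reg 1 v (set_reg 0 u s)"

text \<open>
  \<open>serves w U Q ub qb ans es s rs\<close>: from state \<open>s\<close>, reached after the updates \<open>es\<close>, the requests \<open>rs\<close>
  are served one after the other, each update by \<open>U\<close> in time \<open>ub\<close> and each query by \<open>Q\<close> in time
  \<open>qb es'\<close> with an answer satisfying \<open>ans es'\<close>, where \<open>es'\<close> are the updates made before the query.
\<close>

fun serves :: "nat \<Rightarrow> prog \<Rightarrow> prog \<Rightarrow> real \<Rightarrow> (edge list \<Rightarrow> real)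
    \<Rightarrow> (edge list \<Rightarrow> nat \<Rightarrow> nat \<Rightarrow> state \<Rightarrow> bool) \<Rightarrow> edge list \<Rightarrow> state \<Rightarrow> request list \<Rightarrow> bool" where
  "serves w U Q ub qb ans es s [] \<longleftrightarrow> True"
| "serves w U Q ub qb ans es s (Update e # rs) \<longleftrightarrow>
     (\<exists>t s'. exec w U (pass_args (fst e) (snd e) s) t s' \<and> real t \<le> ub
        \<and> serves w U Q ub qb ans (es @ [e]) s' rs)"
| "serves w U Q ub qb ans es s (Query u v # rs) \<longleftrightarrow>
     (\<exists>t s'. exec w Q (pass_args u v s) t s' \<and> real t \<le> qb es \<and> ans es u v s'
        \<and> serves w U Q ub qb ans es s' rs)"

definition valid_prediction :: "nat \<Rightarrow> edge list \<Rightarrow> bool" where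
  "valid_prediction n pred \<longleftrightarrow> distinct pred \<and> set pred \<subseteq> {..<n} \<times> {..<n}"

definition valid_updates :: "edge list \<Rightarrow> edge list \<Rightarrow> bool" where
  "valid_updates pred es \<longleftrightarrow> distinct es \<and> set es = set pred"

definition valid_requests :: "nat \<Rightarrow> edge list \<Rightarrow> request list \<Rightarrow> bool" where
  "valid_requests n pred rs \<longleftrightarrow>
     valid_updates pred (updates rs) \<and> (\<forall>u v. Query u v \<in> set rs \<longrightarrow> u < n \<and> v < n)"

definition stores_prediction :: "nat \<Rightarrow> edge list \<Rightarrow> state \<Rightarrow> bool" where
  "stores_prediction n pred s \<longleftrightarrow>
     reg s 0 = n \<and> reg s 1 = length pred \<and>
     (\<forall>j<length pred. mem s 0 j = fst (pred ! j) \<and> mem s 1 j = snd (pred ! j))"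

text \<open>
  The three programs preprocess the prediction, perform one update and answer one query, with
  preprocessing time \<open>n\<^sup>a\<close>, worst-case update time 1 and query time \<open>\<eta>\<^sup>2\<close>, all up to constant and
  polylogarithmic factors. The query bound is read as \<open>1 + \<eta>\<^sup>2\<close>, since a query takes at least
  one step also when \<open>\<eta> = 0\<close>.
\<close>

definition solvable_with_predictions ::
    "update_mode \<Rightarrow> (edge set \<Rightarrow> nat \<Rightarrow> nat \<Rightarrow> state \<Rightarrow> bool) \<Rightarrow> real \<Rightarrow> bool" where
  "solvable_with_predictions mode answer a \<longleftrightarrow>
     (\<exists>P U Q \<kappa> C c. \<forall>n\<ge>1. \<forall>w. word_size_ok \<kappa> n w \<longrightarrow>
        (\<forall>pred s. valid_prediction n pred \<and> word_state w s \<and> stores_prediction n pred s \<longrightarrow>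
          (\<exists>t s'. exec w P s t s' \<and> real t \<le> soft_O C c n (real n powr a) \<and>
            (\<forall>rs. valid_requests n pred rs \<longrightarrow>
               serves w U Q
                 (soft_O C c n 1)
                 (\<lambda>es. soft_O C c n (1 + (real_of_int (prediction_error mode pred es))\<^sup>2))
                 (\<lambda>es. answer (current_graph mode pred es))
                 [] s' rs))))"

end

theory Submission
  imports Defs
begin

text \<open>
  Let \<open>D\<^sub>k[u, v]\<close> be the least \<open>j\<close> such that the predicted graph with the first \<open>j\<close> edges (for deletions:
  with the last \<open>j\<close> edges) has a path of at most \<open>L\<^sub>k\<close> edges from \<open>u\<close> to \<open>v\<close>. Then \<open>D\<^sub>a\<close> and \<open>D\<^sub>b\<close> have a
  (min, max) product that belongs to the length \<open>L\<^sub>a + L\<^sub>b\<close>, so \<open>O(q log n)\<close> products yield lengths \<open>L\<^sub>k\<close> that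
  grow by factors of at most \<open>1 + 1 / q\<close> up to \<open>n\<^sup>2\<close>. For every \<open>j\<close> the distances in the \<open>j\<close>-th predicted graph
  can be read off from the matrices \<open>D\<^sub>k\<close> up to this factor.

  A (min, max) product is computed in time \<open>n\<^bsup>(3 + \<tau>) / 2\<^esup>\<close> after Duan and Pettie: the entries of one matrix
  are sorted and cut into parts of about \<open>n s\<close> entries, the rows and columns of a part are cut into chunks
  of at most \<open>s\<close> entries, one Boolean product per part tells which chunks contain a witness, and for every
  output entry a single chunk is scanned. The balancing value of \<open>s\<close> depends on \<open>\<tau>\<close>, which need not be
  computable; therefore \<open>s\<close> is adjusted to the counted steps of the multiplications made so far.

  At a query, all but \<open>\<eta>\<close> edges of the current graph belong to the largest predicted graph that it
  contains. A shortest path alternates between the remaining \<open>\<eta>\<close> edges and paths in the predicted graph,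
  so Dijkstra's algorithm on \<open>\<eta> + 2\<close> nodes finds its length. Updates maintain the maximal runs of updated
  positions, from which a query lists the \<open>\<eta>\<close> edges in time \<open>O(\<eta>)\<close>.
\<close>

section \<open>A program logic for the word RAM\<close>

text \<open>A maximum of \<open>A (i, k)\<close> and \<open>B (k, j)\<close> is attained by one of
  the two, so a (min, max) product is the smaller of two half products: the least
  \<open>A (i, k)\<close> with \<open>B (k, j) \<le> A (i, k)\<close>, and the same for the
  exchanged transposes. With parts of \<open>n * s\<close> entries there are about
  \<open>n / s\<close> Boolean products and, since sortedness lets every pair (row or column,
  \<open>j\<close>) cause at most one scan, about \<open>n * n\<close> scans of \<open>s\<close>
  entries. The obstacle is to balance the two without knowing \<open>\<tau>\<close>. If
  \<open>c\<close> steps are counted so far, \<open>s = c div (n * n) + 1\<close> keeps the cost of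
  the scans near \<open>c\<close>, while a part advances by at least \<open>c / n\<close> entries
  and adds at most \<open>T + n * n\<close> to \<open>c\<close>. Hence \<open>c * c\<close> grows by
  about \<open>2 * n * (T + n * n)\<close> per entry at most and ends near
  \<open>(T + n * n) * n ^ 3\<close>, whose root gives the exponent \<open>(3 + \<tau>) / 2\<close>.
  Two facts frame the estimate: multiplication takes at least \<open>n * n\<close> steps, which
  absorbs the overhead \<open>n * n\<close>, and cubic multiplication exists, so
  \<open>\<tau> \<le> 3\<close> may be assumed and all numbers stay polynomial in \<open>n\<close>,
  within words of order \<open>log n\<close> bits.\<close>

definition wlim :: "nat \<Rightarrow> nat" where "wlim w = 2 ^ w"

lemma wlim_pos [simp]: "0 < wlim w"
  by (simp add: wlim_def)

lemma one_less_wlim [simp]: "0 < w \<Longrightarrow> Suc 0 < wlim w"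
  using one_less_power[of "2::nat" w] by (simp add: wlim_def)

lemma binop_val_less: "x < 2 ^ w \<Longrightarrow> y < 2 ^ w \<Longrightarrow> binop_val w f x y < 2 ^ w"
proof (cases f)
  case Sub
  have "nat ((int x - int y) mod 2 ^ w) < 2 ^ w"
    by (simp add: nat_less_iff)
  with Sub show ?thesis by simp
next
  case Div
  assume "x < 2 ^ w"
  with Div show ?thesis
    by simp (metis div_le_dividend le_less_trans)
next
  case Mod
  assume "x < 2 ^ w"
  with Mod show ?thesis
    by simp (metis mod_less_eq_dividend le_less_trans)
next
  case And
  assume "x < 2 ^ w" "y < 2 ^ w"
  then have "take_bit w (x AND y) = x AND y"
    by (simp add: take_bit_and take_bit_nat_eq_self)
  with And show ?thesis
    by (metis binop_val.simps(6) take_bit_nat_eq_self_iff)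
next
  case Or
  assume "x < 2 ^ w" "y < 2 ^ w"
  then have "take_bit w (x OR y) = x OR y"
    by (simp add: take_bit_or take_bit_nat_eq_self)
  with Or show ?thesis
    by (metis binop_val.simps(7) take_bit_nat_eq_self_iff)
next
  case Xor
  assume "x < 2 ^ w" "y < 2 ^ w"
  then have "take_bit w (x XOR y) = x XOR y"
    by (simp add: take_bit_xor take_bit_nat_eq_self)
  with Xor show ?thesis
    by (metis binop_val.simps(8) take_bit_nat_eq_self_iff)
next
  case Shr
  assume "x < 2 ^ w"
  with Shr show ?thesis
    by simp (metis div_le_dividend le_less_trans)
qed simp_all

lemma exec_word_state:
  "exec w p s t s' \<Longrightarrow> word_state w s \<Longrightarrow> word_state w s'"
  by (induction rule: exec.induct)
    (auto simp: word_state_def set_reg_def set_mem_def simp del: binop_val.simps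
      intro!: binop_val_less)

text \<open>The clock is a ghost component: \<open>wp\<close> ties it to the steps of
  \<open>exec\<close>, so time bounds, also amortized ones, become ordinary assertions about
  states.\<close>

record vstate =
  var :: "nat \<Rightarrow> nat"
  arr :: "nat \<Rightarrow> nat \<Rightarrow> nat"
  clk :: nat

text \<open>
  Registers below 64 hold the variables of a program, registers 64 to 127 the intermediate values of
  expressions and the constants of subroutines.
\<close>

definition repr :: "nat \<Rightarrow> vstate \<Rightarrow> state \<Rightarrow> bool" where
  "repr w h s \<longleftrightarrow> word_state w s \<and> (\<forall>r<64. reg s r = var h r) \<and> mem s = arr h"

definition words :: "nat \<Rightarrow> vstate \<Rightarrow> bool" where
  "words w h \<longleftrightarrow> (\<forall>r<64. var h r < wlim w) \<and> (\<forall>b i. arr h b i < wlim w)"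

text \<open>Total correctness with exact time. Many machine states represent the same
  \<open>h\<close>; quantifying over all of them makes the result independent of the
  temporaries.\<close>

definition wp :: "nat \<Rightarrow> prog \<Rightarrow> (vstate \<Rightarrow> bool) \<Rightarrow> vstate \<Rightarrow> bool" where
  "wp w p Q h \<longleftrightarrow> (\<forall>s. repr w h s \<longrightarrow>
     (\<exists>t s' h'. exec w p s t s' \<and> repr w h' s' \<and> clk h' = clk h + t \<and> Q h'))"

definition upd :: "nat \<Rightarrow> nat \<Rightarrow> nat \<Rightarrow> vstate \<Rightarrow> vstate" where
  "upd r v k h = h\<lparr>var := (var h)(r := v), clk := clk h + k\<rparr>"

definition wrt :: "nat \<Rightarrow> nat \<Rightarrow> nat \<Rightarrow> nat \<Rightarrow> vstate \<Rightarrow> vstate" where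
  "wrt b i v k h = h\<lparr>arr := (arr h)(b := (arr h b)(i := v)), clk := clk h + k\<rparr>"

definition tick :: "nat \<Rightarrow> vstate \<Rightarrow> vstate" where
  "tick k h = h\<lparr>clk := clk h + k\<rparr>"

lemma upd_simps [simp]:
  "var (upd r v k h) = (var h)(r := v)" "arr (upd r v k h) = arr h" "clk (upd r v k h) = clk h + k"
  by (simp_all add: upd_def)

lemma wrt_simps [simp]:
  "var (wrt b i v k h) = var h" "arr (wrt b i v k h) = (arr h)(b := (arr h b)(i := v))"
  "clk (wrt b i v k h) = clk h + k"
  by (simp_all add: wrt_def)

lemma tick_simps [simp]:
  "var (tick k h) = var h" "arr (tick k h) = arr h" "clk (tick k h) = clk h + k"
  by (simp_all add: tick_def)

lemma repr_words: "repr w h s \<Longrightarrow> words w h"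
  unfolding repr_def words_def word_state_def wlim_def by metis

lemma words_var: "words w h \<Longrightarrow> r < 64 \<Longrightarrow> var h r < wlim w"
  and words_arr: "words w h \<Longrightarrow> arr h b i < wlim w"
  by (auto simp: words_def)

text \<open>\<open>Op\<close> is arithmetic on natural numbers and carries the obligation
  \<open>okop\<close> that the word operation does not wrap; \<open>Raw\<close> is the machine
  operation, used where sums modulo \<open>2 ^ w\<close> are intended.\<close>

datatype exp = Rv nat | Nm nat | Op binop exp exp | Raw binop exp exp | Ld nat exp

instantiation exp :: "{plus, minus, times, divide, modulo}"
begin
definition plus_exp :: "exp \<Rightarrow> exp \<Rightarrow> exp" where "plus_exp = Op Add"
definition minus_exp :: "exp \<Rightarrow> exp \<Rightarrow> exp" where "minus_exp = Op Sub"
definition times_exp :: "exp \<Rightarrow> exp \<Rightarrow> exp" where "times_exp = Op Mul"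
definition divide_exp :: "exp \<Rightarrow> exp \<Rightarrow> exp" where "divide_exp = Op Div"
definition modulo_exp :: "exp \<Rightarrow> exp \<Rightarrow> exp" where "modulo_exp = Op Mod"
instance ..
end

lemmas exp_op_defs = plus_exp_def minus_exp_def times_exp_def divide_exp_def modulo_exp_def

abbreviation exp_less (infix "\<prec>" 50) where "exp_less \<equiv> Op Less"
abbreviation exp_eq (infix "\<doteq>" 50) where "exp_eq \<equiv> Op Eq"

fun ideal :: "binop \<Rightarrow> nat \<Rightarrow> nat \<Rightarrow> nat" where
  "ideal Add x y = x + y"
| "ideal Sub x y = x - y"
| "ideal Mul x y = x * y"
| "ideal Div x y = x div y"
| "ideal Mod x y = x mod y"
| "ideal Less x y = of_bool (x < y)"
| "ideal Eq x y = of_bool (x = y)"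
| "ideal _ x y = 0"

text \<open>The comparisons ask for \<open>1 < wlim w\<close> because \<open>binop_val\<close>
  reduces the truth value modulo \<open>2 ^ w\<close>, which would erase it at
  \<open>w = 0\<close>.\<close>

fun okop :: "nat \<Rightarrow> binop \<Rightarrow> nat \<Rightarrow> nat \<Rightarrow> bool" where
  "okop w Add x y = (x + y < wlim w)"
| "okop w Sub x y = (y \<le> x)"
| "okop w Mul x y = (x * y < wlim w)"
| "okop w Div x y = True"
| "okop w Mod x y = True"
| "okop w Less x y = (1 < wlim w)"
| "okop w Eq x y = (1 < wlim w)"
| "okop w _ x y = False"

fun ev :: "nat \<Rightarrow> vstate \<Rightarrow> exp \<Rightarrow> nat" where
  "ev w h (Rv r) = var h r"
| "ev w h (Nm k) = k"
| "ev w h (Op f a b) = ideal f (ev w h a) (ev w h b)"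
| "ev w h (Raw f a b) = binop_val w f (ev w h a) (ev w h b)"
| "ev w h (Ld b e) = arr h b (ev w h e)"

fun okx :: "nat \<Rightarrow> vstate \<Rightarrow> exp \<Rightarrow> bool" where
  "okx w h (Rv r) = (r < 64)"
| "okx w h (Nm k) = (k < wlim w)"
| "okx w h (Op f a b) = (okx w h a \<and> okx w h b \<and> okop w f (ev w h a) (ev w h b))"
| "okx w h (Raw f a b) = (okx w h a \<and> okx w h b)"
| "okx w h (Ld b e) = okx w h e"

fun ecost :: "exp \<Rightarrow> nat" where
  "ecost (Rv r) = 1"
| "ecost (Nm k) = 1"
| "ecost (Op f a b) = ecost a + ecost b + 1"
| "ecost (Raw f a b) = ecost a + ecost b + 1"
| "ecost (Ld b e) = ecost e + 1"

lemma exp_op_simps [simp]: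
  "ev w h (a + b) = ev w h a + ev w h b"
  "ev w h (a - b) = ev w h a - ev w h b"
  "ev w h (a * b) = ev w h a * ev w h b"
  "ev w h (a div b) = ev w h a div ev w h b"
  "ev w h (a mod b) = ev w h a mod ev w h b"
  "okx w h (a + b) = (okx w h a \<and> okx w h b \<and> ev w h a + ev w h b < wlim w)"
  "okx w h (a - b) = (okx w h a \<and> okx w h b \<and> ev w h b \<le> ev w h a)"
  "okx w h (a * b) = (okx w h a \<and> okx w h b \<and> ev w h a * ev w h b < wlim w)"
  "okx w h (a div b) = (okx w h a \<and> okx w h b)"
  "okx w h (a mod b) = (okx w h a \<and> okx w h b)"
  "ecost (a + b) = ecost a + ecost b + 1"
  "ecost (a - b) = ecost a + ecost b + 1"
  "ecost (a * b) = ecost a + ecost b + 1"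
  "ecost (a div b) = ecost a + ecost b + 1"
  "ecost (a mod b) = ecost a + ecost b + 1"
  by (simp_all add: exp_op_defs)

text \<open>The registers from \<open>d\<close> on form an evaluation stack: the left operand waits
  in \<open>d\<close> while the right one is computed in \<open>d + 1\<close>. This is why
  \<open>cexp_exec\<close> also keeps the registers from 64 up to \<open>d\<close>.\<close>

fun cexp :: "nat \<Rightarrow> exp \<Rightarrow> prog" where
  "cexp d (Rv r) = Move d r"
| "cexp d (Nm k) = Imm d k"
| "cexp d (Op f a b) = Seq (cexp d a) (Seq (cexp (d + 1) b) (Bin f d d (d + 1)))"
| "cexp d (Raw f a b) = Seq (cexp d a) (Seq (cexp (d + 1) b) (Bin f d d (d + 1)))"
| "cexp d (Ld b e) = Seq (cexp d e) (Load d b d)"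

lemma ideal_binop_val: "okop w f x y \<Longrightarrow> x < wlim w \<Longrightarrow> binop_val w f x y = ideal f x y"
proof (cases f)
  case Sub
  assume "okop w f x y" "x < wlim w"
  then have "(int x - int y) mod 2 ^ w = int x - int y"
    using Sub by (intro mod_pos_pos_trivial) (auto simp: wlim_def simp flip: of_nat_diff)
  with Sub show ?thesis by auto
qed (auto simp: wlim_def split: if_splits)

lemma repr_set_temp: "repr w h s \<Longrightarrow> 64 \<le> d \<Longrightarrow> v < 2 ^ w \<Longrightarrow> repr w h (set_reg d v s)"
  by (auto simp: repr_def set_reg_def word_state_def)

lemma reg_set_reg [simp]: "reg (set_reg d v s) r = (if r = d then v else reg s r)"
  and mem_set_reg [simp]: "mem (set_reg d v s) = mem s"
  by (simp_all add: set_reg_def)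

lemma repr_reg_less: "repr w h s \<Longrightarrow> reg s r < 2 ^ w"
  by (simp add: repr_def word_state_def)

lemma repr_mem_less: "repr w h s \<Longrightarrow> mem s b i < 2 ^ w"
  unfolding repr_def word_state_def by blast

lemma cexp_exec:
  "repr w h s \<Longrightarrow> okx w h e \<Longrightarrow> 64 \<le> d \<Longrightarrow>
   \<exists>s'. exec w (cexp d e) s (ecost e) s' \<and> repr w h s' \<and> reg s' d = ev w h e
     \<and> (\<forall>r. 64 \<le> r \<longrightarrow> r < d \<longrightarrow> reg s' r = reg s r)"
proof (induction e arbitrary: d s)
  case (Rv r)
  let ?s = "set_reg d (reg s r) s"
  have "exec w (cexp d (Rv r)) s 1 ?s" unfolding cexp.simps by (rule exec.intros)
  moreover have "repr w h ?s" using Rv by (simp add: repr_set_temp repr_reg_less)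
  moreover have "reg ?s d = var h r" using Rv by (simp add: repr_def)
  ultimately show ?case by (intro exI[of _ ?s]) auto
next
  case (Nm k)
  let ?s = "set_reg d (k mod 2 ^ w) s"
  have "exec w (cexp d (Nm k)) s 1 ?s" unfolding cexp.simps by (rule exec.intros)
  moreover have "repr w h ?s" using Nm by (simp add: repr_set_temp)
  moreover have "reg ?s d = k" using Nm by (simp add: wlim_def)
  ultimately show ?case by (intro exI[of _ ?s]) auto
next
  case (Op f a b)
  then obtain s1 where s1: "exec w (cexp d a) s (ecost a) s1" "repr w h s1" "reg s1 d = ev w h a"
    "\<forall>r. 64 \<le> r \<longrightarrow> r < d \<longrightarrow> reg s1 r = reg s r" by (metis okx.simps(3))
  with Op.prems Op.IH(2)[of s1 "d + 1"] obtain s2 where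
    s2: "exec w (cexp (d + 1) b) s1 (ecost b) s2" "repr w h s2" "reg s2 (d + 1) = ev w h b"
    "\<forall>r. 64 \<le> r \<longrightarrow> r < d + 1 \<longrightarrow> reg s2 r = reg s1 r" by auto
  let ?v = "binop_val w f (reg s2 d) (reg s2 (d + 1))"
  let ?s = "set_reg d ?v s2"
  have "reg s2 d = ev w h a" using s1 s2 Op.prems by simp
  moreover have "ev w h a < wlim w" using s1 by (metis wlim_def repr_reg_less)
  ultimately have v: "?v = ev w h (Op f a b)" using Op.prems s2(3) by (simp add: ideal_binop_val)
  have "exec w (Seq (cexp d a) (Seq (cexp (d + 1) b) (Bin f d d (d + 1)))) s
      (ecost a + (ecost b + 1)) ?s"
    by (rule exec.intros(7)[OF s1(1) exec.intros(7)[OF s2(1) exec.intros(4)]])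
  then have "exec w (cexp d (Op f a b)) s (ecost (Op f a b)) ?s" by (simp add: add.assoc)
  moreover have "repr w h ?s" using s2(2) Op.prems(3)
    by (intro repr_set_temp binop_val_less repr_reg_less[OF s2(2)])
  ultimately show ?case using v s1(4) s2(4) by (intro exI[of _ ?s]) auto
next
  case (Raw f a b)
  then obtain s1 where s1: "exec w (cexp d a) s (ecost a) s1" "repr w h s1" "reg s1 d = ev w h a"
    "\<forall>r. 64 \<le> r \<longrightarrow> r < d \<longrightarrow> reg s1 r = reg s r" by (metis okx.simps(4))
  with Raw.prems Raw.IH(2)[of s1 "d + 1"] obtain s2 where
    s2: "exec w (cexp (d + 1) b) s1 (ecost b) s2" "repr w h s2" "reg s2 (d + 1) = ev w h b"
    "\<forall>r. 64 \<le> r \<longrightarrow> r < d + 1 \<longrightarrow> reg s2 r = reg s1 r" by auto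
  let ?v = "binop_val w f (reg s2 d) (reg s2 (d + 1))"
  let ?s = "set_reg d ?v s2"
  have v: "?v = ev w h (Raw f a b)" using s1 s2 Raw.prems by simp
  have "exec w (Seq (cexp d a) (Seq (cexp (d + 1) b) (Bin f d d (d + 1)))) s
      (ecost a + (ecost b + 1)) ?s"
    by (rule exec.intros(7)[OF s1(1) exec.intros(7)[OF s2(1) exec.intros(4)]])
  then have "exec w (cexp d (Raw f a b)) s (ecost (Raw f a b)) ?s" by (simp add: add.assoc)
  moreover have "repr w h ?s" using s2(2) Raw.prems(3)
    by (intro repr_set_temp binop_val_less repr_reg_less[OF s2(2)])
  ultimately show ?case using v s1(4) s2(4) by (intro exI[of _ ?s]) auto
next
  case (Ld b e)
  then obtain s1 where s1: "exec w (cexp d e) s (ecost e) s1" "repr w h s1" "reg s1 d = ev w h e"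
    "\<forall>r. 64 \<le> r \<longrightarrow> r < d \<longrightarrow> reg s1 r = reg s r" by (metis okx.simps(5))
  let ?s = "set_reg d (mem s1 b (reg s1 d)) s1"
  have "exec w (cexp d (Ld b e)) s (ecost (Ld b e)) ?s"
    unfolding cexp.simps ecost.simps by (rule exec.intros(7)[OF s1(1) exec.intros(5)])
  moreover have "repr w h ?s" using s1 Ld.prems by (simp add: repr_set_temp repr_mem_less)
  moreover have "reg ?s d = ev w h (Ld b e)" using s1 by (simp add: repr_def)
  ultimately show ?case using s1(4) by (intro exI[of _ ?s]) auto
qed

text \<open>A syntactic bound on the effect of a program. Registers from 64 on are left out since
  \<open>vstate\<close> does not show them; an embedded multiplication program thus writes only the
  step counter.\<close>

fun wr :: "prog \<Rightarrow> nat set" where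
  "wr (Imm r k) = (if r < 64 then {r} else {})"
| "wr (Move r x) = (if r < 64 then {r} else {})"
| "wr (Bin f r x y) = (if r < 64 then {r} else {})"
| "wr (Load r b i) = (if r < 64 then {r} else {})"
| "wr (Seq p q) = wr p \<union> wr q"
| "wr (Cond x p q) = wr p \<union> wr q"
| "wr (Loop x p) = wr p"
| "wr _ = {}"

fun wb :: "prog \<Rightarrow> nat set" where
  "wb (Store b i x) = {b}"
| "wb (Seq p q) = wb p \<union> wb q"
| "wb (Cond x p q) = wb p \<union> wb q"
| "wb (Loop x p) = wb p"
| "wb _ = {}"

definition frm :: "nat set \<Rightarrow> nat set \<Rightarrow> vstate \<Rightarrow> vstate \<Rightarrow> bool" where
  "frm X B h h' \<longleftrightarrow> (\<forall>r<64. r \<notin> X \<longrightarrow> var h' r = var h r) \<and> (\<forall>b. b \<notin> B \<longrightarrow> arr h' b = arr h b)"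

lemma frm_var: "frm X B h h' \<Longrightarrow> r < 64 \<Longrightarrow> r \<notin> X \<Longrightarrow> var h' r = var h r"
  and frm_arr: "frm X B h h' \<Longrightarrow> b \<notin> B \<Longrightarrow> arr h' b = arr h b"
  by (auto simp: frm_def)

lemma frm_refl: "frm X B h h"
  by (simp add: frm_def)

lemma exec_frame:
  "exec w p s t s' \<Longrightarrow>
   (\<forall>r<64. r \<notin> wr p \<longrightarrow> reg s' r = reg s r) \<and> (\<forall>b. b \<notin> wb p \<longrightarrow> mem s' b = mem s b)"
  by (induction rule: exec.induct) (auto simp: set_reg_def set_mem_def split: if_splits)

text \<open>Specifications state only what changes; what stays, the word bounds and the monotone
  clock are recovered here from the program text.\<close>

lemma wp_frame:
  assumes "wp w p R h"
    and "\<And>h'. R h' \<Longrightarrow> frm (wr p) (wb p) h h' \<Longrightarrow> words w h' \<Longrightarrow> clk h \<le> clk h' \<Longrightarrow> Q h'"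
  shows "wp w p Q h"
  unfolding wp_def
proof (intro allI impI)
  fix s assume s: "repr w h s"
  then obtain t s' h' where e: "exec w p s t s'" "repr w h' s'" "clk h' = clk h + t" "R h'"
    using assms(1) by (auto simp: wp_def)
  from exec_frame[OF e(1)] s e(2) have "frm (wr p) (wb p) h h'"
    by (auto simp: frm_def repr_def)
  with e assms(2)[of h'] show "\<exists>t s' h'. exec w p s t s' \<and> repr w h' s' \<and> clk h' = clk h + t \<and> Q h'"
    using repr_words by auto
qed

lemma wp_words: "(words w h \<Longrightarrow> wp w p Q h) \<Longrightarrow> wp w p Q h"
  unfolding wp_def using repr_words by blast

lemma wp_seq: "wp w p (wp w q Q) h \<Longrightarrow> wp w (Seq p q) Q h"
  unfolding wp_def
proof (intro allI impI)
  fix s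
  assume a: "\<forall>s. repr w h s \<longrightarrow> (\<exists>t s' h'. exec w p s t s' \<and> repr w h' s' \<and> clk h' = clk h + t \<and>
      (\<forall>s. repr w h' s \<longrightarrow> (\<exists>t s' h''. exec w q s t s' \<and> repr w h'' s' \<and> clk h'' = clk h' + t \<and> Q h'')))"
    and s: "repr w h s"
  then obtain t s' h' where 1: "exec w p s t s'" "repr w h' s'" "clk h' = clk h + t"
    "\<forall>s. repr w h' s \<longrightarrow> (\<exists>t s' h''. exec w q s t s' \<and> repr w h'' s' \<and> clk h'' = clk h' + t \<and> Q h'')"
    by blast
  then obtain t' s'' h'' where 2: "exec w q s' t' s''" "repr w h'' s''" "clk h'' = clk h' + t'" "Q h''"
    by blast
  from 1 2 exec.intros(7)[OF 1(1) 2(1)]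
  show "\<exists>t s' h'. exec w (Seq p q) s t s' \<and> repr w h' s' \<and> clk h' = clk h + t \<and> Q h'"
    by (intro exI[of _ "t + t'"] exI[of _ s''] exI[of _ h'']) simp
qed

definition whilep :: "exp \<Rightarrow> prog \<Rightarrow> prog" where
  "whilep e p = Seq (cexp 64 e) (Loop 64 (Seq p (cexp 64 e)))"

lemma wp_while_unfold:
  assumes "okx w h e"
    and "ev w h e \<noteq> 0 \<Longrightarrow> wp w p (wp w (whilep e p) Q) (tick (ecost e + 1) h)"
    and "ev w h e = 0 \<Longrightarrow> Q (tick (ecost e + 1) h)"
  shows "wp w (whilep e p) Q h"
  unfolding wp_def
proof (intro allI impI)
  fix s assume s: "repr w h s"
  obtain s1 where s1: "exec w (cexp 64 e) s (ecost e) s1" "repr w h s1" "reg s1 64 = ev w h e"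
    using cexp_exec[OF s assms(1), of 64] by auto
  show "\<exists>t s' h'. exec w (whilep e p) s t s' \<and> repr w h' s' \<and> clk h' = clk h + t \<and> Q h'"
  proof (cases "ev w h e = 0")
    case True
    then have "exec w (Loop 64 (Seq p (cexp 64 e))) s1 1 s1" using s1 by (intro exec.intros) simp
    with s1(1) have "exec w (whilep e p) s (ecost e + 1) s1"
      unfolding whilep_def by (rule exec.intros)
    moreover have "repr w (tick (ecost e + 1) h) s1" using s1 by (simp add: repr_def)
    ultimately show ?thesis using assms(3)[OF True] by (intro exI) auto
  next
    case False
    have "repr w (tick (ecost e + 1) h) s1" using s1 by (simp add: repr_def)
    with assms(2)[OF False] obtain t s2 h2 where 2: "exec w p s1 t s2" "repr w h2 s2"
      "clk h2 = clk h + (ecost e + 1) + t" "wp w (whilep e p) Q h2"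
      unfolding wp_def[of w p] by auto
    then obtain t' s3 h3 where 3: "exec w (whilep e p) s2 t' s3" "repr w h3 s3" "clk h3 = clk h2 + t'" "Q h3"
      unfolding wp_def by blast
    \<comment> \<open>\<open>whilep\<close> evaluates its guard once before the loop and again at
      the end of each body. The guard evaluation of the remaining run is therefore reassigned to the
      body just executed.\<close>
    from 3(1) obtain t1 t2 s4 where 4: "exec w (cexp 64 e) s2 t1 s4"
      "exec w (Loop 64 (Seq p (cexp 64 e))) s4 t2 s3" "t' = t1 + t2"
      unfolding whilep_def by (auto elim: exec_SeqE)
    have "exec w (Loop 64 (Seq p (cexp 64 e))) s1 ((t + t1) + t2 + 1) s3"
      using False s1(3) by (intro exec.intros(11)[OF _ exec.intros(7)[OF 2(1) 4(1)] 4(2)]) simp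
    with s1(1) have "exec w (whilep e p) s (ecost e + ((t + t1) + t2 + 1)) s3"
      unfolding whilep_def by (rule exec.intros)
    then show ?thesis using 2 3 4 by (intro exI[of _ s3] exI[of _ h3] exI) auto
  qed
qed

text \<open>The rule supplies the frame relative to the state before the loop, so an invariant need
  not repeat what the body never writes.\<close>

lemma wp_while:
  fixes m :: "vstate \<Rightarrow> nat"
  assumes "I h"
    and ok: "\<And>h'. I h' \<Longrightarrow> frm (wr p) (wb p) h h' \<Longrightarrow> words w h' \<Longrightarrow> okx w h' e"
    and step: "\<And>h'. I h' \<Longrightarrow> frm (wr p) (wb p) h h' \<Longrightarrow> words w h' \<Longrightarrow> ev w h' e \<noteq> 0 \<Longrightarrow>
      wp w p (\<lambda>h''. I h'' \<and> m h'' < m h') (tick (ecost e + 1) h')"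
    and fin: "\<And>h'. I h' \<Longrightarrow> frm (wr p) (wb p) h h' \<Longrightarrow> words w h' \<Longrightarrow> ev w h' e = 0 \<Longrightarrow>
      Q (tick (ecost e + 1) h')"
  shows "wp w (whilep e p) Q h"
proof -
  have "I h' \<Longrightarrow> frm (wr p) (wb p) h h' \<Longrightarrow> wp w (whilep e p) Q h'" for h'
  proof (induction "m h'" arbitrary: h' rule: less_induct)
    case less
    show ?case
    proof (rule wp_words, rule wp_while_unfold)
      assume wd: "words w h'"
      show "okx w h' e" using ok less.prems wd by blast
      show "wp w p (wp w (whilep e p) Q) (tick (ecost e + 1) h')" if nz: "ev w h' e \<noteq> 0"
      proof (rule wp_frame[OF step[OF less.prems wd nz]])
        fix h'' assume h'': "I h'' \<and> m h'' < m h'" "frm (wr p) (wb p) (tick (ecost e + 1) h') h''"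
        with less.prems(2) have "frm (wr p) (wb p) h h''"
          by (auto simp: frm_def)
        with h'' show "wp w (whilep e p) Q h''" by (intro less.hyps) auto
      qed
      show "Q (tick (ecost e + 1) h')" if "ev w h' e = 0" using fin less.prems wd that by blast
    qed
  qed
  with assms(1) show ?thesis by (simp add: frm_refl)
qed

section \<open>Structured commands and their verification conditions\<close>

datatype cmd = Nop | Asg nat exp | Sto nat exp exp | Sq cmd cmd | If exp cmd cmd | Call prog

notation Asg (infix "::=" 58)
notation Sq (infixr ";;" 55)

abbreviation store_notation ("_\<lbrakk>_\<rbrakk> := _" [58, 0, 58] 58) where "b\<lbrakk>i\<rbrakk> := e \<equiv> Sto b i e"

fun compile :: "cmd \<Rightarrow> prog" where
  "compile Nop = Skip"
| "compile (r ::= e) = Seq (cexp 64 e) (Move r 64)"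
| "compile (Sto b i e) = Seq (cexp 64 i) (Seq (cexp 65 e) (Store b 64 65))"
| "compile (c ;; d) = Seq (compile c) (compile d)"
| "compile (If e c d) = Seq (cexp 64 e) (Cond 64 (compile c) (compile d))"
| "compile (Call p) = p"

text \<open>Loop-free code is handled by computation; loops and subroutines enter through
  \<open>Call\<close>, whose condition is a \<open>wp\<close> to be discharged by a
  specification.\<close>

fun vc :: "nat \<Rightarrow> cmd \<Rightarrow> (vstate \<Rightarrow> bool) \<Rightarrow> vstate \<Rightarrow> bool" where
  "vc w Nop Q h \<longleftrightarrow> Q (tick 1 h)"
| "vc w (r ::= e) Q h \<longleftrightarrow> r < 64 \<and> okx w h e \<and> Q (upd r (ev w h e) (ecost e + 1) h)"
| "vc w (Sto b i e) Q h \<longleftrightarrow> okx w h i \<and> okx w h e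
     \<and> Q (wrt b (ev w h i) (ev w h e) (ecost i + ecost e + 1) h)"
| "vc w (c ;; d) Q h \<longleftrightarrow> vc w c (\<lambda>h'. vc w d Q h') h"
| "vc w (If e c d) Q h \<longleftrightarrow> okx w h e
     \<and> (ev w h e \<noteq> 0 \<longrightarrow> vc w c Q (tick (ecost e + 1) h))
     \<and> (ev w h e = 0 \<longrightarrow> vc w d Q (tick (ecost e + 1) h))"
| "vc w (Call p) Q h \<longleftrightarrow> wp w p Q h"

lemma wp_mono: "wp w p R h \<Longrightarrow> (\<And>h'. R h' \<Longrightarrow> Q h') \<Longrightarrow> wp w p Q h"
  by (erule wp_frame) auto

lemma vc_sound: "vc w c Q h \<Longrightarrow> wp w (compile c) Q h"
proof (induction c arbitrary: Q h)
  case Nop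
  show ?case unfolding wp_def
  proof (intro allI impI)
    fix s assume "repr w h s"
    then have "exec w (compile Nop) s 1 s" "repr w (tick 1 h) s"
      using exec.intros(1) by (simp_all add: repr_def)
    with Nop show "\<exists>t s' h'. exec w (compile Nop) s t s' \<and> repr w h' s' \<and> clk h' = clk h + t \<and> Q h'"
      by (intro exI) auto
  qed
next
  case (Asg r e)
  show ?case unfolding wp_def
  proof (intro allI impI)
    fix s assume s: "repr w h s"
    then obtain s1 where s1: "exec w (cexp 64 e) s (ecost e) s1" "repr w h s1" "reg s1 64 = ev w h e"
      using Asg cexp_exec[OF s, of e 64] by auto
    let ?s = "set_reg r (reg s1 64) s1"
    have "exec w (compile (r ::= e)) s (ecost e + 1) ?s"
      unfolding compile.simps by (rule exec.intros(7)[OF s1(1) exec.intros(3)])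
    moreover have "repr w (upd r (ev w h e) (ecost e + 1) h) ?s"
      using s1 repr_reg_less[OF s1(2), of 64] by (auto simp: repr_def word_state_def)
    ultimately show "\<exists>t s' h'. exec w (compile (r ::= e)) s t s' \<and> repr w h' s' \<and> clk h' = clk h + t \<and> Q h'"
      using Asg by (intro exI) auto
  qed
next
  case (Sto b i e)
  show ?case unfolding wp_def
  proof (intro allI impI)
    fix s assume s: "repr w h s"
    obtain s1 where s1: "exec w (cexp 64 i) s (ecost i) s1" "repr w h s1" "reg s1 64 = ev w h i"
      using Sto cexp_exec[OF s, of i 64] by auto
    obtain s2 where s2: "exec w (cexp 65 e) s1 (ecost e) s2" "repr w h s2" "reg s2 65 = ev w h e"
      "reg s2 64 = ev w h i"
      using Sto cexp_exec[OF s1(2), of e 65] s1(3) by auto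
    let ?s = "set_mem b (reg s2 64) (reg s2 65) s2"
    have "exec w (compile (Sto b i e)) s (ecost i + (ecost e + 1)) ?s"
      unfolding compile.simps by (rule exec.intros(7)[OF s1(1) exec.intros(7)[OF s2(1) exec.intros(6)]])
    moreover have "repr w (wrt b (ev w h i) (ev w h e) (ecost i + ecost e + 1) h) ?s"
      using s2 by (auto simp: repr_def word_state_def set_mem_def fun_eq_iff) metis
    ultimately show "\<exists>t s' h'. exec w (compile (Sto b i e)) s t s' \<and> repr w h' s' \<and> clk h' = clk h + t \<and> Q h'"
      using Sto by (intro exI) auto
  qed
next
  case (Sq c d)
  have "wp w (compile c) (\<lambda>h'. vc w d Q h') h" using Sq by simp
  then have "wp w (compile c) (wp w (compile d) Q) h" by (rule wp_mono) (rule Sq.IH(2))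
  then show ?case by (simp add: wp_seq)
next
  case (If e c d)
  show ?case unfolding wp_def
  proof (intro allI impI)
    fix s assume s: "repr w h s"
    obtain s1 where s1: "exec w (cexp 64 e) s (ecost e) s1" "repr w h s1" "reg s1 64 = ev w h e"
      using If.prems cexp_exec[OF s, of e 64] by auto
    have r1: "repr w (tick (ecost e + 1) h) s1" using s1 by (simp add: repr_def)
    show "\<exists>t s' h'. exec w (compile (If e c d)) s t s' \<and> repr w h' s' \<and> clk h' = clk h + t \<and> Q h'"
    proof (cases "ev w h e = 0")
      case True
      then have "wp w (compile d) Q (tick (ecost e + 1) h)" using If by simp
      with r1 obtain t s' h' where x: "exec w (compile d) s1 t s'" "repr w h' s'" "clk h' = clk h + (ecost e + 1) + t" "Q h'"
        by (auto simp: wp_def)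
      have "exec w (compile (If e c d)) s (ecost e + (t + 1)) s'"
        unfolding compile.simps by (rule exec.intros(7)[OF s1(1) exec.intros(9)]) (use s1 x True in auto)
      with x show ?thesis by (intro exI) auto
    next
      case False
      then have "wp w (compile c) Q (tick (ecost e + 1) h)" using If by simp
      with r1 obtain t s' h' where x: "exec w (compile c) s1 t s'" "repr w h' s'" "clk h' = clk h + (ecost e + 1) + t" "Q h'"
        by (auto simp: wp_def)
      have "exec w (compile (If e c d)) s (ecost e + (t + 1)) s'"
        unfolding compile.simps by (rule exec.intros(7)[OF s1(1) exec.intros(8)]) (use s1 x False in auto)
      with x show ?thesis by (intro exI) auto
    qed
  qed
qed simp

lemma vc_call:
  assumes "wp w p R h"
    and "\<And>h'. R h' \<Longrightarrow> frm (wr p) (wb p) h h' \<Longrightarrow> words w h' \<Longrightarrow> clk h \<le> clk h' \<Longrightarrow> vc w c Q h'"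
  shows "vc w (Call p ;; c) Q h"
  using wp_frame[OF assms] by simp

lemma vc_call_last:
  assumes "wp w p R h"
    and "\<And>h'. R h' \<Longrightarrow> frm (wr p) (wb p) h h' \<Longrightarrow> words w h' \<Longrightarrow> clk h \<le> clk h' \<Longrightarrow> Q h'"
  shows "vc w (Call p) Q h"
  using wp_frame[OF assms] by simp

lemma wr_cexp [simp]: "64 \<le> d \<Longrightarrow> wr (cexp d e) = {}"
  by (induction e arbitrary: d) auto

lemma wb_cexp [simp]: "wb (cexp d e) = {}"
  by (induction e arbitrary: d) auto

lemma wr_whilep [simp]: "wr (whilep e p) = wr p"
  and wb_whilep [simp]: "wb (whilep e p) = wb p"
  by (simp_all add: whilep_def)

lemma wr_compile [simp]:
  "wr (compile Nop) = {}" "wr (compile (r ::= e)) = (if r < 64 then {r} else {})"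
  "wr (compile (Sto b i e)) = {}" "wr (compile (c ;; d)) = wr (compile c) \<union> wr (compile d)"
  "wr (compile (If e c d)) = wr (compile c) \<union> wr (compile d)" "wr (compile (Call p)) = wr p"
  by simp_all

lemma wb_compile [simp]:
  "wb (compile Nop) = {}" "wb (compile (r ::= e)) = {}"
  "wb (compile (Sto b i e)) = {b}" "wb (compile (c ;; d)) = wb (compile c) \<union> wb (compile d)"
  "wb (compile (If e c d)) = wb (compile c) \<union> wb (compile d)" "wb (compile (Call p)) = wb p"
  by simp_all

declare compile.simps [simp del]

definition forp :: "nat \<Rightarrow> nat \<Rightarrow> prog \<Rightarrow> prog" where
  "forp r l p = Seq (compile (r ::= Nm 0))
     (whilep (Rv r \<prec> Rv l) (Seq p (compile (r ::= Rv r + Nm 1))))"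

abbreviation For :: "nat \<Rightarrow> nat \<Rightarrow> cmd \<Rightarrow> cmd" where
  "For r l c \<equiv> Call (forp r l (compile c))"
abbreviation While :: "exp \<Rightarrow> cmd \<Rightarrow> cmd" where
  "While e c \<equiv> Call (whilep e (compile c))"

lemma wr_forp [simp]: "r < 64 \<Longrightarrow> wr (forp r l p) = insert r (wr p)"
  and wb_forp [simp]: "wb (forp r l p) = wb p"
  by (simp_all add: forp_def)

text \<open>The counter is advanced after the body, so the step has to establish the invariant for
  \<open>upd r (Suc i) 4\<close>. The constants are the costs of the initialisation (2), of a test
  (4) and of an increment (4).\<close>

lemma wp_for:
  assumes r: "r < 64" "l < 64" "r \<noteq> l" "r \<notin> wr p" "l \<notin> wr p"
    and N: "var h l = N" "0 < w"
    and init: "I 0 (upd r 0 2 h)"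
    and step: "\<And>i h'. i < N \<Longrightarrow> I i h' \<Longrightarrow> var h' r = i \<Longrightarrow> frm (insert r (wr p)) (wb p) h h' \<Longrightarrow> words w h'
      \<Longrightarrow> wp w p (\<lambda>h''. I (Suc i) (upd r (Suc i) 4 h'')) (tick 4 h')"
    and fin: "\<And>h'. I N h' \<Longrightarrow> var h' r = N \<Longrightarrow> frm (insert r (wr p)) (wb p) h h' \<Longrightarrow> words w h' \<Longrightarrow> Q (tick 4 h')"
  shows "wp w (forp r l p) Q h"
proof -
  let ?p = "Seq p (compile (r ::= Rv r + Nm 1))"
  let ?h = "upd r 0 2 h"
  have wr: "wr ?p = insert r (wr p)" "wb ?p = wb p" using r by auto
  have fr: "frm (insert r (wr p)) (wb p) h h'" if "frm (wr ?p) (wb ?p) ?h h'" for h'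
    using that unfolding wr by (auto simp: frm_def)
  have w1: "1 < wlim w" using N(2) by (simp add: wlim_def del: One_nat_def)
  have "wp w (whilep (Rv r \<prec> Rv l) ?p) Q ?h"
  proof (rule wp_while[where I = "\<lambda>h'. var h' r \<le> N \<and> I (var h' r) h'" and m = "\<lambda>h'. N - var h' r"])
    show "var ?h r \<le> N \<and> I (var ?h r) ?h" using init by simp
  next
    fix h' show "okx w h' (Rv r \<prec> Rv l)" using r w1 by simp
  next
    fix h' assume i: "var h' r \<le> N \<and> I (var h' r) h'" and f: "frm (wr ?p) (wb ?p) ?h h'" and wd: "words w h'"
      and nz: "ev w h' (Rv r \<prec> Rv l) \<noteq> 0"
    have l: "var h' l = N" using fr[OF f] r N by (auto simp: frm_def)
    with nz have lt: "var h' r < N" by simp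
    have wlim: "N < wlim w" using wd l r by (auto simp: words_def)
    have "wp w p (\<lambda>h''. I (Suc (var h' r)) (upd r (Suc (var h' r)) 4 h'')) (tick 4 h')"
      using step lt i fr[OF f] wd by blast
    then have "wp w p (wp w (compile (r ::= Rv r + Nm 1)) (\<lambda>h''. (var h'' r \<le> N \<and> I (var h'' r) h'') \<and> N - var h'' r < N - var h' r)) (tick 4 h')"
    proof (rule wp_frame)
      fix h'' assume I: "I (Suc (var h' r)) (upd r (Suc (var h' r)) 4 h'')" and "frm (wr p) (wb p) (tick 4 h') h''"
      then have v: "var h'' r = var h' r" using r by (auto simp: frm_def)
      show "wp w (compile (r ::= Rv r + Nm 1)) (\<lambda>h''. (var h'' r \<le> N \<and> I (var h'' r) h'') \<and> N - var h'' r < N - var h' r) h''"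
        by (rule vc_sound) (use I v lt wlim w1 r in \<open>auto simp: eval_nat_numeral\<close>)
    qed
    then show "wp w ?p (\<lambda>h''. (var h'' r \<le> N \<and> I (var h'' r) h'') \<and> N - var h'' r < N - var h' r)
      (tick (ecost (Rv r \<prec> Rv l) + 1) h')"
      using wp_seq by (simp add: eval_nat_numeral)
  next
    fix h' assume i: "var h' r \<le> N \<and> I (var h' r) h'" and f: "frm (wr ?p) (wb ?p) ?h h'" and wd: "words w h'"
      and z: "ev w h' (Rv r \<prec> Rv l) = 0"
    have l: "var h' l = N" using fr[OF f] r N by (auto simp: frm_def)
    with z i have "var h' r = N" by simp
    with fin[of h'] i fr[OF f] wd show "Q (tick (ecost (Rv r \<prec> Rv l) + 1) h')" by (simp add: eval_nat_numeral)
  qed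
  then have "wp w (compile (r ::= Nm 0)) (wp w (whilep (Rv r \<prec> Rv l) ?p) Q) h"
    using r w1 by (intro vc_sound) (simp add: eval_nat_numeral)
  then show ?thesis unfolding forp_def by (rule wp_seq)
qed

lemma wp_for_const:
  assumes r: "r < 64" "l < 64" "r \<noteq> l" "r \<notin> wr p" "l \<notin> wr p"
    and N: "var h l = N" "0 < w"
    and init: "I 0 (upd r 0 2 h)"
    and step: "\<And>i h'. i < N \<Longrightarrow> I i h' \<Longrightarrow> var h' r = i \<Longrightarrow> frm (insert r (wr p)) (wb p) h h' \<Longrightarrow> words w h'
      \<Longrightarrow> wp w p (\<lambda>h''. clk h'' \<le> clk h' + T \<and> I (Suc i) (upd r (Suc i) 4 h'')) (tick 4 h')"
    and fin: "\<And>h'. I N h' \<Longrightarrow> var h' r = N \<Longrightarrow> frm (insert r (wr p)) (wb p) h h' \<Longrightarrow> words w h' \<Longrightarrow>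
      clk h' \<le> clk h + 2 + N * (T + 4) \<Longrightarrow> Q (tick 4 h')"
  shows "wp w (forp r l p) Q h"
proof (rule wp_for[where I = "\<lambda>i h'. I i h' \<and> clk h' \<le> clk h + 2 + i * (T + 4)", OF r N])
  show "I 0 (upd r 0 2 h) \<and> clk (upd r 0 2 h) \<le> clk h + 2 + 0 * (T + 4)" using init by simp
next
  fix i h' assume a: "i < N" "I i h' \<and> clk h' \<le> clk h + 2 + i * (T + 4)" "var h' r = i"
    "frm (insert r (wr p)) (wb p) h h'" "words w h'"
  show "wp w p (\<lambda>h''. I (Suc i) (upd r (Suc i) 4 h'') \<and>
              clk (upd r (Suc i) 4 h'') \<le> clk h + 2 + Suc i * (T + 4)) (tick 4 h')"
    by (rule wp_mono[OF step]) (use a in auto)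
qed (use fin in auto)

section \<open>Counting sort\<close>

abbreviation (input) "vN \<equiv> 2::nat"
abbreviation (input) "vM \<equiv> 3::nat"
abbreviation (input) "vInf \<equiv> 4::nat"
abbreviation (input) "vNN \<equiv> 5::nat"
abbreviation (input) "vN2 \<equiv> 6::nat"
abbreviation (input) "vCnt \<equiv> 7::nat"

abbreviation (input) "bA \<equiv> 5::nat"
abbreviation (input) "bB \<equiv> 6::nat"
abbreviation (input) "bCA \<equiv> 7::nat"
abbreviation (input) "bCnt \<equiv> 9::nat"
abbreviation (input) "bOrd \<equiv> 10::nat"

text \<open>The position that stable sorting by \<open>A\<close> assigns to index
  \<open>p\<close>.\<close>

definition rk :: "nat \<Rightarrow> (nat \<Rightarrow> nat) \<Rightarrow> nat \<Rightarrow> nat" where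
  "rk N A p = card {x. x < N \<and> A x < A p} + card {x. x < p \<and> A x = A p}"

lemma rk_mono:
  assumes "p < N" "p' < N" "A p < A p' \<or> (A p = A p' \<and> p < p')"
  shows "rk N A p < rk N A p'"
proof (cases "A p < A p'")
  case True
  have "rk N A p < card {x. x < N \<and> A x < A p} + card (insert p {x. x < p \<and> A x = A p})"
    by (simp add: rk_def)
  also have "\<dots> = card ({x. x < N \<and> A x < A p} \<union> insert p {x. x < p \<and> A x = A p})"
    by (rule card_Un_disjoint[symmetric]) auto
  also have "\<dots> \<le> card {x. x < N \<and> A x < A p'}"
    by (rule card_mono) (use True assms in auto)
  finally show ?thesis by (simp add: rk_def)
next
  case False
  with assms have e: "A p = A p'" "p < p'" by auto
  have "card {x. x < p \<and> A x = A p} < card {x. x < p' \<and> A x = A p'}"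
    by (rule psubset_card_mono) (use e in auto)
  with e show ?thesis by (simp add: rk_def)
qed

lemma rk_less: assumes "p < N" shows "rk N A p < N"
proof -
  have "rk N A p = card ({x. x < N \<and> A x < A p} \<union> {x. x < p \<and> A x = A p})"
    unfolding rk_def by (rule card_Un_disjoint[symmetric]) auto
  also have "\<dots> < card {..<N}"
    by (rule psubset_card_mono) (use assms in auto)
  finally show ?thesis by simp
qed

lemma rk_inj: "inj_on (rk N A) {..<N}"
proof (rule inj_onI)
  fix p p' assume "p \<in> {..<N}" "p' \<in> {..<N}" "rk N A p = rk N A p'"
  then show "p = p'" using rk_mono[of p N p' A] rk_mono[of p' N p A]
    by (cases "A p < A p'"; cases "A p' < A p"; cases "p < p'"; cases "p' < p") auto
qed

lemma rk_surj: "z < N \<Longrightarrow> \<exists>p<N. rk N A p = z"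
proof -
  have "rk N A ` {..<N} = {..<N}"
    by (rule card_subset_eq) (auto simp: rk_less card_image rk_inj)
  then show "z < N \<Longrightarrow> \<exists>p<N. rk N A p = z" by (metis (no_types, lifting) imageE lessThan_iff)
qed

definition csort1 :: prog where
  "csort1 = compile (14 ::= Rv vInf + Nm 2 ;; For 13 14 (Sto bCnt (Rv 13) (Nm 0)))"

text \<open>Occurrences of \<open>v\<close> are counted in cell \<open>v + 1\<close>, so that the
  prefix sums of \<open>csort3\<close> leave in cell \<open>v\<close> the number of smaller keys,
  the first free position for key \<open>v\<close>.\<close>

definition csort2 :: prog where
  "csort2 = compile (For 13 vNN (15 ::= Ld bA (Rv 13) + Nm 1 ;; Sto bCnt (Rv 15) (Ld bCnt (Rv 15) + Nm 1)))"

definition csort3 :: prog where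
  "csort3 = compile (14 ::= Rv vInf + Nm 1 ;;
     For 13 14 (Sto bCnt (Rv 13 + Nm 1) (Ld bCnt (Rv 13 + Nm 1) + Ld bCnt (Rv 13))))"

definition csort4 :: prog where
  "csort4 = compile (For 13 vNN (15 ::= Ld bA (Rv 13) ;; Sto bOrd (Ld bCnt (Rv 15)) (Rv 13) ;;
     Sto bCnt (Rv 15) (Ld bCnt (Rv 15) + Nm 1)))"

definition csort :: prog where
  "csort = compile (Call csort1 ;; Call csort2 ;; Call csort3 ;; Call csort4)"

lemma wr_csort: "wr csort = {13, 14, 15}" "wb csort = {bCnt, bOrd}"
  by (auto simp: csort_def csort1_def csort2_def csort3_def csort4_def)

lemma card_less_Suc_filter:
  "card {x. x < Suc i \<and> P x} = card {x. x < i \<and> P x} + of_bool (P i)"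
proof -
  have "{x. x < Suc i \<and> P x} = {x. x < i \<and> P x} \<union> (if P i then {i} else {})"
    by (auto simp: less_Suc_eq)
  then show ?thesis by (auto simp: card_insert_if)
qed

lemma card_filter_le: "card {x. x < (i::nat) \<and> P x} \<le> i"
  using card_mono[of "{..<i}" "{x. x < i \<and> P x}"] by auto

lemma csort1_spec:
  assumes "var h vInf = I" "0 < w" "I + 3 < wlim w"
  shows "wp w csort1 (\<lambda>h'. clk h' \<le> clk h + 20 * (I + 3) \<and> (\<forall>v<I + 2. arr h' bCnt v = 0)) h"
  unfolding csort1_def
  apply (rule vc_sound, simp add: assms del: add_2_eq_Suc')
  using assms(3) apply simp
proof (rule wp_for_const[where N = "I + 2" and I = "\<lambda>i h'. \<forall>v<i. arr h' bCnt v = 0" and T = 10], goal_cases)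
  case (9 i h')
  show ?case by (rule vc_sound) (use 9 assms in \<open>auto simp: less_Suc_eq\<close>)
qed (use assms in auto)

lemma csort2_spec:
  assumes "var h vNN = N" "0 < w" "I + N + 3 < wlim w" "\<forall>p<N. arr h bA p \<le> I" "\<forall>v<I + 2. arr h bCnt v = 0"
  shows "wp w csort2 (\<lambda>h'. clk h' \<le> clk h + 20 * (N + 3) \<and> arr h' bCnt 0 = 0 \<and>
     (\<forall>v\<le>I. arr h' bCnt (Suc v) = card {x. x < N \<and> arr h bA x = v})) h"
  unfolding csort2_def
  apply (rule vc_sound, simp add: assms)
proof (rule wp_for_const[where N = N and I = "\<lambda>i h'. arr h' bCnt 0 = 0 \<and>
     (\<forall>v\<le>I. arr h' bCnt (Suc v) = card {x. x < i \<and> arr h bA x = v})" and T = 15], goal_cases)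
  case (9 i h')
  note f = 9(3) frm_var[OF 9(4)] frm_arr[OF 9(4)]
  have "arr h bA i \<le> I" using assms 9 by auto
  moreover have "card {x. x < i \<and> arr h bA x = arr h bA i} \<le> i" by (rule card_filter_le)
  ultimately show ?case by (intro vc_sound) (use 9 assms in \<open>auto simp: f card_less_Suc_filter\<close>)
qed (use assms in auto)

lemma csort3_spec:
  assumes "var h vInf = I" "0 < w" "I + N + 3 < wlim w" "arr h bCnt 0 = 0"
    "\<forall>v\<le>I. arr h bCnt (Suc v) = card {x. x < N \<and> A x = v}"
  shows "wp w csort3 (\<lambda>h'. clk h' \<le> clk h + 30 * (I + 3) \<and>
     (\<forall>v\<le>I + 1. arr h' bCnt v = card {x. x < N \<and> A x < v})) h"
  unfolding csort3_def
proof (rule vc_sound, simp add: assms, intro conjI, goal_cases)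
  case 2
  show ?case
proof (rule wp_for_const[where N = "I + 1" and I = "\<lambda>i h'. 
     (\<forall>v\<le>i. arr h' bCnt v = card {x. x < N \<and> A x < v}) \<and>
     (\<forall>v\<le>I. i \<le> v \<longrightarrow> arr h' bCnt (Suc v) = card {x. x < N \<and> A x = v})" and T = 20], goal_cases)
  case (9 i h')
  note f = 9(3) frm_var[OF 9(4)] frm_arr[OF 9(4)]
  have "{x. x < N \<and> A x < Suc i} = {x. x < N \<and> A x = i} \<union> {x. x < N \<and> A x < i}" by auto
  then have c: "card {x. x < N \<and> A x < Suc i} = card {x. x < N \<and> A x = i} + card {x. x < N \<and> A x < i}"
    using card_Un_disjoint[of "{x. x < N \<and> A x = i}" "{x. x < N \<and> A x < i}"] by auto
  have c': "card {x. x < N \<and> A x < Suc i} \<le> N" by (rule card_filter_le)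
  show ?case by (intro vc_sound) (use 9 assms c c' in \<open>auto simp: f le_Suc_eq\<close>)
qed (use assms in auto)
qed (use assms in auto)

lemma csort4_spec:
  assumes "var h vNN = N" "0 < w" "I + N + 3 < wlim w" "\<forall>p<N. arr h bA p \<le> I"
    "\<forall>v\<le>I + 1. arr h bCnt v = card {x. x < N \<and> arr h bA x < v}"
  shows "wp w csort4 (\<lambda>h'. clk h' \<le> clk h + 30 * (N + 3) \<and> (\<forall>p<N. arr h' bOrd (rk N (arr h bA) p) = p)) h"
  unfolding csort4_def
  apply (rule vc_sound, simp add: assms)
proof (rule wp_for_const[where N = N and I = "\<lambda>i h'. (\<forall>p<i. arr h' bOrd (rk N (arr h bA) p) = p) \<and>
     (\<forall>v\<le>I. arr h' bCnt v = card {x. x < N \<and> arr h bA x < v} + card {x. x < i \<and> arr h bA x = v})" and T = 21], goal_cases)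
  case (9 i h')
  note f = 9(3) frm_var[OF 9(4)] frm_arr[OF 9(4)]
  let ?A = "arr h bA"
  have a: "?A i \<le> I" using assms 9 by auto
  then have c: "arr h' bCnt (?A i) = rk N ?A i" using 9(2) by (simp add: rk_def)
  have ne: "rk N ?A p \<noteq> rk N ?A i" if "p < i" for p
    using inj_onD[OF rk_inj[of N ?A], of p i] that 9(1) by auto
  have c': "rk N ?A i < N" using rk_less 9(1) by blast
  show ?case by (intro vc_sound) (use 9 assms a c c' ne in \<open>auto simp: f All_less_Suc card_less_Suc_filter\<close>)
next
  case (10 h')
  then show ?case by simp
qed (use assms in auto)

lemma csort_spec:
  assumes "var h vNN = N" "var h vInf = I" "0 < w" "I + N + 3 < wlim w" "\<forall>p<N. arr h bA p \<le> I"
  shows "wp w csort (\<lambda>h'. clk h' \<le> clk h + 100 * (N + I + 3) \<and> (\<forall>z<N. arr h' bOrd z < N) \<and>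
     (\<forall>p<N. \<exists>z<N. arr h' bOrd z = p) \<and>
     (\<forall>z z'. z < z' \<and> z' < N \<longrightarrow> arr h bA (arr h' bOrd z) \<le> arr h bA (arr h' bOrd z'))) h"
  unfolding csort_def
proof (rule vc_sound, rule vc_call[OF csort1_spec[of _ I]], goal_cases)
  case (4 h1)
  note f1 = frm_var[OF 4(2)] frm_arr[OF 4(2)]
  show ?case
  proof (rule vc_call[OF csort2_spec[of _ N _ I]], goal_cases)
    case (6 h2)
    note f2 = frm_var[OF 6(2)] frm_arr[OF 6(2)]
    show ?case
    proof (rule vc_call[OF csort3_spec[of _ I _ N "arr h bA"]], goal_cases)
      case (6 h3)
      note f3 = frm_var[OF 6(2)] frm_arr[OF 6(2)]
      have a: "arr h3 bA = arr h bA" by (simp add: f1 f2 f3 csort1_def csort2_def csort3_def)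
      show ?case
      proof (rule vc_call_last[OF csort4_spec[of _ N _ I]], goal_cases)
        case (6 h4)
        let ?A = "arr h bA" and ?o = "arr h4 bOrd"
        have o: "?o (rk N ?A p) = p" if "p < N" for p using 6(1) that a by auto
        have 1: "?o z < N" if "z < N" for z using rk_surj[OF that, of ?A] o by auto
        have 2: "\<exists>z<N. ?o z = p" if "p < N" for p using o[OF that] rk_less[OF that, of ?A] by blast
        have 3: "?A (?o z) \<le> ?A (?o z')" if zz: "z < z'" "z' < N" for z z'
        proof -
          obtain p p' where p: "p < N" "rk N ?A p = z" "p' < N" "rk N ?A p' = z'"
            using rk_surj[of z N ?A] rk_surj[of z' N ?A] zz by auto
          then show ?thesis using rk_mono[of p' N p ?A] o[of p] o[of p'] zz by fastforce
        qed
        show ?case using 1 2 3 6 \<open>clk h3 \<le> _ \<and> _\<close> \<open>clk h2 \<le> _ \<and> _\<close> \<open>clk h1 \<le> _ \<and> _\<close>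
          by (auto simp: )
      qed (use assms 6 a in \<open>auto simp: f1 f2 f3 csort1_def csort2_def csort3_def\<close>)
    qed (use assms 6 in \<open>auto simp: f1 f2 csort1_def csort2_def\<close>)
  qed (use assms 4 in \<open>auto simp: f1 csort1_def\<close>)
qed (use assms in auto)

section \<open>Half products\<close>

abbreviation (input) "vX \<equiv> 8::nat"
abbreviation (input) "vS \<equiv> 9::nat"
abbreviation (input) "vY \<equiv> 10::nat"
abbreviation (input) "vR \<equiv> 11::nat"
abbreviation (input) "vC \<equiv> 12::nat"

lemma index_inj:
  fixes v e s :: nat
  assumes "v * s + e = v' * s + e'" "e < s" "e' < s"
  shows "v = v' \<and> e = e'"
proof -
  have s: "s \<noteq> 0" using assms by auto
  have "v = (v * s + e) div s" "v' = (v' * s + e') div s" using s assms(2,3) by simp_all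
  then have "v = v'" using assms(1) by metis
  then show ?thesis using assms(1) by simp
qed

lemma index_eq_iff:
  fixes v e s :: nat
  shows "e < s \<Longrightarrow> e' < s \<Longrightarrow> v * s + e = v' * s + e' \<longleftrightarrow> v = v' \<and> e = e'"
  using index_inj by blast

lemma index_less: "i < (a::nat) \<Longrightarrow> j < b \<Longrightarrow> i * b + j < a * b"
  using mult_le_mono1[of "Suc i" a b] by simp

text \<open>
  Ranks \<open>x, \<dots>, z - 1\<close> distributed over virtual lines: line \<open>v\<close> has key \<open>K v\<close> and holds the
  \<open>S v \<le> s\<close> ranks \<open>L (v * s), L (v * s + 1), \<dots>\<close>; \<open>c i\<close> is the line of key \<open>i\<close> that is being filled.
  Lines beyond the first \<open>n\<close> are opened only when a line is full, whence the second conjunct.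
\<close>

definition chunked :: "nat \<Rightarrow> nat \<Rightarrow> (nat \<Rightarrow> nat) \<Rightarrow> nat \<Rightarrow> nat \<Rightarrow> (nat \<Rightarrow> nat) \<Rightarrow> (nat \<Rightarrow> nat)
    \<Rightarrow> (nat \<Rightarrow> nat) \<Rightarrow> (nat \<Rightarrow> nat) \<Rightarrow> (nat \<Rightarrow> nat) \<Rightarrow> nat \<Rightarrow> bool" where
  "chunked n s key x z c S K L \<rho> R \<longleftrightarrow>
     n \<le> R \<and> s * (R - n) + (\<Sum>i<n. S (c i)) = z - x \<and>
     (\<forall>i<n. c i < R \<and> K (c i) = i) \<and>
     (\<forall>v<R. K v < n \<and> S v \<le> s) \<and>
     (\<forall>v<R. \<forall>e<S v. x \<le> L (v * s + e) \<and> L (v * s + e) < z \<and> \<rho> (L (v * s + e)) = v) \<and>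
     (\<forall>v<R. \<forall>e' e. e' < e \<longrightarrow> e < S v \<longrightarrow> L (v * s + e') < L (v * s + e)) \<and>
     (\<forall>z'. x \<le> z' \<and> z' < z \<longrightarrow> \<rho> z' < R \<and> K (\<rho> z') = key z' \<and> \<rho> z' \<le> c (key z') \<and>
        (\<exists>e<S (\<rho> z'). L (\<rho> z' * s + e) = z')) \<and>
     (\<forall>z1 z2. x \<le> z1 \<and> z1 \<le> z2 \<and> z2 < z \<and> key z1 = key z2 \<longrightarrow> \<rho> z1 \<le> \<rho> z2)"

lemma chunkedD:
  assumes "chunked n s key x z c S K L \<rho> R"
  shows "n \<le> R" "s * (R - n) + (\<Sum>i<n. S (c i)) = z - x"
    "i < n \<Longrightarrow> c i < R" "i < n \<Longrightarrow> K (c i) = i"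
    "v < R \<Longrightarrow> K v < n" "v < R \<Longrightarrow> S v \<le> s"
    "v < R \<Longrightarrow> e < S v \<Longrightarrow> x \<le> L (v * s + e)" "v < R \<Longrightarrow> e < S v \<Longrightarrow> L (v * s + e) < z"
    "v < R \<Longrightarrow> e < S v \<Longrightarrow> \<rho> (L (v * s + e)) = v"
    "v < R \<Longrightarrow> e' < e \<Longrightarrow> e < S v \<Longrightarrow> L (v * s + e') < L (v * s + e)"
    "x \<le> z' \<Longrightarrow> z' < z \<Longrightarrow> \<rho> z' < R" "x \<le> z' \<Longrightarrow> z' < z \<Longrightarrow> K (\<rho> z') = key z'"
    "x \<le> z' \<Longrightarrow> z' < z \<Longrightarrow> \<rho> z' \<le> c (key z')"
    "x \<le> z' \<Longrightarrow> z' < z \<Longrightarrow> \<exists>e<S (\<rho> z'). L (\<rho> z' * s + e) = z'"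
    "x \<le> z1 \<Longrightarrow> z1 \<le> z2 \<Longrightarrow> z2 < z \<Longrightarrow> key z1 = key z2 \<Longrightarrow> \<rho> z1 \<le> \<rho> z2"
  using assms unfolding chunked_def by simp_all

text \<open>Every line beyond the first \<open>n\<close> was opened because a line with
  \<open>s\<close> ranks was full, and at most \<open>n\<close> full lines fit into
  \<open>n * s\<close> ranks.\<close>

lemma chunked_lines_le:
  assumes "chunked n s key x z c S K L \<rho> R" "z - x \<le> n * s" "0 < s"
  shows "R \<le> 2 * n"
proof -
  have "s * (R - n) \<le> n * s" "n \<le> R" using chunkedD(1,2)[OF assms(1)] assms(2) by linarith+
  then have "R - n \<le> n" using assms(3) by (metis mult.commute mult_le_cancel1)
  with \<open>n \<le> R\<close> show ?thesis by simp
qed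

lemma chunked_init:
  assumes "\<forall>i<n. c i = i \<and> K i = i \<and> S i = 0"
  shows "chunked n s key x x c S K L \<rho> n"
  using assms by (auto simp: chunked_def)

lemma chunked_add:
  assumes ch: "chunked n s key x z c S K L \<rho> R" and i: "key z < n" "x \<le> z"
    and v: "v = c (key z)" and less: "S v < s"
  shows "chunked n s key x (Suc z) c (S(v := Suc (S v))) K (L(v * s + S v := z)) (\<rho>(z := v)) R"
proof -
  note d = chunkedD[OF ch]
  have cK: "\<And>i. i < n \<Longrightarrow> c i < R \<and> K (c i) = i" using d(3,4) by blast
  have vR: "v < R" and Kv: "K v = key z" using cK i v by auto
  have Sle: "\<And>u. u < R \<Longrightarrow> S u \<le> s" using d(6) .
  have ne: "u * s + e \<noteq> v * s + S v" if "u < R" "e < S u" for u e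
    using index_inj[of u s e v "S v"] Sle[OF that(1)] that less by auto
  have sum: "(\<Sum>i<n. (S(v := Suc (S v))) (c i)) = Suc (\<Sum>i<n. S (c i))"
  proof -
    have "(\<Sum>i<n. (S(v := Suc (S v))) (c i)) = (\<Sum>i<n. S (c i) + of_bool (i = key z))"
    proof (rule sum.cong)
      fix j assume "j \<in> {..<n}"
      then have "c j = v \<longleftrightarrow> j = key z" using cK[of j] cK[OF i(1)] v by (metis lessThan_iff)
      then show "(S(v := Suc (S v))) (c j) = S (c j) + of_bool (j = key z)" by auto
    qed simp
    also have "\<dots> = Suc (\<Sum>i<n. S (c i))"
      using i by (simp add: sum.distrib of_bool_def)
    finally show ?thesis .
  qed
  have ex: "\<exists>e<(S(v := Suc (S v))) (\<rho> z'). (L(v * s + S v := z)) (\<rho> z' * s + e) = z'"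
    if zz: "x \<le> z'" "z' < z" for z'
  proof -
    obtain e where e: "e < S (\<rho> z')" "L (\<rho> z' * s + e) = z'" "\<rho> z' < R"
      using d(14)[OF zz] d(11)[OF zz] by blast
    then show ?thesis using ne[of "\<rho> z'" e] by (intro exI[of _ e]) auto
  qed
  show ?thesis
    unfolding chunked_def
  proof (intro conjI allI impI)
    show "n \<le> R" using d(1) .
    show "s * (R - n) + (\<Sum>i<n. (S(v := Suc (S v))) (c i)) = Suc z - x"
      unfolding sum using d(2) i by linarith
    show "c i < R" "K (c i) = i" if "i < n" for i using cK that by auto
    show "K u < n" if "u < R" for u using d(5) that .
    show "(S(v := Suc (S v))) u \<le> s" if "u < R" for u using Sle[OF that] less by auto
  next
    fix u e assume u: "u < R" "e < (S(v := Suc (S v))) u"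
    let ?L = "L(v * s + S v := z)"
    consider "e < S u" | "u = v" "e = S v" using u by (auto split: if_splits simp: less_Suc_eq)
    then have "x \<le> ?L (u * s + e) \<and> ?L (u * s + e) < Suc z \<and> (\<rho>(z := v)) (?L (u * s + e)) = u"
    proof cases
      case 1
      have "x \<le> L (u * s + e) \<and> L (u * s + e) < z \<and> \<rho> (L (u * s + e)) = u" using d(7-9)[OF u(1) 1] by simp
      then show ?thesis using ne[OF u(1) 1] by auto
    next
      case 2
      then show ?thesis using i by auto
    qed
    then show "x \<le> ?L (u * s + e)" "?L (u * s + e) < Suc z" "(\<rho>(z := v)) (?L (u * s + e)) = u" by auto
  next
    fix u e' e assume u: "u < R" "e' < e" "e < (S(v := Suc (S v))) u"
    let ?L = "L(v * s + S v := z)"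
    consider "e < S u" | "u = v" "e = S v" using u by (auto split: if_splits simp: less_Suc_eq)
    then show "?L (u * s + e') < ?L (u * s + e)"
    proof cases
      case 1
      have "L (u * s + e') < L (u * s + e)" using d(10)[OF u(1,2) 1] .
      then show ?thesis using ne[OF u(1) 1] ne[OF u(1), of e'] 1 u by auto
    next
      case 2
      have "L (u * s + e') < z" using d(8)[OF u(1), of e'] u 2 by auto
      then show ?thesis using ne[OF u(1), of e'] 2 u by auto
    qed
  next
    fix z' assume z': "x \<le> z' \<and> z' < Suc z"
    show "(\<rho>(z := v)) z' < R" "K ((\<rho>(z := v)) z') = key z'" "(\<rho>(z := v)) z' \<le> c (key z')"
      using d(11-13)[of z'] z' vR Kv v by (auto simp: less_Suc_eq)
    show "\<exists>e<(S(v := Suc (S v))) ((\<rho>(z := v)) z'). (L(v * s + S v := z)) ((\<rho>(z := v)) z' * s + e) = z'"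
    proof (cases "z' = z")
      case True
      then show ?thesis by (intro exI[of _ "S v"]) auto
    next
      case False
      then show ?thesis using ex[of z'] z' by auto
    qed
  next
    fix z1 z2 assume z: "x \<le> z1 \<and> z1 \<le> z2 \<and> z2 < Suc z \<and> key z1 = key z2"
    show "(\<rho>(z := v)) z1 \<le> (\<rho>(z := v)) z2"
    proof (cases "z2 = z")
      case True
      then show ?thesis using d(13)[of z1] z v by auto
    next
      case False
      then have "z2 < z" "z1 < z" using z by auto
      then show ?thesis using d(15)[of z1 z2] z by auto
    qed
  qed
qed

text \<open>The full line drops out of the sum over the current lines with its \<open>s\<close>
  ranks; the term \<open>s * (R - n)\<close> takes them over.\<close>

lemma chunked_open:
  assumes ch: "chunked n s key x z c S K L \<rho> R" and i: "i < n" and full: "S (c i) = s"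
  shows "chunked n s key x z (c(i := R)) (S(R := 0)) (K(R := i)) L \<rho> (Suc R)"
proof -
  note d = chunkedD[OF ch]
  have cK: "\<And>i. i < n \<Longrightarrow> c i < R \<and> K (c i) = i" using d(3,4) by blast
  have sum: "(\<Sum>j<n. (S(R := 0)) ((c(i := R)) j)) + s = (\<Sum>i<n. S (c i))"
  proof -
    have 1: "(\<Sum>j\<in>{..<n} - {i}. (S(R := 0)) ((c(i := R)) j)) = (\<Sum>j\<in>{..<n} - {i}. S (c j))"
    proof (rule sum.cong)
      fix j assume "j \<in> {..<n} - {i}"
      then show "(S(R := 0)) ((c(i := R)) j) = S (c j)" using cK[of j] by auto
    qed simp
    have 2: "(\<Sum>j<n. f j) = f i + (\<Sum>j\<in>{..<n} - {i}. f j)" for f :: "nat \<Rightarrow> nat"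
      using i by (intro sum.remove) auto
    show ?thesis unfolding 2 1 using full by simp
  qed
  show ?thesis
    unfolding chunked_def
  proof (intro conjI allI impI)
    show "n \<le> Suc R" using d(1) by simp
    have "s * (Suc R - n) = s * (R - n) + s" using d(1) by (simp add: Suc_diff_le)
    then show "s * (Suc R - n) + (\<Sum>j<n. (S(R := 0)) ((c(i := R)) j)) = z - x"
      using sum d(2) by linarith
    show "(c(i := R)) j < Suc R" "(K(R := i)) ((c(i := R)) j) = j" if "j < n" for j
      using cK[OF that] by auto
    show "(K(R := i)) u < n" "(S(R := 0)) u \<le> s" if "u < Suc R" for u
      using d(5,6)[of u] i that by (auto simp: less_Suc_eq)
  next
    fix u e assume "u < Suc R" "e < (S(R := 0)) u"
    then have "u < R" "e < S u" by (auto split: if_splits)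
    then show "x \<le> L (u * s + e)" "L (u * s + e) < z" "\<rho> (L (u * s + e)) = u" using d(7-9) by auto
  next
    fix u e' e assume "u < Suc R" "e' < e" "e < (S(R := 0)) u"
    then have "u < R" "e < S u" by (auto split: if_splits)
    then show "L (u * s + e') < L (u * s + e)" using d(10) \<open>e' < e\<close> by auto
  next
    fix z' assume z': "x \<le> z' \<and> z' < z"
    then have a: "\<rho> z' < R \<and> K (\<rho> z') = key z' \<and> \<rho> z' \<le> c (key z')" using d(11-13)[of z'] by auto
    then show "\<rho> z' < Suc R" "(K(R := i)) (\<rho> z') = key z'" "\<rho> z' \<le> (c(i := R)) (key z')" by auto
    show "\<exists>e<(S(R := 0)) (\<rho> z'). L (\<rho> z' * s + e) = z'" using d(14)[of z'] z' a by auto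
  next
    fix z1 z2 assume z: "x \<le> z1 \<and> z1 \<le> z2 \<and> z2 < z \<and> key z1 = key z2"
    then show "\<rho> z1 \<le> \<rho> z2" using d(15) by blast
  qed
qed

text \<open>Banks \<open>b\<close> to \<open>b + 4\<close> hold \<open>c\<close>, \<open>S\<close>,
  \<open>K\<close>, \<open>L\<close> and \<open>\<rho>\<close> of \<open>chunked\<close>. Rows use
  \<open>b = 13\<close> with the number of lines in \<open>vR\<close>, columns \<open>b = 18\<close>
  with \<open>vC\<close>.\<close>

definition chunk_init :: "nat \<Rightarrow> nat \<Rightarrow> prog" where
  "chunk_init b l = compile (For 13 vN (Sto b (Rv 13) (Rv 13) ;; Sto (b + 2) (Rv 13) (Rv 13) ;;
     Sto (b + 1) (Rv 13) (Nm 0)) ;; l ::= Rv vN)"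

definition chunk_step :: "nat \<Rightarrow> nat \<Rightarrow> exp \<Rightarrow> prog" where
  "chunk_step b l k = compile (17 ::= k ;; 18 ::= Ld b (Rv 17) ;;
     If (Ld (b + 1) (Rv 18) \<doteq> Rv vS)
       (18 ::= Rv l ;; Sto b (Rv 17) (Rv l) ;; Sto (b + 2) (Rv l) (Rv 17) ;; Sto (b + 1) (Rv l) (Nm 0) ;;
        l ::= Rv l + Nm 1) Nop ;;
     Sto (b + 3) (Rv 18 * Rv vS + Ld (b + 1) (Rv 18)) (Rv 16) ;;
     Sto (b + 4) (Rv 16) (Rv 18) ;;
     Sto (b + 1) (Rv 18) (Ld (b + 1) (Rv 18) + Nm 1))"

definition chunk_loop :: "nat \<Rightarrow> nat \<Rightarrow> exp \<Rightarrow> prog" where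
  "chunk_loop b l k = compile (15 ::= Rv vY - Rv vX ;;
     For 14 15 (16 ::= Rv vX + Rv 14 ;; Call (chunk_step b l k)))"

definition is_chunked :: "nat \<Rightarrow> nat \<Rightarrow> nat \<Rightarrow> nat \<Rightarrow> (nat \<Rightarrow> nat) \<Rightarrow> nat \<Rightarrow> nat \<Rightarrow> vstate \<Rightarrow> bool" where
  "is_chunked b l n s key x z h \<longleftrightarrow>
     chunked n s key x z (arr h b) (arr h (b + 1)) (arr h (b + 2)) (arr h (b + 3)) (arr h (b + 4)) (var h l)"

lemma wr_chunk [simp]:
  "l < 64 \<Longrightarrow> wr (chunk_init b l) = {13, l}" "wb (chunk_init b l) = {b, b + 1, b + 2}"
  "l < 64 \<Longrightarrow> wr (chunk_step b l k) = {17, 18, l}" "wb (chunk_step b l k) = {b, b + 1, b + 2, b + 3, b + 4}"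
  "l < 64 \<Longrightarrow> wr (chunk_loop b l k) = {14, 15, 16, 17, 18, l}" "wb (chunk_loop b l k) = {b, b + 1, b + 2, b + 3, b + 4}"
  by (auto simp: chunk_init_def chunk_step_def chunk_loop_def)

lemma chunk_init_spec:
  assumes "var h vN = n" "0 < w" "l < 64" "l \<notin> {2, 13}"
  shows "wp w (chunk_init b l) (\<lambda>h'. clk h' \<le> clk h + 20 * n + 20 \<and> is_chunked b l n s key x x h') h"
  unfolding chunk_init_def
proof (rule vc_sound, rule vc_call[where R = "\<lambda>h'. clk h' \<le> clk h + 20 * n + 10 \<and> (\<forall>i<n. arr h' b i = i \<and> arr h' (b + 2) i = i \<and> arr h' (b + 1) i = 0)"], goal_cases)
  case 1
  show ?case
  proof (rule wp_for_const[where N = n and I = "\<lambda>m h'. \<forall>i<m. arr h' b i = i \<and> arr h' (b + 2) i = i \<and> arr h' (b + 1) i = 0" and T = 14], goal_cases)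
    case (9 i h')
    show ?case by (rule vc_sound) (use 9 assms in \<open>auto simp: less_Suc_eq\<close>)
  qed (use assms in auto)
next
  case (2 h')
  then show ?case using assms frm_var[OF 2(2), of 2]
    by (auto simp: is_chunked_def intro!: chunked_init)
qed

lemma chunk_step_spec:
  assumes "is_chunked b l n s key x z h" "var h 16 = z" "var h vS = s" "0 < s" "x \<le> z" "z - x \<le> n * s"
    "0 < w" "okx w (upd 17 (key z) 0 h) (Rv 17)" "okx w h k" "ev w h k = key z" "key z < n" "l \<in> {vR, vC}"
    "2 * n * s + 2 * n + s + 2 < wlim w"
  shows "wp w (chunk_step b l k) (\<lambda>h'. clk h' \<le> clk h + ecost k + 60 \<and> is_chunked b l n s key x (Suc z) h') h"
proof -
  let ?c = "arr h b" and ?S = "arr h (b + 1)" and ?R = "var h l"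
  have ch: "chunked n s key x z ?c ?S (arr h (b + 2)) (arr h (b + 3)) (arr h (b + 4)) ?R"
    using assms(1) by (simp add: is_chunked_def)
  have R2: "?R \<le> 2 * n" using chunked_lines_le[OF ch] assms by auto
  have cR: "?c (key z) < ?R" "?S (?c (key z)) \<le> s" using chunkedD(3,6)[OF ch] assms(11) by auto
  have lim: "?c (key z) * s + ?S (?c (key z)) < wlim w" "?c (key z) * s < wlim w" "?R * s < wlim w" "Suc s < wlim w" "Suc ?R < wlim w"
  proof -
    have "?R * s \<le> 2 * n * s" using R2 by simp
    moreover have "?c (key z) * s \<le> ?R * s" using cR by simp
    ultimately show "?c (key z) * s + ?S (?c (key z)) < wlim w" "?c (key z) * s < wlim w" "?R * s < wlim w" "Suc s < wlim w" "Suc ?R < wlim w"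
      using cR R2 assms(13) by linarith+
  qed
  have l: "l < 64" "l \<notin> {9, 16, 17, 18}" using assms(12) by auto
  show ?thesis
  proof (cases "?S (?c (key z)) = s")
    case True
    have op: "chunked n s key x z (?c(key z := ?R)) (?S(?R := 0)) ((arr h (b + 2))(?R := key z)) (arr h (b + 3)) (arr h (b + 4)) (Suc ?R)"
      using chunked_open[OF ch assms(11) True] .
    have "chunked n s key x (Suc z) (?c(key z := ?R)) (?S(?R := Suc 0)) ((arr h (b + 2))(?R := key z))
        ((arr h (b + 3))(?R * s := z)) ((arr h (b + 4))(z := ?R)) (Suc ?R)"
      using chunked_add[OF op assms(11,5) refl] assms(4) by simp
    then show ?thesis unfolding chunk_step_def
      using True assms l lim by (intro vc_sound) (auto simp: is_chunked_def)
  next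
    case False
    have "chunked n s key x (Suc z) ?c (?S(?c (key z) := Suc (?S (?c (key z))))) (arr h (b + 2))
        ((arr h (b + 3))(?c (key z) * s + ?S (?c (key z)) := z)) ((arr h (b + 4))(z := ?c (key z))) ?R"
      using chunked_add[OF ch assms(11,5) refl] cR False by simp
    then show ?thesis unfolding chunk_step_def
      using False assms l lim cR by (intro vc_sound) (auto simp: is_chunked_def)
  qed
qed

lemma chunk_loop_spec:
  assumes "is_chunked b l n s key x x h" "var h vX = x" "var h vY = y" "var h vS = s" "0 < s" "x \<le> y" "y - x \<le> n * s"
    "0 < w" "l \<in> {vR, vC}" "2 * n * s + 2 * n + s + 2 < wlim w"
    and k: "\<And>z h'. x \<le> z \<Longrightarrow> z < y \<Longrightarrow> frm {14, 15, 16, 17, 18, l} {b, b + 1, b + 2, b + 3, b + 4} h h' \<Longrightarrow> var h' 16 = z \<Longrightarrow>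
      okx w h' k \<and> ev w h' k = key z \<and> key z < n"
  shows "wp w (chunk_loop b l k) (\<lambda>h'. clk h' \<le> clk h + (ecost k + 80) * (y - x) + 20 \<and> is_chunked b l n s key x y h') h"
  unfolding chunk_loop_def
proof (rule vc_sound, simp add: assms, rule wp_words, rule wp_for_const[where N = "y - x" and I = "\<lambda>i h'. is_chunked b l n s key x (x + i) h'" and T = "ecost k + 70"], goal_cases)
  case (9 i h')
  have l: "l < 64" "l \<notin> {8, 9, 10, 14, 15, 16, 17, 18}" using assms(9) by auto
  note f = frm_var[OF 9(5)] frm_arr[OF 9(5)]
  have v: "var h' 8 = x" "var h' 9 = s" using l by (simp_all add: f assms)
  have y: "y < wlim w" using words_var[OF 9(1), of 10] assms(3) by simp
  show ?case
  proof (rule vc_sound, simp add: v 9(4), intro conjI, goal_cases)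
    case 1 then show ?case using 9(2) y by linarith
  next
    case 2
    let ?h = "upd 16 (x + i) (Suc (Suc (Suc (Suc 0)))) (tick 4 h')"
    have fr: "frm {14, 15, 16, 17, 18, l} {b, b + 1, b + 2, b + 3, b + 4} h ?h"
      using 9(5) l by (auto simp: frm_def)
    note kk = k[OF _ _ fr, of "x + i"]
    have lt: "x + i < y" using 9(2) by simp
    show ?case
      by (rule wp_frame[OF chunk_step_spec[where s = s and n = n and x = x and z = "x + i" and key = key]])
        (use assms v l kk lt 9(3) in \<open>auto simp: is_chunked_def\<close>)
  qed
next
  case (10 h')
  then show ?case using assms by (auto simp: is_chunked_def algebra_simps)
qed (use assms in \<open>auto simp: is_chunked_def\<close>)

section \<open>Scanning a chunk for witnesses\<close>

definition scan :: "nat \<Rightarrow> prog" where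
  "scan b = compile (For 23 21 (24 ::= Ld bOrd (Ld b (Rv 20 + Rv 23)) ;; 25 ::= Ld bA (Rv 24) ;;
     26 ::= (Rv 24 div Rv vN) * Rv vN + Rv 22 ;;
     If (Ld bB ((Rv 24 mod Rv vN) * Rv vN + Rv 22) \<prec> Rv 25 + Nm 1)
       (If (Rv 25 \<prec> Ld bCA (Rv 26)) (Sto bCA (Rv 26) (Rv 25)) Nop) Nop))"

lemma wr_scan [simp]: "wr (scan b) = {23, 24, 25, 26}" "wb (scan b) = {bCA}"
  by (auto simp: scan_def)

text \<open>The soundness half of the product, with \<open>J\<close> as infinity. It survives
  whatever scans are made, so completeness is tracked separately, as upper bounds on single
  entries.\<close>

definition attained :: "nat \<Rightarrow> nat \<Rightarrow> (nat \<Rightarrow> nat) \<Rightarrow> (nat \<Rightarrow> nat) \<Rightarrow> (nat \<Rightarrow> nat) \<Rightarrow> bool" where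
  "attained n J A B D \<longleftrightarrow> (\<forall>i<n. \<forall>j<n. D (i * n + j) = J \<or>
     (\<exists>k<n. B (k * n + j) \<le> A (i * n + k) \<and> D (i * n + j) = A (i * n + k)))"

lemma attained_upd:
  assumes "attained n J A B D" "p < n * n" "j < n" "B ((p mod n) * n + j) \<le> A p"
  shows "attained n J A B (D((p div n) * n + j := A p))"
  unfolding attained_def
proof (intro allI impI)
  fix i j' assume ij: "i < n" "j' < n"
  show "(D((p div n) * n + j := A p)) (i * n + j') = J \<or>
     (\<exists>k<n. B (k * n + j') \<le> A (i * n + k) \<and> (D((p div n) * n + j := A p)) (i * n + j') = A (i * n + k))"
  proof (cases "i = p div n \<and> j' = j")
    case True
    have "p mod n < n" using ij by simp
    then show ?thesis using True assms by (intro disjI2 exI[of _ "p mod n"]) simp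
  next
    case False
    then have "i * n + j' \<noteq> (p div n) * n + j" using index_inj[of i n j' "p div n" j] ij assms by auto
    then show ?thesis using assms(1) ij by (simp add: attained_def)
  qed
qed

text \<open>Row and column are decoded from the position of each entry, so one routine serves column
  chunks, whose entries aim at many output rows, and row chunks, whose entries all aim at the same
  output entry.\<close>

lemma scan_spec:
  assumes "var h vN = n" "var h 20 = a" "var h 21 = l" "var h 22 = j" "j < n" "0 < w"
    "\<forall>e<l. arr h bOrd (arr h b (a + e)) < n * n" "a + l < wlim w" "n * n + n + 2 < wlim w"
    "\<forall>p<n * n. arr h bA p + 2 < wlim w" "attained n J (arr h bA) (arr h bB) (arr h bCA)" "b \<noteq> bCA"
  shows "wp w (scan b) (\<lambda>h'. clk h' \<le> clk h + 60 * l + 10 \<and> (\<forall>p. arr h' bCA p \<le> arr h bCA p) \<and>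
     attained n J (arr h bA) (arr h bB) (arr h' bCA) \<and>
     (\<forall>e<l. let p = arr h bOrd (arr h b (a + e)) in arr h bB ((p mod n) * n + j) \<le> arr h bA p \<longrightarrow>
        arr h' bCA ((p div n) * n + j) \<le> arr h bA p)) h"
  unfolding scan_def
proof (rule vc_sound, simp, rule wp_for_const[where N = l and T = 52 and I = "\<lambda>i h'. (\<forall>p. arr h' bCA p \<le> arr h bCA p) \<and>
     attained n J (arr h bA) (arr h bB) (arr h' bCA) \<and>
     (\<forall>e<i. let p = arr h bOrd (arr h b (a + e)) in arr h bB ((p mod n) * n + j) \<le> arr h bA p \<longrightarrow>
        arr h' bCA ((p div n) * n + j) \<le> arr h bA p)"], goal_cases)
  case (9 i h')
  note f = 9(3) frm_var[OF 9(4)] frm_arr[OF 9(4)]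
  let ?p = "arr h bOrd (arr h b (a + i))" and ?A = "arr h bA"
  have p: "?p < n * n" using assms 9 by auto
  then have dm: "?p div n < n" "?p mod n < n" using assms(5) by (simp_all add: less_mult_imp_div_less)
  have id: "(?p div n) * n + j < n * n" "(?p mod n) * n + j < n * n" using dm assms(5) index_less by auto
  have l: "(?p div n) * n + j < wlim w" "(?p mod n) * n + j < wlim w" "(?p div n) * n < wlim w" "(?p mod n) * n < wlim w" "a + i < wlim w"
    "Suc (?A ?p) < wlim w" "1 < wlim w"
    using id assms(8,9,10) p 9(1) by (auto dest!: spec[of _ ?p])
  note at = attained_upd[OF _ p assms(5), of J ?A "arr h bB"]
  let ?B = "arr h bB" and ?i = "(?p div n) * n + j"
  let ?D = "(arr h' bCA)(?i := ?A ?p)"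
  show ?case
  proof (cases "?B ((?p mod n) * n + j) \<le> ?A ?p \<and> ?A ?p < arr h' bCA ?i")
    case True
    have 1: "?D q \<le> arr h' bCA q" for q using True by auto
    have 2: "\<forall>q. ?D q \<le> arr h bCA q" using 1 9(2) le_trans by blast
    have 3: "attained n J ?A ?B ?D" using at True 9(2) by blast
    have 4: "\<forall>e<Suc i. let p = arr h bOrd (arr h b (a + e)) in ?B ((p mod n) * n + j) \<le> ?A p \<longrightarrow>
        ?D ((p div n) * n + j) \<le> ?A p"
    proof (intro allI impI, unfold Let_def, intro impI)
      fix e assume e: "e < Suc i" and le: "?B ((arr h bOrd (arr h b (a + e)) mod n) * n + j) \<le> ?A (arr h bOrd (arr h b (a + e)))"
      show "?D ((arr h bOrd (arr h b (a + e)) div n) * n + j) \<le> ?A (arr h bOrd (arr h b (a + e)))"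
      proof (cases "e = i")
        case False
        then have "arr h' bCA ((arr h bOrd (arr h b (a + e)) div n) * n + j) \<le> ?A (arr h bOrd (arr h b (a + e)))"
          using 9(2) e le by (simp add: Let_def)
        then show ?thesis by (rule order_trans[OF 1])
      qed simp
    qed
    show ?thesis using True assms l 2 3 4 by (intro vc_sound) (simp add: f less_Suc_eq_le)
  next
    case False
    have 4: "\<forall>e<Suc i. let p = arr h bOrd (arr h b (a + e)) in ?B ((p mod n) * n + j) \<le> ?A p \<longrightarrow>
        arr h' bCA ((p div n) * n + j) \<le> ?A p"
      using 9(2) False by (auto simp: All_less_Suc Let_def)
    show ?thesis using False assms l 9(2) 4
      by (intro vc_sound, cases "?B ((?p mod n) * n + j) \<le> ?A ?p") (simp_all add: f less_Suc_eq_le)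
  qed
next
  case (10 h')
  then show ?case by simp
next
  case 8
  then show ?case using assms(11) by simp
qed (simp_all add: assms(1-6))

abbreviation (input) "bF \<equiv> 11::nat"
abbreviation (input) "bG \<equiv> 12::nat"
abbreviation (input) "bX \<equiv> 128::nat"
abbreviation (input) "bY \<equiv> 129::nat"
abbreviation (input) "bZ \<equiv> 130::nat"

text \<open>Only a column chunk whose range is split by \<open>B (k, j)\<close> is scanned here. A
  chunk that is good as a whole is left to the Boolean product via \<open>bY\<close>, and a chunk
  entirely below \<open>B (k, j)\<close> contains no witness.\<close>

definition colpass :: prog where
  "colpass = compile (30 ::= Rv vC * Rv vN ;; For 31 30 (
     32 ::= Rv 31 div Rv vN ;; 22 ::= Rv 31 mod Rv vN ;; 21 ::= Ld 19 (Rv 32) ;;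
     If (Nm 0 \<prec> Rv 21) (
       20 ::= Rv 32 * Rv vS ;; 33 ::= Ld 20 (Rv 32) * Rv vN + Rv 22 ;; 34 ::= Ld bB (Rv 33) ;;
       If (Ld bA (Ld bOrd (Ld 21 (Rv 20))) \<prec> Rv 34)
         (If (Rv 34 \<prec> Ld bA (Ld bOrd (Ld 21 ((Rv 20 + Rv 21) - Nm 1))) + Nm 1)
            (If (Ld bF (Rv 33) \<doteq> Nm 0) (Sto bF (Rv 33) (Nm 1) ;; Call (scan 21)) Nop) Nop)
         (Sto bY (Rv 32 * Rv vN2 + Rv 22) (Nm 1))) Nop))"

text \<open>A nonzero product entry certifies a witness inside the row chunk. As ranks ascend, later
  chunks of the same row cannot improve on the first certified one, so one scan per row and
  \<open>j\<close> is enough.\<close>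

definition rowpass :: prog where
  "rowpass = compile (30 ::= Rv vR * Rv vN ;; For 31 30 (
     32 ::= Rv 31 div Rv vN ;; 22 ::= Rv 31 mod Rv vN ;;
     If (Nm 0 \<prec> Ld bZ (Rv 32 * Rv vN2 + Rv 22)) (
       33 ::= Ld 15 (Rv 32) * Rv vN + Rv 22 ;;
       If (Ld bG (Rv 33) \<doteq> Nm 0) (Sto bG (Rv 33) (Nm 1) ;; 20 ::= Rv 32 * Rv vS ;;
         21 ::= Ld 14 (Rv 32) ;; Call (scan 16)) Nop) Nop))"

lemma wr_colpass [simp]: "wr colpass = {20, 21, 22, 23, 24, 25, 26, 30, 31, 32, 33, 34}" "wb colpass = {bCA, bF, bY}"
  by (auto simp: colpass_def)

lemma wr_rowpass [simp]: "wr rowpass = {20, 21, 22, 23, 24, 25, 26, 30, 31, 32, 33}" "wb rowpass = {bCA, bG}"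
  by (auto simp: rowpass_def)

locale half =
  fixes n J w :: nat and A B od :: "nat \<Rightarrow> nat"
  assumes n: "0 < n" and w: "0 < w"
    and A_le: "\<And>p. p < n * n \<Longrightarrow> A p \<le> J"
    and od_less: "\<And>z. z < n * n \<Longrightarrow> od z < n * n"
    and sorted: "\<And>z z'. z \<le> z' \<Longrightarrow> z' < n * n \<Longrightarrow> A (od z) \<le> A (od z')"
    and lim: "4 * (n * n) + J + 4 * n + 4 < wlim w"
begin

definition stat :: "vstate \<Rightarrow> bool" where
  "stat h \<longleftrightarrow> var h vN = n \<and> var h vNN = n * n \<and> var h vN2 = 2 * n \<and> var h vInf = J \<and>
     arr h bA = A \<and> arr h bB = B \<and> arr h bOrd = od"

definition col :: "nat \<Rightarrow> nat" where "col z = od z mod n"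
definition row :: "nat \<Rightarrow> nat" where "row z = od z div n"

lemma col_less [simp]: "col z < n"
  using n by (simp add: col_def)

lemma row_less: "z < n * n \<Longrightarrow> row z < n"
  using od_less[of z] by (simp add: row_def less_mult_imp_div_less)

definition good :: "nat \<Rightarrow> nat \<Rightarrow> bool" where
  "good z j \<longleftrightarrow> B (col z * n + j) \<le> A (od z)"

text \<open>
  A flag for \<open>(k, j)\<close> promises that \<open>val (k, j)\<close> bounds \<open>A\<close> from below at all ranks with key \<open>k\<close>
  that are still to be visited with \<open>j\<close> when the flat loop over pairs (line, \<open>j\<close>) is at \<open>q\<close>.
\<close>

definition flagged :: "(nat \<Rightarrow> nat) \<Rightarrow> (nat \<Rightarrow> nat) \<Rightarrow> (nat \<Rightarrow> nat) \<Rightarrow> nat \<Rightarrow> nat \<Rightarrow> nat \<Rightarrow> (nat \<Rightarrow> nat) \<Rightarrow> bool" where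
  "flagged key val \<rho> x y q F \<longleftrightarrow> (\<forall>k<n. \<forall>j<n. F (k * n + j) \<noteq> 0 \<longrightarrow>
     (\<forall>z. x \<le> z \<and> z < n * n \<and> key z = k \<and> (z < y \<longrightarrow> q \<le> \<rho> z * n + j) \<longrightarrow> val (k * n + j) \<le> A (od z)))"

lemma flaggedD:
  "flagged key val \<rho> x y q F \<Longrightarrow> F (key z * n + j) \<noteq> 0 \<Longrightarrow> key z < n \<Longrightarrow> j < n \<Longrightarrow> x \<le> z \<Longrightarrow> z < n * n \<Longrightarrow>
   (z < y \<Longrightarrow> q \<le> \<rho> z * n + j) \<Longrightarrow> val (key z * n + j) \<le> A (od z)"
  unfolding flagged_def by blast

lemma flagged_mono:
  assumes "flagged key val \<rho> x y q F" "q \<le> q'" "\<And>p. val' p \<le> val p"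
  shows "flagged key val' \<rho> x y q' F"
  unfolding flagged_def
proof (intro allI impI)
  fix k j z assume a: "k < n" "j < n" "F (k * n + j) \<noteq> 0"
    "x \<le> z \<and> z < n * n \<and> key z = k \<and> (z < y \<longrightarrow> q' \<le> \<rho> z * n + j)"
  then have "val (key z * n + j) \<le> A (od z)" using assms(2) by (intro flaggedD[OF assms(1)]) auto
  with assms(3)[of "k * n + j"] a show "val' (k * n + j) \<le> A (od z)" by simp
qed

text \<open>Ranks from \<open>y\<close> on were covered without the proviso on \<open>q\<close>, so
  the promise carries over to whatever lines the next part assigns to them.\<close>

lemma flagged_next:
  assumes "flagged key val \<rho> x y q F" "x \<le> y"
  shows "flagged key val \<rho>' y y' q' F"
  unfolding flagged_def
proof (intro allI impI)
  fix k j z assume a: "k < n" "j < n" "F (k * n + j) \<noteq> 0"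
    "y \<le> z \<and> z < n * n \<and> key z = k \<and> (z < y' \<longrightarrow> q' \<le> \<rho>' z * n + j)"
  then have "val (key z * n + j) \<le> A (od z)" using assms(2) by (intro flaggedD[OF assms(1)]) auto
  with a show "val (k * n + j) \<le> A (od z)" by simp
qed

lemma flagged_upd:
  assumes "flagged key val \<rho> x y q F" "k < n" "j < n"
    "\<And>z. x \<le> z \<Longrightarrow> z < n * n \<Longrightarrow> key z = k \<Longrightarrow> (z < y \<Longrightarrow> q \<le> \<rho> z * n + j) \<Longrightarrow> val (k * n + j) \<le> A (od z)"
  shows "flagged key val \<rho> x y q (F(k * n + j := v))"
  unfolding flagged_def
proof (intro allI impI)
  fix k' j' z assume a: "k' < n" "j' < n" "(F(k * n + j := v)) (k' * n + j') \<noteq> 0"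
    "x \<le> z \<and> z < n * n \<and> key z = k' \<and> (z < y \<longrightarrow> q \<le> \<rho> z * n + j')"
  show "val (k' * n + j') \<le> A (od z)"
  proof (cases "k' = k \<and> j' = j")
    case True
    then show ?thesis using a assms(4) by blast
  next
    case False
    then have "k' * n + j' \<noteq> k * n + j" using index_inj[of k' n j' k j] a assms by auto
    then show ?thesis using a assms(1) unfolding flagged_def by simp
  qed
qed

text \<open>The potential of the analysis: a scan of at most \<open>s\<close> entries happens only
  together with a newly raised flag, and no flag is lowered during a half product.\<close>

definition nflags :: "(nat \<Rightarrow> nat) \<Rightarrow> nat" where "nflags F = card {p. p < n * n \<and> F p \<noteq> 0}"

lemma nflags_le: "nflags F \<le> n * n"
  unfolding nflags_def by (rule card_filter_le)

lemma nflags_upd: "p < n * n \<Longrightarrow> F p = 0 \<Longrightarrow> nflags (F(p := Suc 0)) = Suc (nflags F)"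
proof -
  assume "p < n * n" "F p = 0"
  then have "{q. q < n * n \<and> (F(p := Suc 0)) q \<noteq> 0} = insert p {q. q < n * n \<and> F q \<noteq> 0}" by auto
  with \<open>F p = 0\<close> show ?thesis by (simp add: nflags_def)
qed

end

locale part = half +
  fixes x y s :: nat
  assumes s: "0 < s" and xy: "x \<le> y" "y \<le> n * n" "y - x \<le> n * s"
    and lim_s: "2 * n * s + 2 * n + s + 2 < wlim w"
begin

lemma line_bounds:
  assumes ch: "chunked n s key x y c S K L \<rho> R" and z: "x \<le> z" "z < y" and v: "\<rho> z = v"
  shows "0 < S v" "L (v * s) \<le> z" "z \<le> L (v * s + S v - Suc 0)" "\<exists>e<S v. L (v * s + e) = z" "v < R" "K v = key z"
proof -
  note d = chunkedD[OF ch]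
  show ex: "\<exists>e<S v. L (v * s + e) = z" using d(14) z v by blast
  show vR: "v < R" and "K v = key z" using d(11,12) z v by auto
  then obtain e where e: "e < S v" "L (v * s + e) = z" using ex by blast
  then show "0 < S v" by simp
  show "L (v * s) \<le> z" using d(10)[OF vR, of 0 e] e by (cases "e = 0") auto
  show "z \<le> L (v * s + S v - Suc 0)" using d(10)[OF vR, of e "S v - Suc 0"] e
    by (cases "e = S v - Suc 0") (auto simp: less_imp_le Nat.add_diff_assoc)
qed

lemma line_ends:
  assumes ch: "chunked n s key x y c S K L \<rho> R" and v: "v < R" "0 < S v"
  shows "x \<le> L (v * s)" "L (v * s) < y" "\<rho> (L (v * s)) = v"
    "x \<le> L (v * s + S v - Suc 0)" "L (v * s + S v - Suc 0) < y" "\<rho> (L (v * s + S v - Suc 0)) = v"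
  using chunkedD(7-9)[OF ch v(1), of 0] chunkedD(7-9)[OF ch v(1), of "S v - Suc 0"] v by auto

text \<open>The lines of one key are filled one after the other in order of rank, so a later line,
  or a later part, holds only later ranks; sortedness does the rest.\<close>

lemma line_later:
  assumes ch: "chunked n s key x y c S K L \<rho> R" and z: "x \<le> z0" "z0 < y" "x \<le> z" "z < n * n" "key z = key z0"
    and "z < y \<Longrightarrow> \<rho> z0 < \<rho> z"
  shows "A (od z0) \<le> A (od z)"
proof (rule sorted)
  show "z0 \<le> z"
  proof (rule ccontr)
    assume "\<not> z0 \<le> z"
    then have "z < y" "\<rho> z \<le> \<rho> z0" using z chunkedD(15)[OF ch, of z z0] by auto
    with assms(7) show False by simp
  qed
qed (use z in simp)

lemma flat_less: "q < R * n \<Longrightarrow> q div n < R" "q mod n < n"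
  using n by (simp_all add: less_mult_imp_div_less)

lemma flat_step:
  assumes "v * n + j < Suc q" "j < n" "\<not> v * n + j < q"
  shows "v = q div n \<and> j = q mod n"
proof -
  have "q = v * n + j" using assms by simp
  with assms(2) show ?thesis by simp
qed

lemma flat_next:
  assumes "Suc q \<le> v * n + q mod n"
  shows "q div n < v"
proof (rule ccontr)
  assume "\<not> q div n < v"
  then have "v * n \<le> (q div n) * n" by simp
  then have "v * n + q mod n \<le> q" using div_mult_mod_eq[of q n] by linarith
  with assms show False by simp
qed

text \<open>Each new flag pays \<open>80 * s\<close> steps for its scan; everything else is constant
  per pair of line and column \<open>j\<close>, of which there are at most
  \<open>2 * n * n\<close>.\<close>

lemma colpass_spec:
  assumes st: "stat h" "var h vS = s" and ch0: "is_chunked 18 vC n s col x y h"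
    and fl: "flagged col B (arr h 22) x y 0 (arr h bF)"
    and at: "attained n J A B (arr h bCA)" and Y0: "\<forall>p<2 * n * (2 * n). arr h bY p = 0"
  shows "wp w colpass (\<lambda>h'. clk h' + 80 * s * nflags (arr h bF) \<le> clk h + 200 * (n * n) + 20 + 80 * s * nflags (arr h' bF) \<and>
     (\<forall>p. arr h' bCA p \<le> arr h bCA p) \<and> attained n J A B (arr h' bCA) \<and>
     flagged col B (arr h 22) y y 0 (arr h' bF) \<and>
     (\<forall>p<2 * n * (2 * n). arr h' bY p \<le> 1) \<and>
     (\<forall>v j. v < 2 * n \<and> j < 2 * n \<and> arr h' bY (v * (2 * n) + j) \<noteq> 0 \<longrightarrow>
        j < n \<and> (\<forall>z. x \<le> z \<and> z < y \<and> arr h 22 z = v \<longrightarrow> good z j)) \<and>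
     (\<forall>z j. x \<le> z \<and> z < y \<and> j < n \<and> good z j \<longrightarrow>
        arr h' bCA (row z * n + j) \<le> A (od z) \<or> arr h' bY (arr h 22 z * (2 * n) + j) \<noteq> 0)) h"
proof -
  define C c S K L \<gamma> where "C = var h vC" and "c = arr h 18" and "S = arr h 19" and "K = arr h 20"
    and "L = arr h 21" and "\<gamma> = arr h 22"
  note defs = C_def c_def S_def K_def L_def \<gamma>_def
  have ch: "chunked n s col x y c S K L \<gamma> C" using ch0 by (simp add: is_chunked_def defs eval_nat_numeral)
  note d = chunkedD[OF ch]
  have C2: "C \<le> 2 * n" using chunked_lines_le[OF ch] xy s by auto
  have Cn: "C * n \<le> 2 * (n * n)" using mult_le_mono1[OF C2, of n] by (simp add: mult.assoc)
  define inv where "inv = (\<lambda>q (h'::vstate). (\<forall>p. arr h' bCA p \<le> arr h bCA p) \<and> attained n J A B (arr h' bCA) \<and>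
     flagged col B \<gamma> x y q (arr h' bF) \<and>
     (\<forall>p<2 * n * (2 * n). arr h' bY p \<le> 1) \<and>
     (\<forall>v j. v < 2 * n \<and> j < 2 * n \<and> arr h' bY (v * (2 * n) + j) \<noteq> 0 \<longrightarrow>
        j < n \<and> (\<forall>z. x \<le> z \<and> z < y \<and> \<gamma> z = v \<longrightarrow> good z j)) \<and>
     (\<forall>z j. x \<le> z \<and> z < y \<and> j < n \<and> good z j \<and> \<gamma> z * n + j < q \<longrightarrow>
        arr h' bCA (row z * n + j) \<le> A (od z) \<or> arr h' bY (\<gamma> z * (2 * n) + j) \<noteq> 0))"
  show ?thesis unfolding colpass_def
  proof (rule vc_sound, simp, intro conjI, goal_cases)
    case 1
    have "var h 12 * var h 2 = C * n" using st by (simp add: C_def stat_def)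
    then show ?case using Cn lim by linarith
  next
    case 2
    let ?b = "If (Nm 0 \<prec> Rv 21) Nop Nop"
    show ?case
    proof (rule wp_for[where N = "C * n" and I = "\<lambda>q h'. inv q h' \<and>
        clk h' + 80 * s * nflags (arr h bF) \<le> clk h + 6 + 100 * q + 80 * s * nflags (arr h' bF)"], goal_cases)
      case (9 q h')
      define v j where "v = q div n" and "j = q mod n"
      have v: "v < C" and j: "j < n" using flat_less(1)[OF 9(1)] flat_less(2) by (simp_all add: v_def j_def)
      have q: "q = v * n + j" by (simp add: v_def j_def)
      note f = frm_var[OF 9(4)] frm_arr[OF 9(4)]
      have vs: "var h' vN = n" "var h' vN2 = 2 * n" "var h' vS = s" "arr h' bA = A" "arr h' bB = B" "arr h' bOrd = od"
        "arr h' 19 = S" "arr h' 20 = K" "arr h' 21 = L" using st by (simp_all add: f stat_def defs)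
      note I = 9(2)[THEN conjunct1, unfolded inv_def]
      have I1: "\<And>p. arr h' bCA p \<le> arr h bCA p" and I2: "attained n J A B (arr h' bCA)"
        and I3: "flagged col B \<gamma> x y q (arr h' bF)" and I4: "\<And>p. p < 2 * n * (2 * n) \<Longrightarrow> arr h' bY p \<le> 1"
        and I5: "\<And>v j. v < 2 * n \<Longrightarrow> j < 2 * n \<Longrightarrow> arr h' bY (v * (2 * n) + j) \<noteq> 0 \<Longrightarrow>
          j < n \<and> (\<forall>z. x \<le> z \<and> z < y \<and> \<gamma> z = v \<longrightarrow> good z j)"
        and I6: "\<And>z j. x \<le> z \<Longrightarrow> z < y \<Longrightarrow> j < n \<Longrightarrow> good z j \<Longrightarrow> \<gamma> z * n + j < q \<Longrightarrow>
          arr h' bCA (row z * n + j) \<le> A (od z) \<or> arr h' bY (\<gamma> z * (2 * n) + j) \<noteq> 0"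
        using I by blast+
      have invI: "inv (Suc q) h''" if 1: "\<And>p. arr h'' bCA p \<le> arr h' bCA p" and 2: "attained n J A B (arr h'' bCA)"
          and 3: "flagged col B \<gamma> x y (Suc q) (arr h'' bF)"
          and 4: "\<And>p. arr h'' bY p = arr h' bY p \<or> arr h'' bY p = 1 \<and> p = v * (2 * n) + j \<and> (\<forall>z. x \<le> z \<and> z < y \<and> \<gamma> z = v \<longrightarrow> good z j)"
          and 5: "\<And>z. x \<le> z \<Longrightarrow> z < y \<Longrightarrow> good z j \<Longrightarrow> \<gamma> z = v \<Longrightarrow>
             arr h'' bCA (row z * n + j) \<le> A (od z) \<or> arr h'' bY (\<gamma> z * (2 * n) + j) \<noteq> 0" for h''
        unfolding inv_def
      proof (intro conjI allI impI)
        show "arr h'' bCA p \<le> arr h bCA p" for p using 1[of p] I1[of p] by simp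
        show "attained n J A B (arr h'' bCA)" by fact
        show "flagged col B \<gamma> x y (Suc q) (arr h'' bF)" by fact
        show "arr h'' bY p \<le> 1" if "p < 2 * n * (2 * n)" for p using 4[of p] I4[OF that] by auto
      next
        fix u k assume u: "u < 2 * n \<and> k < 2 * n \<and> arr h'' bY (u * (2 * n) + k) \<noteq> 0"
        have "k < n \<and> (\<forall>z. x \<le> z \<and> z < y \<and> \<gamma> z = u \<longrightarrow> good z k)"
        proof (cases "arr h' bY (u * (2 * n) + k) = 0")
          case False
          then show ?thesis using I5 u by blast
        next
          case True
          with 4[of "u * (2 * n) + k"] u have e: "u * (2 * n) + k = v * (2 * n) + j" and g: "\<forall>z. x \<le> z \<and> z < y \<and> \<gamma> z = v \<longrightarrow> good z j" by auto
          then have "u = v \<and> k = j" using index_inj[OF e] u j by simp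
          then show ?thesis using g j by simp
        qed
        then show "k < n" "\<And>z. x \<le> z \<and> z < y \<and> \<gamma> z = u \<Longrightarrow> good z k" by auto
      next
        fix z k assume z: "x \<le> z \<and> z < y \<and> k < n \<and> good z k \<and> \<gamma> z * n + k < Suc q"
        show "arr h'' bCA (row z * n + k) \<le> A (od z) \<or> arr h'' bY (\<gamma> z * (2 * n) + k) \<noteq> 0"
        proof (cases "\<gamma> z * n + k < q")
          case True
          then have "arr h' bCA (row z * n + k) \<le> A (od z) \<or> arr h' bY (\<gamma> z * (2 * n) + k) \<noteq> 0" using I6 z by blast
          then show ?thesis using 1[of "row z * n + k"] 4[of "\<gamma> z * (2 * n) + k"] by auto
        next
          case False
          then have "\<gamma> z = v \<and> k = j" using flat_step[of "\<gamma> z" k q] z by (simp add: v_def j_def)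
          then show ?thesis using 5 z by blast
        qed
      qed
      have Suc_fl: "flagged col B \<gamma> x y (Suc q) (arr h' bF)" by (rule flagged_mono[OF I3]) auto
      have clk: "clk h' + 80 * s * nflags (arr h bF) \<le> clk h + 6 + 100 * q + 80 * s * nflags (arr h' bF)" using 9(2) by blast
      have Kv: "K v < n" using d(5)[OF v] .
      have idx: "K v * n + j < n * n" using index_less[OF Kv j] .
      have l1: "v * (2 * n) + j < wlim w" "v * (2 * n) < wlim w"
      proof -
        have "v * (2 * n) + j < C * (2 * n)" using index_less[OF v, of j "2 * n"] j by simp
        also have "\<dots> \<le> 4 * (n * n)" using Cn by simp
        finally show "v * (2 * n) + j < wlim w" using lim by linarith
        then show "v * (2 * n) < wlim w" by linarith
      qed
      have l2: "v * s + S v < wlim w" "v * s < wlim w"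
      proof -
        have "v * s \<le> 2 * n * s" using v C2 by (intro mult_le_mono1) simp
        then show "v * s + S v < wlim w" "v * s < wlim w" using d(6)[OF v] lim_s by linarith+
      qed
      have l3: "K v * n + j < wlim w" "K v * n < wlim w" using idx lim by linarith+
      have A2: "\<forall>p<n * n. A p + 2 < wlim w"
      proof (intro allI impI)
        fix p assume "p < n * n"
        then show "A p + 2 < wlim w" using A_le[of p] lim by linarith
      qed
      have od_lt: "z < y \<Longrightarrow> od z < n * n" for z using od_less xy by simp
      show ?case
      proof (cases "S v = 0")
        case True
        have no: "\<gamma> z \<noteq> v" if "x \<le> z" "z < y" for z
          using line_bounds(1)[OF ch that refl] True by auto
        show ?thesis
        proof (rule vc_sound, simp add: vs 9(3) True w v_def[symmetric] j_def[symmetric], intro conjI, goal_cases)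
          case 1
          show ?case by (rule invI) (use I2 Suc_fl no in auto)
        qed (use clk in auto)
      next
        case False
        then have S0: "0 < S v" by simp
        note le = line_ends[OF ch v S0]
        let ?lo = "A (od (L (v * s)))" and ?hi = "A (od (L (v * s + S v - Suc 0)))" and ?b = "B (K v * n + j)"
        have bnd: "?lo \<le> A (od z)" "A (od z) \<le> ?hi" "col z = K v" "\<exists>e<S v. L (v * s + e) = z" if "x \<le> z" "z < y" "\<gamma> z = v" for z
          using line_bounds[OF ch that] sorted that xy le by auto
        have hi_l: "Suc ?hi < wlim w" using A_le[OF od_lt[OF le(5)]] lim by linarith
        have last_le: "v * s + S v - Suc 0 < wlim w" "Suc 0 \<le> v * s + S v" using l2 S0 by linarith+
        consider "?b \<le> ?lo" | "?lo < ?b" "?b \<le> ?hi" "arr h' bF (K v * n + j) = 0" |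
          "?lo < ?b" "?b \<le> ?hi" "arr h' bF (K v * n + j) \<noteq> 0" | "?lo < ?b" "?hi < ?b" by linarith
        then show ?thesis
        proof cases
          case 1
          then show ?thesis
          proof (intro vc_sound, simp add: vs 9(3) S0 w l1 l2 l3 hi_l v_def[symmetric] j_def[symmetric] last_le, intro conjI, goal_cases)
            case 1
            show ?case by (rule invI) (use I2 Suc_fl bnd \<open>?b \<le> ?lo\<close> in \<open>force simp: good_def\<close>)+
          qed (use clk in auto)
        next
          case 2
          \<comment> \<open>The line is split by \<open>B (k, j)\<close>, so its greatest entry is
            at least that value, and so is every entry on later lines of this column.\<close>
          have fl': "flagged col B \<gamma> x y (Suc q) ((arr h' bF)(K v * n + j := Suc 0))"
          proof (rule flagged_upd[OF Suc_fl Kv j])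
            fix z assume z: "x \<le> z" "z < n * n" "col z = K v" "z < y \<Longrightarrow> Suc q \<le> \<gamma> z * n + j"
            have "?hi \<le> A (od z)"
            proof (rule line_later[OF ch le(4,5) z(1,2)])
              show "col z = col (L (v * s + S v - Suc 0))" using bnd(3)[OF le(4-6)] z by simp
              show "\<gamma> (L (v * s + S v - Suc 0)) < \<gamma> z" if "z < y"
                using flat_next[of q "\<gamma> z"] z(4)[OF that] le(6) by (simp add: v_def j_def)
            qed
            with 2 show "?b \<le> A (od z)" by simp
          qed
          have nf: "nflags ((arr h' bF)(K v * n + j := Suc 0)) = Suc (nflags (arr h' bF))"
            using nflags_upd[of _ "arr h' bF", OF idx] 2(3) by blast
          have ol: "od (L (v * s + e)) < n * n" if "e < S v" for e using od_lt d(8)[OF v that] by blast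
          have sc: "60 * S v + 10 \<le> 70 * s" using d(6)[OF v] s by linarith
          show ?thesis
          proof (rule vc_sound, simp add: 2 vs 9(3) S0 w l1 l2 l3 hi_l v_def[symmetric] j_def[symmetric] last_le less_Suc_eq_le cong: conj_cong,
              rule wp_frame[OF scan_spec[where n = n and a = "v * s" and l = "S v" and j = j and J = J]], goal_cases)
            case (13 h'')
            note g = frm_arr[OF 13(2)]
            have e: "arr h'' bF = (arr h' bF)(K v * n + j := Suc 0)" "arr h'' bY = arr h' bY" using g by simp_all
            have r: "\<forall>p. arr h'' bCA p \<le> arr h' bCA p" "attained n J A B (arr h'' bCA)" "clk h'' \<le> clk h' + 60 * S v + 100"
              "\<And>e. e < S v \<Longrightarrow> good (L (v * s + e)) j \<Longrightarrow> arr h'' bCA (row (L (v * s + e)) * n + j) \<le> A (od (L (v * s + e)))"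
              using 13(1) vs by (auto simp: Let_def good_def col_def row_def)
            have "inv (Suc q) (upd 31 (Suc q) 4 h'')"
            proof (rule invI)
              show "flagged col B \<gamma> x y (Suc q) (arr (upd 31 (Suc q) 4 h'') bF)" using fl' e by simp
            next
              fix z assume z: "x \<le> z" "z < y" "good z j" "\<gamma> z = v"
              obtain e where "e < S v" "L (v * s + e) = z" using bnd(4)[OF z(1,2,4)] by blast
              with r(4)[of e] z show "arr (upd 31 (Suc q) 4 h'') bCA (row z * n + j) \<le> A (od z) \<or>
                arr (upd 31 (Suc q) 4 h'') bY (\<gamma> z * (2 * n) + j) \<noteq> 0" by auto
            qed (use r e in auto)
            moreover have "clk (upd 31 (Suc q) 4 h'') + 80 * s * nflags (arr h bF) \<le> clk h + 6 + 100 * Suc q + 80 * s * nflags (arr h'' bF)"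
              using 13(1) clk sc nf e by (simp add: algebra_simps)
            ultimately show ?case by simp
          qed (use vs j l2 I2 ol w A2 lim in auto)
        next
          case 3
          \<comment> \<open>This case is contradictory, so testing the flag never suppresses a
            necessary scan: the first rank of the line is still to be visited, and a raised flag
            promises \<open>B (k, j) \<le> ?lo\<close>.\<close>
          have "B (col (L (v * s)) * n + j) \<le> ?lo"
          proof (rule flaggedD[OF I3])
            show "arr h' bF (col (L (v * s)) * n + j) \<noteq> 0" using 3 bnd(3)[OF le(1-3)] by simp
          qed (use le j xy q in auto)
          then show ?thesis using 3 bnd(3)[OF le(1-3)] by simp
        next
          case 4
          then show ?thesis
          proof (intro vc_sound, simp add: vs 9(3) S0 w l1 l2 l3 hi_l v_def[symmetric] j_def[symmetric] last_le, intro conjI, goal_cases)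
            case 1
            show ?case by (rule invI) (use I2 Suc_fl bnd \<open>?hi < ?b\<close> in \<open>force simp: good_def\<close>)+
          qed (use clk in auto)
        qed
      qed
    next
      case (10 h')
      then have I: "inv (C * n) h'" and c: "clk h' + 80 * s * nflags (arr h bF) \<le> clk h + 6 + 100 * (C * n) + 80 * s * nflags (arr h' bF)"
        by auto
      note I = I[unfolded inv_def]
      have fl: "flagged col B \<gamma> y y 0 (arr h' bF)" using flagged_next[of col B \<gamma> x y "C * n" "arr h' bF" \<gamma> y 0] I xy by blast
      have "\<gamma> z * n + j < C * n" if "x \<le> z" "z < y" "j < n" for z j
        using index_less[OF d(11)] that by blast
      note g = this
      have cc: "clk (tick 4 h') + 80 * s * nflags (arr h bF) \<le> clk h + 200 * (n * n) + 20 + 80 * s * nflags (arr h' bF)"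
        using c Cn unfolding tick_simps by linarith
      show ?case unfolding \<gamma>_def[symmetric] tick_simps(2)
        by (intro conjI cc; insert I fl g) (blast | (simp; fail) | (simp, blast))+
    next
      case 8
      have "arr h bY (v * (2 * n) + j) = 0" if "v < 2 * n" "j < 2 * n" for v j
        using Y0 index_less[OF that] by blast
      then show ?case using st fl at Y0 by (auto simp: inv_def \<gamma>_def)
    qed (use st w in \<open>auto simp: stat_def defs\<close>)
  qed
qed

text \<open>\<open>hit\<close> and \<open>cpl\<close> are the two sides of the Boolean product: a
  nonzero entry of \<open>bZ\<close> stems from a real witness, and a witness is either recorded by
  \<open>colpass\<close> already or visible in \<open>bZ\<close>.\<close>

lemma rowpass_spec:
  assumes st: "stat h" "var h vS = s" and ch0: "is_chunked 13 vR n s row x y h"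
    and fl: "flagged row (arr h bCA) (arr h 17) x y 0 (arr h bG)"
    and at: "attained n J A B (arr h bCA)"
    and hit: "\<And>v j. v < 2 * n \<Longrightarrow> j < n \<Longrightarrow> arr h bZ (v * (2 * n) + j) \<noteq> 0 \<Longrightarrow>
       \<exists>z. x \<le> z \<and> z < y \<and> arr h 17 z = v \<and> good z j"
    and cpl: "\<And>z j. x \<le> z \<Longrightarrow> z < y \<Longrightarrow> j < n \<Longrightarrow> good z j \<Longrightarrow>
       arr h bCA (row z * n + j) \<le> A (od z) \<or> arr h bZ (arr h 17 z * (2 * n) + j) \<noteq> 0"
  shows "wp w rowpass (\<lambda>h'. clk h' + 80 * s * nflags (arr h bG) \<le> clk h + 200 * (n * n) + 20 + 80 * s * nflags (arr h' bG) \<and>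
     (\<forall>p. arr h' bCA p \<le> arr h bCA p) \<and> attained n J A B (arr h' bCA) \<and>
     flagged row (arr h' bCA) (arr h 17) y y 0 (arr h' bG) \<and>
     (\<forall>z j. x \<le> z \<and> z < y \<and> j < n \<and> good z j \<longrightarrow> arr h' bCA (row z * n + j) \<le> A (od z))) h"
proof -
  define R c S K L \<rho> where "R = var h vR" and "c = arr h 13" and "S = arr h 14" and "K = arr h 15"
    and "L = arr h 16" and "\<rho> = arr h 17"
  note defs = R_def c_def S_def K_def L_def \<rho>_def
  have ch: "chunked n s row x y c S K L \<rho> R" using ch0 by (simp add: is_chunked_def defs eval_nat_numeral)
  note d = chunkedD[OF ch]
  have R2: "R \<le> 2 * n" using chunked_lines_le[OF ch] xy s by auto
  have Rn: "R * n \<le> 2 * (n * n)" using mult_le_mono1[OF R2, of n] by (simp add: mult.assoc)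
  define inv where "inv = (\<lambda>q (h'::vstate). (\<forall>p. arr h' bCA p \<le> arr h bCA p) \<and> attained n J A B (arr h' bCA) \<and>
     flagged row (arr h' bCA) \<rho> x y q (arr h' bG) \<and>
     (\<forall>z j. x \<le> z \<and> z < y \<and> j < n \<and> good z j \<and> \<rho> z * n + j < q \<longrightarrow> arr h' bCA (row z * n + j) \<le> A (od z)))"
  show ?thesis unfolding rowpass_def
  proof (rule vc_sound, simp, intro conjI, goal_cases)
    case 1
    have "var h 11 * var h 2 = R * n" using st by (simp add: R_def stat_def)
    then show ?case using Rn lim by linarith
  next
    case 2
    show ?case
    proof (rule wp_for[where N = "R * n" and I = "\<lambda>q h'. inv q h' \<and>
        clk h' + 80 * s * nflags (arr h bG) \<le> clk h + 6 + 100 * q + 80 * s * nflags (arr h' bG)"], goal_cases)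
      case (9 q h')
      define v j where "v = q div n" and "j = q mod n"
      have v: "v < R" and j: "j < n" using flat_less(1)[OF 9(1)] flat_less(2) by (simp_all add: v_def j_def)
      have q: "q = v * n + j" by (simp add: v_def j_def)
      note f = frm_var[OF 9(4)] frm_arr[OF 9(4)]
      define Z where "Z = arr h bZ"
      have vs: "var h' vN = n" "var h' vN2 = 2 * n" "var h' vS = s" "arr h' bA = A" "arr h' bB = B" "arr h' bOrd = od"
        "arr h' 14 = S" "arr h' 15 = K" "arr h' 16 = L" "arr h' bZ = Z" using st by (simp_all add: f stat_def defs Z_def)
      note I = 9(2)[THEN conjunct1, unfolded inv_def]
      have I1: "\<And>p. arr h' bCA p \<le> arr h bCA p" and I2: "attained n J A B (arr h' bCA)"
        and I3: "flagged row (arr h' bCA) \<rho> x y q (arr h' bG)"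
        and I6: "\<And>z j. x \<le> z \<Longrightarrow> z < y \<Longrightarrow> j < n \<Longrightarrow> good z j \<Longrightarrow> \<rho> z * n + j < q \<Longrightarrow>
          arr h' bCA (row z * n + j) \<le> A (od z)"
        using I by blast+
      have invI: "inv (Suc q) h''" if 1: "\<And>p. arr h'' bCA p \<le> arr h' bCA p" and 2: "attained n J A B (arr h'' bCA)"
          and 3: "flagged row (arr h'' bCA) \<rho> x y (Suc q) (arr h'' bG)"
          and 5: "\<And>z. x \<le> z \<Longrightarrow> z < y \<Longrightarrow> good z j \<Longrightarrow> \<rho> z = v \<Longrightarrow> arr h'' bCA (row z * n + j) \<le> A (od z)" for h''
        unfolding inv_def
      proof (intro conjI allI impI)
        show "arr h'' bCA p \<le> arr h bCA p" for p using 1[of p] I1[of p] by simp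
        show "attained n J A B (arr h'' bCA)" by fact
        show "flagged row (arr h'' bCA) \<rho> x y (Suc q) (arr h'' bG)" by fact
      next
        fix z k assume z: "x \<le> z \<and> z < y \<and> k < n \<and> good z k \<and> \<rho> z * n + k < Suc q"
        show "arr h'' bCA (row z * n + k) \<le> A (od z)"
        proof (cases "\<rho> z * n + k < q")
          case True
          then have "arr h' bCA (row z * n + k) \<le> A (od z)" using I6 z by blast
          then show ?thesis using 1[of "row z * n + k"] by simp
        next
          case False
          then have "\<rho> z = v \<and> k = j" using flat_step[of "\<rho> z" k q] z by (simp add: v_def j_def)
          then show ?thesis using 5 z by blast
        qed
      qed
      have Suc_fl: "flagged row (arr h' bCA) \<rho> x y (Suc q) (arr h' bG)" by (rule flagged_mono[OF I3]) auto
      have clk: "clk h' + 80 * s * nflags (arr h bG) \<le> clk h + 6 + 100 * q + 80 * s * nflags (arr h' bG)" using 9(2) by blast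
      have Kv: "K v < n" using d(5)[OF v] .
      have idx: "K v * n + j < n * n" using index_less[OF Kv j] .
      have l1: "v * (2 * n) + j < wlim w" "v * (2 * n) < wlim w"
      proof -
        have "v * (2 * n) + j < R * (2 * n)" using index_less[OF v, of j "2 * n"] j by simp
        also have "\<dots> \<le> 4 * (n * n)" using Rn by simp
        finally show "v * (2 * n) + j < wlim w" using lim by linarith
        then show "v * (2 * n) < wlim w" by linarith
      qed
      have l2: "v * s + S v < wlim w" "v * s < wlim w"
      proof -
        have "v * s \<le> 2 * n * s" using v R2 by (intro mult_le_mono1) simp
        then show "v * s + S v < wlim w" "v * s < wlim w" using d(6)[OF v] lim_s by linarith+
      qed
      have l3: "K v * n + j < wlim w" "K v * n < wlim w" using idx lim by linarith+
      have A2: "\<forall>p<n * n. A p + 2 < wlim w"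
      proof (intro allI impI)
        fix p assume "p < n * n"
        then show "A p + 2 < wlim w" using A_le[of p] lim by linarith
      qed
      have od_lt: "z < y \<Longrightarrow> od z < n * n" for z using od_less xy by simp
      have bnd: "row z = K v" "\<exists>e<S v. L (v * s + e) = z" if "x \<le> z" "z < y" "\<rho> z = v" for z
        using line_bounds(4,6)[OF ch that] by auto
      consider "Z (v * (2 * n) + j) = 0" | "0 < Z (v * (2 * n) + j)" "arr h' bG (K v * n + j) \<noteq> 0"
        | "0 < Z (v * (2 * n) + j)" "arr h' bG (K v * n + j) = 0" by blast
      then show ?case
      proof cases
        case 1
        have old: "arr h' bCA (row z * n + j) \<le> A (od z)" if "x \<le> z" "z < y" "good z j" "\<rho> z = v" for z
          using cpl[OF that(1,2) j that(3)] 1 that(4) I1[of "row z * n + j"] by (simp add: Z_def \<rho>_def)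
        from 1 show ?thesis
        proof (intro vc_sound, simp add: vs 9(3) w l1 v_def[symmetric] j_def[symmetric], intro conjI, goal_cases)
          case 1
          show ?case by (rule invI) (use I2 Suc_fl old in auto)
        qed (use clk in auto)
      next
        case 2
        \<comment> \<open>An earlier chunk of this row raised the flag, and the output entry found
          there bounds all entries of the present chunk from below; omitting the scan loses
          nothing.\<close>
        have old: "arr h' bCA (row z * n + j) \<le> A (od z)" if z: "x \<le> z" "z < y" "good z j" "\<rho> z = v" for z
        proof (rule flaggedD[OF I3])
          show "arr h' bG (row z * n + j) \<noteq> 0" using 2 bnd(1)[OF z(1,2,4)] by simp
          show "row z < n" using Kv bnd(1)[OF z(1,2,4)] by simp
        qed (use j z xy q in auto)
        from 2 show ?thesis
        proof (intro vc_sound, simp add: vs 9(3) w l1 l3 v_def[symmetric] j_def[symmetric], intro conjI, goal_cases)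
          case 1
          show ?case by (rule invI) (use I2 Suc_fl old in auto)
        qed (use clk in auto)
      next
        case 3
        have nf: "nflags ((arr h' bG)(K v * n + j := Suc 0)) = Suc (nflags (arr h' bG))"
          using nflags_upd[of _ "arr h' bG", OF idx] 3(2) by blast
        have ol: "od (L (v * s + e)) < n * n" if "e < S v" for e using od_lt d(8)[OF v that] by blast
        have sc: "60 * S v + 10 \<le> 70 * s" using d(6)[OF v] s by linarith
        show ?thesis
        proof (rule vc_sound, simp add: 3 vs 9(3) w l1 l2 l3 v_def[symmetric] j_def[symmetric],
            rule wp_frame[OF scan_spec[where n = n and a = "v * s" and l = "S v" and j = j and J = J]], goal_cases)
          case (13 h'')
          note g = frm_arr[OF 13(2)]
          have e: "arr h'' bG = (arr h' bG)(K v * n + j := Suc 0)" using g by simp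
          have r: "\<And>p. arr h'' bCA p \<le> arr h' bCA p" "attained n J A B (arr h'' bCA)"
            "\<And>e. e < S v \<Longrightarrow> good (L (v * s + e)) j \<Longrightarrow> arr h'' bCA (row (L (v * s + e)) * n + j) \<le> A (od (L (v * s + e)))"
            using 13(1) vs by (auto simp: Let_def good_def col_def row_def)
          have new: "arr h'' bCA (row z * n + j) \<le> A (od z)" if z: "x \<le> z" "z < y" "good z j" "\<rho> z = v" for z
          proof -
            obtain e where "e < S v" "L (v * s + e) = z" using bnd(2)[OF z(1,2,4)] by blast
            with r(3)[of e] z show ?thesis by simp
          qed
          have "v < 2 * n" using v R2 by simp
          \<comment> \<open>After the scan the output entry is at most the entry at this witness,
            hence at most every entry on later lines of the row: exactly the promise of the new
            flag.\<close>
          then obtain z0 where z0: "x \<le> z0" "z0 < y" "\<rho> z0 = v" "good z0 j"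
            using hit[of v j] j 3(1) by (auto simp: Z_def \<rho>_def)
          have fl0: "flagged row (arr h'' bCA) \<rho> x y (Suc q) (arr h' bG)" by (rule flagged_mono[OF I3 _ r(1)]) simp
          have fl': "flagged row (arr h'' bCA) \<rho> x y (Suc q) ((arr h' bG)(K v * n + j := Suc 0))"
          proof (rule flagged_upd[OF fl0 Kv j])
            fix z assume z: "x \<le> z" "z < n * n" "row z = K v" "z < y \<Longrightarrow> Suc q \<le> \<rho> z * n + j"
            have "A (od z0) \<le> A (od z)"
            proof (rule line_later[OF ch z0(1,2) z(1,2)])
              show "row z = row z0" using bnd(1)[OF z0(1-3)] z by simp
              show "\<rho> z0 < \<rho> z" if "z < y"
                using flat_next[of q "\<rho> z"] z(4)[OF that] z0(3) by (simp add: v_def j_def)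
            qed
            with new[OF z0(1,2,4,3)] bnd(1)[OF z0(1-3)] show "arr h'' bCA (K v * n + j) \<le> A (od z)" by simp
          qed
          have "inv (Suc q) (upd 31 (Suc q) 4 h'')"
            by (rule invI) (use r(1,2) fl' e new in auto)
          moreover have "clk (upd 31 (Suc q) 4 h'') + 80 * s * nflags (arr h bG) \<le> clk h + 6 + 100 * Suc q + 80 * s * nflags (arr h'' bG)"
            using 13(1) clk sc nf e by (simp add: algebra_simps)
          ultimately show ?case by simp
        qed (use vs j l2 I2 ol w A2 lim in auto)
      qed
    next
      case (10 h')
      then have I: "inv (R * n) h'" and c: "clk h' + 80 * s * nflags (arr h bG) \<le> clk h + 6 + 100 * (R * n) + 80 * s * nflags (arr h' bG)"
        by auto
      note I = I[unfolded inv_def]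
      have fl: "flagged row (arr h' bCA) \<rho> y y 0 (arr h' bG)"
        using flagged_next[of row "arr h' bCA" \<rho> x y "R * n" "arr h' bG" \<rho> y 0] I xy by blast
      have "\<rho> z * n + j < R * n" if "x \<le> z" "z < y" "j < n" for z j
        using index_less[OF d(11)] that by blast
      note g = this
      have cc: "clk (tick 4 h') + 80 * s * nflags (arr h bG) \<le> clk h + 200 * (n * n) + 20 + 80 * s * nflags (arr h' bG)"
        using c Rn unfolding tick_simps by linarith
      show ?case unfolding \<rho>_def[symmetric] tick_simps(2)
        by (intro conjI cc; insert I fl g) (blast | (simp; fail) | (simp, blast))+
    qed (use st fl at w in \<open>auto simp: inv_def stat_def defs\<close>)
  qed
qed

end

section \<open>One part of the sorted entries\<close>

definition zero_xy :: prog where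
  "zero_xy = compile (35 ::= Rv vN2 * Rv vN2 ;; For 36 35 (Sto bX (Rv 36) (Nm 0) ;; Sto bY (Rv 36) (Nm 0)))"

definition fill_x :: prog where
  "fill_x = compile (15 ::= Rv vY - Rv vX ;; For 14 15 (16 ::= Rv vX + Rv 14 ;;
     Sto bX (Ld 17 (Rv 16) * Rv vN2 + Ld 22 (Rv 16)) (Nm 1)))"

definition part_setup :: prog where
  "part_setup = compile (vY ::= Rv vX + Rv vN * Rv vS ;; If (Rv vNN \<prec> Rv vY) (vY ::= Rv vNN) Nop)"

text \<open>Besides the steps of the multiplication, \<open>n * n\<close> is counted per part to pay
  for the passes over it. The new \<open>s\<close> makes \<open>n * n\<close> scans cost about as
  much as has been counted; the summand 1 guarantees progress.\<close>

definition part_fin :: prog where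
  "part_fin = compile (vCnt ::= Rv vCnt + Rv vNN ;; vX ::= Rv vX + Rv vN * Rv vS ;; vS ::= Rv vCnt div Rv vNN + Nm 1)"

definition part_prog :: "prog \<Rightarrow> prog" where
  "part_prog MM = compile (Call part_setup ;; Call (chunk_init 13 vR) ;; Call (chunk_loop 13 vR (Ld bOrd (Rv 16) div Rv vN)) ;;
     Call (chunk_init 18 vC) ;; Call (chunk_loop 18 vC (Ld bOrd (Rv 16) mod Rv vN)) ;;
     Call zero_xy ;; Call fill_x ;; Call colpass ;; Call MM ;; Call rowpass ;; Call part_fin)"

definition half_init :: prog where
  "half_init = compile (For 13 vNN (Sto bCA (Rv 13) (Rv vInf) ;; Sto bF (Rv 13) (Nm 0) ;; Sto bG (Rv 13) (Nm 0)) ;;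
     vX ::= Nm 0 ;; vS ::= Nm 1 ;; vCnt ::= Nm 0)"

definition half_prog :: "prog \<Rightarrow> prog" where
  "half_prog MM = compile (Call csort ;; Call half_init ;; While (Rv vX \<prec> Rv vNN) (Call (part_prog MM)))"

lemma wr_zero_fill [simp]: "wr zero_xy = {35, 36}" "wb zero_xy = {bX, bY}" "wr fill_x = {14, 15, 16}" "wb fill_x = {bX}"
  "wr part_setup = {10}" "wb part_setup = {}" "wr part_fin = {7, 8, 9}" "wb part_fin = {}"
  "wr half_init = {8, 9, 7, 13}" "wb half_init = {bCA, bF, bG}"
  by (auto simp: zero_xy_def fill_x_def half_init_def part_setup_def part_fin_def)

text \<open>
  \<open>MM\<close> multiplies the 0-1 matrices of order \<open>2 * n\<close> in banks \<open>bX\<close> and \<open>bY\<close> and adds the number of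
  steps of the underlying multiplication program, at most \<open>T\<close>, to register \<open>vCnt\<close>.
\<close>

definition multiplies :: "nat \<Rightarrow> nat \<Rightarrow> nat \<Rightarrow> prog \<Rightarrow> bool" where
  "multiplies w n T MM \<longleftrightarrow> wr MM = {vCnt} \<and> wb MM \<subseteq> {128..} \<and>
     (\<forall>h. var h vN2 = 2 * n \<and> (\<forall>p<2 * n * (2 * n). arr h bX p \<le> 1 \<and> arr h bY p \<le> 1) \<and> var h vCnt + T < wlim w \<longrightarrow>
       wp w MM (\<lambda>h'. var h vCnt \<le> var h' vCnt \<and> var h' vCnt \<le> var h vCnt + T \<and>
         clk h' + 2 * var h vCnt \<le> clk h + 2 * var h' vCnt + 10 \<and>
         (\<forall>i<2 * n. \<forall>j<2 * n. arr h' bZ (i * (2 * n) + j) =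
            (\<Sum>l<2 * n. arr h bX (i * (2 * n) + l) * arr h bY (l * (2 * n) + j)))) h)"

lemma multiplies_wr: "multiplies w n T MM \<Longrightarrow> wr MM = {vCnt}"
  and multiplies_wb: "multiplies w n T MM \<Longrightarrow> b < 128 \<Longrightarrow> b \<notin> wb MM"
  by (auto simp: multiplies_def)

lemma zero_xy_spec:
  assumes "var h vN2 = m" "m * m < wlim w" "0 < w"
  shows "wp w zero_xy (\<lambda>h'. clk h' \<le> clk h + 20 * (m * m) + 20 \<and> (\<forall>p<m * m. arr h' bX p = 0 \<and> arr h' bY p = 0)) h"
  unfolding zero_xy_def
proof (rule vc_sound, simp add: assms, rule wp_for_const[where N = "m * m" and I = "\<lambda>i h'. \<forall>p<i. arr h' bX p = 0 \<and> arr h' bY p = 0" and T = 10], goal_cases)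
  case (9 i h')
  show ?case by (rule vc_sound) (use 9 assms in \<open>auto simp: less_Suc_eq\<close>)
qed (use assms in auto)

lemma fill_x_spec:
  assumes "var h vN2 = m" "m * m < wlim w" "0 < w" "var h vX = x" "var h vY = y" "x \<le> y"
    and "\<forall>z. x \<le> z \<and> z < y \<longrightarrow> arr h 17 z < m \<and> arr h 22 z < m" and "\<forall>p<m * m. arr h bX p = 0"
  shows "wp w fill_x (\<lambda>h'. clk h' \<le> clk h + 30 * (y - x) + 20 \<and> (\<forall>p<m * m. arr h' bX p \<le> 1) \<and>
     (\<forall>u<m. \<forall>v<m. arr h' bX (u * m + v) \<noteq> 0 \<longleftrightarrow> (\<exists>z. x \<le> z \<and> z < y \<and> arr h 17 z = u \<and> arr h 22 z = v))) h"
  unfolding fill_x_def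
proof (rule vc_sound, simp add: assms, rule wp_words, rule wp_for_const[where N = "y - x" and I = "\<lambda>i h'. (\<forall>p<m * m. arr h' bX p \<le> 1) \<and>
     (\<forall>u<m. \<forall>v<m. arr h' bX (u * m + v) \<noteq> 0 \<longleftrightarrow> (\<exists>z. x \<le> z \<and> z < x + i \<and> arr h 17 z = u \<and> arr h 22 z = v))" and T = 20], goal_cases)
  case (9 i h')
  note f = frm_var[OF 9(5)] frm_arr[OF 9(5)]
  let ?z = "x + i"
  have vs: "var h' 8 = x" "var h' 6 = m" "arr h' 17 = arr h 17" "arr h' 22 = arr h 22" using assms by (simp_all add: f)
  have z: "arr h 17 ?z < m" "arr h 22 ?z < m" using assms(7) 9(2) by auto
  have id: "arr h 17 ?z * m + arr h 22 ?z < m * m" using index_less z by blast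
  have l: "arr h 17 ?z * m + arr h 22 ?z < wlim w" "arr h 17 ?z * m < wlim w" using id assms(2) by linarith+
  have y: "x + i < wlim w" using words_var[OF 9(1), of 10] assms(5) 9(2) by simp
  have e: "(arr h 17 ?z * m + arr h 22 ?z = u * m + v) \<longleftrightarrow> (arr h 17 ?z = u \<and> arr h 22 ?z = v)" if "u < m" "v < m" for u v
    using index_eq_iff z that by blast
  have ex: "(\<exists>z. x \<le> z \<and> z < x + Suc i \<and> P z) \<longleftrightarrow> (\<exists>z. x \<le> z \<and> z < x + i \<and> P z) \<or> P ?z" for P
    by (metis add_Suc_right le_add1 less_Suc_eq)
  show ?case
  proof (rule vc_sound, simp add: vs 9(4) l y assms(3), intro conjI allI impI, goal_cases)
    case (1 p)
    then show ?case using 9(3) by auto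
  next
    case (2 u v)
    then show ?case using e[of u v] ex[of "\<lambda>z. arr h 17 z = u \<and> arr h 22 z = v"] by auto
  next
    case (3 u v)
    then show ?case using e[of u v] ex[of "\<lambda>z. arr h 17 z = u \<and> arr h 22 z = v"] 9(3) by simp blast
  qed
next
  case (10 h')
  then show ?case using assms by simp
next
  case 8
  have "arr h bX (u * m + v) = 0" if "u < m" "v < m" for u v using assms(8) index_less[OF that] by blast
  then show ?case using assms(8) by simp
qed (use assms in auto)

lemma half_init_spec:
  assumes "var h vNN = N" "var h vInf = J" "0 < w"
  shows "wp w half_init (\<lambda>h'. clk h' \<le> clk h + 30 * N + 20 \<and> (\<forall>p<N. arr h' bCA p = J \<and> arr h' bF p = 0 \<and> arr h' bG p = 0) \<and>
     var h' vX = 0 \<and> var h' vS = 1 \<and> var h' vCnt = 0) h"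
  unfolding half_init_def
proof (rule vc_sound, rule vc_call[where R = "\<lambda>h'. clk h' \<le> clk h + 30 * N + 10 \<and> (\<forall>p<N. arr h' bCA p = J \<and> arr h' bF p = 0 \<and> arr h' bG p = 0)"], goal_cases)
  case 1
  show ?case
  proof (rule wp_for_const[where N = N and I = "\<lambda>i h'. \<forall>p<i. arr h' bCA p = J \<and> arr h' bF p = 0 \<and> arr h' bG p = 0" and T = 14], goal_cases)
    case (9 i h')
    note f = frm_var[OF 9(4)] frm_arr[OF 9(4)]
    show ?case by (rule vc_sound) (use 9 assms in \<open>auto simp: f less_Suc_eq\<close>)
  qed (use assms in auto)
next
  case (2 h')
  then show ?case using assms by simp
qed

context half
begin

text \<open>The state between two parts. With both bounds of \<open>flagged\<close> equal to
  \<open>x\<close>, no rank belongs to a current part, so the assignment of lines is immaterial and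
  set to 0.\<close>

definition head :: "nat \<Rightarrow> vstate \<Rightarrow> bool" where
  "head x h \<longleftrightarrow> stat h \<and> attained n J A B (arr h bCA) \<and> flagged col B (\<lambda>_. 0) x x 0 (arr h bF) \<and>
     flagged row (arr h bCA) (\<lambda>_. 0) x x 0 (arr h bG) \<and>
     (\<forall>z j. z < x \<and> z < n * n \<and> j < n \<and> good z j \<longrightarrow> arr h bCA (row z * n + j) \<le> A (od z))"

definition flags :: "vstate \<Rightarrow> nat" where "flags h = nflags (arr h bF) + nflags (arr h bG)"

lemma flagged_shift:
  assumes "flagged key val \<rho> y y q F" "y \<le> x'"
  shows "flagged key val \<rho>' x' x' q' F"
  unfolding flagged_def
proof (intro allI impI)
  fix k j z assume a: "k < n" "j < n" "F (k * n + j) \<noteq> 0"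
    "x' \<le> z \<and> z < n * n \<and> key z = k \<and> (z < x' \<longrightarrow> q' \<le> \<rho>' z * n + j)"
  then have "val (key z * n + j) \<le> A (od z)" using assms(2) by (intro flaggedD[OF assms(1)]) auto
  with a show "val (k * n + j) \<le> A (od z)" by simp
qed

text \<open>Time is charged to two accounts: the growth of \<open>vCnt\<close> pays for the
  multiplication and all passes of order \<open>n * n\<close>, the new flags pay for the
  scans.\<close>

lemma part_prog_spec:
  assumes mm: "multiplies w n T MM" and hd: "head x h" and v: "var h vX = x" "var h vS = s" "var h vCnt = c"
    and x: "x < n * n" and s: "0 < s"
    and lims: "x + n * s < wlim w" "2 * n * s + 2 * n + s + 2 < wlim w" "c + T + n * n + 1 < wlim w"
  shows "wp w (part_prog MM) (\<lambda>h'. head (x + n * s) h' \<and> var h' vX = x + n * s \<and> c + n * n \<le> var h' vCnt \<and>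
     var h' vCnt \<le> c + n * n + T \<and> var h' vS = var h' vCnt div (n * n) + 1 \<and>
     clk h' + 80 * s * flags h + 2000 * c \<le> clk h + 2000 * var h' vCnt + 80 * s * flags h') h"
proof -
  define y where "y = min (x + n * s) (n * n)"
  interpret part n J w A B od x y s
    by unfold_locales (use s x lims in \<open>auto simp: y_def min_def\<close>)
  have st: "stat h" using hd by (simp add: head_def)
  then have vs: "var h 2 = n" "var h 5 = n * n" "var h 6 = 2 * n" by (simp_all add: stat_def)
  have xy: "x \<le> y" "y \<le> n * n" "y - x \<le> n * s" "y - x \<le> n * n" using x by (auto simp: y_def)
  have ns: "n * s < wlim w" using lims by linarith
  have nn: "0 < n * n" using n by simp
  have n2: "4 * (n * n) < wlim w" using lim by linarith
  let ?kr = "Ld bOrd (Rv 16) div Rv vN" and ?kc = "Ld bOrd (Rv 16) mod Rv vN"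
  have hd': "attained n J A B (arr h bCA)" "flagged col B (\<lambda>_. 0) x x 0 (arr h bF)"
    "flagged row (arr h bCA) (\<lambda>_. 0) x x 0 (arr h bG)"
    "\<And>z j. z < x \<Longrightarrow> z < n * n \<Longrightarrow> j < n \<Longrightarrow> good z j \<Longrightarrow> arr h bCA (row z * n + j) \<le> A (od z)"
    using hd by (auto simp: head_def)
  note [simp] = multiplies_wr[OF mm] multiplies_wb[OF mm]
  note stat' = st[unfolded stat_def]
  have su: "wp w part_setup (\<lambda>h'. clk h' \<le> clk h + 20 \<and> var h' 10 = y) h"
    unfolding part_setup_def
    by (rule vc_sound) (use v vs lims ns n w in \<open>auto simp: y_def min_def\<close>)
  show ?thesis unfolding part_prog_def
  proof (rule vc_sound, rule vc_call[OF su], goal_cases)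
    case (1 h1)
    note h1 = 1 and f1 = frm_var[OF 1(2)] frm_arr[OF 1(2)]
    show ?case
    proof (rule vc_call[OF chunk_init_spec[where n = n and s = s and key = row and x = x]], goal_cases)
      case (5 h2)
      note h2 = 5 and f2 = frm_var[OF 5(2)] frm_arr[OF 5(2)]
      show ?case
      proof (rule vc_call[OF chunk_loop_spec[where n = n and s = s and key = row and x = x and y = y]], goal_cases)
        case (11 z h')
        have "arr h' 10 = od" "var h' 2 = n" using stat' frm_arr[OF 11(3), of 10] frm_var[OF 11(3), of 2] by (simp_all add: f1 f2)
        then show ?case using 11(4) row_less[of z] 11(2) xy(2) by (simp add: row_def)
      next
        case (12 h3)
        note h3 = 12 and f3 = frm_var[OF 12(2)] frm_arr[OF 12(2)]
        show ?case
        proof (rule vc_call[OF chunk_init_spec[where n = n and s = s and key = col and x = x]], goal_cases)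
          case (5 h4)
          note h4 = 5 and f4 = frm_var[OF 5(2)] frm_arr[OF 5(2)]
          show ?case
          proof (rule vc_call[OF chunk_loop_spec[where n = n and s = s and key = col and x = x and y = y]], goal_cases)
            case (11 z h')
            have "arr h' 10 = od" "var h' 2 = n" using stat' frm_arr[OF 11(3), of 10] frm_var[OF 11(3), of 2] by (simp_all add: f1 f2 f3 f4)
            then show ?case using 11(4) n by (simp add: col_def)
          next
            case (12 h5)
            note h5 = 12 and f5 = frm_var[OF 12(2)] frm_arr[OF 12(2)]
            show ?case
            proof (rule vc_call[OF zero_xy_spec[where m = "2 * n"]], goal_cases)
              case (4 h6)
              note h6 = 4 and f6 = frm_var[OF 4(2)] frm_arr[OF 4(2)]
              note ff = f1 f2 f3 f4 f5 f6
              define \<rho> \<gamma> where "\<rho> = arr h6 17" and "\<gamma> = arr h6 22"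
              have cr: "is_chunked 13 11 n s row x y h6" and cc: "is_chunked 18 12 n s col x y h6"
                using h3(1) h5(1) by (simp_all add: is_chunked_def f4 f5 f6)
              note cr' = cr[unfolded is_chunked_def, simplified, folded \<rho>_def]
              note cc' = cc[unfolded is_chunked_def, simplified, folded \<gamma>_def]
              have R: "var h6 11 \<le> 2 * n" "var h6 12 \<le> 2 * n"
                using chunked_lines_le[OF cr'] chunked_lines_le[OF cc'] xy s by auto
              have rg: "\<rho> z < 2 * n" "\<gamma> z < 2 * n" if "x \<le> z" "z < y" for z
                using chunkedD(11)[OF cr' that] chunkedD(11)[OF cc' that] R by auto
              show ?case
              proof (rule vc_call[OF fill_x_spec[where m = "2 * n" and x = x and y = y]], goal_cases)
                case (9 h7)
                note h7 = 9 and f7 = frm_var[OF 9(2)] frm_arr[OF 9(2)]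
                have st7: "stat h7" using stat' by (simp add: stat_def ff f7)
                have g7: "arr h7 22 = \<gamma>" by (simp add: f7 \<gamma>_def)
                have F7: "arr h7 bF = arr h bF" "arr h7 bCA = arr h bCA" by (simp_all add: ff f7)
                show ?case
                proof (rule vc_call[OF colpass_spec], goal_cases)
                  case 1 show ?case by (rule st7)
                next
                  case 2 show ?case using v by (simp add: ff f7)
                next
                  case 3 show ?case using cc by (simp add: is_chunked_def f7)
                next
                  case 4 show ?case unfolding F7 by (rule flagged_next[OF hd'(2)]) simp
                next
                  case 5 show ?case using hd'(1) F7 by simp
                next
                  case 6 show ?case using h6(1) by (simp add: f7)
                next
                  case (7 h8)
                  note h8 = 7 and f8 = frm_var[OF 7(2)] frm_arr[OF 7(2)]
                  note c8 = h8(1)[unfolded g7]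
                  have Y8: "\<And>v j z. v < 2 * n \<Longrightarrow> j < 2 * n \<Longrightarrow> arr h8 bY (v * (2 * n) + j) \<noteq> 0 \<Longrightarrow> x \<le> z \<Longrightarrow> z < y \<Longrightarrow> \<gamma> z = v \<Longrightarrow> good z j"
                    using c8 by blast
                  have X8: "arr h8 bX = arr h7 bX" by (simp add: f8)
                  have X7: "\<And>u v. u < 2 * n \<Longrightarrow> v < 2 * n \<Longrightarrow> arr h7 bX (u * (2 * n) + v) \<noteq> 0 \<longleftrightarrow> (\<exists>z. x \<le> z \<and> z < y \<and> \<rho> z = u \<and> \<gamma> z = v)"
                    using h7(1) unfolding \<rho>_def \<gamma>_def by blast
                  have X1: "\<forall>p<2 * n * (2 * n). arr h8 bX p \<le> 1 \<and> arr h8 bY p \<le> 1" using h7(1) c8 unfolding X8 by blast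
                  have cnt8: "var h8 7 = c" using v by (simp add: ff f7 f8)
                  have "var h8 6 = 2 * n" using vs by (simp add: ff f7 f8)
                  with X1 cnt8 lims mm have MM: "wp w MM (\<lambda>h'. var h8 vCnt \<le> var h' vCnt \<and> var h' vCnt \<le> var h8 vCnt + T \<and>
                     clk h' + 2 * var h8 vCnt \<le> clk h8 + 2 * var h' vCnt + 10 \<and>
                     (\<forall>i<2 * n. \<forall>j<2 * n. arr h' bZ (i * (2 * n) + j) =
                        (\<Sum>l<2 * n. arr h8 bX (i * (2 * n) + l) * arr h8 bY (l * (2 * n) + j)))) h8"
                    unfolding multiplies_def by (elim conjE allE[of _ h8]) auto
                  show ?case
                  proof (rule vc_call[OF MM], goal_cases)
                    case (1 h9)
                    note h9 = 1 and f9 = frm_var[OF 1(2)] frm_arr[OF 1(2)]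
                    have Z9: "arr h9 bZ (i * (2 * n) + j) = (\<Sum>l<2 * n. arr h7 bX (i * (2 * n) + l) * arr h8 bY (l * (2 * n) + j))"
                      if "i < 2 * n" "j < 2 * n" for i j using h9(1) that unfolding X8 by blast
                    have st9: "stat h9" using stat' by (simp add: stat_def ff f7 f8 f9)
                    have r9: "arr h9 17 = \<rho>" by (simp add: f7 f8 f9 \<rho>_def)
                    have CA9: "arr h9 bCA = arr h8 bCA" "arr h9 bG = arr h bG" by (simp_all add: ff f7 f8 f9)
                    have le8: "\<And>p. arr h8 bCA p \<le> arr h bCA p" using c8 F7 by simp
                    show ?case
                    proof (rule vc_call[OF rowpass_spec], goal_cases)
                      case 1 show ?case by (rule st9)
                    next
                      case 2 show ?case using v by (simp add: ff f7 f8 f9)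
                    next
                      case 3 show ?case using cr by (simp add: is_chunked_def f7 f8 f9)
                    next
                      case 4 show ?case unfolding CA9 by (rule flagged_next[OF flagged_mono[OF hd'(3) le_refl le8]]) simp
                    next
                      case 5 show ?case using c8 CA9 by simp
                    next
                      case (6 u j)
                      then have "(\<Sum>l<2 * n. arr h7 bX (u * (2 * n) + l) * arr h8 bY (l * (2 * n) + j)) \<noteq> 0" using Z9[of u j] by simp
                      then have "\<not> (\<forall>l\<in>{..<2 * n}. arr h7 bX (u * (2 * n) + l) * arr h8 bY (l * (2 * n) + j) = 0)"
                        unfolding sum_eq_0_iff[OF finite_lessThan] .
                      then obtain l where l: "l < 2 * n" "arr h7 bX (u * (2 * n) + l) \<noteq> 0" "arr h8 bY (l * (2 * n) + j) \<noteq> 0"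
                        by auto
                      \<comment> \<open>The nonzero summand \<open>l\<close> names a column chunk
                        shared with the row chunk \<open>u\<close>. As \<open>bY\<close> marks it
                        good as a whole for \<open>j\<close>, the shared entry is a witness.\<close>
                      obtain z where z: "x \<le> z" "z < y" "\<rho> z = u" "\<gamma> z = l" using X7[OF 6(1) l(1)] l(2) by blast
                      have "good z j" using Y8[OF l(1) _ l(3) z(1,2,4)] 6(2) by simp
                      then show ?case using z r9 by blast
                    next
                      case (7 z j)
                      then have "arr h8 bCA (row z * n + j) \<le> A (od z) \<or> arr h8 bY (\<gamma> z * (2 * n) + j) \<noteq> 0" using c8 by blast
                      then show ?case
                      proof
                        assume Y: "arr h8 bY (\<gamma> z * (2 * n) + j) \<noteq> 0"
                        have X: "arr h7 bX (\<rho> z * (2 * n) + \<gamma> z) \<noteq> 0" using X7[OF rg[OF 7(1,2)]] 7 by blast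
                        have j2: "j < 2 * n" using 7 by simp
                        have "arr h9 bZ (\<rho> z * (2 * n) + j) \<noteq> 0"
                          unfolding Z9[OF rg(1)[OF 7(1,2)] j2] sum_eq_0_iff[OF finite_lessThan] using X Y rg(2)[OF 7(1,2)]
                          by (metis lessThan_iff mult_eq_0_iff)
                        then show ?thesis using r9 by simp
                      qed (simp add: CA9)
                    next
                      case (8 h10)
                      note h10 = 8 and f10 = frm_var[OF 8(2)] frm_arr[OF 8(2)]
                      note c10 = h10(1)[unfolded r9 CA9]
                      have vv: "var h10 2 = n" "var h10 5 = n * n" "var h10 8 = x" "var h10 9 = s" "var h10 7 = var h9 7"
                        using vs v by (simp_all add: ff f7 f8 f9 f10)
                      have cb: "c \<le> var h9 7" "var h9 7 \<le> c + T" using h9(1) cnt8 by auto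
                      have st10: "stat h10" using stat' by (simp add: stat_def ff f7 f8 f9 f10)
                      have F10: "arr h10 bF = arr h8 bF" by (simp add: f9 f10)
                      have yx: "y \<le> x + n * s" by (simp add: y_def)
                      have cpl: "arr h10 bCA (row z * n + j) \<le> A (od z)" if z: "z < x + n * s" "z < n * n" "j < n" "good z j" for z j
                      proof (cases "z < x")
                        case True
                        have "arr h10 bCA (row z * n + j) \<le> arr h bCA (row z * n + j)" using c10 le8 le_trans by blast
                        then show ?thesis using hd'(4)[OF True z(2-4)] by simp
                      next
                        case False
                        then have "x \<le> z" "z < y" using z by (auto simp: y_def)
                        then show ?thesis using c10 z by blast
                      qed
                      have fl10: "flagged col B \<gamma> y y 0 (arr h10 bF)" "flagged row (arr h10 bCA) \<rho> y y 0 (arr h10 bG)"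
                        "attained n J A B (arr h10 bCA)"
                        using c8 c10 unfolding F10 by blast+
                      have head10: "head (x + n * s) h10"
                        unfolding head_def using st10 fl10 flagged_shift[OF fl10(1) yx] flagged_shift[OF fl10(2) yx] cpl by blast
                      have ck: "clk h10 + 80 * s * flags h + 2000 * c + 1000 \<le> clk h + 2000 * (var h9 7 + n * n) + 80 * s * flags h10"
                      proof -
                        have 1: "clk h10 + 80 * s * nflags (arr h bG) \<le> clk h9 + 200 * (n * n) + 20 + 80 * s * nflags (arr h10 bG)" using c10 by blast
                        have 2: "clk h9 + 2 * c \<le> clk h8 + 2 * var h9 7 + 10" using h9(1) cnt8 by simp
                        have 3: "clk h8 + 80 * s * nflags (arr h bF) \<le> clk h7 + 200 * (n * n) + 20 + 80 * s * nflags (arr h10 bF)" using c8 F7 F10 by simp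
                        have 4: "clk h7 \<le> clk h6 + 30 * (y - x) + 20" "clk h6 \<le> clk h5 + 80 * (n * n) + 20" using h7(1) h6(1) by auto
                        have 5: "clk h5 \<le> clk h4 + 84 * (y - x) + 20" "clk h4 \<le> clk h3 + 20 * n + 20" 
                           "clk h3 \<le> clk h2 + 84 * (y - x) + 20" "clk h2 \<le> clk h1 + 20 * n + 20" "clk h1 \<le> clk h + 20"
                          using h5(1) h4(1) h3(1) h2(1) h1(1) by (auto simp: eval_nat_numeral)
                        have 6: "n \<le> n * n" "1 \<le> n * n" using n by auto
                        show ?thesis using 1 2 3 4 5 6 xy(4) cb unfolding flags_def add_mult_distrib2 by linarith
                      qed
                      have l: "var h9 7 + n * n < wlim w" "Suc ((var h9 7 + n * n) div (n * n)) < wlim w"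
                      proof -
                        show 1: "var h9 7 + n * n < wlim w" using cb lims by linarith
                        have "(var h9 7 + n * n) div (n * n) \<le> var h9 7 + n * n" by simp
                        then show "Suc ((var h9 7 + n * n) div (n * n)) < wlim w" using cb lims by linarith
                      qed
                      have fin: "wp w part_fin (\<lambda>h'. var h' 7 = var h9 7 + n * n \<and> var h' 8 = x + n * s \<and>
                          var h' 9 = (var h9 7 + n * n) div (n * n) + 1 \<and> clk h' \<le> clk h10 + 100) h10"
                        unfolding part_fin_def by (rule vc_sound, use l lims ns w in \<open>simp add: vv\<close>)
                      show ?case
                      proof (rule vc_call_last[OF fin], goal_cases)
                        case (1 h11)
                        note f11 = frm_var[OF 1(2)] frm_arr[OF 1(2)]
                        have "head (x + n * s) h11" using head10 by (simp add: head_def stat_def f11)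
                        moreover have "flags h11 = flags h10" by (simp add: flags_def f11)
                        ultimately show ?case using 1(1) ck cb by simp
                      qed
                    qed
                  qed
                qed
              qed (use n2 w xy v rg h6(1) in \<open>auto simp: \<rho>_def \<gamma>_def ff h1 vs\<close>)
            qed (use n2 w vs in \<open>auto simp: f1 f2 f3 f4 f5\<close>)
          qed (use h4(1) h1(1) v xy s w lims in \<open>auto simp: f1 f2 f3 f4\<close>)
        qed (use vs w in \<open>auto simp: f1 f2 f3\<close>)
      qed (use h2(1) h1(1) v xy s w lims in \<open>auto simp: f1 f2\<close>)
    qed (use vs w in \<open>auto simp: f1\<close>)
  qed
qed

end

text \<open>\<open>X\<close> is the final value of the counter. Its quadratic inequality holds for
  every multiplication program; the exponent comes in only when the inequality is solved.\<close>

lemma half_prog_spec: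
  assumes mm: "multiplies w n T MM" and n: "0 < n" and w: "0 < w"
    and v: "var h vN = n" "var h vNN = n * n" "var h vN2 = 2 * n" "var h vInf = J"
    and AJ: "\<forall>p<n * n. arr h bA p \<le> J"
    and lim: "4 * (n * n) + J + 4 * n + 4 < wlim w" and lim2: "8 * (n * n * n) * (T + n * n + 2) < wlim w"
  shows "wp w (half_prog MM) (\<lambda>h'. (\<exists>X. clk h' \<le> clk h + 5000 * (n * n + J + 1 + X) \<and>
       X * X \<le> 4 * (T + n * n) * (n * n * n) + 3 * (T + n * n) * X) \<and>
     (\<forall>i<n. \<forall>j<n. \<forall>k<n. arr h bB (k * n + j) \<le> arr h bA (i * n + k) \<longrightarrow> arr h' bCA (i * n + j) \<le> arr h bA (i * n + k)) \<and>
     attained n J (arr h bA) (arr h bB) (arr h' bCA)) h"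
  unfolding half_prog_def
proof (rule vc_sound, rule vc_call[OF csort_spec[where N = "n * n" and I = J]], goal_cases)
  case (6 h1)
  note f1 = frm_var[OF 6(2), unfolded wr_csort] frm_arr[OF 6(2), unfolded wr_csort]
  define A B od where "A = arr h bA" and "B = arr h bB" and "od = arr h1 bOrd"
  have o: "\<And>z. z < n * n \<Longrightarrow> od z < n * n" "\<And>p. p < n * n \<Longrightarrow> \<exists>z<n * n. od z = p"
    "\<And>z z'. z < z' \<Longrightarrow> z' < n * n \<Longrightarrow> A (od z) \<le> A (od z')" and c1: "clk h1 \<le> clk h + 100 * (n * n + J + 3)"
    using 6(1) by (auto simp: A_def od_def)
  interpret half n J w A B od
  proof
    show "A (od z) \<le> A (od z')" if "z \<le> z'" "z' < n * n" for z z'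
      using o(3)[of z z'] that by (cases "z = z'") auto
  qed (use n w AJ lim o in \<open>auto simp: A_def\<close>)
  show ?case
  proof (rule vc_call[OF half_init_spec[where N = "n * n" and J = J]], goal_cases)
    case (4 h2)
    note f2 = frm_var[OF 4(2)] frm_arr[OF 4(2)]
    have i2: "\<And>p. p < n * n \<Longrightarrow> arr h2 bCA p = J \<and> arr h2 bF p = 0 \<and> arr h2 bG p = 0"
      and v2: "var h2 8 = 0" "var h2 9 = 1" "var h2 7 = 0" and c2: "clk h2 \<le> clk h1 + 30 * (n * n) + 20"
      using 4(1) by auto
    have "stat h2" unfolding stat_def using v by (simp add: f1 f2 A_def B_def od_def)
    moreover have "attained n J A B (arr h2 bCA)" unfolding attained_def using i2 index_less by auto
    moreover have "flagged k u r 0 0 0 (arr h2 bF)" "flagged k u r 0 0 0 (arr h2 bG)" for k u r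
      unfolding flagged_def using i2 index_less by auto
    ultimately have hd2: "head 0 h2" unfolding head_def by simp
    define Tq P where "Tq = T + n * n" and "P = n * n * n * Tq"
    have nn: "0 < n * n" using n by simp
    have n3: "n \<le> n * n * n" "n * n \<le> n * n * n" "1 \<le> n * n * n" "n \<le> n * n" using n by auto
    have PT: "Tq \<le> P" "n * n * Tq \<le> P" unfolding P_def using n3 n by auto
    have lim3: "8 * P + 16 * (n * n * n) < wlim w" using lim2 unfolding P_def Tq_def by (simp add: algebra_simps)
    \<comment> \<open>The invariant compares \<open>c * c\<close>, for the count \<open>c\<close>,
      with the number \<open>x\<close> of ranks done. A part of \<open>n * s\<close> ranks adds some
      \<open>d \<le> Tq\<close> to \<open>c\<close>, and \<open>c \<le> n * n * s\<close>; so
      \<open>2 * c * d\<close> is covered by the growth of \<open>2 * n * Tq * x\<close>, and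
      \<open>d * d\<close> by that of \<open>Tq * c\<close>. The cruder bound
      \<open>c \<le> x * Tq\<close> rules out overflow.\<close>
    show ?case unfolding vc.simps
    proof (rule wp_while[where m = "\<lambda>h'. n * n - var h' 8" and I = "\<lambda>h'. head (var h' 8) h' \<and>
        var h' 9 = var h' 7 div (n * n) + 1 \<and> var h' 7 * var h' 7 \<le> 2 * n * Tq * var h' 8 + Tq * var h' 7 \<and>
        var h' 8 \<le> n * n + n * var h' 9 \<and> var h' 7 \<le> var h' 8 * Tq \<and>
        clk h' \<le> clk h2 + 2010 * var h' 7 + 80 * var h' 9 * flags h'"], goal_cases)
      case 1
      then show ?case using hd2 v2 by simp
    next
      case (2 h')
      then show ?case using w by simp
    next
      case (3 h')
      define x s c where "x = var h' 8" and "s = var h' 9" and "c = var h' 7"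
      have I: "head x h'" "s = c div (n * n) + 1" "c * c \<le> 2 * n * Tq * x + Tq * c" "x \<le> n * n + n * s" "c \<le> x * Tq"
        "clk h' \<le> clk h2 + 2010 * c + 80 * s * flags h'"
        using 3(1) by (auto simp: x_def s_def c_def)
      have x: "x < n * n" using 3(4) I(1) by (simp add: head_def stat_def x_def)
      have c: "c \<le> n * n * Tq" by (rule order_trans[OF I(5) mult_le_mono1[OF less_imp_le[OF x]]])
      have cs: "c \<le> n * n * s"
      proof -
        have "c < n * n * (c div (n * n)) + n * n"
          using mult_div_mod_eq[of "n * n" c] mod_less_divisor[OF nn, of c] by linarith
        then show ?thesis unfolding I(2) by (simp add: algebra_simps)
      qed
      have "c div (n * n) \<le> c" by simp
      then have s: "s \<le> n * n * Tq + 1" using I(2) c by linarith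
      have "n * s \<le> n * (n * n * Tq + 1)" using s by (rule mult_le_mono2)
      then have ns: "n * s \<le> P + n" by (simp add: P_def algebra_simps)
      have s0: "0 < s" using I(2) by simp
      have nsx: "1 \<le> n * s" using s0 n by simp
      have l: "x + n * s < wlim w" "2 * n * s + 2 * n + s + 2 < wlim w" "c + T + n * n + 1 < wlim w"
      proof -
        show "x + n * s < wlim w" using x ns n3 lim3 by linarith
        have "2 * n * s = 2 * (n * s)" by simp
        then show "2 * n * s + 2 * n + s + 2 < wlim w" using ns s PT n3 lim3 by linarith
        show "c + T + n * n + 1 < wlim w" using c PT n3 lim3 Tq_def by linarith
      qed
      have hd: "head x (tick 4 h')" using I(1) by (simp add: head_def stat_def)
      have fl: "flags (tick 4 h') = flags h'" by (simp add: flags_def)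
      have e4: "ecost (Rv 8 \<prec> Rv 5) + 1 = 4" by simp
      show ?case unfolding compile.simps e4
      proof (rule wp_mono[OF part_prog_spec[OF mm hd _ _ _ x s0 l]], goal_cases)
        case (4 h'')
        define c' where "c' = var h'' 7"
        have r: "head (x + n * s) h''" "var h'' 8 = x + n * s" "c + n * n \<le> c'" "c' \<le> c + Tq" "var h'' 9 = c' div (n * n) + 1"
          "clk h'' + 80 * s * flags h' + 2000 * c \<le> clk h' + 4 + 2000 * c' + 80 * s * flags h''"
          using 4 unfolding c'_def Tq_def fl by auto
        have ss: "s \<le> var h'' 9" unfolding r(5) I(2) using r(3) by (simp add: div_le_mono)
        obtain d where d: "c' = c + d" "d \<le> Tq" using r(3,4) le_Suc_ex[of c c'] by auto
        have "c' * c' \<le> 2 * n * Tq * (x + n * s) + Tq * c'"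
        proof -
          have "c' * c' = c * c + 2 * (c * d) + d * d" unfolding d by (simp add: algebra_simps)
          moreover have "c * d \<le> n * n * s * Tq" using mult_le_mono[OF cs d(2)] .
          moreover have "d * d \<le> Tq * d" using d(2) by simp
          moreover have "2 * n * Tq * (x + n * s) + Tq * c' = 2 * n * Tq * x + Tq * c + 2 * (n * n * s * Tq) + Tq * d"
            unfolding d by (simp add: algebra_simps)
          ultimately show ?thesis using I(3) by linarith
        qed
        moreover have "x + n * s \<le> n * n + n * var h'' 9" using x mult_le_mono2[OF ss, of n] by linarith
        moreover have "c' \<le> (x + n * s) * Tq"
        proof -
          have "Tq \<le> n * s * Tq" using nsx by simp
          then show ?thesis using r(4) I(5) unfolding add_mult_distrib by linarith
        qed
        moreover have "clk h'' \<le> clk h2 + 2010 * c' + 80 * var h'' 9 * flags h''"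
        proof -
          have "80 * s * flags h'' \<le> 80 * var h'' 9 * flags h''" using ss by simp
          then show ?thesis using r(6) I(6) r(3) nn by linarith
        qed
        moreover have "n * n - (x + n * s) < n * n - x" using nsx x by linarith
        ultimately show ?case using r unfolding x_def[symmetric] c'_def[symmetric] by (simp add: c'_def)
      qed (simp_all add: x_def s_def c_def)
    next
      case (4 h')
      define x s c where "x = var h' 8" and "s = var h' 9" and "c = var h' 7"
      have I: "head x h'" "s = c div (n * n) + 1" "c * c \<le> 2 * n * Tq * x + Tq * c" "x \<le> n * n + n * s" "c \<le> x * Tq"
        "clk h' \<le> clk h2 + 2010 * c + 80 * s * flags h'"
        using 4(1) by (auto simp: x_def s_def c_def)
      have x: "n * n \<le> x" using 4(4) I(1) by (simp add: head_def stat_def x_def)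
      have "n * n * (c div (n * n)) \<le> c" by simp
      then have s: "n * n * s \<le> n * n + c" unfolding I(2) by (simp add: algebra_simps)
      have "c * c \<le> 4 * Tq * (n * n * n) + 3 * Tq * c"
      proof -
        \<comment> \<open>The last part may overshoot \<open>n * n\<close> by at most
          \<open>n * s\<close>, and \<open>n * n * s \<le> n * n + c\<close>. This turns the factors
          2 and 1 of the invariant into 4 and 3.\<close>
        have "n * x \<le> n * n * n + n * n * s" using mult_le_mono2[OF I(4), of n] by (simp add: algebra_simps)
        also have "\<dots> \<le> 2 * (n * n * n) + c" using s n3 by linarith
        finally have "2 * Tq * (n * x) \<le> 2 * Tq * (2 * (n * n * n) + c)" by (rule mult_le_mono2)
        then show ?thesis using I(3) by (simp add: algebra_simps)
      qed
      moreover have "clk (tick 4 h') \<le> clk h + 5000 * (n * n + J + 1 + c)"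
      proof -
        have "flags h' \<le> 2 * (n * n)" unfolding flags_def using nflags_le[of "arr h' bF"] nflags_le[of "arr h' bG"] by linarith
        then have "80 * s * flags h' \<le> 80 * s * (2 * (n * n))" by (rule mult_le_mono2)
        also have "\<dots> = 160 * (n * n * s)" by simp
        also have "\<dots> \<le> 160 * (n * n + c)" by (rule mult_le_mono2[OF s])
        finally show ?thesis using I(6) c1 c2 by simp
      qed
      moreover have "arr h' bCA (i * n + j) \<le> A (i * n + k)" if ijk: "i < n" "j < n" "k < n" "B (k * n + j) \<le> A (i * n + k)" for i j k
      proof -
        obtain z where z: "z < n * n" "od z = i * n + k" using o(2) index_less[OF ijk(1,3)] by blast
        have "row z = i" "col z = k" using z ijk by (auto simp: row_def col_def)
        then have "good z j" using ijk z by (simp add: good_def)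
        then show ?thesis using I(1) z x ijk \<open>row z = i\<close> unfolding head_def by (metis less_le_trans)
      qed
      moreover have "attained n J A B (arr h' bCA)" using I(1) by (simp add: head_def)
      ultimately show ?case unfolding A_def[symmetric] B_def[symmetric] Tq_def[symmetric]
        by auto
    qed
  qed (use v w in \<open>auto simp: f1\<close>)
qed (use v w lim AJ in auto)

section \<open>Min-max products and distance scales\<close>

abbreviation (input) "bD \<equiv> 2::nat"
abbreviation (input) "bL \<equiv> 3::nat"
abbreviation (input) "bIdx \<equiv> 4::nat"
abbreviation (input) "bTmp \<equiv> 8::nat"
abbreviation (input) "vK \<equiv> 46::nat"

lemma wr_part_prog [simp]:
  "wr MM = {vCnt} \<Longrightarrow> wr (part_prog MM) = {7, 8, 9, 10, 11, 12, 13, 14, 15, 16, 17, 18, 20, 21, 22, 23, 24, 25, 26, 30, 31, 32, 33, 34, 35, 36}"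
  "wb (part_prog MM) = {7, 11, 12, 13, 14, 15, 16, 17, 18, 19, 20, 21, 22, 128, 129} \<union> wb MM"
  by (auto simp: part_prog_def)

lemma wr_half_prog [simp]:
  "wr MM = {vCnt} \<Longrightarrow> wr (half_prog MM) = {7, 8, 9, 10, 11, 12, 13, 14, 15, 16, 17, 18, 20, 21, 22, 23, 24, 25, 26, 30, 31, 32, 33, 34, 35, 36}"
  "wb (half_prog MM) = {7, 9, 10, 11, 12, 13, 14, 15, 16, 17, 18, 19, 20, 21, 22, 128, 129} \<union> wb MM"
  by (auto simp: half_prog_def wr_csort)

definition load_ab :: prog where
  "load_ab = compile (43 ::= Rv 40 * Rv vNN ;; 44 ::= Rv 41 * Rv vNN ;;
     For 13 vNN (Sto bA (Rv 13) (Ld bD (Rv 43 + Rv 13)) ;; Sto bB (Rv 13) (Ld bD (Rv 44 + Rv 13))))"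

definition save_ca :: prog where
  "save_ca = compile (For 13 vNN (Sto bTmp (Rv 13) (Ld bCA (Rv 13))))"

definition load_transposed :: prog where
  "load_transposed = compile (For 13 vNN (14 ::= (Rv 13 mod Rv vN) * Rv vN + Rv 13 div Rv vN ;;
     Sto bA (Rv 13) (Ld bD (Rv 44 + Rv 14)) ;; Sto bB (Rv 13) (Ld bD (Rv 43 + Rv 14))))"

definition combine :: prog where
  "combine = compile (45 ::= Rv 42 * Rv vNN ;;
     For 13 vNN (14 ::= Ld bCA ((Rv 13 mod Rv vN) * Rv vN + Rv 13 div Rv vN) ;; 15 ::= Ld bTmp (Rv 13) ;;
       If (Rv 14 \<prec> Rv 15) (Sto bD (Rv 45 + Rv 13) (Rv 14)) (Sto bD (Rv 45 + Rv 13) (Rv 15))))"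

definition minmax_prog :: "prog \<Rightarrow> prog" where
  "minmax_prog MM = compile (Call load_ab ;; Call (half_prog MM) ;; Call save_ca ;; Call load_transposed ;;
     Call (half_prog MM) ;; Call combine)"

lemma wr_minmax_parts [simp]:
  "wr load_ab = {13, 43, 44}" "wb load_ab = {5, 6}" "wr save_ca = {13}" "wb save_ca = {8}"
  "wr load_transposed = {13, 14}" "wb load_transposed = {5, 6}" "wr combine = {13, 14, 15, 45}" "wb combine = {2}"
  by (auto simp: load_ab_def save_ca_def load_transposed_def combine_def)

lemma wr_minmax [simp]:
  "wr MM = {vCnt} \<Longrightarrow> wr (minmax_prog MM) = {7, 8, 9, 10, 11, 12, 13, 14, 15, 16, 17, 18, 20, 21, 22, 23, 24, 25, 26, 30, 31, 32, 33, 34, 35, 36, 43, 44, 45}"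
  "wb (minmax_prog MM) = {2, 5, 6, 7, 8, 9, 10, 11, 12, 13, 14, 15, 16, 17, 18, 19, 20, 21, 22, 128, 129} \<union> wb MM"
  by (auto simp: minmax_prog_def)

lemma load_ab_spec:
  assumes "var h vNN = N" "var h 40 = a" "var h 41 = b" "0 < w" "Suc a * N < wlim w" "Suc b * N < wlim w"
  shows "wp w load_ab (\<lambda>h'. clk h' \<le> clk h + 40 * N + 40 \<and> var h' 43 = a * N \<and> var h' 44 = b * N \<and>
     (\<forall>p<N. arr h' bA p = arr h bD (a * N + p) \<and> arr h' bB p = arr h bD (b * N + p))) h"
proof -
  have l: "a * N < wlim w" "b * N < wlim w" using assms(5,6) by simp_all
  show ?thesis unfolding load_ab_def
proof (rule vc_sound, simp add: assms l, rule wp_for_const[where N = N and T = 20 and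
    I = "\<lambda>i h'. \<forall>p<i. arr h' bA p = arr h bD (a * N + p) \<and> arr h' bB p = arr h bD (b * N + p)"], goal_cases)
  case (9 i h')
  note f = 9(3) frm_var[OF 9(4)] frm_arr[OF 9(4)]
  show ?case by (rule vc_sound) (use 9 assms in \<open>auto simp: f less_Suc_eq\<close>)
next
  case (10 h')
  show ?case using 10 assms frm_var[OF 10(3), of 43] frm_var[OF 10(3), of 44] by simp
qed (use assms in auto)
qed

lemma save_ca_spec:
  assumes "var h vNN = N" "0 < w"
  shows "wp w save_ca (\<lambda>h'. clk h' \<le> clk h + 20 * N + 20 \<and> (\<forall>p<N. arr h' bTmp p = arr h bCA p)) h"
  unfolding save_ca_def
proof (rule vc_sound, simp add: assms, rule wp_for_const[where N = N and T = 10 and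
    I = "\<lambda>i h'. \<forall>p<i. arr h' bTmp p = arr h bCA p"], goal_cases)
  case (9 i h')
  note f = 9(3) frm_var[OF 9(4)] frm_arr[OF 9(4)]
  show ?case by (rule vc_sound) (use 9 assms in \<open>auto simp: f less_Suc_eq\<close>)
qed (use assms in auto)

lemma transpose_less: "p < n * n \<Longrightarrow> (p mod n) * n + p div n < n * (n::nat)"
  by (metis index_less less_mult_imp_div_less mod_less_divisor mult_0 not_gr_zero not_less_zero)

lemma load_transposed_spec:
  assumes "var h vNN = n * n" "var h vN = n" "var h 43 = a" "var h 44 = b" "0 < w" "a + n * n < wlim w" "b + n * n < wlim w"
  shows "wp w load_transposed (\<lambda>h'. clk h' \<le> clk h + 50 * (n * n) + 40 \<and>
     (\<forall>p<n * n. arr h' bA p = arr h bD (b + ((p mod n) * n + p div n)) \<and> arr h' bB p = arr h bD (a + ((p mod n) * n + p div n)))) h"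
  unfolding load_transposed_def
proof (rule vc_sound, simp add: assms, rule wp_for_const[where N = "n * n" and T = 30 and
    I = "\<lambda>i h'. \<forall>p<i. arr h' bA p = arr h bD (b + ((p mod n) * n + p div n)) \<and> arr h' bB p = arr h bD (a + ((p mod n) * n + p div n))"], goal_cases)
  case (9 i h')
  note f = 9(3) frm_var[OF 9(4)] frm_arr[OF 9(4)]
  have t: "(i mod n) * n + i div n < n * n" using transpose_less 9(1) .
  have l: "(i mod n) * n + i div n < wlim w" "(i mod n) * n < wlim w" "a + ((i mod n) * n + i div n) < wlim w" "b + ((i mod n) * n + i div n) < wlim w"
    using t assms(6,7) by linarith+
  show ?case by (rule vc_sound, simp add: f assms l) (use 9 in \<open>auto simp: less_Suc_eq\<close>)
qed (use assms in auto)

lemma combine_spec: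
  assumes "var h vNN = n * n" "var h vN = n" "var h 42 = c" "0 < w" "Suc c * (n * n) < wlim w"
  shows "wp w combine (\<lambda>h'. clk h' \<le> clk h + 60 * (n * n) + 40 \<and> (\<forall>q<c * (n * n). arr h' bD q = arr h bD q) \<and>
     (\<forall>p<n * n. arr h' bD (c * (n * n) + p) = min (arr h bTmp p) (arr h bCA ((p mod n) * n + p div n)))) h"
proof -
  have l0: "c * (n * n) < wlim w" using assms(5) by simp
  show ?thesis unfolding combine_def
proof (rule vc_sound, simp add: assms l0, rule wp_for_const[where N = "n * n" and T = 40 and
    I = "\<lambda>i h'. (\<forall>q<c * (n * n). arr h' bD q = arr h bD q) \<and>
      (\<forall>p<i. arr h' bD (c * (n * n) + p) = min (arr h bTmp p) (arr h bCA ((p mod n) * n + p div n)))"], goal_cases)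
  case (9 i h')
  note f = 9(3) frm_var[OF 9(4)] frm_arr[OF 9(4)]
  have t: "(i mod n) * n + i div n < n * n" using transpose_less 9(1) .
  have l: "(i mod n) * n + i div n < wlim w" "(i mod n) * n < wlim w" "c * (n * n) + i < wlim w"
    using t assms(5)[unfolded mult_Suc] 9(1) by linarith+
  show ?case by (rule vc_sound, simp add: f assms l) (use 9(2) in \<open>auto simp: less_Suc_eq\<close>)
qed (use assms in auto)
qed

text \<open>If the larger of \<open>A (i, k)\<close> and \<open>B (k, j)\<close> is the former,
  \<open>k\<close> is a witness for \<open>C1\<close> at \<open>(i, j)\<close>, otherwise for
  \<open>C2\<close> at \<open>(j, i)\<close>. Restricting to \<open>t < J\<close> keeps the default
  value of \<open>attained\<close> out.\<close>

lemma minmax_combine: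
  fixes n J :: nat
  assumes c1: "\<forall>i<n. \<forall>j<n. \<forall>k<n. B (k * n + j) \<le> A (i * n + k) \<longrightarrow> C1 (i * n + j) \<le> A (i * n + k)"
    and a1: "attained n J A B C1"
    and c2: "\<forall>i<n. \<forall>j<n. \<forall>k<n. B' (k * n + j) \<le> A' (i * n + k) \<longrightarrow> C2 (i * n + j) \<le> A' (i * n + k)"
    and a2: "attained n J A' B' C2"
    and A': "\<And>i j. i < n \<Longrightarrow> j < n \<Longrightarrow> A' (i * n + j) = B (j * n + i) \<and> B' (i * n + j) = A (j * n + i)"
    and ij: "i < n" "j < n" and t: "t < J"
  shows "min (C1 (i * n + j)) (C2 (j * n + i)) \<le> t \<longleftrightarrow> (\<exists>k<n. A (i * n + k) \<le> t \<and> B (k * n + j) \<le> t)"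
proof
  assume "min (C1 (i * n + j)) (C2 (j * n + i)) \<le> t"
  then consider "C1 (i * n + j) \<le> t" | "C2 (j * n + i) \<le> t" by (auto simp: min_def split: if_splits)
  then show "\<exists>k<n. A (i * n + k) \<le> t \<and> B (k * n + j) \<le> t"
  proof cases
    case 1
    then obtain k where "k < n" "B (k * n + j) \<le> A (i * n + k)" "C1 (i * n + j) = A (i * n + k)"
      using a1 ij t unfolding attained_def by (metis leD)
    then show ?thesis using 1 by (intro exI[of _ k]) auto
  next
    case 2
    then obtain k where "k < n" "B' (k * n + i) \<le> A' (j * n + k)" "C2 (j * n + i) = A' (j * n + k)"
      using a2 ij t unfolding attained_def by (metis leD)
    then show ?thesis using 2 A'[of k i] A'[of j k] ij by (intro exI[of _ k]) auto
  qed
next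
  assume "\<exists>k<n. A (i * n + k) \<le> t \<and> B (k * n + j) \<le> t"
  then obtain k where k: "k < n" "A (i * n + k) \<le> t" "B (k * n + j) \<le> t" by blast
  show "min (C1 (i * n + j)) (C2 (j * n + i)) \<le> t"
  proof (cases "B (k * n + j) \<le> A (i * n + k)")
    case True
    then have "C1 (i * n + j) \<le> A (i * n + k)" using c1 ij k by blast
    then show ?thesis using k by simp
  next
    case False
    then have "B' (k * n + i) \<le> A' (j * n + k)" using A'[of k i] A'[of j k] ij k by simp
    then have "C2 (j * n + i) \<le> A' (j * n + k)" using c2 ij k by blast
    then show ?thesis using k A'[of j k] ij by simp
  qed
qed

text \<open>
  The total counted time \<open>X\<close> of the multiplications in one half product satisfies this inequality,
  because the part size is always about \<open>1 / n\<close> times the time counted so far.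
\<close>

definition budget :: "nat \<Rightarrow> nat \<Rightarrow> nat \<Rightarrow> bool" where
  "budget n T M \<longleftrightarrow> (\<forall>X. X * X \<le> 4 * (T + n * n) * (n * n * n) + 3 * (T + n * n) * X \<longrightarrow> X \<le> M)"

text \<open>The product is described by its thresholds \<open>t < J\<close>, the form in which it
  will be read as the composition of path relations in the predicted graph number
  \<open>t\<close>.\<close>

lemma minmax_spec:
  assumes mm: "multiplies w n T MM" and n: "0 < n" and w: "0 < w" and M: "budget n T M"
    and v: "var h vN = n" "var h vNN = n * n" "var h vN2 = 2 * n" "var h vInf = J"
      "var h 40 = a" "var h 41 = b" "var h 42 = c" "a < c" "b < c"
    and AJ: "\<forall>p<n * n. arr h bD (a * (n * n) + p) \<le> J" "\<forall>p<n * n. arr h bD (b * (n * n) + p) \<le> J"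
    and lim: "4 * (n * n) + J + 4 * n + 4 < wlim w" "8 * (n * n * n) * (T + n * n + 2) < wlim w" "Suc c * (n * n) < wlim w"
  shows "wp w (minmax_prog MM) (\<lambda>h'. clk h' \<le> clk h + 11000 * (n * n + J + 1 + M) \<and>
     (\<forall>q<c * (n * n). arr h' bD q = arr h bD q) \<and> (\<forall>p<n * n. arr h' bD (c * (n * n) + p) \<le> J) \<and>
     (\<forall>i<n. \<forall>j<n. \<forall>t<J. arr h' bD (c * (n * n) + (i * n + j)) \<le> t \<longleftrightarrow>
        (\<exists>k<n. arr h bD (a * (n * n) + (i * n + k)) \<le> t \<and> arr h bD (b * (n * n) + (k * n + j)) \<le> t))) h"
proof -
  note [simp] = multiplies_wr[OF mm] multiplies_wb[OF mm]
  have la: "Suc a * (n * n) < wlim w" "Suc b * (n * n) < wlim w"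
  proof -
    have "Suc a * (n * n) \<le> Suc c * (n * n)" "Suc b * (n * n) \<le> Suc c * (n * n)" using v by (intro mult_le_mono1; simp)+
    then show "Suc a * (n * n) < wlim w" "Suc b * (n * n) < wlim w" using lim(3) by linarith+
  qed
  define A B where "A = (\<lambda>p. arr h bD (a * (n * n) + p))" and "B = (\<lambda>p. arr h bD (b * (n * n) + p))"
  show ?thesis unfolding minmax_prog_def
  proof (rule vc_sound, rule vc_call[OF load_ab_spec[where N = "n * n" and a = a and b = b]], goal_cases)
    case (7 h1)
    note h1 = 7 and f1 = frm_var[OF 7(2)] frm_arr[OF 7(2)]
    have A1: "arr h1 bA p = A p" "arr h1 bB p = B p" if "p < n * n" for p using h1(1) that by (auto simp: A_def B_def)
    show ?case
    proof (rule vc_call[OF half_prog_spec[OF mm n w, where J = J]], goal_cases)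
      case (8 h2)
      note h2 = 8 and f2 = frm_var[OF 8(2)] frm_arr[OF 8(2)]
      have c2: "clk h2 \<le> clk h1 + 5000 * (n * n + J + 1 + M)"
      proof -
        obtain X where X: "clk h2 \<le> clk h1 + 5000 * (n * n + J + 1 + X)" "X \<le> M"
          using h2(1) M unfolding budget_def by blast
        then show ?thesis by simp
      qed
      show ?case
      proof (rule vc_call[OF save_ca_spec[where N = "n * n"]], goal_cases)
        case (3 h3)
        note h3 = 3 and f3 = frm_var[OF 3(2)] frm_arr[OF 3(2)]
        show ?case
        proof (rule vc_call[OF load_transposed_spec[where n = n and a = "a * (n * n)" and b = "b * (n * n)"]], goal_cases)
          case (8 h4)
          note h4 = 8 and f4 = frm_var[OF 8(2)] frm_arr[OF 8(2)]
          have D3: "arr h3 bD = arr h bD" by (simp add: f1 f2 f3)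
          have A4: "arr h4 bA p = B ((p mod n) * n + p div n)" "arr h4 bB p = A ((p mod n) * n + p div n)" if "p < n * n" for p
            using h4(1) that unfolding D3 by (auto simp: A_def B_def)
          show ?case
          proof (rule vc_call[OF half_prog_spec[OF mm n w, where J = J]], goal_cases)
            case (8 h5)
            note h5 = 8 and f5 = frm_var[OF 8(2)] frm_arr[OF 8(2)]
            have c5: "clk h5 \<le> clk h4 + 5000 * (n * n + J + 1 + M)"
            proof -
              obtain X where X: "clk h5 \<le> clk h4 + 5000 * (n * n + J + 1 + X)" "X \<le> M"
                using h5(1) M unfolding budget_def by blast
              then show ?thesis by simp
            qed
            show ?case
            proof (rule vc_call_last[OF combine_spec[where n = n and c = c]], goal_cases)
              case (6 h6)
              have D5: "arr h5 bD = arr h bD" by (simp add: f1 f2 f3 f4 f5)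
              have T5: "arr h5 bTmp p = arr h2 bCA p" if "p < n * n" for p using h3(1) that by (simp add: f4 f5)
              have res: "arr h6 bD (c * (n * n) + (i * n + j)) = min (arr h2 bCA (i * n + j)) (arr h5 bCA (j * n + i))" if "i < n" "j < n" for i j
                using 6(1) index_less[OF that] that T5[OF index_less[OF that]] by simp
              have at: "attained n J A B (arr h2 bCA)"
              proof -
                have at1: "attained n J (arr h1 bA) (arr h1 bB) (arr h2 bCA)" using h2(1) by blast
                show ?thesis unfolding attained_def
                proof (intro allI impI)
                  fix i j assume ij: "i < n" "j < n"
                  then show "arr h2 bCA (i * n + j) = J \<or> (\<exists>k<n. B (k * n + j) \<le> A (i * n + k) \<and> arr h2 bCA (i * n + j) = A (i * n + k))"
                    using at1 unfolding attained_def by (metis A1 index_less)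
                qed
              qed
              have cp: "\<forall>i<n. \<forall>j<n. \<forall>k<n. B (k * n + j) \<le> A (i * n + k) \<longrightarrow> arr h2 bCA (i * n + j) \<le> A (i * n + k)"
                using h2(1) A1 index_less by metis
              have tr: "arr h4 bA (i * n + j) = B (j * n + i) \<and> arr h4 bB (i * n + j) = A (j * n + i)" if "i < n" "j < n" for i j
                using A4[OF index_less[OF that]] that by simp
              have at2: "attained n J (arr h4 bA) (arr h4 bB) (arr h5 bCA)"
                and cp2: "\<forall>i<n. \<forall>j<n. \<forall>k<n. arr h4 bB (k * n + j) \<le> arr h4 bA (i * n + k) \<longrightarrow> arr h5 bCA (i * n + j) \<le> arr h4 bA (i * n + k)"
                using h5(1) by blast+
              have mc: "arr h6 bD (c * (n * n) + (i * n + j)) \<le> t \<longleftrightarrow> (\<exists>k<n. A (i * n + k) \<le> t \<and> B (k * n + j) \<le> t)"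
                if "i < n" "j < n" "t < J" for i j t
                using res[OF that(1,2)] minmax_combine[OF cp at cp2 at2 tr that] by simp
              have le: "arr h6 bD (c * (n * n) + p) \<le> J" if "p < n * n" for p
              proof -
                have d: "p div n < n" "p mod n < n" using that n by (simp_all add: less_mult_imp_div_less)
                have "arr h2 bCA (p div n * n + p mod n) \<le> J"
                  using at d AJ(1) index_less[OF d(1)] unfolding attained_def A_def by (metis order_refl)
                then show ?thesis using res[OF d] by simp
              qed
              show ?case
              proof (intro conjI allI impI)
                have "1 \<le> n * n" using n by simp
                then show "clk h6 \<le> clk h + 11000 * (n * n + J + 1 + M)"
                  using 6(1)[THEN conjunct1] c5 h4(1)[THEN conjunct1] h3(1)[THEN conjunct1] c2 h1(1)[THEN conjunct1]
                  unfolding add_mult_distrib2 by linarith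
              qed (use 6(1) D5 le mc in \<open>auto simp: A_def B_def\<close>)
            qed (use v n w lim(3) in \<open>auto simp: f1 f2 f3 f4 f5\<close>)
          qed (use v lim AJ A4 transpose_less in \<open>auto simp: f1 f2 f3 f4 B_def\<close>)
        qed (use v w la h1(1) in \<open>auto simp: f1 f2 f3\<close>)
      qed (use v w in \<open>auto simp: f1 f2\<close>)
    qed (use v lim AJ A1 in \<open>auto simp: f1 A_def\<close>)
  qed (use v w la in auto)
qed

text \<open>The lengths behave like floating point numbers: all integers up to \<open>2 * q\<close>,
  then blocks of \<open>q\<close> lengths, each block the double of the one before. So every new
  length is its predecessor plus 1 or twice an earlier length, and costs one product.\<close>

fun scale :: "nat \<Rightarrow> nat \<Rightarrow> nat" where
  "scale q k = (if k \<le> 2 * q \<or> q = 0 then k else 2 * scale q (k - q))"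

declare scale.simps [simp del]

lemma scale_small: "k \<le> 2 * q \<Longrightarrow> scale q k = k"
  by (simp add: scale.simps)

lemma scale_double:
  assumes "0 < q" "q \<le> k"
  shows "scale q (k + q) = 2 * scale q k"
proof (cases "k = q")
  case True
  then show ?thesis by (simp add: scale.simps)
next
  case False
  then show ?thesis using assms by (subst scale.simps) auto
qed

text \<open>For \<open>q \<le> k < 2 * q\<close> the step goes from \<open>k\<close> to
  \<open>k + 1\<close>, a factor of at most \<open>1 + 1 / q\<close>; doubling both sides keeps the
  ratio.\<close>

lemma scale_step: "0 < q \<Longrightarrow> q \<le> k \<Longrightarrow> q * scale q (Suc k) \<le> (q + 1) * scale q k"
proof (induction k rule: less_induct)
  case (less k)
  show ?case
  proof (cases "k < 2 * q")
    case True
    then show ?thesis using less.prems by (simp add: scale_small)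
  next
    case False
    then have d: "scale q (k - q + q) = 2 * scale q (k - q)" "scale q (Suc (k - q) + q) = 2 * scale q (Suc (k - q))"
      using less.prems by (intro scale_double; simp)+
    have "q * scale q (Suc (k - q)) \<le> (q + 1) * scale q (k - q)" using less False by auto
    then show ?thesis using d less.prems False by (simp add: algebra_simps)
  qed
qed

lemma scale_Suc: "0 < q \<Longrightarrow> scale q k < scale q (Suc k)"
proof (induction k rule: less_induct)
  case (less k)
  show ?case
  proof (cases "k < 2 * q")
    case True
    then show ?thesis by (simp add: scale_small)
  next
    case False
    then have d: "scale q (k - q + q) = 2 * scale q (k - q)" "scale q (Suc (k - q) + q) = 2 * scale q (Suc (k - q))"
      using less.prems by (intro scale_double; simp)+
    have "scale q (k - q) < scale q (Suc (k - q))" using less False by auto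
    then show ?thesis using d less.prems False by simp
  qed
qed

lemma scale_mono: "0 < q \<Longrightarrow> j \<le> k \<Longrightarrow> scale q j \<le> scale q k"
  using lift_Suc_mono_le[of "scale q" j k] scale_Suc[of q] by (simp add: less_imp_le)

text \<open>Shows that a number of levels of order \<open>q * log n\<close> reaches the length
  \<open>n * n\<close>.\<close>

lemma scale_pow: "0 < q \<Longrightarrow> scale q (q + q * x) = q * 2 ^ x"
proof (induction x)
  case 0
  then show ?case by (simp add: scale_small)
next
  case (Suc x)
  then show ?case using scale_double[of q "q + q * x"] by (simp add: algebra_simps)
qed

section \<open>Paths of bounded length in the predicted graphs\<close>

definition near :: "edge set \<Rightarrow> nat \<Rightarrow> nat \<Rightarrow> nat \<Rightarrow> bool" where
  "near G l u v \<longleftrightarrow> (\<exists>i\<le>l. (u, v) \<in> G ^^ i)"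

lemma near_refl: "near G l u u"
  unfolding near_def by (intro exI[of _ 0]) simp

lemma near_mono: "near G l u v \<Longrightarrow> l \<le> l' \<Longrightarrow> near G l' u v"
  unfolding near_def using le_trans by blast

lemma relpow_target: "(u, v) \<in> G ^^ i \<Longrightarrow> G \<subseteq> {..<n} \<times> {..<n} \<Longrightarrow> u < n \<Longrightarrow> v < (n::nat)"
  by (induction i arbitrary: v) auto

text \<open>A path is cut after \<open>a\<close> edges, or at its end if it is shorter.\<close>

lemma near_add:
  assumes "G \<subseteq> {..<n} \<times> {..<n}" "u < n"
  shows "near G (a + b) u v \<longleftrightarrow> (\<exists>x<n. near G a u x \<and> near G b x v)"
proof
  assume "near G (a + b) u v"
  then obtain i where i: "i \<le> a + b" "(u, v) \<in> G ^^ i" by (auto simp: near_def)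
  define j where "j = min i a"
  have "(u, v) \<in> G ^^ j O G ^^ (i - j)" using i(2) relpow_add[of j "i - j" G] by (simp add: j_def)
  then obtain x where x: "(u, x) \<in> G ^^ j" "(x, v) \<in> G ^^ (i - j)" by blast
  have "x < n" using relpow_target[OF x(1) assms] .
  moreover have "j \<le> a" "i - j \<le> b" using i(1) by (auto simp: j_def)
  ultimately show "\<exists>x<n. near G a u x \<and> near G b x v" using x unfolding near_def by blast
next
  assume "\<exists>x<n. near G a u x \<and> near G b x v"
  then obtain x i j where "i \<le> a" "(u, x) \<in> G ^^ i" "j \<le> b" "(x, v) \<in> G ^^ j" by (auto simp: near_def)
  then have "(u, v) \<in> G ^^ (i + j)" "i + j \<le> a + b" by (auto simp: relpow_add)
  then show "near G (a + b) u v" unfolding near_def by blast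
qed

definition pre_regs :: prog where
  "pre_regs = compile (vN ::= Rv 0 ;; vM ::= Rv 1 ;; vInf ::= Rv 1 + Nm 1 ;; vNN ::= Rv vN * Rv vN ;; vN2 ::= Rv vN + Rv vN)"

definition pre_fill :: prog where
  "pre_fill = compile (For 13 vNN (Sto bD (Rv 13) (Rv vInf) ;; Sto bD (Rv vNN + Rv 13) (Rv vInf)))"

text \<open>\<open>wx\<close> computes the weight of the edge with index in register 13, the only
  difference between the two modes here. \<open>bIdx\<close> maps an edge to its position counted
  from 1, since 0 is the artificial front position.\<close>

definition pre_edges :: "exp \<Rightarrow> prog" where
  "pre_edges wx = compile (For 13 vM (14 ::= Ld 0 (Rv 13) * Rv vN + Ld 1 (Rv 13) ;;
     Sto bD (Rv vNN + Rv 14) wx ;; Sto bIdx (Rv 14) (Rv 13 + Nm 1)))"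

definition pre_diag :: prog where
  "pre_diag = compile (For 13 vN (14 ::= Rv 13 * Rv vN + Rv 13 ;; Sto bD (Rv 14) (Nm 0) ;; Sto bD (Rv vNN + Rv 14) (Nm 0)))"

text \<open>The factors of the next level: the current level and level 1 while lengths are
  consecutive integers, afterwards twice the level that lies \<open>q\<close> below.\<close>

definition scale_select :: "nat \<Rightarrow> prog" where
  "scale_select q = compile (42 ::= Rv vK + Nm 1 ;;
     If (Rv 42 \<prec> Nm (2 * q + 1)) (40 ::= Rv vK ;; 41 ::= Nm 1) (40 ::= Rv 42 - Nm q ;; 41 ::= Rv 42 - Nm q))"

definition scale_step_prog :: "nat \<Rightarrow> prog \<Rightarrow> prog" where
  "scale_step_prog q MM = compile (Call (scale_select q) ;; Call (minmax_prog MM) ;; Sto bL (Rv 42) (Ld bL (Rv 40) + Ld bL (Rv 41)) ;; vK ::= Rv 42)"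

definition scales_prog :: "nat \<Rightarrow> prog \<Rightarrow> prog" where
  "scales_prog q MM = compile (Sto bL (Nm 0) (Nm 0) ;; Sto bL (Nm 1) (Nm 1) ;; vK ::= Nm 1 ;;
     While (Ld bL (Rv vK) \<prec> Rv vNN) (Call (scale_step_prog q MM)))"

definition pre_prog :: "nat \<Rightarrow> exp \<Rightarrow> prog \<Rightarrow> prog" where
  "pre_prog q wx MM = compile (Call pre_regs ;; Call pre_fill ;; Call (pre_edges wx) ;; Call pre_diag ;; Call (scales_prog q MM))"

lemma wr_pre [simp]:
  "wr pre_regs = {2, 3, 4, 5, 6}" "wb pre_regs = {}" "wr pre_fill = {13}" "wb pre_fill = {2}"
  "wr (pre_edges wx) = {13, 14}" "wb (pre_edges wx) = {2, 4}" "wr pre_diag = {13, 14}" "wb pre_diag = {2}"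
  by (auto simp: pre_regs_def pre_fill_def pre_edges_def pre_diag_def)

lemma wr_scale_select [simp]: "wr (scale_select q) = {40, 41, 42}" "wb (scale_select q) = {}"
  by (auto simp: scale_select_def)

lemma wr_scales [simp]:
  "wr MM = {vCnt} \<Longrightarrow> wr (scale_step_prog q MM) = {7, 8, 9, 10, 11, 12, 13, 14, 15, 16, 17, 18, 20, 21, 22, 23, 24, 25, 26, 30, 31, 32, 33, 34, 35, 36, 40, 41, 42, 43, 44, 45, 46}"
  "wb (scale_step_prog q MM) = {2, 3, 5, 6, 7, 8, 9, 10, 11, 12, 13, 14, 15, 16, 17, 18, 19, 20, 21, 22, 128, 129} \<union> wb MM"
  "wr MM = {vCnt} \<Longrightarrow> wr (scales_prog q MM) = {7, 8, 9, 10, 11, 12, 13, 14, 15, 16, 17, 18, 20, 21, 22, 23, 24, 25, 26, 30, 31, 32, 33, 34, 35, 36, 40, 41, 42, 43, 44, 45, 46}"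
  "wb (scales_prog q MM) = {2, 3, 5, 6, 7, 8, 9, 10, 11, 12, 13, 14, 15, 16, 17, 18, 19, 20, 21, 22, 128, 129} \<union> wb MM"
  by (auto simp: scale_step_prog_def scales_prog_def)

text \<open>\<open>wt i\<close> is the first index of a predicted graph that contains the predicted
  edge \<open>i\<close>. In these terms insertions and deletions both yield one growing family of
  graphs.\<close>

locale predicted =
  fixes n m q w :: nat and pred :: "edge list" and wt :: "nat \<Rightarrow> nat"
  assumes n: "0 < n" and q: "0 < q" and w: "0 < w" and m: "m = length pred"
    and pred: "distinct pred" "set pred \<subseteq> {..<n} \<times> {..<n}"
    and wt: "\<And>i. i < m \<Longrightarrow> 0 < wt i \<and> wt i \<le> m"
    and limn: "6 * (n * n) + 6 * n + 10 < wlim w"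
begin

definition E :: "nat \<Rightarrow> edge set" where "E j = {pred ! i | i. i < m \<and> wt i \<le> j}"

text \<open>The entry is determined by its thresholds, with \<open>m + 1\<close> as infinity; this
  matches the characterisation of the product.\<close>

definition dist_ok :: "(nat \<Rightarrow> nat) \<Rightarrow> nat \<Rightarrow> bool" where
  "dist_ok D k \<longleftrightarrow> (\<forall>u<n. \<forall>v<n. D (k * (n * n) + (u * n + v)) \<le> m + 1 \<and>
     (\<forall>j\<le>m. D (k * (n * n) + (u * n + v)) \<le> j \<longleftrightarrow> near (E j) (scale q k) u v))"

definition pos :: "nat \<Rightarrow> nat" where "pos i = fst (pred ! i) * n + snd (pred ! i)"

lemma m_le: "m \<le> n * n"
proof -
  have "m = card (set pred)" using pred(1) m by (simp add: distinct_card)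
  also have "\<dots> \<le> card ({..<n} \<times> {..<n})" by (rule card_mono) (use pred in auto)
  finally show ?thesis by (simp add: card_cartesian_product)
qed

lemma pred_less: "i < m \<Longrightarrow> fst (pred ! i) < n \<and> snd (pred ! i) < n"
  using subsetD[OF pred(2), of "pred ! i"] m by (auto simp: mem_Times_iff)

lemma pos_less: "i < m \<Longrightarrow> pos i < n * n"
  unfolding pos_def using pred_less index_less by blast

lemma pos_eq: "i < m \<Longrightarrow> u < n \<Longrightarrow> v < n \<Longrightarrow> pos i = u * n + v \<longleftrightarrow> pred ! i = (u, v)"
  unfolding pos_def using pred_less[of i] index_eq_iff[of "snd (pred ! i)" n v "fst (pred ! i)" u] by (metis fst_conv prod.collapse snd_conv)

lemma pos_inj: "i < m \<Longrightarrow> j < m \<Longrightarrow> pos i = pos j \<longleftrightarrow> i = j"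
  using pos_eq[of i "fst (pred ! j)" "snd (pred ! j)"] pred_less[of j] nth_eq_iff_index_eq[OF pred(1)] m
  by (auto simp: pos_def)

lemma E_subset: "E j \<subseteq> {..<n} \<times> {..<n}"
proof
  fix e assume "e \<in> E j"
  then obtain i where "i < m" "e = pred ! i" by (auto simp: E_def)
  then have "e \<in> set pred" using m by simp
  then show "e \<in> {..<n} \<times> {..<n}" using pred(2) by blast
qed

lemma pre_regs_spec:
  assumes "var h 0 = n" "var h 1 = m"
  shows "wp w pre_regs (\<lambda>h'. clk h' \<le> clk h + 30 \<and> var h' vN = n \<and> var h' vM = m \<and> var h' vInf = m + 1 \<and> var h' vNN = n * n \<and> var h' vN2 = 2 * n) h"
  unfolding pre_regs_def
  by (rule vc_sound) (use assms m_le limn w in simp)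

lemma pre_fill_spec:
  assumes "var h vNN = n * n" "var h vInf = J"
  shows "wp w pre_fill (\<lambda>h'. clk h' \<le> clk h + 30 * (n * n) + 20 \<and> (\<forall>p<2 * (n * n). arr h' bD p = J)) h"
  unfolding pre_fill_def
proof (rule vc_sound, simp add: assms, rule wp_for_const[where N = "n * n" and T = 20 and
    I = "\<lambda>i h'. \<forall>p<i. arr h' bD p = J \<and> arr h' bD (n * n + p) = J"], goal_cases)
  case (9 i h')
  note f = 9(3) frm_var[OF 9(4)] frm_arr[OF 9(4)]
  have l: "n * n + i < wlim w" using 9(1) limn by linarith
  show ?case by (rule vc_sound, simp add: f assms l) (use 9 in \<open>auto simp: less_Suc_eq\<close>)
next
  case (10 h')
  have "arr h' bD p = J" if "p < 2 * (n * n)" for p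
  proof (cases "p < n * n")
    case False
    then have "p - n * n < n * n" "n * n + (p - n * n) = p" using that by auto
    then show ?thesis using 10(1) by metis
  qed (use 10(1) in simp)
  then show ?case using 10 by simp
qed (use assms w in auto)

lemma pre_edges_spec:
  assumes v: "var h vN = n" "var h vNN = n * n" "var h vM = m" "var h vInf = m + 1"
    and inp: "\<forall>i<m. arr h 0 i = fst (pred ! i) \<and> arr h 1 i = snd (pred ! i)"
    and fill: "\<forall>p<2 * (n * n). arr h bD p = m + 1"
    and wx: "\<And>h' i. i < m \<Longrightarrow> var h' 13 = i \<Longrightarrow> var h' vM = m \<Longrightarrow> okx w h' wx \<and> ev w h' wx = wt i" "ecost wx \<le> 5"
  shows "wp w (pre_edges wx) (\<lambda>h'. clk h' \<le> clk h + 50 * (n * n) + 20 \<and> (\<forall>p<n * n. arr h' bD p = m + 1) \<and>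
     (\<forall>i<m. arr h' bD (n * n + pos i) = wt i \<and> arr h' bIdx (pos i) = i + 1) \<and>
     (\<forall>p<n * n. (\<forall>i<m. pos i \<noteq> p) \<longrightarrow> arr h' bD (n * n + p) = m + 1)) h"
  unfolding pre_edges_def
proof (rule vc_sound, simp, rule wp_for_const[where N = m and T = 40 and
    I = "\<lambda>c h'. (\<forall>p<n * n. arr h' bD p = m + 1) \<and>
     (\<forall>i<c. arr h' bD (n * n + pos i) = wt i \<and> arr h' bIdx (pos i) = i + 1) \<and>
     (\<forall>p<n * n. (\<forall>i<c. pos i \<noteq> p) \<longrightarrow> arr h' bD (n * n + p) = m + 1)"], goal_cases)
  case (9 i h')
  note f = 9(3) frm_var[OF 9(4)] frm_arr[OF 9(4)]
  have vs: "var h' 2 = n" "var h' 5 = n * n" "var h' 3 = m" "arr h' 0 i = fst (pred ! i)" "arr h' (Suc 0) i = snd (pred ! i)"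
    using v inp 9(1) by (simp_all add: f)
  have p: "pos i < n * n" using pos_less 9(1) .
  then have l: "fst (pred ! i) * n + snd (pred ! i) < wlim w" "fst (pred ! i) * n < wlim w" "n * n + (fst (pred ! i) * n + snd (pred ! i)) < wlim w" "Suc i < wlim w"
    using limn m_le 9(1) unfolding pos_def by linarith+
  have e: "okx w (upd r x k (tick 4 h')) wx" "ev w (upd r x k (tick 4 h')) wx = wt i" if "r \<noteq> 13" "r \<noteq> 3" for r x k
    using wx(1)[OF 9(1), of "upd r x k (tick 4 h')"] 9(3) vs that by auto
  have pi: "pos j \<noteq> pos i" if "j < i" for j using pos_inj[of j i] that 9(1) by auto
  note I = 9(2)
  have "(\<forall>p<n * n. ((arr h' bD)(n * n + pos i := wt i)) p = m + 1)" using I p by auto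
  moreover have "\<forall>j<Suc i. ((arr h' bD)(n * n + pos i := wt i)) (n * n + pos j) = wt j \<and> ((arr h' bIdx)(pos i := Suc i)) (pos j) = Suc j"
    using I pi by (auto simp: less_Suc_eq)
  moreover have "\<forall>p<n * n. (\<forall>j<Suc i. pos j \<noteq> p) \<longrightarrow> ((arr h' bD)(n * n + pos i := wt i)) (n * n + p) = m + 1"
    using I by (auto simp: less_Suc_eq)
  ultimately show ?case
    by (intro vc_sound, simp add: vs 9(3) l[folded pos_def] e w wx(2) pos_def[symmetric]) (use wx(2) l[folded pos_def] in simp)
next
  case (10 h')
  have "m * 44 \<le> n * n * 44" using m_le by (rule mult_le_mono1)
  then show ?case using 10 by simp
qed (use v fill w in auto)

lemma pre_diag_spec:
  assumes v: "var h vN = n" "var h vNN = n * n"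
    and D0: "\<forall>p<n * n. arr h bD p = m + 1"
    and D1: "\<forall>i<m. arr h bD (n * n + pos i) = wt i" "\<forall>p<n * n. (\<forall>i<m. pos i \<noteq> p) \<longrightarrow> arr h bD (n * n + p) = m + 1"
  shows "wp w pre_diag (\<lambda>h'. clk h' \<le> clk h + 40 * (n * n) + 20 \<and> dist_ok (arr h' bD) 0 \<and> dist_ok (arr h' bD) 1) h"
  unfolding pre_diag_def
proof (rule vc_sound, simp, rule wp_for_const[where N = n and T = 30 and
    I = "\<lambda>c h'. \<forall>u<n. \<forall>v<n. arr h' bD (u * n + v) = (if u = v \<and> u < c then 0 else arr h bD (u * n + v)) \<and>
      arr h' bD (n * n + (u * n + v)) = (if u = v \<and> u < c then 0 else arr h bD (n * n + (u * n + v)))"], goal_cases)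
  case (9 i h')
  note f = 9(3) frm_var[OF 9(4)] frm_arr[OF 9(4)]
  have vs: "var h' 2 = n" "var h' 5 = n * n" using v by (simp_all add: f)
  have d: "i * n + i < n * n" using index_less 9(1) by blast
  then have l: "i * n + i < wlim w" "i * n < wlim w" "n * n + (i * n + i) < wlim w" using limn by linarith+
  have e: "u * n + v = i * n + i \<longleftrightarrow> u = i \<and> v = i" "u * n + v < n * n" if "u < n" "v < n" for u v
    using index_eq_iff[of v n i u i] index_less[of u n v n] that 9(1) by auto
  have ne: "u * n + v \<noteq> n * n + x" "n * n + x \<noteq> u * n + v" if "u < n" "v < n" for u v x
    using e(2)[OF that] by auto
  show ?case
    by (rule vc_sound, simp add: vs 9(3) l w) (use 9(2) d in \<open>auto simp: e ne less_Suc_eq\<close>)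
next
  case (10 h')
  let ?D = "arr h' bD"
  have a: "?D (u * n + v) = (if u = v then 0 else m + 1)" if "u < n" "v < n" for u v
    using 10(1) D0 that index_less[OF that] by auto
  have b: "?D (n * n + (u * n + v)) = (if u = v then 0 else arr h bD (n * n + (u * n + v)))" if "u < n" "v < n" for u v
    using 10(1) that by auto
  have r1: "near G 1 u v \<longleftrightarrow> u = v \<or> (u, v) \<in> G" for G u v
    unfolding near_def by (auto simp: le_Suc_eq)
  have r0: "near G 0 u v \<longleftrightarrow> u = v" for G u v unfolding near_def by auto
  have c: "arr h bD (n * n + (u * n + v)) \<le> m + 1 \<and> (\<forall>j\<le>m. arr h bD (n * n + (u * n + v)) \<le> j \<longleftrightarrow> (u, v) \<in> E j)" if uv: "u < n" "v < n" for u v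
  proof (cases "\<exists>i<m. pred ! i = (u, v)")
    case True
    then obtain i where i: "i < m" "pred ! i = (u, v)" by blast
    then have "arr h bD (n * n + (u * n + v)) = wt i" using D1(1) pos_eq[of i u v] uv by metis
    moreover have "(u, v) \<in> E j \<longleftrightarrow> wt i \<le> j" for j
      unfolding E_def using i nth_eq_iff_index_eq[OF pred(1)] m by (auto, metis)
    ultimately show ?thesis using wt[OF i(1)] by auto
  next
    case False
    then have "arr h bD (n * n + (u * n + v)) = m + 1" using D1(2) pos_eq uv index_less[OF uv] by metis
    moreover have "(u, v) \<notin> E j" for j unfolding E_def using False by auto
    ultimately show ?thesis by auto
  qed
  have s: "scale q 0 = 0" "scale q 1 = 1" using q by (auto intro: scale_small)
  have "dist_ok ?D 0" unfolding dist_ok_def s using a r0 by simp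
  moreover have "dist_ok ?D 1" unfolding dist_ok_def s r1 using b c by auto
  moreover have "clk h' + 4 \<le> clk h + 40 * (n * n) + 20"
  proof -
    define N where "N = n * n"
    have "n \<le> N" by (simp add: N_def)
    then show ?thesis using 10(5) unfolding N_def[symmetric] by simp
  qed
  ultimately show ?case by simp
qed (use v w in auto)

text \<open>At threshold \<open>j\<close> the (min, max) product composes two relations
  \<open>near (E j)\<close>, and by \<open>near_add\<close> composition adds the lengths.\<close>

lemma dist_ok_product:
  assumes a: "dist_ok D a" and b: "dist_ok D b" and sc: "scale q c = scale q a + scale q b"
    and le: "\<forall>p<n * n. D' (c * (n * n) + p) \<le> m + 1"
    and mm: "\<forall>i<n. \<forall>j<n. \<forall>t<m + 1. D' (c * (n * n) + (i * n + j)) \<le> t \<longleftrightarrow>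
        (\<exists>k<n. D (a * (n * n) + (i * n + k)) \<le> t \<and> D (b * (n * n) + (k * n + j)) \<le> t)"
  shows "dist_ok D' c"
  unfolding dist_ok_def
proof (intro allI impI conjI)
  fix u v assume uv: "u < n" "v < n"
  show "D' (c * (n * n) + (u * n + v)) \<le> m + 1" using le index_less[OF uv] by blast
  fix j assume j: "j \<le> m"
  have "D' (c * (n * n) + (u * n + v)) \<le> j \<longleftrightarrow>
      (\<exists>k<n. D (a * (n * n) + (u * n + k)) \<le> j \<and> D (b * (n * n) + (k * n + v)) \<le> j)"
    using mm uv j by simp
  also have "\<dots> \<longleftrightarrow> (\<exists>k<n. near (E j) (scale q a) u k \<and> near (E j) (scale q b) k v)"
    using a b uv j unfolding dist_ok_def by (metis (no_types, lifting))
  also have "\<dots> \<longleftrightarrow> near (E j) (scale q c) u v"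
    unfolding sc using near_add[OF E_subset uv(1)] by blast
  finally show "D' (c * (n * n) + (u * n + v)) \<le> j \<longleftrightarrow> near (E j) (scale q c) u v" .
qed

lemma dist_ok_cong:
  assumes "dist_ok D k" "k < c" "\<forall>p<c * (n * n). D' p = D p"
  shows "dist_ok D' k"
proof -
  have "D' (k * (n * n) + (u * n + v)) = D (k * (n * n) + (u * n + v))" if "u < n" "v < n" for u v
    using assms(3) index_less[OF assms(2) index_less[OF that]] by blast
  then show ?thesis using assms(1) unfolding dist_ok_def by simp
qed

definition scales_ok :: "nat \<Rightarrow> vstate \<Rightarrow> bool" where
  "scales_ok K h \<longleftrightarrow> 1 \<le> K \<and> (\<forall>k\<le>K. dist_ok (arr h bD) k \<and> arr h bL k = scale q k)"

lemma scale_step_prog_spec: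
  assumes mm: "multiplies w n T MM" and M: "budget n T M"
    and v: "var h vN = n" "var h vNN = n * n" "var h vN2 = 2 * n" "var h vInf = m + 1" "var h vK = K"
    and sc: "scales_ok K h" and less: "scale q K < n * n"
    and lim: "8 * (n * n * n) * (T + n * n + 2) < wlim w" "(K + 3) * (n * n) < wlim w" "K + 2 * q + 3 < wlim w"
  shows "wp w (scale_step_prog q MM) (\<lambda>h'. clk h' \<le> clk h + 22000 * (n * n + 1 + M) + 100 \<and>
     scales_ok (K + 1) h' \<and> var h' vK = K + 1) h"
proof -
  note [simp] = multiplies_wr[OF mm] multiplies_wb[OF mm]
  define a b where "a = (if K + 1 \<le> 2 * q then K else K + 1 - q)" and "b = (if K + 1 \<le> 2 * q then 1 else K + 1 - q)"
  have K: "1 \<le> K" using sc by (simp add: scales_ok_def)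
  have ab: "a \<le> K" "b \<le> K" using K q by (auto simp: a_def b_def)
  have scale: "scale q (K + 1) = scale q a + scale q b"
  proof (cases "K + 1 \<le> 2 * q")
    case True
    then show ?thesis using q by (simp add: a_def b_def scale_small)
  next
    case False
    then show ?thesis using scale_double[of q "K + 1 - q"] q by (simp add: a_def b_def)
  qed
  have ok: "dist_ok (arr h bD) a" "dist_ok (arr h bD) b" using sc ab by (auto simp: scales_ok_def)
  have le: "arr h bD (k * (n * n) + p) \<le> m + 1" if "dist_ok (arr h bD) k" "p < n * n" for k p
  proof -
    have "p div n < n" "p mod n < n" using that(2) n by (simp_all add: less_mult_imp_div_less)
    then show ?thesis using that(1) unfolding dist_ok_def by (metis div_mult_mod_eq)
  qed
  have Lb: "scale q a + scale q b < wlim w"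
  proof -
    have "scale q a \<le> scale q K" "scale q b \<le> scale q K" using scale_mono[OF q] ab by auto
    then show ?thesis using less limn by linarith
  qed
  have l2: "Suc (K + 1) * (n * n) < wlim w"
    using lim(2) mult_le_mono1[of "Suc (K + 1)" "K + 3" "n * n"] by simp
  have pre: "wp w (scale_select q) (\<lambda>h'. clk h' \<le> clk h + 30 \<and> var h' 40 = a \<and> var h' 41 = b \<and> var h' 42 = K + 1) h"
    unfolding scale_select_def
    by (rule vc_sound) (use v lim w in \<open>auto simp: a_def b_def\<close>)
  show ?thesis unfolding scale_step_prog_def
  proof (rule vc_sound, rule vc_call[OF pre], goal_cases)
    case (1 h1)
    note f1 = frm_var[OF 1(2)] frm_arr[OF 1(2)]
    show ?case
    proof (rule vc_call[OF minmax_spec[OF mm n w M, where J = "m + 1" and a = a and b = b and c = "K + 1"]], goal_cases)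
      case (15 h2)
      note f2 = frm_var[OF 15(2)] frm_arr[OF 15(2)]
      have D1: "arr h1 bD = arr h bD" by (simp add: f1)
      note r = 15(1)[unfolded D1]
      have v2: "var h2 40 = a" "var h2 41 = b" "var h2 42 = K + 1" using 1(1) by (simp_all add: f2)
      have L2: "arr h2 bL = arr h bL" by (simp add: f1 f2)
      have La: "arr h bL a = scale q a" "arr h bL b = scale q b" using sc ab by (auto simp: scales_ok_def)
      have new: "dist_ok (arr h2 bD) (K + 1)"
        by (rule dist_ok_product[OF ok scale]) (use r in blast)+
      have old: "dist_ok (arr h2 bD) k" if "k \<le> K" for k
        using dist_ok_cong[of "arr h bD" k "K + 1" "arr h2 bD"] sc that r by (auto simp: scales_ok_def)
      have ck: "clk h2 \<le> clk h + 30 + 22000 * (n * n + 1 + M)"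
      proof -
        define N where "N = n * n"
        have "m \<le> N" using m_le by (simp add: N_def)
        moreover have "clk h2 \<le> clk h1 + 11000 * (N + (m + 1) + 1 + M)" using r unfolding N_def by blast
        ultimately show ?thesis using 1(1) unfolding N_def[symmetric] by simp
      qed
      have "scales_ok (K + 1) h'" if "arr h' bD = arr h2 bD" "arr h' bL = (arr h bL)(K + 1 := scale q (K + 1))" for h'
        using new old sc that unfolding scales_ok_def by (auto simp: le_Suc_eq)
      note ext = this
      show ?case using ck Lb by (simp add: v2 L2 La) (rule ext[simplified], use scale in \<open>simp_all add: L2\<close>)
    qed (use v w ab lim l2 limn m_le 1(1) le[OF ok(1)] le[OF ok(2)] in \<open>auto simp: f1\<close>)
  qed
qed

text \<open>\<open>KB\<close> belongs to the analysis: the program stops by testing the length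
  itself and computes no logarithm.\<close>

lemma scales_prog_spec:
  assumes mm: "multiplies w n T MM" and M: "budget n T M"
    and v: "var h vN = n" "var h vNN = n * n" "var h vN2 = 2 * n" "var h vInf = m + 1"
    and D: "dist_ok (arr h bD) 0" "dist_ok (arr h bD) 1" and KB: "n * n \<le> scale q KB" "1 \<le> KB"
    and lim: "8 * (n * n * n) * (T + n * n + 2) < wlim w" "(KB + 3) * (n * n) < wlim w" "KB + 2 * q + 3 < wlim w"
  shows "wp w (scales_prog q MM) (\<lambda>h'. clk h' \<le> clk h + KB * (22000 * (n * n + 1 + M) + 200) + 50 \<and>
     scales_ok (var h' vK) h' \<and> var h' vK \<le> KB \<and> n * n \<le> scale q (var h' vK)) h"
proof -
  note [simp] = multiplies_wr[OF mm] multiplies_wb[OF mm]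
  define S where "S = 22000 * (n * n + 1 + M) + 200"
  have s: "scale q 0 = 0" "scale q 1 = 1" using q by (auto intro: scale_small)
  let ?h = "upd 46 (Suc 0) (Suc (Suc 0)) (wrt 3 (Suc 0) (Suc 0) (Suc (Suc (Suc 0))) (wrt 3 0 0 (Suc (Suc (Suc 0))) h))"
  have init: "scales_ok 1 ?h" unfolding scales_ok_def using D s by (auto simp: le_Suc_eq)
  show ?thesis unfolding scales_prog_def
  proof (rule vc_sound, simp add: w, rule wp_while[where m = "\<lambda>h'. KB - var h' 46" and I = "\<lambda>h'. scales_ok (var h' 46) h' \<and>
      var h' 46 \<le> KB \<and> clk h' \<le> clk h + 20 + var h' 46 * S"], goal_cases)
    case 1
    then show ?case using init KB by simp
  next
    case (2 h')
    then show ?case using w by simp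
  next
    case (3 h')
    note f = frm_var[OF 3(2)] frm_arr[OF 3(2)]
    define K where "K = var h' 46"
    have I: "scales_ok K h'" "K \<le> KB" "clk h' \<le> clk h + 20 + K * S" using 3(1) by (auto simp: K_def)
    have vs: "var h' vN = n" "var h' vNN = n * n" "var h' vN2 = 2 * n" "var h' vInf = m + 1" using v by (simp_all add: f)
    have less: "scale q K < n * n" using 3(4) I(1) vs by (simp add: scales_ok_def K_def[symmetric])
    then have KK: "K < KB" using KB(1) I(2) by (metis le_neq_implies_less not_le)
    have l: "(K + 3) * (n * n) < wlim w"
      using mult_le_mono1[of "K + 3" "KB + 3" "n * n"] KK lim(2) by linarith
    show ?case unfolding compile.simps
    proof (rule wp_mono[OF scale_step_prog_spec[OF mm M, where K = K]], goal_cases)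
      case (11 h'')
      then show ?case using I KK by (simp add: S_def K_def[symmetric])
    qed (use vs I less lim l KK in \<open>auto simp: K_def scales_ok_def\<close>)
  next
    case (4 h')
    note f = frm_var[OF 4(2)] frm_arr[OF 4(2)]
    have vs: "var h' vNN = n * n" using v by (simp add: f)
    have ge: "n * n \<le> scale q (var h' 46)" using 4(1,4) vs by (simp add: scales_ok_def)
    have "var h' 46 * S \<le> KB * S" using 4(1) by simp
    then have "clk h' + 10 \<le> clk h + KB * S + 50" using 4(1) by linarith
    then show ?case using 4(1) ge unfolding S_def scales_ok_def by simp
  qed
qed

lemma pre_prog_spec:
  assumes mm: "multiplies w n T MM" and M: "budget n T M"
    and v: "var h 0 = n" "var h 1 = m"
    and inp: "\<forall>i<m. arr h 0 i = fst (pred ! i) \<and> arr h 1 i = snd (pred ! i)"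
    and wx: "\<And>h' i. i < m \<Longrightarrow> var h' 13 = i \<Longrightarrow> var h' vM = m \<Longrightarrow> okx w h' wx \<and> ev w h' wx = wt i" "ecost wx \<le> 5"
    and KB: "n * n \<le> scale q KB" "1 \<le> KB"
    and lim: "8 * (n * n * n) * (T + n * n + 2) < wlim w" "(KB + 3) * (n * n) < wlim w" "KB + 2 * q + 3 < wlim w"
  shows "wp w (pre_prog q wx MM) (\<lambda>h'. clk h' \<le> clk h + KB * (22000 * (n * n + 1 + M) + 200) + 500 * (n * n) + 500 \<and>
     var h' vN = n \<and> var h' vM = m \<and> var h' vInf = m + 1 \<and> var h' vNN = n * n \<and>
     scales_ok (var h' vK) h' \<and> var h' vK \<le> KB \<and> n * n \<le> scale q (var h' vK) \<and>
     (\<forall>i<m. arr h' bIdx (pos i) = i + 1) \<and> arr h' 0 = arr h 0 \<and> arr h' 1 = arr h 1) h"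
  unfolding pre_prog_def
proof (rule vc_sound, rule vc_call[OF pre_regs_spec[OF v]], goal_cases)
  case (1 h1)
  note [simp] = multiplies_wr[OF mm] multiplies_wb[OF mm]
  note h1 = 1 and f1 = frm_var[OF 1(2)] frm_arr[OF 1(2)]
  show ?case
  proof (rule vc_call[OF pre_fill_spec[where J = "m + 1"]], goal_cases)
    case (3 h2)
    note h2 = 3 and f2 = frm_var[OF 3(2)] frm_arr[OF 3(2)]
    show ?case
    proof (rule vc_call[OF pre_edges_spec[OF _ _ _ _ _ _ wx]], goal_cases)
      case (10 h3)
      note h3 = 10 and f3 = frm_var[OF 10(2)] frm_arr[OF 10(2)]
      show ?case
      proof (rule vc_call[OF pre_diag_spec], goal_cases)
        case (6 h4)
        note h4 = 6 and f4 = frm_var[OF 6(2)] frm_arr[OF 6(2)]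
        show ?case
        proof (rule vc_call_last[OF scales_prog_spec[OF mm M _ _ _ _ _ _ KB lim]], goal_cases)
          case (7 h5)
          note f5 = frm_var[OF 7(2)] frm_arr[OF 7(2)]
          have "clk h5 \<le> clk h + KB * (22000 * (n * n + 1 + M) + 200) + 500 * (n * n) + 500"
            using 7(1)[THEN conjunct1] h4(1)[THEN conjunct1] h3(1)[THEN conjunct1] h2(1)[THEN conjunct1] h1(1)[THEN conjunct1] by linarith
          moreover have "arr h5 bIdx = arr h3 bIdx" by (simp add: f4 f5)
          ultimately show ?case using 7(1) h3(1) h1(1) by (simp add: f1 f2 f3 f4 f5)
        qed (use h1(1) h4(1) in \<open>auto simp: f1 f2 f3 f4\<close>)
      qed (use h1(1) h3(1) in \<open>auto simp: f1 f2 f3\<close>)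
    qed (use h1(1) h2(1) inp wx in \<open>auto simp: f1 f2\<close>)
  qed (use h1(1) in auto)
qed

end

section \<open>Updates\<close>

definition maximal_run :: "nat set \<Rightarrow> nat \<Rightarrow> nat \<Rightarrow> bool" where
  "maximal_run J l r \<longleftrightarrow> l \<le> r \<and> {l..r} \<subseteq> J \<and> (l = 0 \<or> l - 1 \<notin> J) \<and> Suc r \<notin> J"

lemma run_left: "(y::nat) \<in> J \<Longrightarrow> \<exists>l\<le>y. {l..y} \<subseteq> J \<and> (l = 0 \<or> l - 1 \<notin> J)"
proof (induction y)
  case 0
  then show ?case by (intro exI[of _ 0]) simp
next
  case (Suc y)
  show ?case
  proof (cases "y \<in> J")
    case True
    then obtain l where "l \<le> y" "{l..y} \<subseteq> J" "l = 0 \<or> l - 1 \<notin> J" using Suc.IH by blast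
    then show ?thesis using Suc.prems by (intro exI[of _ l]) (auto simp: atLeastAtMostSuc_conv)
  next
    case False
    then show ?thesis using Suc.prems by (intro exI[of _ "Suc y"]) simp
  qed
qed

lemma run_right:
  assumes "(y::nat) \<in> J" "\<forall>z\<in>J. z \<le> m"
  shows "\<exists>r\<ge>y. {y..r} \<subseteq> J \<and> Suc r \<notin> J"
  using assms(1)
proof (induction "m - y" arbitrary: y rule: less_induct)
  case less
  show ?case
  proof (cases "Suc y \<in> J")
    case True
    then have "m - Suc y < m - y" using assms(2) by auto
    then obtain r where "Suc y \<le> r" "{Suc y..r} \<subseteq> J" "Suc r \<notin> J" using less.hyps[of "Suc y"] True by blast
    moreover have "{y..r} = insert y {Suc y..r}" using calculation by auto
    ultimately show ?thesis using less.prems by (intro exI[of _ r]) auto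
  next
    case False
    then show ?thesis using less.prems by (intro exI[of _ y]) simp
  qed
qed

lemma maximal_run_unique:
  assumes "maximal_run J l r" "maximal_run J l' r'" "y \<in> {l..r}" "y \<in> {l'..r'}"
  shows "l = l' \<and> r = r'"
proof -
  have left: "\<not> l1 < l2" if "maximal_run J l1 r1" "maximal_run J l2 r2" "y \<in> {l1..r1}" "y \<in> {l2..r2}" for l1 r1 l2 r2
  proof
    assume "l1 < l2"
    then have "l2 - 1 \<in> {l1..r1}" using that by auto
    then have "l2 - 1 \<in> J" using that(1) unfolding maximal_run_def by blast
    then show False using that \<open>l1 < l2\<close> by (auto simp: maximal_run_def)
  qed
  have right: "\<not> r1 < r2" if "maximal_run J l1 r1" "maximal_run J l2 r2" "y \<in> {l1..r1}" "y \<in> {l2..r2}" for l1 r1 l2 r2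
  proof
    assume "r1 < r2"
    then have "Suc r1 \<in> {l2..r2}" using that by auto
    then have "Suc r1 \<in> J" using that(2) unfolding maximal_run_def by blast
    then show False using that by (auto simp: maximal_run_def)
  qed
  show ?thesis using left[OF assms] left[OF assms(2,1,4,3)] right[OF assms] right[OF assms(2,1,4,3)] by auto
qed

text \<open>Only the two ends of a maximal run carry correct values; cells inside a run may go
  stale, which is what makes an update take constant time.\<close>

definition runs_ok :: "nat set \<Rightarrow> (nat \<Rightarrow> nat) \<Rightarrow> (nat \<Rightarrow> nat) \<Rightarrow> bool" where
  "runs_ok J EN ST \<longleftrightarrow> (\<forall>l r. maximal_run J l r \<longrightarrow> EN l = r \<and> ST r = l)"

text \<open>The new position merges with the run that ends just before it and the run that starts
  just after it. Every other maximal run avoids \<open>x\<close> and keeps both ends, so two cells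
  suffice.\<close>

lemma runs_ok_insert:
  assumes ok: "runs_ok J EN ST" and x: "x \<notin> J" "0 < x" and fin: "\<forall>z\<in>J. z \<le> m"
    and l: "l = (if x - 1 \<in> J then ST (x - 1) else x)" and r: "r = (if Suc x \<in> J then EN (Suc x) else x)"
  shows "runs_ok (insert x J) (EN(l := r)) (ST(r := l))" "l \<le> x" "x \<le> r" "maximal_run (insert x J) l r"
proof -
  have L: "l \<le> x \<and> {l..<x} \<subseteq> J \<and> (l = 0 \<or> l - 1 \<notin> J)"
  proof (cases "x - 1 \<in> J")
    case True
    then obtain l' where l': "l' \<le> x - 1" "{l'..x - 1} \<subseteq> J" "l' = 0 \<or> l' - 1 \<notin> J" using run_left by blast
    then have "maximal_run J l' (x - 1)" using x by (simp add: maximal_run_def)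
    then have "ST (x - 1) = l'" using ok by (simp add: runs_ok_def)
    moreover have "{l'..<x} = {l'..x - 1}" using x by auto
    ultimately show ?thesis using l l' True by auto
  qed (use l in auto)
  have R: "x \<le> r \<and> {Suc x..r} \<subseteq> J \<and> Suc r \<notin> J"
  proof (cases "Suc x \<in> J")
    case True
    then obtain r' where r': "Suc x \<le> r'" "{Suc x..r'} \<subseteq> J" "Suc r' \<notin> J" using run_right[OF _ fin] by blast
    then have "maximal_run J (Suc x) r'" using x by (simp add: maximal_run_def)
    then have "EN (Suc x) = r'" using ok by (simp add: runs_ok_def)
    then show ?thesis using r r' True by auto
  qed (use r in auto)
  show "l \<le> x" "x \<le> r" using L R by auto
  have "{l..r} = {l..<x} \<union> {x} \<union> {Suc x..r}" using L R by auto
  then show mr: "maximal_run (insert x J) l r" unfolding maximal_run_def using L R x by auto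
  show "runs_ok (insert x J) (EN(l := r)) (ST(r := l))"
    unfolding runs_ok_def
  proof (intro allI impI)
    fix l' r' assume m': "maximal_run (insert x J) l' r'"
    show "(EN(l := r)) l' = r' \<and> (ST(r := l)) r' = l'"
    proof (cases "x \<in> {l'..r'}")
      case True
      then have "l' = l \<and> r' = r" using maximal_run_unique[OF m' mr True] L R by auto
      then show ?thesis by simp
    next
      case False
      then have "maximal_run J l' r'" using m' by (auto simp: maximal_run_def)
      then have "EN l' = r'" "ST r' = l'" using ok by (auto simp: runs_ok_def)
      moreover have "l' \<noteq> l"
      proof
        assume "l' = l"
        then have "r' = r" using maximal_run_unique[OF m' mr, of l] m' mr by (auto simp: maximal_run_def)
        then show False using False \<open>l' = l\<close> L R by auto
      qed
      moreover have "r' \<noteq> r"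
      proof
        assume "r' = r"
        then have "l' = l" using maximal_run_unique[OF m' mr, of r] m' mr by (auto simp: maximal_run_def)
        then show False using False \<open>r' = r\<close> L R by auto
      qed
      ultimately show ?thesis by simp
    qed
  qed
qed

text \<open>An unordered list with an inverse index; that \<open>P\<close> inverts \<open>SA\<close>
  also forces the listed elements to be distinct.\<close>

definition enumerates :: "nat \<Rightarrow> (nat \<Rightarrow> nat) \<Rightarrow> (nat \<Rightarrow> nat) \<Rightarrow> nat set \<Rightarrow> bool" where
  "enumerates c SA P S \<longleftrightarrow> SA ` {..<c} = S \<and> (\<forall>i<c. P (SA i) = i)"

lemma enumerates_add:
  assumes "enumerates c SA P S" "x \<notin> S"
  shows "enumerates (Suc c) (SA(c := x)) (P(x := c)) (insert x S)"
proof -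
  have "SA i \<noteq> x" if "i < c" for i using assms that by (auto simp: enumerates_def)
  moreover have "(SA(c := x)) ` {..<Suc c} = insert x (SA ` {..<c})" by (auto simp: lessThan_Suc)
  ultimately show ?thesis using assms by (auto simp: enumerates_def less_Suc_eq)
qed

text \<open>Deletion in constant time: the last element moves into the gap.\<close>

lemma enumerates_remove:
  assumes e: "enumerates c SA P S" and z: "z \<in> S"
  shows "0 < c" "P z < c" "enumerates (c - 1) (SA(P z := SA (c - 1))) (P(SA (c - 1) := P z)) (S - {z})"
proof -
  obtain i where i: "i < c" "SA i = z" using e z by (auto simp: enumerates_def)
  then have P: "P z = i" using e by (auto simp: enumerates_def)
  show c: "0 < c" "P z < c" using i P by auto
  have inj: "SA j = SA k \<longleftrightarrow> j = k" if "j < c" "k < c" for j k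
    using e that unfolding enumerates_def by metis
  let ?SA = "SA(i := SA (c - 1))"
  have "?SA ` {..<c - 1} = S - {z}"
  proof
    show "?SA ` {..<c - 1} \<subseteq> S - {z}"
    proof
      fix y assume "y \<in> ?SA ` {..<c - 1}"
      then obtain j where j: "j < c - 1" "y = ?SA j" by auto
      show "y \<in> S - {z}"
      proof (cases "j = i")
        case True
        then have "y = SA (c - 1)" using j by simp
        then show ?thesis using e i inj[of "c - 1" i] j True by (auto simp: enumerates_def)
      next
        case False
        then show ?thesis using e i inj[of j i] j by (auto simp: enumerates_def)
      qed
    qed
    show "S - {z} \<subseteq> ?SA ` {..<c - 1}"
    proof
      fix y assume y: "y \<in> S - {z}"
      then obtain j where j: "j < c" "y = SA j" using e by (auto simp: enumerates_def)
      then have ji: "j \<noteq> i" using y i by auto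
      show "y \<in> ?SA ` {..<c - 1}"
      proof (cases "j = c - 1")
        case True
        then show ?thesis using j ji i by (intro image_eqI[of _ _ i]) auto
      next
        case False
        then show ?thesis using j ji by (intro image_eqI[of _ _ j]) auto
      qed
    qed
  qed
  moreover have "(P(SA (c - 1) := i)) (?SA j) = j" if "j < c - 1" for j
    using e that inj[of j "c - 1"] unfolding enumerates_def by auto
  ultimately show "enumerates (c - 1) (SA(P z := SA (c - 1))) (P(SA (c - 1) := P z)) (S - {z})"
    unfolding P by (simp add: enumerates_def)
qed

text \<open>Position 0 counts as updated, so the run at the front has no start in this set; the
  starts index exactly the runs that lie ahead of it.\<close>

definition starts :: "nat set \<Rightarrow> nat set" where
  "starts I = {y \<in> I. y - 1 \<notin> insert 0 I}"

lemma starts_insert: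
  assumes "x \<notin> I" "0 < x"
  shows "starts (insert x I) = (if x - 1 \<in> insert 0 I then starts I else insert x (starts I)) -
    (if Suc x \<in> I then {Suc x} else {})"
  using assms by (auto simp: starts_def)

text \<open>
  Positions count from 1 and position 0 is always taken as updated, so that the run of updates
  that starts at the front is the one starting at 0.
\<close>

definition dynamic :: "nat \<Rightarrow> nat set \<Rightarrow> vstate \<Rightarrow> bool" where
  "dynamic m I h \<longleftrightarrow> I \<subseteq> {1..m} \<and> (\<forall>y\<le>m + 1. arr h 30 y = of_bool (y \<in> insert 0 I)) \<and>
     runs_ok (insert 0 I) (arr h 31) (arr h 32) \<and> enumerates (var h 50) (arr h 33) (arr h 34) (starts I) \<and>
     var h 51 \<in> insert 0 I \<and> (\<forall>y\<in>I. y \<le> var h 51)"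

definition dyn_init :: prog where
  "dyn_init = compile (14 ::= Rv vM + Nm 2 ;; For 13 14 (Sto 30 (Rv 13) (Nm 0)) ;;
     Sto 30 (Nm 0) (Nm 1) ;; Sto 31 (Nm 0) (Nm 0) ;; Sto 32 (Nm 0) (Nm 0) ;; 50 ::= Nm 0 ;; 51 ::= Nm 0)"

definition upd_left :: prog where
  "upd_left = compile (14 ::= Rv 13 ;; If (Ld 30 (Rv 13 - Nm 1) \<doteq> Nm 0)
     (Sto 33 (Rv 50) (Rv 13) ;; Sto 34 (Rv 13) (Rv 50) ;; 50 ::= Rv 50 + Nm 1) (14 ::= Ld 32 (Rv 13 - Nm 1)))"

definition upd_right :: prog where
  "upd_right = compile (15 ::= Rv 13 ;; If (Ld 30 (Rv 13 + Nm 1) \<doteq> Nm 0) Nop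
     (15 ::= Ld 31 (Rv 13 + Nm 1) ;; 50 ::= Rv 50 - Nm 1 ;; 16 ::= Ld 33 (Rv 50) ;; 17 ::= Ld 34 (Rv 13 + Nm 1) ;;
      Sto 33 (Rv 17) (Rv 16) ;; Sto 34 (Rv 16) (Rv 17)))"

text \<open>Insertions and deletions are recorded alike, as the set of predicted positions that have
  been updated. Register 51 keeps the greatest one, which the decremental query needs.\<close>

definition upd_prog :: prog where
  "upd_prog = compile (13 ::= Ld bIdx (Rv 0 * Rv vN + Rv 1) ;; Call upd_left ;; Call upd_right ;;
     Sto 31 (Rv 14) (Rv 15) ;; Sto 32 (Rv 15) (Rv 14) ;; Sto 30 (Rv 13) (Nm 1) ;;
     If (Rv 51 \<prec> Rv 13) (51 ::= Rv 13) Nop)"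

lemma wr_dyn [simp]:
  "wr dyn_init = {13, 14, 50, 51}" "wb dyn_init = {30, 31, 32}"
  "wr upd_left = {14, 50}" "wb upd_left = {33, 34}" "wr upd_right = {15, 16, 17, 50}" "wb upd_right = {33, 34}"
  "wr upd_prog = {13, 14, 15, 16, 17, 50, 51}" "wb upd_prog = {30, 31, 32, 33, 34}"
  by (auto simp: dyn_init_def upd_left_def upd_right_def upd_prog_def)

lemma dyn_init_spec:
  assumes "var h vM = m" "0 < w" "m + 3 < wlim w"
  shows "wp w dyn_init (\<lambda>h'. clk h' \<le> clk h + 20 * m + 100 \<and> dynamic m {} h') h"
  unfolding dyn_init_def
proof (rule vc_sound, simp add: assms, intro conjI, goal_cases)
  case 1 then show ?case using assms by simp
next
  case 2 then show ?case using assms by simp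
next
  case 3
  show ?case
  proof (rule wp_for_const[where N = "m + 2" and T = 10 and I = "\<lambda>i h'. \<forall>y<i. arr h' 30 y = 0"], goal_cases)
    case (9 i h')
    show ?case by (rule vc_sound) (use 9 assms in \<open>auto simp: less_Suc_eq\<close>)
  next
    case (10 h')
    have "runs_ok {0} EN ST" if "EN 0 = 0" "ST 0 = 0" for EN ST :: "nat \<Rightarrow> nat"
      unfolding runs_ok_def
    proof (intro allI impI)
      fix l r assume "maximal_run {0} l r"
      then have "l \<in> {l..r}" "r \<in> {l..r}" "{l..r} \<subseteq> {0}" by (auto simp: maximal_run_def)
      then have "l = 0" "r = 0" by blast+
      then show "EN l = r \<and> ST r = l" using that by simp
    qed
    then show ?case using 10 assms by (simp add: dynamic_def enumerates_def starts_def)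
  qed (use assms in auto)
qed

lemma upd_left_spec:
  assumes d: "dynamic m I h" and x: "var h 13 = x" "0 < x" "x \<le> m" "x \<notin> I" and w: "0 < w" "m + 3 < wlim w"
  shows "wp w upd_left (\<lambda>h'. clk h' \<le> clk h + 40 \<and> var h' 14 = (if x - 1 \<in> insert 0 I then arr h 32 (x - 1) else x) \<and>
     enumerates (var h' 50) (arr h' 33) (arr h' 34) (if x - 1 \<in> insert 0 I then starts I else insert x (starts I))) h"
proof -
  have e: "enumerates (var h 50) (arr h 33) (arr h 34) (starts I)" using d by (simp add: dynamic_def)
  have ins: "arr h 30 (x - Suc 0) = of_bool (x - 1 \<in> insert 0 I)" using d x by (simp add: dynamic_def)
  have fin: "finite I" "card I \<le> m"
    using d finite_subset[of I "{1..m}"] card_mono[of "{1..m}" I] by (auto simp: dynamic_def)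
  have c: "var h 50 \<le> m"
  proof -
    have "inj_on (arr h 33) {..<var h 50}" using e unfolding enumerates_def by (intro inj_onI) (metis lessThan_iff)
    then have "var h 50 = card (starts I)" using e card_image[of "arr h 33" "{..<var h 50}"] by (simp add: enumerates_def)
    also have "\<dots> \<le> card I" by (rule card_mono) (use fin in \<open>auto simp: starts_def\<close>)
    finally show ?thesis using fin by simp
  qed
  have xs: "x \<notin> starts I" using x by (simp add: starts_def)
  show ?thesis unfolding upd_left_def
  proof (cases "x - 1 \<in> insert 0 I")
    case True
    then show "wp w (compile (14 ::= Rv 13 ;; If (Ld 30 (Rv 13 - Nm 1) \<doteq> Nm 0)
     (Sto 33 (Rv 50) (Rv 13) ;; Sto 34 (Rv 13) (Rv 50) ;; 50 ::= Rv 50 + Nm 1) (14 ::= Ld 32 (Rv 13 - Nm 1))))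
     (\<lambda>h'. clk h' \<le> clk h + 40 \<and> var h' 14 = (if x - 1 \<in> insert 0 I then arr h 32 (x - 1) else x) \<and>
     enumerates (var h' 50) (arr h' 33) (arr h' 34) (if x - 1 \<in> insert 0 I then starts I else insert x (starts I))) h"
      using x w ins e by (intro vc_sound) auto
  next
    case False
    then show "wp w (compile (14 ::= Rv 13 ;; If (Ld 30 (Rv 13 - Nm 1) \<doteq> Nm 0)
     (Sto 33 (Rv 50) (Rv 13) ;; Sto 34 (Rv 13) (Rv 50) ;; 50 ::= Rv 50 + Nm 1) (14 ::= Ld 32 (Rv 13 - Nm 1))))
     (\<lambda>h'. clk h' \<le> clk h + 40 \<and> var h' 14 = (if x - 1 \<in> insert 0 I then arr h 32 (x - 1) else x) \<and>
     enumerates (var h' 50) (arr h' 33) (arr h' 34) (if x - 1 \<in> insert 0 I then starts I else insert x (starts I))) h"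
      using x w ins c enumerates_add[OF e xs] by (intro vc_sound) auto
  qed
qed

lemma upd_right_spec:
  assumes ins: "arr h 30 (Suc x) = of_bool (Suc x \<in> I)" and e: "enumerates (var h 50) (arr h 33) (arr h 34) S"
    and x: "var h 13 = x" "x \<le> m" and S: "Suc x \<in> I \<Longrightarrow> Suc x \<in> S" and w: "0 < w" "m + 3 < wlim w"
  shows "wp w upd_right (\<lambda>h'. clk h' \<le> clk h + 60 \<and> var h' 15 = (if Suc x \<in> I then arr h 31 (Suc x) else x) \<and>
     enumerates (var h' 50) (arr h' 33) (arr h' 34) (S - (if Suc x \<in> I then {Suc x} else {}))) h"
proof (cases "Suc x \<in> I")
  case True
  note r = enumerates_remove[OF e S[OF True]]
  show ?thesis unfolding upd_right_def using True x w ins r by (intro vc_sound) auto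
next
  case False
  show ?thesis unfolding upd_right_def using False x w ins e by (intro vc_sound) auto
qed

lemma upd_prog_spec:
  assumes d: "dynamic m I h" and a: "var h 0 = u" "var h 1 = v" "var h vN = n" "u < n" "v < n" "arr h bIdx (u * n + v) = x"
    and x: "0 < x" "x \<le> m" "x \<notin> I" and w: "0 < w" "m + 3 < wlim w" "n * n < wlim w"
  shows "wp w upd_prog (\<lambda>h'. clk h' \<le> clk h + 200 \<and> dynamic m (insert x I) h') h"
proof -
  have l: "u * n + v < wlim w" "u * n < wlim w" using index_less[OF a(4,5)] w by linarith+
  have fin: "\<forall>z\<in>insert 0 I. z \<le> m" using d by (auto simp: dynamic_def)
  show ?thesis unfolding upd_prog_def
  proof (rule vc_sound, subst vc.simps(4), simp only: vc.simps(2), intro conjI, goal_cases)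
    case 1 then show ?case by simp
  next
    case 2 then show ?case using a l by simp
  next
    case 3
    let ?h = "upd 13 (ev w h (Ld bIdx (Rv 0 * Rv vN + Rv 1))) (ecost (Ld bIdx (Rv 0 * Rv vN + Rv 1)) + 1) h"
    have v13: "var ?h 13 = x" using a by simp
    have d0: "dynamic m I ?h" using d by (simp add: dynamic_def)
    show ?case
    proof (rule vc_call[OF upd_left_spec[OF d0 v13 x w(1,2)]], goal_cases)
      case (1 h1)
      note f1 = frm_var[OF 1(2)] frm_arr[OF 1(2)]
      define S where "S = (if x - 1 \<in> insert 0 I then starts I else insert x (starts I))"
      have ins: "arr h1 30 (Suc x) = of_bool (Suc x \<in> I)" using d x by (simp add: f1 dynamic_def)
      have S: "Suc x \<in> I \<Longrightarrow> Suc x \<in> S" using x by (auto simp: S_def starts_def)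
      have v1: "var h1 13 = x" using v13 by (simp add: f1)
      have e1: "enumerates (var h1 50) (arr h1 33) (arr h1 34) S" using 1(1) by (simp add: S_def)
      show ?case
      proof (rule vc_call[OF upd_right_spec[OF ins e1 v1 x(2) S w(1,2)]], goal_cases)
        case (2 h2)
        note f2 = frm_var[OF 2(2)] frm_arr[OF 2(2)]
        define l r where "l = (if x - 1 \<in> insert 0 I then arr h 32 (x - 1) else x)"
          and "r = (if Suc x \<in> insert 0 I then arr h 31 (Suc x) else x)"
        have l2: "var h2 14 = l" using 1(1) by (simp add: f2 l_def)
        have r2: "var h2 15 = r" using 2(1) by (simp add: r_def f1)
        have ro: "runs_ok (insert 0 I) (arr h 31) (arr h 32)" using d by (simp add: dynamic_def)
        have x0: "x \<notin> insert 0 I" using x by simp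
        have ok: "runs_ok (insert 0 (insert x I)) ((arr h 31)(l := r)) ((arr h 32)(r := l))"
          using runs_ok_insert(1)[OF ro x0 x(1) fin l_def r_def] by (simp add: insert_commute)
        have st: "enumerates (var h2 50) (arr h2 33) (arr h2 34) (starts (insert x I))"
          using 2(1) unfolding starts_insert[OF x(3,1)] S_def by simp
        have v2: "var h2 13 = x" "var h2 51 = var h 51" "arr h2 30 = arr h 30" "arr h2 31 = arr h 31" "arr h2 32 = arr h 32"
          using v13 by (simp_all add: f1 f2)
        have ck: "clk h2 \<le> clk h + 110" using 1(1) 2(1) by simp
        have mx: "var h 51 \<in> insert 0 I" "\<forall>y\<in>I. y \<le> var h 51" "I \<subseteq> {1..m}" "\<forall>y\<le>m + 1. arr h 30 y = of_bool (y \<in> insert 0 I)"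
          using d by (auto simp: dynamic_def)
        show ?case
        proof (cases "var h 51 < x")
          case True
          then show ?thesis using ok st mx ck x w by (auto simp: l2 r2 v2 dynamic_def)
        next
          case False
          then show ?thesis using ok st mx ck x w by (auto simp: l2 r2 v2 dynamic_def)
        qed
      qed
    qed
  qed
qed

section \<open>Listing the edges outside the predicted graph\<close>

definition q_start :: prog where
  "q_start = compile (Sto 40 (Nm 0) (Rv 0) ;; Sto 41 (Nm 0) (Rv 0) ;; Sto 40 (Nm 1) (Rv 1) ;; Sto 41 (Nm 1) (Rv 1) ;; 52 ::= Nm 2)"

definition emit :: prog where
  "emit = compile (Sto 40 (Rv 52) (Ld 0 (Rv 54 - Nm 1)) ;; Sto 41 (Rv 52) (Ld 1 (Rv 54 - Nm 1)) ;; 52 ::= Rv 52 + Nm 1)"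

definition emit_run :: prog where
  "emit_run = compile (While (Ld 30 (Rv 54)) (Call emit ;; 54 ::= Rv 54 + Nm 1))"

text \<open>The end of the front run is the largest prefix of the prediction that is present, the
  index of the predicted graph; all other runs consist of insertions that came early.\<close>

definition enum_inc :: prog where
  "enum_inc = compile (Call q_start ;; For 55 50 (54 ::= Ld 33 (Rv 55) ;; Call emit_run) ;; 53 ::= Ld 31 (Nm 0))"

text \<open>The predicted edges after the greatest deleted position are all present and form the
  predicted graph. The gaps before it hold the remaining edges; each jump over a run follows an
  emitted edge, so the time is linear in their number.\<close>

definition enum_dec :: prog where
  "enum_dec = compile (Call q_start ;; 54 ::= Ld 31 (Nm 0) + Nm 1 ;;
     While (Rv 54 \<prec> Rv 51 + Nm 1) (Call emit ;; 54 ::= Rv 54 + Nm 1 ;; If (Ld 30 (Rv 54)) (54 ::= Ld 31 (Rv 54) + Nm 1) Nop) ;;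
     53 ::= Rv vM - Rv 51)"

lemma wr_enum [simp]:
  "wr q_start = {52}" "wb q_start = {40, 41}" "wr emit = {52}" "wb emit = {40, 41}"
  "wr emit_run = {52, 54}" "wb emit_run = {40, 41}"
  "wr enum_inc = {52, 53, 54, 55}" "wb enum_inc = {40, 41}" "wr enum_dec = {52, 53, 54}" "wb enum_dec = {40, 41}"
  by (auto simp: q_start_def emit_def emit_run_def enum_inc_def enum_dec_def)

text \<open>The position before the later start would lie inside the run of the earlier one.\<close>

lemma starts_disjoint:
  assumes "l \<in> starts I" "l' \<in> starts I" "l \<le> y" "{l..y} \<subseteq> insert 0 I" "l' \<le> y" "{l'..y} \<subseteq> insert 0 I"
  shows "l = l'"
proof -
  have aux: "\<not> l1 < l2" if "l1 \<in> starts I" "l2 \<in> starts I" "l1 \<le> y" "{l1..y} \<subseteq> insert 0 I" "l2 \<le> y" for l1 l2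
  proof
    assume "l1 < l2"
    then have "l2 - 1 \<in> {l1..y}" using that by auto
    then have "l2 - 1 \<in> insert 0 I" using that(4) by blast
    then show False using that(2) by (simp add: starts_def)
  qed
  show ?thesis using aux[of l l'] aux[of l' l] assms by auto
qed

context predicted
begin

definition inp :: "vstate \<Rightarrow> bool" where
  "inp h \<longleftrightarrow> (\<forall>i<m. arr h 0 i = fst (pred ! i) \<and> arr h 1 i = snd (pred ! i))"

text \<open>The end points of the query are stored as the loops \<open>(u, u)\<close> and
  \<open>(v, v)\<close> at indices 0 and 1, so that source, target and listed edges are nodes of one
  kind for Dijkstra's algorithm.\<close>

definition emitted :: "nat \<Rightarrow> nat \<Rightarrow> nat set \<Rightarrow> vstate \<Rightarrow> bool" where
  "emitted u v Y h \<longleftrightarrow> var h 52 = card Y + 2 \<and> Y \<subseteq> {1..m} \<and>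
     arr h 40 0 = u \<and> arr h 41 0 = u \<and> arr h 40 1 = v \<and> arr h 41 1 = v \<and>
     (\<forall>e. 2 \<le> e \<and> e < var h 52 \<longrightarrow> (\<exists>y\<in>Y. (arr h 40 e, arr h 41 e) = pred ! (y - 1))) \<and>
     (\<forall>y\<in>Y. \<exists>e. 2 \<le> e \<and> e < var h 52 \<and> (arr h 40 e, arr h 41 e) = pred ! (y - 1))"

lemma emitted_tick [simp]: "emitted u v Y (tick k h) = emitted u v Y h"
  and emitted_upd [simp]: "r \<noteq> 52 \<Longrightarrow> emitted u v Y (upd r x k h) = emitted u v Y h"
  by (simp_all add: emitted_def)

lemma emitted_count: "emitted u v Y h \<Longrightarrow> var h 52 = card Y + 2"
  by (simp add: emitted_def)

lemma q_start_spec: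
  assumes "var h 0 = u" "var h 1 = v"
  shows "wp w q_start (\<lambda>h'. clk h' \<le> clk h + 20 \<and> emitted u v {} h') h"
  unfolding q_start_def
  by (rule vc_sound) (use assms w limn n in \<open>simp add: emitted_def\<close>)

lemma emit_spec:
  assumes e: "emitted u v Y h" and y: "var h 54 = y" "y \<notin> Y" "1 \<le> y" "y \<le> m" and i: "inp h"
  shows "wp w emit (\<lambda>h'. clk h' \<le> clk h + 30 \<and> emitted u v (insert y Y) h') h"
proof -
  have fin: "finite Y" "card Y \<le> m"
    using e finite_subset[of Y "{1..m}"] card_mono[of "{1..m}" Y] by (auto simp: emitted_def)
  have c: "var h 52 = card Y + 2" using e by (simp add: emitted_def)
  have D1: "\<exists>z\<in>Y. (arr h 40 e, arr h 41 e) = pred ! (z - 1)" if "2 \<le> e \<and> e < var h 52" for e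
    using e that unfolding emitted_def by simp
  have D2: "\<exists>e. 2 \<le> e \<and> e < var h 52 \<and> (arr h 40 e, arr h 41 e) = pred ! (z - 1)" if "z \<in> Y" for z
    using e that unfolding emitted_def by (elim conjE) blast
  have D3: "Y \<subseteq> {1..m}" "arr h 40 0 = u" "arr h 41 0 = u" "arr h 40 1 = v" "arr h 41 1 = v"
    using e unfolding emitted_def by simp_all
  have l: "Suc (Suc (Suc (card Y))) < wlim w" "1 < wlim w" using fin m_le limn by linarith+
  have p: "arr h 0 (y - Suc 0) = fst (pred ! (y - Suc 0))" "arr h (Suc 0) (y - Suc 0) = snd (pred ! (y - Suc 0))"
    using i y by (simp_all add: inp_def)
  have em: "emitted u v (insert y Y) h'"
    if "var h' 52 = card Y + 3" "arr h' 40 = (arr h 40)(card Y + 2 := fst (pred ! (y - 1)))"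
      "arr h' 41 = (arr h 41)(card Y + 2 := snd (pred ! (y - 1)))" for h'
  proof -
    have e1: "\<exists>z\<in>insert y Y. (arr h' 40 e, arr h' 41 e) = pred ! (z - 1)" if "2 \<le> e \<and> e < var h' 52" for e
    proof (cases "e = card Y + 2")
      case True
      then show ?thesis using \<open>arr h' 40 = _\<close> \<open>arr h' 41 = _\<close> by simp
    next
      case False
      then have "2 \<le> e \<and> e < var h 52" using that \<open>var h' 52 = _\<close> c by auto
      then show ?thesis using D1[of e] False \<open>arr h' 40 = _\<close> \<open>arr h' 41 = _\<close> by auto
    qed
    have e2: "\<exists>e. 2 \<le> e \<and> e < var h' 52 \<and> (arr h' 40 e, arr h' 41 e) = pred ! (z - 1)" if zz: "z \<in> insert y Y" for z
    proof (cases "z = y")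
      case True
      then show ?thesis using \<open>arr h' 40 = _\<close> \<open>arr h' 41 = _\<close> \<open>var h' 52 = _\<close> by (intro exI[of _ "card Y + 2"]) auto
    next
      case False
      then obtain e' where "2 \<le> e' \<and> e' < var h 52 \<and> (arr h 40 e', arr h 41 e') = pred ! (z - 1)"
        using D2[of z] zz by blast
      then show ?thesis using \<open>arr h' 40 = _\<close> \<open>arr h' 41 = _\<close> \<open>var h' 52 = _\<close> c by (intro exI[of _ e']) auto
    qed
    have "arr h' 40 0 = u" "arr h' 41 0 = u" "arr h' 40 1 = v" "arr h' 41 1 = v" "var h' 52 = card (insert y Y) + 2" "insert y Y \<subseteq> {1..m}"
      using that D3 y fin by auto
    then show ?thesis unfolding emitted_def using e1 e2 by blast
  qed
  show ?thesis unfolding emit_def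
    by (rule vc_sound, simp add: y c l w p) (use em l fin y in simp)
qed

definition run_from :: "nat set \<Rightarrow> nat \<Rightarrow> nat set" where
  "run_from I l = {y. l \<le> y \<and> {l..y} \<subseteq> insert 0 I}"

text \<open>Time is charged to register 52, the number of nodes listed.\<close>

lemma emit_run_spec:
  assumes e: "emitted u v Y h" and d: "dynamic m I h" and l: "var h 54 = l" "l \<in> starts I" and i: "inp h"
    and dis: "Y \<inter> run_from I l = {}"
  shows "wp w emit_run (\<lambda>h'. emitted u v (Y \<union> run_from I l) h' \<and> clk h' + 60 * var h 52 \<le> clk h + 60 * var h' 52 + 20) h"
proof -
  have lI: "l \<in> I" "1 \<le> l" "I \<subseteq> {1..m}" using l(2) d by (auto simp: starts_def dynamic_def)
  \<comment> \<open>Cell \<open>m + 1\<close> is a sentinel: it stays 0 and stops a run that reaches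
    position \<open>m\<close>.\<close>
  have ins: "\<And>y. y \<le> m + 1 \<Longrightarrow> arr h 30 y = of_bool (y \<in> insert 0 I)" using d by (simp add: dynamic_def)
  show ?thesis unfolding emit_run_def
  proof (rule vc_sound, simp only: vc.simps, rule wp_while[where m = "\<lambda>h'. m + 1 - var h' 54" and
      I = "\<lambda>h'. l \<le> var h' 54 \<and> var h' 54 \<le> m + 1 \<and> {l..<var h' 54} \<subseteq> insert 0 I \<and> emitted u v (Y \<union> {l..<var h' 54}) h' \<and>
        clk h' + 60 * var h 52 \<le> clk h + 60 * var h' 52"], goal_cases)
    case 1
    then show ?case using l lI e by auto
  next
    case (2 h')
    then show ?case by simp
  next
    case (3 h')
    note f = frm_var[OF 3(2)] frm_arr[OF 3(2)]
    define y where "y = var h' 54"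
    have I: "l \<le> y" "y \<le> m + 1" "{l..<y} \<subseteq> insert 0 I" "emitted u v (Y \<union> {l..<y}) h'" "clk h' + 60 * var h 52 \<le> clk h + 60 * var h' 52"
      using 3(1) by (auto simp: y_def)
    have "arr h' 30 y \<noteq> 0" using 3(4) by (simp add: y_def)
    then have yJ: "y \<in> insert 0 I" using ins[OF I(2)] by (simp add: f)
    then have y: "y \<in> I" "y \<le> m" "1 \<le> y" using I(1) lI by auto
    have sub: "{l..y} \<subseteq> insert 0 I" 
    proof -
      have "{l..y} = insert y {l..<y}" using I(1) by auto
      then show ?thesis using I(3) yJ by simp
    qed
    then have "y \<in> run_from I l" using I(1) by (simp add: run_from_def)
    then have yn: "y \<notin> Y \<union> {l..<y}" using dis by auto
    have e': "emitted u v (Y \<union> {l..<y}) (tick 3 h')" using I(4) by simp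
    have y54: "var (tick 3 h') 54 = y" by (simp add: y_def)
    have i': "inp (tick 3 h')" using i by (simp add: inp_def f)
    have e3: "ecost (Ld 30 (Rv 54)) + 1 = 3" by simp
    have ins1: "insert y (Y \<union> {l..<y}) = Y \<union> {l..<Suc y}" using I(1) by auto
    have sub': "{l..<Suc y} \<subseteq> insert 0 I" using sub by (simp add: atLeastLessThanSuc_atLeastAtMost)
    have c': "var h' 52 = card (Y \<union> {l..<y}) + 2" using emitted_count[OF I(4)] .
    have finY: "finite (Y \<union> {l..<y})" using I(4) finite_subset unfolding emitted_def by blast
    have ly: "Suc y < wlim w" using y m_le limn by linarith
    show ?case unfolding e3
    proof (rule vc_sound, rule vc_call[OF emit_spec[OF e' y54 yn y(3,2) i']], goal_cases)
      case (1 h'')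
      note g = frm_var[OF 1(2)] frm_arr[OF 1(2)]
      have v: "var h'' 54 = y" using y54 by (simp add: g)
      have em: "emitted u v (Y \<union> {l..<Suc y}) h''" using 1(1) unfolding ins1 by blast
      have "var h'' 52 = Suc (var h' 52)" using emitted_count[OF em] c' yn finY unfolding ins1[symmetric] by simp
      moreover have "emitted u v (Y \<union> {l..<Suc y}) (upd 54 (Suc y) k h'')" for k using em by simp
      ultimately show ?case using 1(1) I y sub' ly by (simp add: v y_def[symmetric])
    qed
  next
    case (4 h')
    note f = frm_var[OF 4(2)] frm_arr[OF 4(2)]
    define y where "y = var h' 54"
    have I: "l \<le> y" "y \<le> m + 1" "{l..<y} \<subseteq> insert 0 I" "emitted u v (Y \<union> {l..<y}) h'" "clk h' + 60 * var h 52 \<le> clk h + 60 * var h' 52"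
      using 4(1) by (auto simp: y_def)
    have "arr h' 30 y = 0" using 4(4) by (simp add: y_def)
    then have yJ: "y \<notin> insert 0 I" using ins[OF I(2)] by (simp add: f)
    have "run_from I l = {l..<y}"
    proof
      show "run_from I l \<subseteq> {l..<y}"
      proof
        fix z assume z: "z \<in> run_from I l"
        then have "z < y" using yJ I(1) unfolding run_from_def by (metis (no_types, lifting) atLeastAtMost_iff mem_Collect_eq not_le subsetD)
        then show "z \<in> {l..<y}" using z by (simp add: run_from_def)
      qed
      show "{l..<y} \<subseteq> run_from I l"
      proof
        fix z assume z: "z \<in> {l..<y}"
        then have "{l..z} \<subseteq> {l..<y}" by auto
        then show "z \<in> run_from I l" using z I(3) by (auto simp: run_from_def)
      qed
    qed
    then show ?case using I by simp
  qed
qed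

lemma run_front:
  assumes "I \<subseteq> {1..m}"
  shows "\<exists>r. maximal_run (insert 0 I) 0 r"
proof -
  have b: "\<forall>z\<in>insert 0 I. z \<le> m" using assms by auto
  have "(0::nat) \<in> insert 0 I" by simp
  then obtain r where "0 \<le> r" "{0..r} \<subseteq> insert 0 I" "Suc r \<notin> insert 0 I" using run_right[OF _ b, of 0] by blast
  then show ?thesis unfolding maximal_run_def by blast
qed

text \<open>Going left from an updated \<open>y > r\<close> one meets a start, because a run back to
  0 would contain \<open>Suc r\<close>, which is not updated.\<close>

lemma starts_runs:
  assumes "maximal_run (insert 0 I) 0 r" "I \<subseteq> {1..m}"
  shows "(\<Union>l\<in>starts I. run_from I l) = {y \<in> I. r < y}"
proof
  show "(\<Union>l\<in>starts I. run_from I l) \<subseteq> {y \<in> I. r < y}"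
  proof
    fix y assume "y \<in> (\<Union>l\<in>starts I. run_from I l)"
    then obtain l where l: "l \<in> starts I" "l \<le> y" "{l..y} \<subseteq> insert 0 I" by (auto simp: run_from_def)
    have l1: "1 \<le> l" using l(1) assms(2) by (auto simp: starts_def)
    have "y \<in> {l..y}" using l(2) by simp
    then have "y \<in> insert 0 I" using l(3) by blast
    then have "y \<in> I" using l1 l(2) by auto
    moreover have "r < y"
    proof (rule ccontr)
      assume "\<not> r < y"
      then have "l - 1 \<in> {0..r}" using l(2) by auto
      then have "l - 1 \<in> insert 0 I" using assms(1) unfolding maximal_run_def by blast
      then show False using l(1) by (simp add: starts_def)
    qed
    ultimately show "y \<in> {y \<in> I. r < y}" by simp
  qed
  show "{y \<in> I. r < y} \<subseteq> (\<Union>l\<in>starts I. run_from I l)"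
  proof
    fix y assume y: "y \<in> {y \<in> I. r < y}"
    then have "y \<in> insert 0 I" by simp
    then obtain l where l: "l \<le> y" "{l..y} \<subseteq> insert 0 I" "l = 0 \<or> l - 1 \<notin> insert 0 I" using run_left[of y "insert 0 I"] by blast
    have "l \<noteq> 0"
    proof
      assume "l = 0"
      then have "Suc r \<in> {l..y}" using y by simp
      then have "Suc r \<in> insert 0 I" using l(2) by blast
      then show False using assms(1) by (simp add: maximal_run_def)
    qed
    moreover have "l \<in> {l..y}" using l(1) by simp
    then have "l \<in> insert 0 I" using l(2) by blast
    ultimately have "l \<in> starts I" using l(3) by (auto simp: starts_def)
    then show "y \<in> (\<Union>l\<in>starts I. run_from I l)" using l by (auto simp: run_from_def)
  qed
qed

lemma enum_inc_spec:
  assumes d: "dynamic m I h" and i: "inp h" and v: "var h 0 = u" "var h 1 = v" and r: "maximal_run (insert 0 I) 0 r"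
  shows "wp w enum_inc (\<lambda>h'. emitted u v {y \<in> I. r < y} h' \<and> var h' 53 = r \<and> clk h' \<le> clk h + 100 * var h' 52 + 100) h"
proof -
  have I: "I \<subseteq> {1..m}" using d by (simp add: dynamic_def)
  have en: "enumerates (var h 50) (arr h 33) (arr h 34) (starts I)" using d by (simp add: dynamic_def)
  have EN: "arr h 31 0 = r" using d r by (simp add: dynamic_def runs_ok_def)
  define Y where "Y = (\<lambda>a. \<Union>k<a. run_from I (arr h 33 k))"
  have st: "arr h 33 k \<in> starts I" if "k < var h 50" for k using en that by (auto simp: enumerates_def)
  have inj: "j = k" if "arr h 33 j = arr h 33 k" "j < var h 50" "k < var h 50" for j k
    using en that unfolding enumerates_def by metis
  have Yend: "Y (var h 50) = {y \<in> I. r < y}"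
  proof -
    have s: "starts I = arr h 33 ` {..<var h 50}" using en by (simp add: enumerates_def)
    have "Y (var h 50) = (\<Union>l\<in>starts I. run_from I l)" unfolding Y_def s by simp
    then show ?thesis using starts_runs[OF r I] by simp
  qed
  show ?thesis unfolding enum_inc_def
  proof (rule vc_sound, rule vc_call[OF q_start_spec[OF v]], goal_cases)
    case (1 h1)
    note f1 = frm_var[OF 1(2)] frm_arr[OF 1(2)]
    show ?case unfolding vc.simps
    proof (rule wp_for[where N = "var h 50" and I = "\<lambda>a h'. emitted u v (Y a) h' \<and> clk h' + 200 \<le> clk h + 30 + 100 * var h' 52"], goal_cases)
      case 8
      then show ?case using 1(1) using emitted_count[of u v "{}" h1] by (simp add: Y_def)
    next
      case (9 a h')
      note f = frm_var[OF 9(4)] frm_arr[OF 9(4)]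
      have S: "arr h' 33 = arr h 33" by (simp add: f f1)
      let ?h = "upd 54 (arr h 33 a) (Suc (Suc (Suc 0))) (tick 4 h')"
      have e: "emitted u v (Y a) ?h" using 9(2) by simp
      have d': "dynamic m I ?h" using d by (simp add: dynamic_def f f1)
      have i': "inp ?h" using i by (simp add: inp_def f f1)
      have dis: "Y a \<inter> run_from I (arr h 33 a) = {}"
      proof (rule ccontr)
        assume "Y a \<inter> run_from I (arr h 33 a) \<noteq> {}"
        then obtain y k where y: "k < a" "y \<in> run_from I (arr h 33 k)" "y \<in> run_from I (arr h 33 a)" by (auto simp: Y_def)
        then have "arr h 33 k = arr h 33 a"
          using starts_disjoint[OF st[of k] st[of a], of y] 9(1) by (auto simp: run_from_def)
        then show False using inj[of k a] y(1) 9(1) by simp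
      qed
      have ne: "arr h 33 a \<in> run_from I (arr h 33 a)" using st[OF 9(1)] by (auto simp: run_from_def starts_def)
      have YS: "Y a \<union> run_from I (arr h 33 a) = Y (Suc a)" by (auto simp: Y_def less_Suc_eq)
      have v54: "var ?h 54 = arr h 33 a" by simp
      show ?case
      proof (rule vc_sound, simp add: S 9(3), rule wp_mono[OF emit_run_spec[OF e d' v54 st[OF 9(1)] i' dis]], goal_cases)
        case (1 h'')
        have em: "emitted u v (Y (Suc a)) h''" using 1 YS by simp
        have fin: "finite (Y (Suc a))" using em finite_subset unfolding emitted_def by blast
        \<comment> \<open>Each run contributes at least its start as a new edge, so the overhead per
          run is paid by the growth of register 52 as well.\<close>
        have "Y a \<subset> Y (Suc a)" using YS dis ne by blast
        then have "card (Y a) < card (Y (Suc a))" using fin by (rule psubset_card_mono[rotated])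
        then have "var h' 52 < var h'' 52" using emitted_count[OF em] emitted_count[OF 9(2)[THEN conjunct1]] by linarith
        then show ?case using 1 9(2) em by simp
      qed
    next
      case (10 h')
      note f = frm_var[OF 10(3)] frm_arr[OF 10(3)]
      show ?case using 10(1) EN Yend by (simp add: f f1)
    qed (use w in \<open>auto simp: f1\<close>)
  qed
qed

lemma enum_dec_spec:
  assumes d: "dynamic m I h" and i: "inp h" and v: "var h 0 = u" "var h 1 = v" "var h vM = m" and M: "M = var h 51"
  shows "wp w enum_dec (\<lambda>h'. emitted u v {y. 1 \<le> y \<and> y \<le> M \<and> y \<notin> I} h' \<and> var h' 53 = m - M \<and> clk h' \<le> clk h + 100 * var h' 52 + 100) h"
proof -
  have I: "I \<subseteq> {1..m}" using d by (simp add: dynamic_def)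
  have ins: "\<And>y. y \<le> m + 1 \<Longrightarrow> arr h 30 y = of_bool (y \<in> insert 0 I)" using d by (simp add: dynamic_def)
  have ro: "runs_ok (insert 0 I) (arr h 31) (arr h 32)" using d by (simp add: dynamic_def)
  have mx: "M \<in> insert 0 I" "\<And>y. y \<in> insert 0 I \<Longrightarrow> y \<le> M" using d M by (auto simp: dynamic_def)
  then have Mm: "M \<le> m" using I by auto
  obtain r where r: "maximal_run (insert 0 I) 0 r" using run_front[OF I] by blast
  then have EN: "arr h 31 0 = r" using ro by (simp add: runs_ok_def)
  have rJ: "{0..r} \<subseteq> insert 0 I" "Suc r \<notin> insert 0 I" using r by (auto simp: maximal_run_def)
  have rM: "r \<le> M"
  proof -
    have "r \<in> {0..r}" by simp
    then show ?thesis using rJ(1) mx(2) by blast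
  qed
  define Y where "Y = (\<lambda>y. {z. 1 \<le> z \<and> z < y \<and> z \<notin> I})"
  have lim: "m + 5 < wlim w" using m_le limn by linarith
  show ?thesis unfolding enum_dec_def
  proof (rule vc_sound, rule vc_call[OF q_start_spec[OF v(1,2)]], goal_cases)
    case (1 h1)
    note f1 = frm_var[OF 1(2)] frm_arr[OF 1(2)]
    have Y0: "Y (Suc r) = {}"
    proof -
      have "z \<in> I" if "1 \<le> z" "z \<le> r" for z
      proof -
        have "z \<in> {0..r}" using that by simp
        then have "z \<in> insert 0 I" using rJ(1) by blast
        then show ?thesis using that by simp
      qed
      then show ?thesis by (auto simp: Y_def)
    qed
    have EN1: "arr h1 31 0 = r" using EN by (simp add: f1)
    have r1: "Suc r < wlim w" using rM Mm lim by linarith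
    show ?case
    proof (simp add: EN1 r1 w del: vc.simps(6), rule vc_call_last[where R = "\<lambda>h'. emitted u v (Y (Suc M)) h' \<and> clk h' \<le> clk h + 90 + 100 * var h' 52"], goal_cases)
      case 1
      show ?case
      proof (rule wp_while[where m = "\<lambda>h'. m + 1 - var h' 54" and I = "\<lambda>h'. 1 \<le> var h' 54 \<and> var h' 54 \<le> M + 1 \<and> var h' 54 \<notin> insert 0 I \<and>
          emitted u v (Y (var h' 54)) h' \<and> clk h' + 100 \<le> clk h + 150 + 100 * var h' 52"], goal_cases)
        case 1
        then show ?case using \<open>clk h1 \<le> clk h + 20 \<and> emitted u v {} h1\<close> Y0 rM rJ(2) emitted_count[of u v "{}" h1] by simp
      next
        case (2 h')
        have "var h' 51 = M" using frm_var[OF 2(2), of 51] M by (simp add: f1)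
        then show ?case using Mm lim w by simp
      next
        case (3 h')
        note f = frm_var[OF 3(2)] frm_arr[OF 3(2)]
        define y where "y = var h' 54"
        have "var h' 51 = M" using M by (simp add: f f1)
        then have yM: "y \<le> M" using 3(4) by (simp add: y_def)
        have J: "1 \<le> y" "y \<notin> insert 0 I" "emitted u v (Y y) h'" "clk h' + 100 \<le> clk h + 150 + 100 * var h' 52"
          using 3(1) by (auto simp: y_def)
        have e6: "ecost (Rv 54 \<prec> Rv 51 + Nm 1) + 1 = 6" by simp
        have e': "emitted u v (Y y) (tick 6 h')" using J(3) by simp
        have y54: "var (tick 6 h') 54 = y" by (simp add: y_def)
        have i': "inp (tick 6 h')" using i by (simp add: inp_def f f1)
        have yn: "y \<notin> Y y" by (simp add: Y_def)
        have YS: "insert y (Y y) = Y (Suc y)" using J by (auto simp: Y_def)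
        have finY: "finite (Y y)" by (rule finite_subset[of _ "{..<y}"]) (auto simp: Y_def)
        have ym: "y \<le> m" using yM Mm by simp
        show ?case unfolding One_nat_def[symmetric] e6
        proof (rule vc_sound, rule vc_call[OF emit_spec[OF e' y54 yn J(1) ym i']], goal_cases)
          case (1 h'')
          note g = frm_var[OF 1(2)] frm_arr[OF 1(2)]
          have v2: "var h'' 54 = y" "arr h'' 30 = arr h 30" "arr h'' 31 = arr h 31" using y54 by (simp_all add: g f f1)
          have em: "emitted u v (Y (Suc y)) h''" "clk h'' \<le> clk h' + 36" using 1(1) unfolding YS by auto
          have c: "var h'' 52 = Suc (var h' 52)" using emitted_count[OF em(1)] emitted_count[OF J(3)] yn finY unfolding YS[symmetric] by simp
          have insy: "arr h 30 (Suc y) = of_bool (Suc y \<in> insert 0 I)" using ins[of "Suc y"] ym by simp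
          have ly: "Suc y < wlim w" using ym lim by linarith
          show ?case
          proof (cases "Suc y \<in> I")
            case False
            then show ?thesis using em c J yM ly insy w ym by (simp add: v2 y_def[symmetric])
          next
            case True
            have "\<forall>z\<in>insert 0 I. z \<le> m" using I by auto
            then obtain s where s: "Suc y \<le> s" "{Suc y..s} \<subseteq> insert 0 I" "Suc s \<notin> insert 0 I"
              using run_right[of "Suc y" "insert 0 I" m] True by blast
            then have "maximal_run (insert 0 I) (Suc y) s" using J(2) by (simp add: maximal_run_def)
            then have ENs: "arr h 31 (Suc y) = s" using ro by (simp add: runs_ok_def)
            have "s \<in> {Suc y..s}" using s(1) by simp
            then have sM: "s \<le> M" using s(2) mx(2) by blast
            have "Y (Suc s) = Y (Suc y)"
            proof -
              have "z \<in> I" if "Suc y \<le> z" "z \<le> s" for z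
              proof -
                have "z \<in> {Suc y..s}" using that by simp
                then have "z \<in> insert 0 I" using s(2) by blast
                then show ?thesis using that by simp
              qed
              then show ?thesis using s(1) by (auto simp: Y_def less_Suc_eq_le) (meson not_less_eq_eq)+
            qed
            moreover have "Suc s < wlim w" using sM Mm lim by linarith
            ultimately show ?thesis using em c J sM ly insy w ym s True by (simp add: v2 ENs y_def[symmetric])
          qed
        qed
      next
        case (4 h')
        note f = frm_var[OF 4(2)] frm_arr[OF 4(2)]
        have "var h' 51 = M" using M by (simp add: f f1)
        then have "var h' 54 = Suc M" using 4(1,4) by simp
        then show ?case using 4(1) by simp
      qed
    next
      case (2 h2)
      note f = frm_var[OF 2(2)] frm_arr[OF 2(2)]
      have "Y (Suc M) = {y. 1 \<le> y \<and> y \<le> M \<and> y \<notin> I}" by (auto simp: Y_def)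
      then show ?case using 2(1) v M Mm by (simp add: f f1)
    qed
  qed
qed

end

section \<open>Queries\<close>

text \<open>The levels are visited downwards and each hit overwrites register 58, so the least level
  wins; without a hit the value \<open>cap\<close> in register 47 remains.\<close>

definition est_prog :: prog where
  "est_prog = compile (58 ::= Rv 47 ;; 59 ::= Rv vK + Nm 1 ;; For 60 59 (61 ::= Rv vK - Rv 60 ;;
     If (Ld bD (Rv 61 * Rv vNN + (Rv 56 * Rv vN + Rv 57)) \<prec> Rv 53 + Nm 1) (58 ::= Ld bL (Rv 61)) Nop))"

definition dj_init :: prog where
  "dj_init = compile (47 ::= (Rv vNN + Rv vNN) + Nm 2 ;;
     For 54 52 (Sto 42 (Rv 54) (Rv 47) ;; Sto 43 (Rv 54) (Nm 0)) ;; Sto 42 (Nm 0) (Nm 0))"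

text \<open>The running minimum starts at \<open>cap + 1\<close>, so that a node is selected even
  when all open nodes have the value \<open>cap\<close>.\<close>

definition dj_select :: prog where
  "dj_select = compile (62 ::= Nm 0 ;; 63 ::= Rv 47 + Nm 1 ;; For 54 52 (If (Ld 43 (Rv 54) \<doteq> Nm 0)
     (If (Ld 42 (Rv 54) \<prec> Rv 63) (62 ::= Rv 54 ;; 63 ::= Ld 42 (Rv 54)) Nop) Nop))"

definition dj_relax :: prog where
  "dj_relax = compile (56 ::= Ld 41 (Rv 62) ;; For 54 52 (57 ::= Ld 40 (Rv 54) ;; Call est_prog ;;
     55 ::= (Rv 63 + Rv 58) + Nm 1 ;; If (Rv 55 \<prec> Ld 42 (Rv 54)) (Sto 42 (Rv 54) (Rv 55)) Nop))"

definition dj_step :: prog where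
  "dj_step = compile (Call dj_select ;; Sto 43 (Rv 62) (Nm 1) ;; Call dj_relax)"

definition dj_prog :: prog where
  "dj_prog = compile (Call dj_init ;; For 48 52 (Call dj_step) ;;
     0 ::= (Ld 42 (Nm 1) \<prec> Rv 47) ;; 1 ::= Ld 42 (Nm 1) - Nm 1)"

lemma wr_dj [simp]:
  "wr est_prog = {58, 59, 60, 61}" "wb est_prog = {}" "wr dj_init = {47, 54}" "wb dj_init = {42, 43}"
  "wr dj_select = {54, 62, 63}" "wb dj_select = {}" "wr dj_relax = {54, 55, 56, 57, 58, 59, 60, 61}" "wb dj_relax = {42}"
  "wr dj_step = {54, 55, 56, 57, 58, 59, 60, 61, 62, 63}" "wb dj_step = {42, 43}"
  "wr dj_prog = {0, 1, 47, 48, 54, 55, 56, 57, 58, 59, 60, 61, 62, 63}" "wb dj_prog = {42, 43}"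
  by (auto simp: est_prog_def dj_init_def dj_select_def dj_relax_def dj_step_def dj_prog_def)

lemma near_relpow_trans: "near G i u x \<Longrightarrow> near G j x v \<Longrightarrow> near G (i + j) u v"
proof -
  assume "near G i u x" "near G j x v"
  then obtain i' j' where "i' \<le> i" "(u, x) \<in> G ^^ i'" "j' \<le> j" "(x, v) \<in> G ^^ j'" by (auto simp: near_def)
  then have "(u, v) \<in> G ^^ (i' + j')" "i' + j' \<le> i + j" by (auto simp: relpow_add)
  then show ?thesis unfolding near_def by blast
qed

lemma relpow_mono: "(G :: ('a \<times> 'a) set) \<subseteq> H \<Longrightarrow> G ^^ i \<subseteq> H ^^ i"
  by (induction i) auto

lemma near_subset: "near G i u v \<Longrightarrow> G \<subseteq> H \<Longrightarrow> near H i u v"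
  unfolding near_def using relpow_mono by blast

lemma near_rtrancl: "near G i u v \<Longrightarrow> (u, v) \<in> G\<^sup>*"
  unfolding near_def using relpow_imp_rtrancl by blast

text \<open>The bound is the number of edges instead of \<open>n - 1\<close>; as the lengths grow
  geometrically, this costs only a constant factor in the number of levels.\<close>

lemma rtrancl_near:
  assumes "(u, v) \<in> G\<^sup>*" "G \<subseteq> {..<n} \<times> {..<n}"
  shows "near G (n * n) u v"
proof -
  have fin: "finite G" using assms(2) finite_subset by blast
  have "card G \<le> card ({..<n} \<times> {..<n})" using assms(2) by (intro card_mono) auto
  then have "card G \<le> n * n" by simp
  moreover obtain i where "i \<le> card G" "(u, v) \<in> G ^^ i" using assms(1) rtrancl_finite_eq_relpow[OF fin] by auto
  ultimately show ?thesis unfolding near_def by (meson le_trans)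
qed

locale snapshot = predicted +
  fixes K thr :: nat
  assumes K: "n * n \<le> scale q K" and thr: "thr \<le> m" and limK: "(K + 3) * (n * n) + K + 10 < wlim w"
begin

text \<open>This plays infinity. A finite estimate is at most \<open>2 * (n * n)\<close>, because
  \<open>(q + 1) / q \<le> 2\<close>, and the loop edge of the target adds 1 to its node
  value.\<close>

definition cap :: nat where "cap = 2 * (n * n) + 2"

definition est :: "nat \<Rightarrow> nat \<Rightarrow> nat" where
  "est x y = (if \<exists>k\<le>K. near (E thr) (scale q k) x y
     then scale q (LEAST k. k \<le> K \<and> near (E thr) (scale q k) x y) else cap)"

lemma cap_lim: "2 * cap + 2 < wlim w"
  using limn unfolding cap_def by simp

lemma est_cap: "\<not> (\<exists>k\<le>K. near (E thr) (scale q k) x y) \<Longrightarrow> est x y = cap"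
  unfolding est_def by (rule if_not_P)

lemma est_near: "est x y < cap \<Longrightarrow> near (E thr) (est x y) x y"
proof -
  assume less: "est x y < cap"
  then have ex: "\<exists>k. k \<le> K \<and> near (E thr) (scale q k) x y" using est_cap[of x y] by auto
  then have "est x y = scale q (LEAST k. k \<le> K \<and> near (E thr) (scale q k) x y)" unfolding est_def by (rule if_P)
  then show ?thesis using LeastI_ex[OF ex] by simp
qed

lemma est_upper:
  assumes "near (E thr) l x y"
  shows "q * est x y \<le> (q + 1) * l"
proof (cases "\<exists>k\<le>K. near (E thr) (scale q k) x y")
  case True
  define k where "k = (LEAST k. k \<le> K \<and> near (E thr) (scale q k) x y)"
  have k: "k \<le> K" "near (E thr) (scale q k) x y" using True LeastI_ex[of "\<lambda>k. k \<le> K \<and> near (E thr) (scale q k) x y"] by (auto simp: k_def)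
  have e: "est x y = scale q k" using True by (simp add: est_def k_def)
  show ?thesis
  proof (cases k)
    case 0
    then show ?thesis by (simp add: e scale_small)
  next
    case (Suc j)
    have "\<not> near (E thr) (scale q j) x y" using not_less_Least[of j "\<lambda>k. k \<le> K \<and> near (E thr) (scale q k) x y"] Suc k by (auto simp: k_def)
    then have l: "scale q j < l" using assms near_mono by (meson not_le)
    show ?thesis
    proof (cases "j < q")
      case True
      then have "scale q k \<le> l" using l Suc by (simp add: scale_small)
      then have "q * scale q k \<le> q * l" by (rule mult_le_mono2)
      then show ?thesis unfolding e add_mult_distrib by linarith
    next
      case False
      then have "q * scale q (Suc j) \<le> (q + 1) * scale q j" using scale_step[OF q, of j] by simp
      also have "\<dots> \<le> (q + 1) * l" using l by (intro mult_le_mono2) simp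
      finally show ?thesis unfolding e Suc .
    qed
  qed
next
  case False
  have "near (E thr) (n * n) x y" using rtrancl_near[OF near_rtrancl[OF assms] E_subset] .
  then have "near (E thr) (scale q K) x y" using K near_mono by blast
  then show ?thesis using False by blast
qed

lemma est_le_cap: "est x y \<le> cap"
proof (cases "\<exists>k\<le>K. near (E thr) (scale q k) x y")
  case True
  then have "near (E thr) (n * n) x y" using rtrancl_near[OF near_rtrancl E_subset] by blast
  then have "q * est x y \<le> (q + 1) * (n * n)" by (rule est_upper)
  also have "\<dots> \<le> q * (2 * (n * n))" using q by simp
  finally have "est x y \<le> 2 * (n * n)" using q by simp
  then show ?thesis by (simp add: cap_def)
next
  case False
  then show ?thesis using est_cap[OF False] by simp
qed

definition stat5 :: "vstate \<Rightarrow> bool" where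
  "stat5 h \<longleftrightarrow> var h vN = n \<and> var h vNN = n * n \<and> var h vK = K \<and> var h 53 = thr \<and> scales_ok K h"

lemma est_prog_spec:
  assumes st: "stat5 h" "var h 47 = cap" and xy: "var h 56 = x" "var h 57 = y" "x < n" "y < n"
  shows "wp w est_prog (\<lambda>h'. var h' 58 = est x y \<and> clk h' \<le> clk h + 60 * (K + 2)) h"
proof -
  \<comment> \<open>\<open>P i\<close> singles out the hits among the first \<open>i\<close> levels
    visited, counted from \<open>K\<close> downwards; \<open>val i\<close> is then the content of
    register 58.\<close>
  define P where "P = (\<lambda>i k. K < k + i \<and> k \<le> K \<and> near (E thr) (scale q k) x y)"
  define val where "val = (\<lambda>i. if \<exists>k. P i k then scale q (LEAST k. P i k) else cap)"
  have lim: "K + 5 < wlim w" "thr + 2 < wlim w" using limn limK thr m_le by linarith+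
  have K1: "Suc K < wlim w" using lim by linarith
  have xyl: "x * n + y < n * n" using index_less xy by blast
  have L: "arr h bL k = scale q k" "dist_ok (arr h bD) k" if "k \<le> K" for k using st that by (auto simp: stat5_def scales_ok_def)
  have dk: "arr h bD (k * (n * n) + (x * n + y)) \<le> thr \<longleftrightarrow> near (E thr) (scale q k) x y" if "k \<le> K" for k
    using L(2)[OF that] xy thr unfolding dist_ok_def by blast
  have v: "var h vN = n" "var h vNN = n * n" "var h vK = K" "var h 53 = thr" using st by (auto simp: stat5_def)
  have step: "val (Suc i) = (if near (E thr) (scale q (K - i)) x y then scale q (K - i) else val i)" if "i \<le> K" for i
  proof (cases "near (E thr) (scale q (K - i)) x y")
    case True
    then have "P (Suc i) (K - i)" using that by (simp add: P_def)
    moreover have "(LEAST k. P (Suc i) k) = K - i"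
      by (rule Least_equality) (use calculation in \<open>auto simp: P_def\<close>)
    ultimately show ?thesis using True by (auto simp: val_def)
  next
    case False
    then have "P (Suc i) = P i" using that by (auto simp: P_def fun_eq_iff) (metis diff_add_inverse2 le_neq_implies_less less_Suc_eq_le not_less_eq add_Suc_right)
    then have "val (Suc i) = val i" unfolding val_def by (rule arg_cong[where f = "\<lambda>p. if \<exists>k. p k then scale q (LEAST k. p k) else cap"])
    then show ?thesis using False by simp
  qed
  show ?thesis unfolding est_prog_def
  proof (rule vc_sound, simp add: v K1 st w, rule wp_for_const[where N = "K + 1" and T = 40 and I = "\<lambda>i h'. var h' 58 = val i"], goal_cases)
      case 8
      have "\<not> (\<exists>k. P 0 k)" by (auto simp: P_def)
      then have "val 0 = cap" unfolding val_def by (rule if_not_P)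
      then show ?case using st by simp
    next
      case (9 i h')
      note f = frm_var[OF 9(4)] frm_arr[OF 9(4)]
      have i: "i \<le> K" using 9(1) by simp
      have vs: "var h' 46 = K" "var h' 5 = n * n" "var h' 56 = x" "var h' 57 = y" "var h' 2 = n" "var h' 53 = thr" "arr h' 2 = arr h 2" "arr h' 3 = arr h 3"
        using v xy by (simp_all add: f)
      have a: "(K - i) * (n * n) + (x * n + y) < (K + 1) * (n * n)" using index_less[of "K - i" "K + 1"] xyl by simp
      have "(K + 1) * (n * n) \<le> (K + 3) * (n * n)" by (intro mult_le_mono1) simp
      then have l: "(K - i) * (n * n) + (x * n + y) < wlim w" "(K - i) * (n * n) < wlim w" "x * n + y < wlim w" "x * n < wlim w" "Suc thr < wlim w"
        using a limK lim xyl by linarith+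
      show ?case
      proof (cases "near (E thr) (scale q (K - i)) x y")
        case True
        then have "arr h bD ((K - i) * (n * n) + (x * n + y)) < Suc thr" using dk[of "K - i"] by simp
        then show ?thesis by (intro vc_sound, simp add: vs 9(3) l i w) (use True step[OF i] L(1)[of "K - i"] in simp)
      next
        case False
        then have "\<not> arr h bD ((K - i) * (n * n) + (x * n + y)) < Suc thr" using dk[of "K - i"] by simp
        then show ?thesis by (intro vc_sound, simp add: vs 9(3) l i w) (use False step[OF i] 9(2) in simp)
      qed
    next
      case (10 h')
      have "P (K + 1) = (\<lambda>k. k \<le> K \<and> near (E thr) (scale q k) x y)" by (auto simp: P_def)
      then have "val (K + 1) = est x y" unfolding val_def est_def
        by (rule arg_cong[where f = "\<lambda>p. if \<exists>k. p k then scale q (LEAST k. p k) else cap"])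
      then show ?case using 10 by simp
    qed (use w lim in auto)
qed

end

section \<open>Dijkstra's algorithm on the listed edges\<close>

locale query = snapshot +
  fixes N u v :: nat and a b :: "nat \<Rightarrow> nat" and G :: "edge set"
  assumes N: "2 \<le> N" and ab: "\<And>e. e < N \<Longrightarrow> a e < n \<and> b e < n"
    and uv: "a 0 = u" "b 0 = u" "a 1 = v" "b 1 = v"
    and G: "G = E thr \<union> {(a e, b e) | e. 2 \<le> e \<and> e < N}"
begin

text \<open>For \<open>e \<noteq> 0\<close>, \<open>f e\<close> counts the edges of a path to the
  tail of \<open>e\<close> plus \<open>e\<close> itself, hence the \<open>- 1\<close>. The settled
  nodes in \<open>S\<close> are described by relaxed inequalities instead of optimality: once all
  nodes are settled, these already bound \<open>f\<close> from above along every path.\<close>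

definition dinv :: "nat set \<Rightarrow> (nat \<Rightarrow> nat) \<Rightarrow> bool" where
  "dinv S f \<longleftrightarrow> (\<forall>k\<in>S. \<forall>l<N. f l \<le> f k + est (b k) (a l) + 1) \<and>
     (\<forall>k\<in>S. \<forall>l<N. l \<notin> S \<longrightarrow> f k \<le> f l) \<and> f 0 = 0 \<and> (\<forall>e<N. f e \<le> cap) \<and> (\<forall>e<N. e \<noteq> 0 \<longrightarrow> 1 \<le> f e) \<and>
     (\<forall>e<N. f e < cap \<longrightarrow> e = 0 \<or> near G (f e - 1) u (a e))"

lemma dinvD:
  assumes "dinv S f"
  shows "k \<in> S \<Longrightarrow> l < N \<Longrightarrow> f l \<le> f k + est (b k) (a l) + 1"
    "k \<in> S \<Longrightarrow> l < N \<Longrightarrow> l \<notin> S \<Longrightarrow> f k \<le> f l" "f 0 = 0" "e < N \<Longrightarrow> f e \<le> cap" "e < N \<Longrightarrow> e \<noteq> 0 \<Longrightarrow> 1 \<le> f e"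
    "e < N \<Longrightarrow> f e < cap \<Longrightarrow> e \<noteq> 0 \<Longrightarrow> near G (f e - 1) u (a e)"
  using assms unfolding dinv_def by blast+

lemma G_subset: "G \<subseteq> {..<n} \<times> {..<n}"
  unfolding G using E_subset ab by auto

lemma dinv_near:
  assumes d: "dinv S f" and e: "e < N" "f e < cap"
  shows "near G (f e) u (b e)"
proof (cases "e = 0")
  case True
  then show ?thesis using uv near_refl by simp
next
  case False
  then have 1: "near G (f e - 1) u (a e)" "1 \<le> f e" using dinvD(5,6)[OF d] e by auto
  have "near G 1 (a e) (b e)"
  proof (cases "e = 1")
    case True
    then show ?thesis using uv near_refl by simp
  next
    case False
    then have "(a e, b e) \<in> G" using G e \<open>e \<noteq> 0\<close> by auto
    then show ?thesis unfolding near_def by (intro exI[of _ 1]) simp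
  qed
  from near_relpow_trans[OF 1(1) this] 1(2) show ?thesis by simp
qed

text \<open>A settled node has a value of at most \<open>f k\<close>, so relaxing through
  \<open>k\<close> cannot lower it, and the inequalities of the settled nodes stay valid.\<close>

lemma dinv_relax:
  assumes d: "dinv S f" and k: "k < N" "k \<notin> S" "\<And>l. l < N \<Longrightarrow> l \<notin> S \<Longrightarrow> f k \<le> f l" and S: "S \<subseteq> {..<N}"
    and f': "\<And>l. l < N \<Longrightarrow> f' l = min (f l) (f k + est (b k) (a l) + 1)"
  shows "dinv (insert k S) f'"
proof -
  note D = dinvD[OF d]
  have le: "f' l \<le> f l" if "l < N" for l using f'[OF that] by simp
  have same: "f' l = f l" if "l \<in> S" for l
  proof -
    have "f l \<le> f k" using D(2) that k by blast
    then show ?thesis using f'[of l] that S by auto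
  qed
  have kk: "f' k = f k" using f'[OF k(1)] by simp
  have ge: "f k \<le> f' l" if "l < N" "l \<notin> S" for l using f'[OF that(1)] k(3)[OF that] by simp
  have N0: "0 < N" using N by simp
  show ?thesis unfolding dinv_def
  proof (intro conjI ballI allI impI)
    fix j l assume j: "j \<in> insert k S" and l: "l < N"
    show "f' l \<le> f' j + est (b j) (a l) + 1"
    proof (cases "j = k")
      case True
      then show ?thesis using kk f'[OF l] by simp
    next
      case False
      then show ?thesis using j same[of j] D(1)[of j l] l le[OF l] by auto
    qed
    show "f' j \<le> f' l" if "l \<notin> insert k S"
    proof (cases "j = k")
      case True
      then show ?thesis using kk ge l that by simp
    next
      case False
      then have "f' j = f j" "f j \<le> f k" using j same D(2) k by auto
      then show ?thesis using ge[of l] l that by simp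
    qed
  next
    show "f' 0 = 0" using f'[OF N0] D(3) by simp
  next
    fix e assume e: "e < N"
    show "f' e \<le> cap" using le[OF e] D(4)[OF e] by simp
    show "1 \<le> f' e" if "e \<noteq> 0" using f'[OF e] D(5)[OF e that] by simp
    assume c: "f' e < cap"
    show "e = 0 \<or> near G (f' e - 1) u (a e)"
    proof (cases "f' e = f e")
      case True
      then show ?thesis using D(6)[OF e] c by auto
    next
      case False
      then have fe: "f' e = f k + est (b k) (a e) + 1" using f'[OF e] by (auto simp: min_def split: if_splits)
      then have "f k < cap" "est (b k) (a e) < cap" using c by auto
      then have "near G (f k) u (b k)" "near G (est (b k) (a e)) (b k) (a e)"
        using dinv_near[OF d k(1)] near_subset[OF est_near, of "b k" "a e" G] G by auto
      from near_relpow_trans[OF this] show ?thesis using fe by simp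
    qed
  qed
qed

text \<open>\<open>e\<close> is the last listed edge of the path and \<open>i\<close> the number of
  predicted edges after it. When the next listed edge is reached, \<open>est_upper\<close> converts
  these \<open>i\<close> steps into an estimate; the factor \<open>(q + 1) / q\<close> is thus
  applied once to the whole path and does not accumulate.\<close>

lemma dinv_path:
  assumes d: "dinv {..<N} f"
  shows "(u, y) \<in> G ^^ l \<Longrightarrow> \<exists>e<N. \<exists>i. near (E thr) i (b e) y \<and> q * f e + (q + 1) * i \<le> (q + 1) * l"
proof (induction l arbitrary: y)
  case 0
  then show ?case using uv N near_refl dinvD(3)[OF d] by (intro exI[of _ 0]) auto
next
  case (Suc l)
  then obtain x where x: "(u, x) \<in> G ^^ l" "(x, y) \<in> G" by auto
  then obtain e i where e: "e < N" "near (E thr) i (b e) x" "q * f e + (q + 1) * i \<le> (q + 1) * l" using Suc.IH by blast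
  from x(2) consider "(x, y) \<in> E thr" | e' where "2 \<le> e'" "e' < N" "x = a e'" "y = b e'" using G by auto
  then show ?case
  proof cases
    case 1
    then have "near (E thr) 1 x y" unfolding near_def by (intro exI[of _ 1]) simp
    then have "near (E thr) (i + 1) (b e) y" using near_relpow_trans e(2) by blast
    then show ?thesis using e by (intro exI[of _ e] conjI exI[of _ "i + 1"]) auto
  next
    case 2
    have "f e' \<le> f e + est (b e) x + 1" using dinvD(1)[OF d, of e e'] e 2 by auto
    then have "q * f e' \<le> q * (f e + est (b e) x + 1)" by (rule mult_le_mono2)
    also have "\<dots> = q * f e + q * est (b e) x + q" by (simp add: algebra_simps)
    also have "\<dots> \<le> q * f e + (q + 1) * i + q" using est_upper[OF e(2)] by simp
    also have "\<dots> \<le> (q + 1) * Suc l" using e(3) by simp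
    finally show ?thesis using 2 near_refl by (intro exI[of _ e'] conjI exI[of _ 0]) auto
  qed
qed

text \<open>The value of node 1 includes the loop at \<open>v\<close>, hence \<open>f 1 - 1\<close>.
  If \<open>v\<close> is reachable, at most \<open>n * n\<close> edges suffice and the estimate
  stays below \<open>cap\<close>.\<close>

lemma dinv_final:
  assumes d: "dinv {..<N} f"
  shows "f 1 < cap \<longleftrightarrow> (u, v) \<in> G\<^sup>*"
    and "(u, v) \<in> G\<^sup>* \<Longrightarrow> distance G u v \<le> f 1 - 1 \<and> q * (f 1 - 1) \<le> (q + 1) * distance G u v"
proof -
  have N1: "1 < N" using N by simp
  have up: "q * (f 1 - 1) \<le> (q + 1) * l" if l: "(u, v) \<in> G ^^ l" for l
  proof -
    obtain e i where e: "e < N" "near (E thr) i (b e) v" "q * f e + (q + 1) * i \<le> (q + 1) * l" using dinv_path[OF d l] by blast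
    have "f 1 - 1 \<le> f e + est (b e) v" using dinvD(1)[OF d, of e 1] e N1 uv by auto
    then have "q * (f 1 - 1) \<le> q * (f e + est (b e) v)" by (rule mult_le_mono2)
    also have "\<dots> \<le> q * f e + (q + 1) * i" using est_upper[OF e(2)] by (simp add: algebra_simps)
    finally show ?thesis using e(3) by simp
  qed
  have dist: "(u, v) \<in> G ^^ distance G u v" if "(u, v) \<in> G\<^sup>*"
    unfolding distance_def by (rule LeastI_ex) (use that rtrancl_imp_relpow in blast)
  have low: "near G (f 1 - 1) u v" if "f 1 < cap" using dinvD(6)[OF d N1 that] uv by simp
  show iff: "f 1 < cap \<longleftrightarrow> (u, v) \<in> G\<^sup>*"
  proof
    assume "f 1 < cap"
    then show "(u, v) \<in> G\<^sup>*" using low near_rtrancl by blast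
  next
    assume r: "(u, v) \<in> G\<^sup>*"
    then obtain l where l: "l \<le> n * n" "(u, v) \<in> G ^^ l" using rtrancl_near[OF r G_subset] by (auto simp: near_def)
    have "q * (f 1 - 1) \<le> (q + 1) * l" using up[OF l(2)] .
    also have "\<dots> \<le> (q + 1) * (n * n)" using l(1) by (rule mult_le_mono2)
    also have "\<dots> \<le> q * (2 * (n * n))" using q by simp
    finally have "f 1 - 1 \<le> 2 * (n * n)" using q by simp
    then show "f 1 < cap" by (simp add: cap_def)
  qed
  assume r: "(u, v) \<in> G\<^sup>*"
  obtain i where i: "i \<le> f 1 - 1" "(u, v) \<in> G ^^ i" using low iff r by (auto simp: near_def)
  have "distance G u v \<le> i" unfolding distance_def by (rule Least_le[of "\<lambda>k. (u, v) \<in> G ^^ k", OF i(2)])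
  then show "distance G u v \<le> f 1 - 1 \<and> q * (f 1 - 1) \<le> (q + 1) * distance G u v" using i(1) up[OF dist[OF r]] by simp
qed

definition done_set :: "vstate \<Rightarrow> nat set" where "done_set h = {e. e < N \<and> arr h 43 e \<noteq> 0}"

definition stat6 :: "vstate \<Rightarrow> bool" where
  "stat6 h \<longleftrightarrow> stat5 h \<and> var h 52 = N \<and> arr h 40 = a \<and> arr h 41 = b"

lemma dj_init_spec:
  assumes st: "stat6 h"
  shows "wp w dj_init (\<lambda>h'. clk h' \<le> clk h + 30 * N + 50 \<and> var h' 47 = cap \<and> done_set h' = {} \<and> dinv {} (arr h' 42)) h"
  unfolding dj_init_def
proof (rule vc_sound, subst vc.simps(4), subst vc.simps(2), intro conjI, goal_cases)
  case 2
  then show ?case using st limn w by (simp add: stat6_def stat5_def)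
next
  case 3
  have c: "ev w h ((Rv vNN + Rv vNN) + Nm 2) = cap" using st by (simp add: stat6_def stat5_def cap_def)
  have N52: "var h 52 = N" using st by (simp add: stat6_def)
  show ?case unfolding c
  proof (rule vc_call[where R = "\<lambda>h'. clk h' \<le> clk h + 30 * N + 40 \<and> (\<forall>e<N. arr h' 42 e = cap \<and> arr h' 43 e = 0)"], goal_cases)
    case 1
    show ?case
    proof (rule wp_for_const[where N = N and T = 15 and I = "\<lambda>i h'. \<forall>e<i. arr h' 42 e = cap \<and> arr h' 43 e = 0"], goal_cases)
      case (9 i h')
      note f = frm_var[OF 9(4)] frm_arr[OF 9(4)]
      show ?case by (rule vc_sound, simp add: f 9(3)) (use 9(2) in \<open>auto simp: less_Suc_eq\<close>)
    qed (use w N52 in auto)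
  next
    case (2 h')
    have "dinv {} ((arr h' 42)(0 := 0))" unfolding dinv_def using 2(1) by (auto simp: cap_def)
    moreover have "var h' 47 = cap" using frm_var[OF 2(2), of 47] by simp
    ultimately show ?case using 2(1) by (simp add: done_set_def)
  qed
qed simp

lemma dj_select_spec:
  assumes st: "stat6 h" "var h 47 = cap" and d: "dinv (done_set h) (arr h 42)" and ne: "\<exists>e<N. e \<notin> done_set h"
  shows "wp w dj_select (\<lambda>h'. clk h' \<le> clk h + 40 * N + 50 \<and> (\<exists>k. var h' 62 = k \<and> k < N \<and> k \<notin> done_set h \<and>
     var h' 63 = arr h 42 k \<and> (\<forall>l<N. l \<notin> done_set h \<longrightarrow> arr h 42 k \<le> arr h 42 l))) h"
proof -
  let ?f = "arr h 42"
  have l: "Suc cap < wlim w" using cap_lim by linarith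
  have N52: "var h 52 = N" using st by (simp add: stat6_def)
  show ?thesis unfolding dj_select_def
  proof (rule vc_sound, simp add: st l w, rule wp_for_const[where N = N and T = 25 and I = "\<lambda>i h'. var h' 63 \<le> cap + 1 \<and>
      (var h' 63 = cap + 1 \<and> (\<forall>e<i. e \<in> done_set h) \<or>
       var h' 62 < i \<and> var h' 62 \<notin> done_set h \<and> var h' 63 = ?f (var h' 62) \<and> (\<forall>e<i. e \<notin> done_set h \<longrightarrow> var h' 63 \<le> ?f e))"], goal_cases)
    case (9 i h')
    note f = frm_var[OF 9(4)] frm_arr[OF 9(4)]
    have A: "arr h' 42 = ?f" "arr h' 43 = arr h 43" by (simp_all add: f)
    have m: "i \<in> done_set h \<longleftrightarrow> arr h 43 i \<noteq> 0" using 9(1) by (simp add: done_set_def)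
    have c: "?f i \<le> cap" using dinvD(4)[OF d 9(1)] .
    note I = 9(2)
    consider "i \<in> done_set h" | "i \<notin> done_set h" "?f i < var h' 63" | "i \<notin> done_set h" "var h' 63 \<le> ?f i" by linarith
    then show ?case
    proof cases
      case 1
      then have "arr h 43 i \<noteq> 0" using m by simp
      then show ?thesis by (intro vc_sound, simp add: A 9(3) w) (use I 1 in \<open>auto simp: less_Suc_eq\<close>)
    next
      case 2
      then have "arr h 43 i = 0" using m by simp
      then show ?thesis using 2 by (intro vc_sound, simp add: A 9(3) w) (use I 2 c in \<open>auto simp: less_Suc_eq\<close>)
    next
      case 3
      then have "arr h 43 i = 0" "\<not> ?f i < var h' 63" using m by simp_all
      then show ?thesis by (intro vc_sound, simp add: A 9(3) w) (use I 3 c in \<open>auto simp: less_Suc_eq\<close>)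
    qed
  next
    case (10 h')
    then show ?case using ne by auto
  qed (use N52 w in auto)
qed

lemma dj_relax_spec:
  assumes st: "stat6 h" "var h 47 = cap" and k: "var h 62 = k" "k < N" "var h 63 = arr h 42 k" "arr h 42 k \<le> cap"
  shows "wp w dj_relax (\<lambda>h'. clk h' \<le> clk h + (60 * (K + 2) + 40) * N + 50 \<and>
     (\<forall>l<N. arr h' 42 l = min (arr h 42 l) (arr h 42 k + est (b k) (a l) + 1))) h"
proof -
  let ?f = "arr h 42"
  have N52: "var h 52 = N" "arr h 41 = b" "arr h 40 = a" using st by (auto simp: stat6_def)
  show ?thesis unfolding dj_relax_def
  proof (rule vc_sound, simp add: k N52, rule wp_for_const[where N = N and T = "60 * (K + 2) + 30" and I = "\<lambda>i h'.
      \<forall>l<N. arr h' 42 l = (if l < i then min (?f l) (?f k + est (b k) (a l) + 1) else ?f l)"], goal_cases)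
    case (9 i h')
    note f = frm_var[OF 9(4)] frm_arr[OF 9(4)]
    let ?h = "upd 57 (a i) (Suc (Suc (Suc 0))) (tick 4 h')"
    have vs: "var h' 63 = ?f k" "arr h' 40 = a" using k N52 by (simp_all add: f)
    have s5: "stat5 ?h" using st by (simp add: stat6_def stat5_def f scales_ok_def)
    have s: "var ?h 47 = cap" "var ?h 56 = b k" "var ?h 57 = a i" "b k < n" "a i < n"
      using st k ab 9(1) by (simp_all add: f)
    have fi: "arr h' 42 i = ?f i" using 9(1,2) by simp
    show ?case
    proof (rule vc_sound, simp add: vs 9(3), rule wp_frame[OF est_prog_spec[OF s5 s]], goal_cases)
      case (1 h'')
      note g = frm_var[OF 1(2)] frm_arr[OF 1(2)]
      have vg: "var h'' 63 = ?f k" "arr h'' 42 = arr h' 42" "var h'' 54 = i" using vs 9(3) by (simp_all add: g)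
      have l: "?f k + est (b k) (a i) < wlim w" "Suc (?f k + est (b k) (a i)) < wlim w" using k(4) est_le_cap[of "b k" "a i"] cap_lim by linarith+
      show ?case by (simp add: vg 1(1) l fi w) (use 1(1) 9(2) in \<open>auto simp: less_Suc_eq min_def\<close>)
    qed
  next
    case (10 h')
    then show ?case by (simp add: algebra_simps)
  qed (use N52 w in auto)
qed

lemma dj_step_spec:
  assumes st: "stat6 h" "var h 47 = cap" and d: "dinv (done_set h) (arr h 42)" and ne: "card (done_set h) < N"
  shows "wp w dj_step (\<lambda>h'. clk h' \<le> clk h + (60 * (K + 2) + 80) * N + 120 \<and> card (done_set h') = Suc (card (done_set h)) \<and>
     dinv (done_set h') (arr h' 42)) h"
proof -
  have sub: "done_set h \<subseteq> {..<N}" by (auto simp: done_set_def)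
  have "\<exists>e<N. e \<notin> done_set h"
  proof (rule ccontr)
    assume "\<not> ?thesis"
    then have "{..<N} \<subseteq> done_set h" by auto
    then have "N \<le> card (done_set h)" using card_mono[of "done_set h" "{..<N}"] finite_subset[OF sub] by simp
    with ne show False by simp
  qed
  note sel = dj_select_spec[OF st d this]
  show ?thesis unfolding dj_step_def
  proof (rule vc_sound, rule vc_call[OF sel], goal_cases)
    case (1 h1)
    note f1 = frm_var[OF 1(2)] frm_arr[OF 1(2)]
    obtain k where k: "var h1 62 = k" "k < N" "k \<notin> done_set h" "var h1 63 = arr h 42 k"
      "\<And>l. l < N \<Longrightarrow> l \<notin> done_set h \<Longrightarrow> arr h 42 k \<le> arr h 42 l" using 1(1) by blast
    let ?h = "wrt 43 k (Suc 0) (Suc (Suc (Suc 0))) h1"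
    have s6: "stat6 ?h" using st by (simp add: stat6_def stat5_def scales_ok_def f1)
    have s: "var ?h 47 = cap" "var ?h 62 = k" "k < N" "var ?h 63 = arr ?h 42 k" "arr ?h 42 k \<le> cap"
      using st k dinvD(4)[OF d k(2)] by (simp_all add: f1)
    have ds: "done_set h' = insert k (done_set h)" if "arr h' 43 = (arr h 43)(k := Suc 0)" for h'
      using k(2) that by (auto simp: done_set_def)
    show ?case
    proof (simp add: k(1) w, rule wp_frame[OF dj_relax_spec[OF s6 s]], goal_cases)
      case (1 h2)
      note f2 = frm_var[OF 1(2)] frm_arr[OF 1(2)]
      have d2: "done_set h2 = insert k (done_set h)" by (rule ds) (simp add: f2 f1)
      have r: "arr h2 42 l = min (arr h 42 l) (arr h 42 k + est (b k) (a l) + 1)" if "l < N" for l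
        using 1(1) that by (simp add: f1)
      have "dinv (insert k (done_set h)) (arr h2 42)" by (rule dinv_relax[OF d k(2,3,5) sub r])
      then show ?case using 1(1) \<open>clk h1 \<le> _ \<and> _\<close> k(3) finite_subset[OF sub] by (simp add: d2 algebra_simps)
    qed
  qed
qed

lemma dj_prog_spec:
  assumes st: "stat6 h"
  shows "wp w dj_prog (\<lambda>h'. clk h' \<le> clk h + 1000 * (K + 2) * (N * N) \<and> var h' 0 = of_bool ((u, v) \<in> G\<^sup>*) \<and>
     ((u, v) \<in> G\<^sup>* \<longrightarrow> distance G u v \<le> var h' 1 \<and> q * var h' 1 \<le> (q + 1) * distance G u v)) h"
  unfolding dj_prog_def
proof (rule vc_sound, rule vc_call[OF dj_init_spec[OF st]], goal_cases)
  case (1 h1)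
  note f1 = frm_var[OF 1(2)] frm_arr[OF 1(2)]
  have s1: "stat6 h1" using st by (simp add: stat6_def stat5_def scales_ok_def f1)
  have N52: "var h1 52 = N" using s1 by (simp add: stat6_def)
  show ?case unfolding vc.simps(4)
  proof (subst vc.simps(6), rule wp_for_const[where N = N and T = "(60 * (K + 2) + 80) * N + 124" and I = "\<lambda>i h'.
      card (done_set h') = i \<and> dinv (done_set h') (arr h' 42)"], goal_cases)
    case 8
    have "done_set (upd 48 0 2 h1) = done_set h1" by (simp add: done_set_def)
    then show ?case using 1(1) by simp
  next
    case (9 i h')
    note f = frm_var[OF 9(4)] frm_arr[OF 9(4)]
    have s': "stat6 (tick 4 h')" using s1 by (simp add: stat6_def stat5_def scales_ok_def f)
    have c: "var (tick 4 h') 47 = cap" using 1(1) by (simp add: f)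
    have d: "dinv (done_set (tick 4 h')) (arr (tick 4 h') 42)" "card (done_set (tick 4 h')) < N" using 9(1,2) by (simp_all add: done_set_def)
    show ?case unfolding compile.simps
      by (rule wp_mono[OF dj_step_spec[OF s' c d]]) (use 9(2) in \<open>auto simp: done_set_def\<close>)
  next
    case (10 h')
    note f = frm_var[OF 10(3)] frm_arr[OF 10(3)]
    have c: "var h' 47 = cap" using 1(1) by (simp add: f)
    have "done_set h' = {..<N}"
      by (rule card_subset_eq) (use 10(1) in \<open>auto simp: done_set_def\<close>)
    then have d: "dinv {..<N} (arr h' 42)" using 10(1) by simp
    have N1: "1 < N" using N by simp
    have ge: "Suc 0 \<le> arr h' 42 (Suc 0)" using dinvD(5)[OF d N1] by simp
    note fin = dinv_final[OF d]
    have ck: "clk h' + 100 \<le> clk h + 1000 * (K + 2) * (N * N)"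
    proof -
      have 1: "clk h' \<le> clk h1 + 2 + N * ((60 * (K + 2) + 80) * N + 124 + 4)" using 10(5) .
      have 2: "N * ((60 * (K + 2) + 80) * N + 124 + 4) = 60 * ((K + 2) * (N * N)) + 80 * (N * N) + 128 * N" by (simp add: algebra_simps)
      have 3: "1000 * (K + 2) * (N * N) = 1000 * ((K + 2) * (N * N))" by (rule mult.assoc)
      have 4: "2 * (N * N) \<le> (K + 2) * (N * N)" by (intro mult_le_mono1) simp
      have 5: "2 * N \<le> N * N" using N by simp
      show ?thesis unfolding 3 using 1 2 4 5 1(1) N \<open>clk h1 \<le> _ \<and> _\<close> by linarith
    qed
    show ?case using ck ge fin w by (simp add: c)
  qed (use N52 w in auto)
qed

end

section \<open>Matrix multiplication programs as subroutines\<close>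

abbreviation (input) "count_step \<equiv> Bin Add vCnt vCnt 127"

text \<open>
  The program runs on registers and banks shifted by 128 and counts its steps in register
  \<open>vCnt\<close>; register 127 holds the constant 1.
\<close>

fun embed :: "prog \<Rightarrow> prog" where
  "embed Skip = Seq Skip count_step"
| "embed (Imm r k) = Seq (Imm (r + 128) k) count_step"
| "embed (Move r x) = Seq (Move (r + 128) (x + 128)) count_step"
| "embed (Bin f r x y) = Seq (Bin f (r + 128) (x + 128) (y + 128)) count_step"
| "embed (Load r b i) = Seq (Load (r + 128) (b + 128) (i + 128)) count_step"
| "embed (Store b i x) = Seq (Store (b + 128) (i + 128) (x + 128)) count_step"
| "embed (Seq p q) = Seq (embed p) (embed q)"
| "embed (Cond x p q) = Seq count_step (Cond (x + 128) (embed p) (embed q))"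
| "embed (Loop x p) = Seq (Loop (x + 128) (Seq (embed p) count_step)) count_step"

definition inner :: "state \<Rightarrow> state" where
  "inner s = \<lparr>reg = \<lambda>r. reg s (r + 128), mem = \<lambda>b. mem s (b + 128)\<rparr>"

definition counted :: "nat \<Rightarrow> state \<Rightarrow> nat \<Rightarrow> state \<Rightarrow> bool" where
  "counted w s t s' \<longleftrightarrow> reg s' 127 = 1 \<and> reg s' vCnt = (reg s vCnt + t) mod 2 ^ w \<and>
     (\<forall>r<128. r \<noteq> vCnt \<longrightarrow> reg s' r = reg s r) \<and> (\<forall>b<128. mem s' b = mem s b)"

lemma counted_trans: "counted w s t s' \<Longrightarrow> counted w s' t' s'' \<Longrightarrow> counted w s (t + t') s''"
  by (auto simp: counted_def mod_add_left_eq add.assoc[symmetric])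

lemma count_step:
  assumes "reg s 127 = 1"
  shows "\<exists>s'. exec w count_step s 1 s' \<and> inner s' = inner s \<and> counted w s 1 s'"
proof -
  let ?s = "set_reg vCnt (binop_val w Add (reg s vCnt) (reg s 127)) s"
  have "exec w count_step s 1 ?s" by (rule exec.intros)
  moreover have "inner ?s = inner s" by (simp add: inner_def)
  moreover have "counted w s 1 ?s" using assms by (simp add: counted_def)
  ultimately show ?thesis by blast
qed

lemma embed_basic:
  assumes "exec w p s 1 s1" "inner s1 = s'" "reg s 127 = 1"
    "\<forall>r<128. reg s1 r = reg s r" "\<forall>b<128. mem s1 b = mem s b"
  shows "\<exists>s2. exec w (Seq p count_step) s (2 * 1) s2 \<and> inner s2 = s' \<and> counted w s 1 s2"
proof -
  obtain s2 where s2: "exec w count_step s1 1 s2" "inner s2 = inner s1" "counted w s1 1 s2"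
    using count_step[of s1 w] assms by auto
  have "exec w (Seq p count_step) s (1 + 1) s2" by (rule exec.intros(7)[OF assms(1) s2(1)])
  moreover have "counted w s 1 s2" using s2(3) assms(4,5) by (simp add: counted_def)
  ultimately show ?thesis using s2(2) assms(2) by (intro exI[of _ s2]) (simp add: numeral_2_eq_2)
qed

text \<open>Every step is accompanied by exactly one counting step, which gives
  \<open>2 * t\<close>. A conditional is counted in front, a successful loop test after its body and
  the failing one behind the loop.\<close>

lemma embed_exec:
  "exec w p s t s' \<Longrightarrow> inner \<sigma> = s \<Longrightarrow> reg \<sigma> 127 = 1 \<Longrightarrow>
   \<exists>\<sigma>'. exec w (embed p) \<sigma> (2 * t) \<sigma>' \<and> inner \<sigma>' = s' \<and> counted w \<sigma> t \<sigma>'"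
proof (induction arbitrary: \<sigma> rule: exec.induct)
  case (1 s)
  show ?case unfolding embed.simps by (rule embed_basic[OF exec.intros(1)]) (use 1 in simp_all)
next
  case (2 r k s)
  show ?case unfolding embed.simps
    by (rule embed_basic[OF exec.intros(2)]) (use 2 in \<open>auto simp: inner_def set_reg_def fun_eq_iff\<close>)
next
  case (3 r x s)
  show ?case unfolding embed.simps
    by (rule embed_basic[OF exec.intros(3)]) (use 3 in \<open>auto simp: inner_def set_reg_def fun_eq_iff\<close>)
next
  case (4 f r x y s)
  show ?case unfolding embed.simps
    by (rule embed_basic[OF exec.intros(4)]) (use 4 in \<open>auto simp: inner_def set_reg_def fun_eq_iff simp del: binop_val.simps\<close>)
next
  case (5 r b i s)
  show ?case unfolding embed.simps
    by (rule embed_basic[OF exec.intros(5)]) (use 5 in \<open>auto simp: inner_def set_reg_def fun_eq_iff\<close>)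
next
  case (6 b i x s)
  show ?case unfolding embed.simps
    by (rule embed_basic[OF exec.intros(6)]) (use 6 in \<open>auto simp: inner_def set_mem_def fun_eq_iff\<close>)
next
  case (7 p s t s' q t' s'')
  obtain \<sigma>1 where 1: "exec w (embed p) \<sigma> (2 * t) \<sigma>1" "inner \<sigma>1 = s'" "counted w \<sigma> t \<sigma>1" using 7 by blast
  then have "reg \<sigma>1 127 = 1" by (simp add: counted_def)
  then obtain \<sigma>2 where 2: "exec w (embed q) \<sigma>1 (2 * t') \<sigma>2" "inner \<sigma>2 = s''" "counted w \<sigma>1 t' \<sigma>2" using 7 1 by blast
  have "exec w (embed (Seq p q)) \<sigma> (2 * t + 2 * t') \<sigma>2" unfolding embed.simps by (rule exec.intros(7)[OF 1(1) 2(1)])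
  then show ?case using counted_trans[OF 1(3) 2(3)] 2(2) by (intro exI[of _ \<sigma>2]) (simp add: algebra_simps)
next
  case (8 s x p t s' q)
  obtain \<sigma>1 where 1: "exec w count_step \<sigma> 1 \<sigma>1" "inner \<sigma>1 = s" "counted w \<sigma> 1 \<sigma>1" using count_step 8 by blast
  then have "reg \<sigma>1 127 = 1" by (simp add: counted_def)
  then obtain \<sigma>2 where 2: "exec w (embed p) \<sigma>1 (2 * t) \<sigma>2" "inner \<sigma>2 = s'" "counted w \<sigma>1 t \<sigma>2" using 8 1 by blast
  have "reg \<sigma>1 (x + 128) \<noteq> 0" using 8(1) 1(2) by (auto simp: inner_def)
  then have "exec w (embed (Cond x p q)) \<sigma> (1 + (2 * t + 1)) \<sigma>2" unfolding embed.simps by (intro exec.intros(7)[OF 1(1)] exec.intros(8) 2(1))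
  moreover have "counted w \<sigma> (t + 1) \<sigma>2" using counted_trans[OF 1(3) 2(3)] by (simp add: add.commute)
  ultimately show ?case using 2(2) by (intro exI[of _ \<sigma>2]) simp
next
  case (9 s x q t s' p)
  obtain \<sigma>1 where 1: "exec w count_step \<sigma> 1 \<sigma>1" "inner \<sigma>1 = s" "counted w \<sigma> 1 \<sigma>1" using count_step 9 by blast
  then have "reg \<sigma>1 127 = 1" by (simp add: counted_def)
  then obtain \<sigma>2 where 2: "exec w (embed q) \<sigma>1 (2 * t) \<sigma>2" "inner \<sigma>2 = s'" "counted w \<sigma>1 t \<sigma>2" using 9 1 by blast
  have "reg \<sigma>1 (x + 128) = 0" using 9(1) 1(2) by (auto simp: inner_def)
  then have "exec w (embed (Cond x p q)) \<sigma> (1 + (2 * t + 1)) \<sigma>2" unfolding embed.simps by (intro exec.intros(7)[OF 1(1)] exec.intros(9) 2(1))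
  moreover have "counted w \<sigma> (t + 1) \<sigma>2" using counted_trans[OF 1(3) 2(3)] by (simp add: add.commute)
  ultimately show ?case using 2(2) by (intro exI[of _ \<sigma>2]) simp
next
  case (10 s x p)
  have "reg \<sigma> (x + 128) = 0" using 10 by (auto simp: inner_def)
  then have "exec w (Loop (x + 128) (Seq (embed p) count_step)) \<sigma> 1 \<sigma>" by (rule exec.intros)
  then show ?case unfolding embed.simps using 10 by (intro embed_basic) auto
next
  case (11 s x p t s' t' s'')
  obtain \<sigma>1 where 1: "exec w (embed p) \<sigma> (2 * t) \<sigma>1" "inner \<sigma>1 = s'" "counted w \<sigma> t \<sigma>1" using 11 by blast
  then have "reg \<sigma>1 127 = 1" by (simp add: counted_def)
  then obtain \<sigma>2 where 2: "exec w count_step \<sigma>1 1 \<sigma>2" "inner \<sigma>2 = s'" "counted w \<sigma>1 1 \<sigma>2" using count_step 1(2) by blast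
  then have "reg \<sigma>2 127 = 1" by (simp add: counted_def)
  then obtain \<sigma>3 where 3: "exec w (embed (Loop x p)) \<sigma>2 (2 * t') \<sigma>3" "inner \<sigma>3 = s''" "counted w \<sigma>2 t' \<sigma>3" using 11 2 by blast
  \<comment> \<open>The embedded rest of the loop is split into the loop proper and the trailing
    count of its failing test, so that one more iteration can be put in front of the loop.\<close>
  obtain a c \<sigma>4 where 4: "exec w (Loop (x + 128) (Seq (embed p) count_step)) \<sigma>2 a \<sigma>4" "exec w count_step \<sigma>4 c \<sigma>3" "2 * t' = a + c"
    using 3(1) unfolding embed.simps by (auto elim: exec_SeqE)
  have "reg \<sigma> (x + 128) \<noteq> 0" using 11(1,6) by (auto simp: inner_def)
  then have "exec w (Loop (x + 128) (Seq (embed p) count_step)) \<sigma> ((2 * t + 1) + a + 1) \<sigma>4"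
    by (rule exec.intros(11)[OF _ exec.intros(7)[OF 1(1) 2(1)] 4(1)])
  then have "exec w (embed (Loop x p)) \<sigma> (((2 * t + 1) + a + 1) + c) \<sigma>3" unfolding embed.simps by (rule exec.intros(7)[OF _ 4(2)])
  moreover have "((2 * t + 1) + a + 1) + c = 2 * (t + t' + 1)" using 4(3) by simp
  moreover have "counted w \<sigma> (t + t' + 1) \<sigma>3" using counted_trans[OF counted_trans[OF 1(3) 2(3)] 3(3)] by (simp add: ac_simps)
  ultimately show ?case using 3(2) by (intro exI[of _ \<sigma>3]) metis
qed

lemma wr_embed: "wr (embed p) = {vCnt}" and wb_embed: "wb (embed p) \<subseteq> {128..}"
  by (induction p) auto

text \<open>Register 128 is register 0 of the embedded program, where it expects the order of the
  matrices.\<close>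

definition mm_prog :: "prog \<Rightarrow> prog" where
  "mm_prog P = Seq (Imm 127 1) (Seq (Move 128 vN2) (embed P))"

lemma mm_prog_multiplies:
  assumes w: "0 < w" "2 * n < 2 ^ w"
    and P: "\<And>A B s. word_state w s \<Longrightarrow> reg s 0 = 2 * n \<Longrightarrow> (\<forall>i<2 * n. \<forall>j<2 * n. \<bar>A i j\<bar> \<le> 1 \<and> \<bar>B i j\<bar> \<le> 1) \<Longrightarrow>
      stores_matrix w (2 * n) 0 A s \<Longrightarrow> stores_matrix w (2 * n) 1 B s \<Longrightarrow>
      \<exists>t s'. exec w P s t s' \<and> t \<le> T \<and> stores_matrix w (2 * n) 2 (\<lambda>i j. \<Sum>l<2 * n. A i l * B l j) s'"
  shows "multiplies w n T (mm_prog P)"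
  unfolding multiplies_def
proof (intro conjI allI impI)
  show "wr (mm_prog P) = {vCnt}" "wb (mm_prog P) \<subseteq> {128..}" using wr_embed wb_embed by (auto simp: mm_prog_def)
next
  fix h :: vstate assume h: "var h vN2 = 2 * n \<and> (\<forall>p<2 * n * (2 * n). arr h bX p \<le> 1 \<and> arr h bY p \<le> 1) \<and> var h vCnt + T < wlim w"
  have h1: "var h vN2 = 2 * n" "\<And>p. p < 2 * n * (2 * n) \<Longrightarrow> arr h bX p \<le> 1 \<and> arr h bY p \<le> 1" "var h vCnt + T < wlim w" using h by auto
  show "wp w (mm_prog P) (\<lambda>h'. var h vCnt \<le> var h' vCnt \<and> var h' vCnt \<le> var h vCnt + T \<and>
         clk h' + 2 * var h vCnt \<le> clk h + 2 * var h' vCnt + 10 \<and>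
         (\<forall>i<2 * n. \<forall>j<2 * n. arr h' bZ (i * (2 * n) + j) =
            (\<Sum>l<2 * n. arr h bX (i * (2 * n) + l) * arr h bY (l * (2 * n) + j)))) h"
    unfolding wp_def
  proof (intro allI impI)
    fix s assume s: "repr w h s"
    define s1 where "s1 = set_reg 127 (1 mod 2 ^ w) s"
    define s2 where "s2 = set_reg 128 (reg s1 vN2) s1"
    have one: "(1::nat) mod 2 ^ w = 1" using w(1) one_less_wlim[of w] by (simp add: wlim_def)
    have e: "exec w (Imm 127 1) s 1 s1" "exec w (Move 128 vN2) s1 1 s2" unfolding s1_def s2_def by (rule exec.intros)+
    have ws: "word_state w s2" using exec_word_state e s by (meson repr_def)
    define N where "N = 2 * n"
    define A B where "A = (\<lambda>i j. int (arr h bX (i * N + j)))" and "B = (\<lambda>i j. int (arr h bY (i * N + j)))"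
    have ws': "word_state w (inner s2)" using ws by (simp add: word_state_def inner_def)
    have mem2: "mem s2 = arr h" using s by (simp add: s2_def s1_def repr_def)
    have r0: "reg (inner s2) 0 = 2 * n" using s h1(1) by (simp add: inner_def s2_def s1_def repr_def)
    have small: "arr h bX (i * N + j) \<le> 1" "arr h bY (i * N + j) \<le> 1" if "i < N" "j < N" for i j
      using h1(2) index_less[OF that] by (auto simp: N_def)
    have word: "nat (int x mod 2 ^ w) = x" if "x < 2 ^ w" for x
      using that by (metis (mono_tags, lifting) mod_less nat_int of_nat_numeral of_nat_power zmod_int)
    have sA: "stores_matrix w (2 * n) 0 A (inner s2)"
      unfolding stores_matrix_def A_def N_def inner_def using word repr_mem_less[OF s] s by (simp add: mem2 repr_def)
    have sB: "stores_matrix w (2 * n) 1 B (inner s2)"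
      unfolding stores_matrix_def B_def N_def inner_def using word repr_mem_less[OF s] s by (simp add: mem2 repr_def)
    have bd: "\<forall>i<2 * n. \<forall>j<2 * n. \<bar>A i j\<bar> \<le> 1 \<and> \<bar>B i j\<bar> \<le> 1" 
    proof (intro allI impI)
      fix i j assume "i < 2 * n" "j < 2 * n"
      then show "\<bar>A i j\<bar> \<le> 1 \<and> \<bar>B i j\<bar> \<le> 1" using small[of i j] by (simp add: A_def B_def N_def)
    qed
    obtain t s' where P': "exec w P (inner s2) t s'" "t \<le> T" "stores_matrix w (2 * n) 2 (\<lambda>i j. \<Sum>l<2 * n. A i l * B l j) s'"
      using P[OF ws' r0 bd sA sB] by blast
    have r127: "reg s2 127 = 1" using one by (simp add: s2_def s1_def)
    obtain s3 where s3: "exec w (embed P) s2 (2 * t) s3" "inner s3 = s'" "counted w s2 t s3"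
      using embed_exec[OF P'(1) refl r127] by blast
    have ex: "exec w (mm_prog P) s (1 + (1 + 2 * t)) s3" unfolding mm_prog_def by (rule exec.intros(7)[OF e(1) exec.intros(7)[OF e(2) s3(1)]])
    have cnt: "reg s3 vCnt = var h vCnt + t"
    proof -
      have "reg s2 vCnt = var h vCnt" using s by (simp add: s2_def s1_def repr_def)
      moreover have "var h vCnt + t < 2 ^ w" using h1(3) P'(2) by (simp add: wlim_def)
      ultimately show ?thesis using s3(3) by (simp add: counted_def)
    qed
    let ?h = "\<lparr>var = reg s3, arr = mem s3, clk = clk h + (1 + (1 + 2 * t))\<rparr>"
    have ws3: "word_state w s3" using exec_word_state[OF ex] s by (simp add: repr_def)
    have rep: "repr w ?h s3" using ws3 by (simp add: repr_def)
    have res: "mem s3 bZ (i * (2 * n) + j) = (\<Sum>l<2 * n. arr h bX (i * (2 * n) + l) * arr h bY (l * (2 * n) + j))" if ij: "i < 2 * n" "j < 2 * n" for i j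
    proof -
      let ?S = "\<Sum>l<2 * n. arr h bX (i * (2 * n) + l) * arr h bY (l * (2 * n) + j)"
      have "?S \<le> (\<Sum>l<2 * n. 1)"
      proof (rule sum_mono)
        fix l assume "l \<in> {..<2 * n}"
        then show "arr h bX (i * (2 * n) + l) * arr h bY (l * (2 * n) + j) \<le> 1"
          using small(1)[of i l] small(2)[of l j] ij mult_le_mono[of "arr h bX (i * (2 * n) + l)" 1 "arr h bY (l * (2 * n) + j)" 1] by (simp add: N_def)
      qed
      \<comment> \<open>A sum of \<open>2 * n\<close> bits fits into a word, so the stored residue
        is the number itself.\<close>
      then have S: "?S < 2 ^ w" using w(2) by simp
      have "mem s3 bZ (i * (2 * n) + j) = mem s' 2 (i * (2 * n) + j)" using s3(2) by (auto simp: inner_def)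
      also have "\<dots> = nat ((\<Sum>l<2 * n. A i l * B l j) mod 2 ^ w)" using P'(3) ij by (simp add: stores_matrix_def)
      also have "(\<Sum>l<2 * n. A i l * B l j) = int ?S" by (simp add: A_def B_def N_def)
      finally show ?thesis using word[OF S] by simp
    qed
    show "\<exists>t s' h'. exec w (mm_prog P) s t s' \<and> repr w h' s' \<and> clk h' = clk h + t \<and>
       var h vCnt \<le> var h' vCnt \<and> var h' vCnt \<le> var h vCnt + T \<and>
         clk h' + 2 * var h vCnt \<le> clk h + 2 * var h' vCnt + 10 \<and>
         (\<forall>i<2 * n. \<forall>j<2 * n. arr h' bZ (i * (2 * n) + j) =
            (\<Sum>l<2 * n. arr h bX (i * (2 * n) + l) * arr h bY (l * (2 * n) + j)))"
      by (intro exI[of _ "1 + (1 + 2 * t)"] exI[of _ s3] exI[of _ ?h]) (use ex rep cnt P'(2) res in auto)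
  qed
qed

section \<open>A lower bound for the time of matrix multiplication\<close>

lemma exec_changes:
  "exec w p s t s' \<Longrightarrow> finite {x. mem s (fst x) (snd x) \<noteq> mem s' (fst x) (snd x)} \<and>
     card {x. mem s (fst x) (snd x) \<noteq> mem s' (fst x) (snd x)} \<le> t"
proof (induction rule: exec.induct)
  case (6 b i x s)
  have sub: "{y. mem s (fst y) (snd y) \<noteq> mem (set_mem b (reg s i) (reg s x) s) (fst y) (snd y)} \<subseteq> {(b, reg s i)}"
    by (auto simp: set_mem_def split: if_splits)
  then show ?case using finite_subset[OF sub] card_mono[OF _ sub] by simp
next
  case (7 p s t s' q t' s'')
  have sub: "{x. mem s (fst x) (snd x) \<noteq> mem s'' (fst x) (snd x)} \<subseteq>
      {x. mem s (fst x) (snd x) \<noteq> mem s' (fst x) (snd x)} \<union> {x. mem s' (fst x) (snd x) \<noteq> mem s'' (fst x) (snd x)}" by auto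
  then show ?case using 7 finite_subset[OF sub] card_mono[OF _ sub] card_Un_le by (meson add_mono finite_UnI le_trans)
next
  case (11 s x p t s' t' s'')
  have sub: "{x. mem s (fst x) (snd x) \<noteq> mem s'' (fst x) (snd x)} \<subseteq>
      {x. mem s (fst x) (snd x) \<noteq> mem s' (fst x) (snd x)} \<union> {x. mem s' (fst x) (snd x) \<noteq> mem s'' (fst x) (snd x)}" by auto
  then show ?case using 11 finite_subset[OF sub] card_mono[OF _ sub] card_Un_le by (meson add_mono finite_UnI le_trans trans_le_add1)
qed auto

text \<open>This converts the constant \<open>\<kappa>\<close> of the word size into room for
  polynomials in \<open>n\<close>.\<close>

lemma word_size_power:
  assumes "word_size_ok \<kappa> n w" "real k \<le> \<kappa>" "1 \<le> n"
  shows "(2 * n) ^ k \<le> wlim w"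
proof -
  have "real k * (1 + log 2 (real n)) \<le> \<kappa> * (1 + log 2 (real n))" using assms by (intro mult_right_mono) auto
  then have a: "real k * (1 + log 2 (real n)) \<le> real w" using assms(1) by (simp add: word_size_ok_def)
  have "log 2 (real ((2 * n) ^ k)) = real k * (1 + log 2 (real n))"
    using assms(3) by (simp add: log_nat_power log_mult algebra_simps)
  then have "real ((2 * n) ^ k) \<le> 2 powr real w" using a assms(3) by (subst log_le_iff[symmetric]) auto
  also have "\<dots> = real (2 ^ w)" by (simp add: powr_realpow)
  finally show ?thesis unfolding wlim_def by (simp only: of_nat_le_iff)
qed

text \<open>The output bank is arbitrary at the start. Filled with ones, it must be overwritten in
  \<open>n * n\<close> cells when both factors are zero. The bound lets terms of order
  \<open>n * n\<close> be absorbed by the assumed multiplication time.\<close>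

lemma matmul_time_lower:
  assumes "\<forall>w. word_size_ok \<kappa> n w \<longrightarrow>
        (\<forall>A B s. word_state w s \<and> reg s 0 = n
            \<and> (\<forall>i<n. \<forall>j<n. \<bar>A i j\<bar> \<le> int n ^ k \<and> \<bar>B i j\<bar> \<le> int n ^ k)
            \<and> stores_matrix w n 0 A s \<and> stores_matrix w n 1 B s \<longrightarrow>
          (\<exists>t s'. exec w P s t s' \<and> real t \<le> U
            \<and> stores_matrix w n 2 (\<lambda>i j. \<Sum>l<n. A i l * B l j) s'))"
    and n: "1 \<le> n"
  shows "real (n * n) \<le> U"
proof -
  \<comment> \<open>One admissible word size is enough; the summand \<open>n\<close> makes
    \<open>n\<close> itself a word.\<close>
  define w where "w = nat \<lceil>\<kappa> * (1 + log 2 (real n))\<rceil> + n + 1"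
  have ok: "word_size_ok \<kappa> n w" unfolding word_size_ok_def w_def by linarith
  have nw: "n < 2 ^ w" "1 < (2::nat) ^ w" using less_exp[of w] unfolding w_def by (auto intro: less_trans[of _ "nat \<lceil>\<kappa> * (1 + log 2 (real n))\<rceil> + n + 1"])
  let ?s = "\<lparr>reg = \<lambda>r. if r = 0 then n else 0, mem = \<lambda>b i. if b = 2 then 1 else 0\<rparr>"
  have ws: "word_state w ?s" using nw by (simp add: word_state_def)
  have st: "stores_matrix w n 0 (\<lambda>_ _. 0) ?s" "stores_matrix w n 1 (\<lambda>_ _. 0) ?s" by (simp_all add: stores_matrix_def)
  have bd: "\<forall>i<n. \<forall>j<n. \<bar>0::int\<bar> \<le> int n ^ k \<and> \<bar>0::int\<bar> \<le> int n ^ k" by simp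
  obtain t s' where e: "exec w P ?s t s'" "real t \<le> U" "stores_matrix w n 2 (\<lambda>i j. \<Sum>l<n. 0 * 0) s'"
    using assms(1)[rule_format, OF ok, of ?s "\<lambda>_ _. 0" "\<lambda>_ _. 0"] ws st bd by auto
  let ?D = "{x. mem ?s (fst x) (snd x) \<noteq> mem s' (fst x) (snd x)}"
  have sub: "Pair 2 ` {..<n * n} \<subseteq> ?D"
  proof
    fix x :: "nat \<times> nat" assume "x \<in> Pair 2 ` {..<n * n}"
    then obtain p where p: "x = (2, p)" "p < n * n" by auto
    have "p div n < n" "p mod n < n" using p(2) n by (auto simp: less_mult_imp_div_less)
    moreover have "\<And>i j. i < n \<Longrightarrow> j < n \<Longrightarrow> mem s' 2 (i * n + j) = 0" using e(3) by (simp add: stores_matrix_def)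
    ultimately have "mem s' 2 (p div n * n + p mod n) = 0" by blast
    then show "x \<in> ?D" using p(1) by simp
  qed
  have "n * n = card (Pair (2::nat) ` {..<n * n})" by (simp add: card_image inj_on_def)
  also have "\<dots> \<le> card ?D" by (rule card_mono[OF _ sub]) (use exec_changes[OF e(1)] in blast)
  also have "\<dots> \<le> t" using exec_changes[OF e(1)] by blast
  finally show ?thesis using e(2) by linarith
qed

section \<open>Cubic matrix multiplication\<close>

definition naive_dot :: prog where
  "naive_dot = compile (6 ::= Nm 0 ;; For 5 2 (6 ::= Raw Add (Rv 6)
     (Raw Mul (Ld 0 (Rv 8 * Rv 2 + Rv 5)) (Ld 1 (Rv 5 * Rv 2 + Rv 9)))))"

definition naive :: prog where
  "naive = compile (2 ::= Rv 0 ;; 7 ::= Rv 2 * Rv 2 ;; For 3 7 (8 ::= Rv 3 div Rv 2 ;; 9 ::= Rv 3 mod Rv 2 ;;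
     Call naive_dot ;; Sto 2 (Rv 3) (Rv 6)))"

lemma wr_naive_dot [simp]: "wr naive_dot = {5, 6}" "wb naive_dot = {}"
  by (auto simp: naive_dot_def)

lemma naive_dot_spec:
  assumes v: "var h 2 = n" "var h 8 = i" "var h 9 = j" "i < n" "j < n" and lim: "0 < w" "n * n < wlim w"
    and A: "\<forall>i<n. \<forall>j<n. arr h 0 (i * n + j) = nat (A i j mod 2 ^ w)" and B: "\<forall>i<n. \<forall>j<n. arr h 1 (i * n + j) = nat (B i j mod 2 ^ w)"
  shows "wp w naive_dot (\<lambda>h'. clk h' \<le> clk h + 40 * n + 20 \<and> var h' 6 = nat ((\<Sum>l<n. A i l * B l j) mod 2 ^ w)) h"
  unfolding naive_dot_def
proof (rule vc_sound, simp add: v, rule wp_for_const[where N = n and T = 30 and I = "\<lambda>k h'. var h' 6 = nat ((\<Sum>l<k. A i l * B l j) mod 2 ^ w)"], goal_cases)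
  case (9 k h')
  note f = frm_var[OF 9(4)] frm_arr[OF 9(4)]
  have vs: "var h' 2 = n" "var h' 8 = i" "var h' 9 = j" "arr h' 0 (i * n + k) = nat (A i k mod 2 ^ w)" "arr h' (Suc 0) (k * n + j) = nat (B k j mod 2 ^ w)"
    using v A B 9(1) by (simp_all add: f)
  have l: "i * n + k < wlim w" "k * n + j < wlim w" "i * n < wlim w" "k * n < wlim w"
    using index_less[OF v(4) 9(1)] index_less[OF 9(1) v(5)] lim(2) by linarith+
  have m: "(nat (S mod 2 ^ w) + (nat (a mod 2 ^ w) * nat (b mod 2 ^ w)) mod 2 ^ w) mod 2 ^ w = nat ((S + a * b) mod 2 ^ w)" for S a b :: int
  proof -
    have "int ((nat (S mod 2 ^ w) + (nat (a mod 2 ^ w) * nat (b mod 2 ^ w)) mod 2 ^ w) mod 2 ^ w) = (S + a * b) mod 2 ^ w"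
      by (simp add: zmod_int mod_simps) (metis mod_add_right_eq mod_mult_eq)
    then show ?thesis by (metis nat_int)
  qed
  show ?case by (rule vc_sound, simp add: vs 9(2,3) l) (simp add: m add.commute)
qed (use v lim in auto)

lemma naive_spec:
  assumes v: "var h 0 = n" and n: "0 < n" and lim: "0 < w" "n * n < wlim w"
    and A: "\<forall>i<n. \<forall>j<n. arr h 0 (i * n + j) = nat (A i j mod 2 ^ w)" and B: "\<forall>i<n. \<forall>j<n. arr h 1 (i * n + j) = nat (B i j mod 2 ^ w)"
  shows "wp w naive (\<lambda>h'. clk h' \<le> clk h + 200 * (n * n * n) \<and>
    (\<forall>i<n. \<forall>j<n. arr h' 2 (i * n + j) = nat ((\<Sum>l<n. A i l * B l j) mod 2 ^ w))) h"
  unfolding naive_def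
proof (rule vc_sound, simp add: v lim, rule wp_for_const[where N = "n * n" and T = "40 * n + 50" and
    I = "\<lambda>p h'. \<forall>i<n. \<forall>j<n. i * n + j < p \<longrightarrow> arr h' 2 (i * n + j) = nat ((\<Sum>l<n. A i l * B l j) mod 2 ^ w)"], goal_cases)
  case (9 p h')
  note f = frm_var[OF 9(4)] frm_arr[OF 9(4)]
  have d: "p div n < n" "p mod n < n" using 9(1) n by (simp_all add: less_mult_imp_div_less)
  have vs: "var h' 2 = n" "arr h' 0 = arr h 0" "arr h' 1 = arr h 1" using v by (simp_all add: f)
  show ?case
  proof (rule vc_sound, simp add: vs 9(3), rule wp_frame[OF naive_dot_spec[where n = n and i = "p div n" and j = "p mod n" and A = A and B = B]], goal_cases)
    case (10 h'')
    note g = frm_var[OF 10(2)] frm_arr[OF 10(2)]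
    have "var h'' 3 = p" "arr h'' 2 = arr h' 2" using 9(3) by (simp_all add: g)
    moreover have "i = p div n" "j = p mod n" if "i < n" "j < n" "i * n + j = p" for i j using that by auto
    ultimately show ?case using 10(1) 9(2) by (auto simp: less_Suc_eq)
  qed (use vs d lim A B in auto)
next
  case (10 h')
  have "n * n * (40 * n + 50 + 4) = 40 * (n * n * n) + 54 * (n * n)" by (simp add: algebra_simps)
  moreover have "n * n \<le> n * n * n" "1 \<le> n * n * n" using n by auto
  ultimately have "clk h' + 4 \<le> clk h + 200 * (n * n * n)" using 10(5) unfolding upd_simps by linarith
  then show ?case using 10(1) index_less by auto
qed (use v lim in auto)

text \<open>This makes the set under the infimum in \<open>matmul_exponent\<close> nonempty and
  allows every exponent above 3 to be replaced by 3.\<close>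

lemma matmul_time_3: "matmul_time 3"
  unfolding matmul_time_def
proof (intro allI)
  fix k
  show "\<exists>P \<kappa> C c. \<forall>n\<ge>1. \<forall>w. word_size_ok \<kappa> n w \<longrightarrow>
        (\<forall>A B s. word_state w s \<and> reg s 0 = n
            \<and> (\<forall>i<n. \<forall>j<n. \<bar>A i j\<bar> \<le> int n ^ k \<and> \<bar>B i j\<bar> \<le> int n ^ k)
            \<and> stores_matrix w n 0 A s \<and> stores_matrix w n 1 B s \<longrightarrow>
          (\<exists>t s'. exec w P s t s' \<and> real t \<le> soft_O C c n (real n powr 3)
            \<and> stores_matrix w n 2 (\<lambda>i j. \<Sum>l<n. A i l * B l j) s'))"
  proof (rule exI[of _ naive], rule exI[of _ 3], rule exI[of _ 200], rule exI[of _ 0], intro allI impI, goal_cases)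
    case (1 n w A B s)
    have "(2 * n) ^ 3 \<le> wlim w" using word_size_power[OF 1(2), of 3] 1(1) by simp
    moreover have "n * n < (2 * n) ^ 3"
    proof -
      have "n * n * 1 \<le> n * n * n" using 1(1) by (intro mult_le_mono2) simp
      then show ?thesis using 1(1) by (simp add: power3_eq_cube)
    qed
    ultimately have lim: "n * n < wlim w" by linarith
    then have w: "0 < w" using 1(1) by (cases w) (auto simp: wlim_def)
    let ?h = "\<lparr>var = reg s, arr = mem s, clk = 0\<rparr>"
    have rep: "repr w ?h s" using 1(3) by (simp add: repr_def)
    have "wp w naive (\<lambda>h'. clk h' \<le> clk ?h + 200 * (n * n * n) \<and>
      (\<forall>i<n. \<forall>j<n. arr h' 2 (i * n + j) = nat ((\<Sum>l<n. A i l * B l j) mod 2 ^ w))) ?h"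
      by (rule naive_spec) (use 1 w lim in \<open>auto simp: stores_matrix_def\<close>)
    then obtain t s' h' where e: "exec w naive s t s'" "repr w h' s'" "clk h' = clk ?h + t" "clk h' \<le> clk ?h + 200 * (n * n * n)"
      "\<forall>i<n. \<forall>j<n. arr h' 2 (i * n + j) = nat ((\<Sum>l<n. A i l * B l j) mod 2 ^ w)" using rep unfolding wp_def by blast
    have "real t \<le> real (200 * (n * n * n))" using e(3,4) by (simp only: of_nat_le_iff)
    also have "\<dots> = soft_O 200 0 n (real n powr 3)" using 1(1) by (simp add: soft_O_def powr_numeral power3_eq_cube)
    finally show ?case using e by (intro exI[of _ t] exI[of _ s']) (auto simp: stores_matrix_def repr_def)
  qed
qed

lemma soft_O_mono: "0 \<le> C \<Longrightarrow> 1 \<le> n \<Longrightarrow> x \<le> y \<Longrightarrow> soft_O C c n x \<le> soft_O C c n y"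
  unfolding soft_O_def by (intro mult_right_mono mult_left_mono) auto

section \<open>The algorithm\<close>

text \<open>Indices \<open>i\<close> count from 0: the edge enters with the prefix of length
  \<open>i + 1\<close>, respectively with the suffix of length \<open>m - i\<close>.\<close>

fun weight :: "update_mode \<Rightarrow> nat \<Rightarrow> nat \<Rightarrow> nat" where
  "weight Incremental m i = i + 1"
| "weight Decremental m i = m - i"

fun weight_exp :: "update_mode \<Rightarrow> exp" where
  "weight_exp Incremental = Rv 13 + Nm 1"
| "weight_exp Decremental = Rv vM - Rv 13"

fun enum_prog :: "update_mode \<Rightarrow> prog" where
  "enum_prog Incremental = enum_inc"
| "enum_prog Decremental = enum_dec"

definition preprocess :: "update_mode \<Rightarrow> nat \<Rightarrow> prog \<Rightarrow> prog" where
  "preprocess mode q P = compile (Call (pre_prog q (weight_exp mode) (mm_prog P)) ;; Call dyn_init)"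

definition query_prog :: "update_mode \<Rightarrow> prog" where
  "query_prog mode = compile (Call (enum_prog mode) ;; Call dj_prog)"

lemma wr_query_prog:
  "wr (query_prog mode) \<subseteq> {0, 1, 47, 48, 52, 53, 54, 55, 56, 57, 58, 59, 60, 61, 62, 63}"
  "wb (query_prog mode) \<subseteq> {40, 41, 42, 43}"
  by (cases mode; auto simp: query_prog_def)+

locale dyn_alg = predicted n m q w pred "weight mode m" for n m q w pred and mode :: update_mode +
  fixes KB :: nat
  assumes limKB: "(KB + 3) * (n * n) + KB + 10 < wlim w"
begin

definition posns :: "edge list \<Rightarrow> nat set" where
  "posns es = {Suc i | i. i < m \<and> pred ! i \<in> set es}"

definition state_ok :: "edge list \<Rightarrow> vstate \<Rightarrow> bool" where
  "state_ok es h \<longleftrightarrow> dynamic m (posns es) h \<and> inp h \<and> var h vN = n \<and> var h vM = m \<and> var h vNN = n * n \<and>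
     scales_ok (var h vK) h \<and> var h vK \<le> KB \<and> n * n \<le> scale q (var h vK) \<and> (\<forall>i<m. arr h bIdx (pos i) = i + 1)"

definition updates_ok :: "edge list \<Rightarrow> bool" where
  "updates_ok es \<longleftrightarrow> distinct es \<and> set es \<subseteq> set pred"

lemma posns_subset: "posns es \<subseteq> {1..m}"
  by (auto simp: posns_def)

lemma posns_iff: "Suc i \<in> posns es \<longleftrightarrow> i < m \<and> pred ! i \<in> set es"
  by (auto simp: posns_def)

lemma posns_card: "updates_ok es \<Longrightarrow> card (posns es) = length es"
proof -
  assume ok: "updates_ok es"
  have eq: "(\<lambda>y. pred ! (y - 1)) ` posns es = set es"
  proof
    show "(\<lambda>y. pred ! (y - 1)) ` posns es \<subseteq> set es" by (auto simp: posns_def)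
    show "set es \<subseteq> (\<lambda>y. pred ! (y - 1)) ` posns es"
    proof
      fix e assume e: "e \<in> set es"
      have "e \<in> set pred" using ok e by (auto simp: updates_ok_def)
      then obtain i where "i < m" "pred ! i = e" using m by (auto simp: in_set_conv_nth)
      then show "e \<in> (\<lambda>y. pred ! (y - 1)) ` posns es" using e by (intro image_eqI[of _ _ "Suc i"]) (auto simp: posns_iff)
    qed
  qed
  have "inj_on (\<lambda>y. pred ! (y - 1)) (posns es)"
  proof (rule inj_onI)
    fix x y assume xy: "x \<in> posns es" "y \<in> posns es" "pred ! (x - 1) = pred ! (y - 1)"
    then obtain i j where "x = Suc i" "i < m" "y = Suc j" "j < m" by (auto simp: posns_def)
    then show "x = y" using xy(3) nth_eq_iff_index_eq[OF pred(1), of i j] m by simp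
  qed
  then have "card (posns es) = card (set es)" using card_image eq by metis
  then show ?thesis using ok by (simp add: updates_ok_def distinct_card)
qed

text \<open>The longest present prefix is the front run, which accounts for \<open>r\<close> of the
  updates; the error counts the others.\<close>

lemma error_incremental:
  assumes ok: "updates_ok es" and r: "maximal_run (insert 0 (posns es)) 0 r"
  shows "prediction_error Incremental pred es = int (card {y \<in> posns es. r < y})"
    and "{y \<in> posns es. y \<le> r} = {1..r}" "r \<le> m"
proof -
  have sub: "{1..r} \<subseteq> posns es"
  proof
    fix y assume y: "y \<in> {1..r}"
    then have "y \<in> insert 0 (posns es)" using r unfolding maximal_run_def by auto
    then show "y \<in> posns es" using y by auto
  qed
  then show low: "{y \<in> posns es. y \<le> r} = {1..r}" using posns_subset[of es] by auto
  show rm: "r \<le> m"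
  proof (cases "r = 0")
    case False
    then have "r \<in> {1..r}" by simp
    then have "r \<in> posns es" using sub by blast
    then show ?thesis using posns_subset[of es] by auto
  qed simp
  have "Max {j. j \<le> length pred \<and> set (take j pred) \<subseteq> set es} = r"
  proof (rule Max_eqI)
    show "finite {j. j \<le> length pred \<and> set (take j pred) \<subseteq> set es}" by (rule finite_subset[of _ "{..length pred}"]) auto
    have "e \<in> set es" if "e \<in> set (take r pred)" for e
    proof -
      obtain i where i: "i < r" "pred ! i = e" using \<open>e \<in> set (take r pred)\<close> by (auto simp: in_set_conv_nth)
      then have "Suc i \<in> {1..r}" by auto
      then have "Suc i \<in> posns es" using sub by blast
      then show ?thesis using i by (simp add: posns_iff)
    qed
    then show "r \<in> {j. j \<le> length pred \<and> set (take j pred) \<subseteq> set es}" using rm m by auto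
    fix j assume j: "j \<in> {j. j \<le> length pred \<and> set (take j pred) \<subseteq> set es}"
    show "j \<le> r"
    proof (rule ccontr)
      assume "\<not> j \<le> r"
      then have "r < length (take j pred)" using j by auto
      then have "take j pred ! r \<in> set (take j pred)" by (rule nth_mem)
      then have "pred ! r \<in> set es" using j \<open>\<not> j \<le> r\<close> by auto
      moreover have "r < m" using j \<open>\<not> j \<le> r\<close> m by simp
      ultimately have "Suc r \<in> posns es" by (simp add: posns_iff)
      then show False using r by (simp add: maximal_run_def)
    qed
  qed
  moreover have "card (posns es) = r + card {y \<in> posns es. r < y}"
  proof -
    have fin: "finite (posns es)" using posns_subset finite_subset by blast
    have "posns es = {y \<in> posns es. y \<le> r} \<union> {y \<in> posns es. r < y}" by auto
    moreover have "card ({y \<in> posns es. y \<le> r} \<union> {y \<in> posns es. r < y}) = card {y \<in> posns es. y \<le> r} + card {y \<in> posns es. r < y}"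
      using fin by (intro card_Un_disjoint) auto
    ultimately show ?thesis using low by simp
  qed
  ultimately show "prediction_error Incremental pred es = int (card {y \<in> posns es. r < y})"
    using posns_card[OF ok] by simp
qed

text \<open>The first intact suffix starts right after the greatest deleted position
  \<open>M\<close>, so the error is \<open>M\<close> minus the number of deletions, the number of
  gaps up to \<open>M\<close>.\<close>

lemma error_decremental:
  assumes ok: "updates_ok es" and M: "M \<in> insert 0 (posns es)" "\<forall>y\<in>posns es. y \<le> M"
  shows "prediction_error Decremental pred es = int (card {y. 1 \<le> y \<and> y \<le> M \<and> y \<notin> posns es})" "M \<le> m"
proof -
  show Mm: "M \<le> m" using M(1) posns_subset[of es] by auto
  have "Min {j. 1 \<le> j \<and> j \<le> length pred + 1 \<and> set (drop (j - 1) pred) \<inter> set es = {}} = M + 1"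
  proof (rule Min_eqI)
    show "finite {j. 1 \<le> j \<and> j \<le> length pred + 1 \<and> set (drop (j - 1) pred) \<inter> set es = {}}"
      by (rule finite_subset[of _ "{..length pred + 1}"]) auto
    have "e \<notin> set es" if "e \<in> set (drop M pred)" for e
    proof
      assume "e \<in> set es"
      obtain i where i: "i < length (drop M pred)" "drop M pred ! i = e" using \<open>e \<in> set (drop M pred)\<close> by (auto simp: in_set_conv_nth)
      then have "M + i < m" "pred ! (M + i) = e" using m Mm by auto
      then have "Suc (M + i) \<in> posns es" using \<open>e \<in> set es\<close> by (simp add: posns_iff)
      then show False using M(2) by fastforce
    qed
    then show "M + 1 \<in> {j. 1 \<le> j \<and> j \<le> length pred + 1 \<and> set (drop (j - 1) pred) \<inter> set es = {}}" using Mm m by auto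
    fix j assume j: "j \<in> {j. 1 \<le> j \<and> j \<le> length pred + 1 \<and> set (drop (j - 1) pred) \<inter> set es = {}}"
    show "M + 1 \<le> j"
    proof (rule ccontr)
      assume "\<not> M + 1 \<le> j"
      then have jM: "j \<le> M" "1 \<le> j" using j by auto
      then have "M \<in> posns es" using M(1) by auto
      then have e: "pred ! (M - 1) \<in> set es" using posns_iff[of "M - 1" es] jM by simp
      have "drop (j - 1) pred ! (M - j) \<in> set (drop (j - 1) pred)" by (rule nth_mem) (use jM Mm m in auto)
      moreover have "drop (j - 1) pred ! (M - j) = pred ! (M - 1)" using jM Mm m by simp
      ultimately show False using e j by auto
    qed
  qed
  moreover have "M = card (posns es) + card {y. 1 \<le> y \<and> y \<le> M \<and> y \<notin> posns es}"
  proof -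
    have fin: "finite (posns es)" using posns_subset finite_subset by blast
    have "{1..M} = posns es \<union> {y. 1 \<le> y \<and> y \<le> M \<and> y \<notin> posns es}" using M(2) posns_subset[of es] by auto
    moreover have "card (posns es \<union> {y. 1 \<le> y \<and> y \<le> M \<and> y \<notin> posns es}) = card (posns es) + card {y. 1 \<le> y \<and> y \<le> M \<and> y \<notin> posns es}"
      using fin by (intro card_Un_disjoint) auto
    ultimately show ?thesis by (metis card_atLeastAtMost diff_Suc_1)
  qed
  ultimately show "prediction_error Decremental pred es = int (card {y. 1 \<le> y \<and> y \<le> M \<and> y \<notin> posns es})"
    using posns_card[OF ok] by simp
qed

text \<open>The common interface of both modes: a predicted graph together with as many listed edges
  as the prediction error.\<close>

lemma enum_spec:
  assumes st: "state_ok es h" and ok: "updates_ok es" and v: "var h 0 = u" "var h 1 = v"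
  shows "wp w (enum_prog mode) (\<lambda>h'. clk h' \<le> clk h + 100 * var h' 52 + 100 \<and> (\<exists>Y. var h' 53 \<le> m \<and> emitted u v Y h' \<and>
     current_graph mode pred es = E (var h' 53) \<union> (\<lambda>y. pred ! (y - 1)) ` Y \<and> int (card Y) = prediction_error mode pred es)) h"
proof (cases mode)
  case Incremental
  have d: "dynamic m (posns es) h" "inp h" using st by (auto simp: state_ok_def)
  obtain r where r: "maximal_run (insert 0 (posns es)) 0 r" using run_front[OF posns_subset] by blast
  note er = error_incremental[OF ok r]
  have "set es = E r \<union> (\<lambda>y. pred ! (y - 1)) ` {y \<in> posns es. r < y}"
  proof
    show "set es \<subseteq> E r \<union> (\<lambda>y. pred ! (y - 1)) ` {y \<in> posns es. r < y}"
    proof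
      fix e assume e: "e \<in> set es"
      have "e \<in> set pred" using ok e by (auto simp: updates_ok_def)
      then obtain i where i: "i < m" "pred ! i = e" using m by (auto simp: in_set_conv_nth)
      then have p: "Suc i \<in> posns es" using e by (simp add: posns_iff)
      show "e \<in> E r \<union> (\<lambda>y. pred ! (y - 1)) ` {y \<in> posns es. r < y}"
      proof (cases "Suc i \<le> r")
        case True
        then show ?thesis using i Incremental unfolding E_def by auto
      next
        case False
        then show ?thesis using i p by (intro UnI2 image_eqI[of _ _ "Suc i"]) auto
      qed
    qed
    show "E r \<union> (\<lambda>y. pred ! (y - 1)) ` {y \<in> posns es. r < y} \<subseteq> set es"
    proof
      fix e assume "e \<in> E r \<union> (\<lambda>y. pred ! (y - 1)) ` {y \<in> posns es. r < y}"
      then show "e \<in> set es"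
      proof
        assume "e \<in> E r"
        then obtain i where i: "i < m" "Suc i \<le> r" "e = pred ! i" using Incremental unfolding E_def by auto
        then have "Suc i \<in> {1..r}" by simp
        then have "Suc i \<in> posns es" using er(2) by blast
        then show ?thesis using i by (simp add: posns_iff)
      qed (auto simp: posns_def)
    qed
  qed
  then show ?thesis using Incremental
    by (simp, intro wp_mono[OF enum_inc_spec[OF d v r]]) (use er in auto)
next
  case Decremental
  define M where "M = var h 51"
  have d: "dynamic m (posns es) h" "inp h" "var h vM = m" using st by (auto simp: state_ok_def)
  have M: "M \<in> insert 0 (posns es)" "\<forall>y\<in>posns es. y \<le> M" using d(1) by (auto simp: dynamic_def M_def)
  note er = error_decremental[OF ok M]
  have "set pred - set es = E (m - M) \<union> (\<lambda>y. pred ! (y - 1)) ` {y. 1 \<le> y \<and> y \<le> M \<and> y \<notin> posns es}"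
  proof
    show "set pred - set es \<subseteq> E (m - M) \<union> (\<lambda>y. pred ! (y - 1)) ` {y. 1 \<le> y \<and> y \<le> M \<and> y \<notin> posns es}"
    proof
      fix e assume e: "e \<in> set pred - set es"
      then obtain i where i: "i < m" "pred ! i = e" using m by (auto simp: in_set_conv_nth)
      then have p: "Suc i \<notin> posns es" using e by (simp add: posns_iff)
      show "e \<in> E (m - M) \<union> (\<lambda>y. pred ! (y - 1)) ` {y. 1 \<le> y \<and> y \<le> M \<and> y \<notin> posns es}"
      proof (cases "Suc i \<le> M")
        case True
        then show ?thesis using i p by (intro UnI2 image_eqI[of _ _ "Suc i"]) auto
      next
        case False
        then have "weight mode m i \<le> m - M" using Decremental by simp
        then show ?thesis using i unfolding E_def by auto
      qed
    qed
    show "E (m - M) \<union> (\<lambda>y. pred ! (y - 1)) ` {y. 1 \<le> y \<and> y \<le> M \<and> y \<notin> posns es} \<subseteq> set pred - set es"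
    proof
      fix e assume "e \<in> E (m - M) \<union> (\<lambda>y. pred ! (y - 1)) ` {y. 1 \<le> y \<and> y \<le> M \<and> y \<notin> posns es}"
      then obtain i where i: "i < m" "e = pred ! i" "Suc i \<notin> posns es"
      proof
        assume "e \<in> E (m - M)"
        then obtain i where i: "i < m" "m - i \<le> m - M" "e = pred ! i" using Decremental unfolding E_def by auto
        then have "M < Suc i" by linarith
        then have "Suc i \<notin> posns es" using M(2) by (meson not_less)
        then show thesis using i that by blast
      next
        assume "e \<in> (\<lambda>y. pred ! (y - 1)) ` {y. 1 \<le> y \<and> y \<le> M \<and> y \<notin> posns es}"
        then obtain y where y: "1 \<le> y" "y \<le> M" "y \<notin> posns es" "e = pred ! (y - 1)" by auto
        then show thesis using that[of "y - 1"] er(2) by auto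
      qed
      then have "e \<notin> set es" by (simp add: posns_iff)
      moreover have "e \<in> set pred" using i(1,2) m by simp
      ultimately show "e \<in> set pred - set es" by blast
    qed
  qed
  then show ?thesis using Decremental
    by (simp, intro wp_mono[OF enum_dec_spec[OF d(1,2) v d(3) M_def]]) (use er in auto)
qed

text \<open>A query writes scratch registers and banks 40 to 43 only, so the invariant survives by
  framing. Dijkstra's algorithm runs on the error plus two nodes, with a number of steps of order
  \<open>KB\<close> per pair.\<close>

lemma query_spec:
  assumes st: "state_ok es h" and ok: "updates_ok es" and v: "var h 0 = u" "var h 1 = v" "u < n" "v < n"
  defines "G \<equiv> current_graph mode pred es"
  shows "wp w (query_prog mode) (\<lambda>h'. state_ok es h' \<and>
     int (clk h') \<le> int (clk h) + 1200 * (int KB + 2) * (prediction_error mode pred es + 2)\<^sup>2 \<and>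
     0 \<le> prediction_error mode pred es \<and> var h' 0 = of_bool ((u, v) \<in> G\<^sup>*) \<and>
     ((u, v) \<in> G\<^sup>* \<longrightarrow> distance G u v \<le> var h' 1 \<and> q * var h' 1 \<le> (q + 1) * distance G u v)) h"
proof (rule wp_frame[where R = "\<lambda>h'. int (clk h') \<le> int (clk h) + 1200 * (int KB + 2) * (prediction_error mode pred es + 2)\<^sup>2 \<and>
     0 \<le> prediction_error mode pred es \<and> var h' 0 = of_bool ((u, v) \<in> G\<^sup>*) \<and>
     ((u, v) \<in> G\<^sup>* \<longrightarrow> distance G u v \<le> var h' 1 \<and> q * var h' 1 \<le> (q + 1) * distance G u v)"], goal_cases)
  case 1
  show ?case unfolding query_prog_def
  proof (rule vc_sound, rule vc_call[OF enum_spec[OF st ok v(1,2)]], goal_cases)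
    case (1 h1)
    have wb: "wr (enum_prog mode) \<subseteq> {52, 53, 54, 55}" "wb (enum_prog mode) \<subseteq> {40, 41}" by (cases mode; simp)+
    have f1: "r < 64 \<Longrightarrow> r \<notin> {52, 53, 54, 55} \<Longrightarrow> var h1 r = var h r" "c \<notin> {40, 41} \<Longrightarrow> arr h1 c = arr h c" for r c
      using frm_var[OF 1(2), of r] frm_arr[OF 1(2), of c] wb by auto
    obtain Y where Y: "var h1 53 \<le> m" "emitted u v Y h1" "G = E (var h1 53) \<union> (\<lambda>y. pred ! (y - 1)) ` Y"
      "int (card Y) = prediction_error mode pred es" using 1(1) unfolding G_def by blast
    have Nc: "var h1 52 = card Y + 2" using emitted_count[OF Y(2)] .
    have ck1: "clk h1 \<le> clk h + 100 * var h1 52 + 100" using 1(1) by blast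
    define K where "K = var h vK"
    have Kb: "K \<le> KB" "n * n \<le> scale q K" "scales_ok K h" using st by (auto simp: state_ok_def K_def)
    have kb: "(K + 3) * (n * n) + K + 10 < wlim w"
    proof -
      have "(K + 3) * (n * n) \<le> (KB + 3) * (n * n)" using Kb(1) by (intro mult_le_mono1) simp
      then show ?thesis using limKB Kb(1) by linarith
    qed
    have ab: "arr h1 40 e < n \<and> arr h1 41 e < n" if e: "e < var h1 52" for e
    proof -
      consider "e = 0" | "e = 1" | "2 \<le> e" by linarith
      then show ?thesis
      proof cases
        case 3
        then obtain y where y: "y \<in> Y" "(arr h1 40 e, arr h1 41 e) = pred ! (y - 1)" using Y(2) e unfolding emitted_def by blast
        have "Y \<subseteq> {1..m}" using Y(2) by (simp add: emitted_def)
        then have "1 \<le> y" "y \<le> m" using y(1) by auto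
        then have "y - 1 < m" by simp
        then show ?thesis using pred_less[of "y - 1"] y(2) by (metis fst_conv snd_conv)
      qed (use Y(2) v in \<open>auto simp: emitted_def\<close>)
    qed
    have Geq: "G = E (var h1 53) \<union> {(arr h1 40 e, arr h1 41 e) | e. 2 \<le> e \<and> e < var h1 52}"
    proof -
      have "(\<lambda>y. pred ! (y - 1)) ` Y = {(arr h1 40 e, arr h1 41 e) | e. 2 \<le> e \<and> e < var h1 52}"
      proof
        show "(\<lambda>y. pred ! (y - 1)) ` Y \<subseteq> {(arr h1 40 e, arr h1 41 e) | e. 2 \<le> e \<and> e < var h1 52}"
        proof
          fix p assume "p \<in> (\<lambda>y. pred ! (y - 1)) ` Y"
          then obtain y where y: "y \<in> Y" "p = pred ! (y - 1)" by blast
          then obtain e where "2 \<le> e \<and> e < var h1 52 \<and> (arr h1 40 e, arr h1 41 e) = pred ! (y - 1)" using Y(2) unfolding emitted_def by blast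
          then show "p \<in> {(arr h1 40 e, arr h1 41 e) | e. 2 \<le> e \<and> e < var h1 52}" using y(2) by (intro CollectI exI[of _ e]) simp
        qed
        show "{(arr h1 40 e, arr h1 41 e) | e. 2 \<le> e \<and> e < var h1 52} \<subseteq> (\<lambda>y. pred ! (y - 1)) ` Y"
        proof
          fix p assume "p \<in> {(arr h1 40 e, arr h1 41 e) | e. 2 \<le> e \<and> e < var h1 52}"
          then obtain e where e: "2 \<le> e \<and> e < var h1 52" "p = (arr h1 40 e, arr h1 41 e)" by blast
          then obtain y where "y \<in> Y" "(arr h1 40 e, arr h1 41 e) = pred ! (y - 1)" using Y(2) unfolding emitted_def by blast
          then show "p \<in> (\<lambda>y. pred ! (y - 1)) ` Y" using e(2) by auto
        qed
      qed
      then show ?thesis using Y(3) by simp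
    qed
    interpret query n m q w pred "weight mode m" K "var h1 53" "var h1 52" u v "arr h1 40" "arr h1 41" G
    proof
      show "arr h1 40 0 = u" "arr h1 41 0 = u" "arr h1 40 1 = v" "arr h1 41 1 = v" using Y(2) unfolding emitted_def by blast+
      show "n * n \<le> scale q K" "var h1 53 \<le> m" "(K + 3) * (n * n) + K + 10 < wlim w" by fact+
      show "2 \<le> var h1 52" using Nc by simp
      show "arr h1 40 e < n \<and> arr h1 41 e < n" if "e < var h1 52" for e by (rule ab[OF that])
      show "G = E (var h1 53) \<union> {(arr h1 40 e, arr h1 41 e) | e. 2 \<le> e \<and> e < var h1 52}" by (rule Geq)
    qed
    have s6: "stat6 h1" using st Kb(3) unfolding stat6_def stat5_def by (simp add: f1 state_ok_def scales_ok_def K_def)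
    show ?case
    proof (rule vc_call_last[OF dj_prog_spec[OF s6]], goal_cases)
      case (1 h2)
      let ?N = "var h1 52"
      have "clk h2 \<le> clk h + 100 * ?N + 100 + 1000 * (K + 2) * (?N * ?N)" using 1(1) ck1 by linarith
      also have "\<dots> \<le> clk h + 1200 * (K + 2) * (?N * ?N)"
      proof -
        have 2: "2 \<le> ?N" using Nc by simp
        then have "2 * ?N \<le> ?N * ?N" "4 \<le> ?N * ?N" using mult_le_mono[OF 2 2] by auto
        moreover have "?N * ?N \<le> (K + 2) * (?N * ?N)" by simp
        moreover have "1000 * (K + 2) * (?N * ?N) = 1000 * ((K + 2) * (?N * ?N))" "1200 * (K + 2) * (?N * ?N) = 1200 * ((K + 2) * (?N * ?N))" by (rule mult.assoc)+
        ultimately show ?thesis by linarith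
      qed
      also have "\<dots> \<le> clk h + 1200 * (KB + 2) * (?N * ?N)" using Kb(1) by simp
      finally have "int (clk h2) \<le> int (clk h + 1200 * (KB + 2) * (?N * ?N))" by (simp only: of_nat_le_iff)
      also have "\<dots> = int (clk h) + 1200 * (int KB + 2) * (int ?N)\<^sup>2" by (simp add: power2_eq_square)
      also have "int ?N = prediction_error mode pred es + 2" using Nc Y(4) by simp
      finally show ?case using 1(1) Y(4) by auto
    qed
  qed
next
  case (2 h')
  have f: "r < 64 \<Longrightarrow> r \<notin> {0, 1, 47, 48, 52, 53, 54, 55, 56, 57, 58, 59, 60, 61, 62, 63} \<Longrightarrow> var h' r = var h r"
    "c \<notin> {40, 41, 42, 43} \<Longrightarrow> arr h' c = arr h c" for r c
    using frm_var[OF 2(2), of r] frm_arr[OF 2(2), of c] wr_query_prog[of mode] by auto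
  have "state_ok es h'" using st by (simp add: state_ok_def dynamic_def inp_def scales_ok_def f)
  then show ?case using 2(1) by blast
qed

lemma update_spec:
  assumes st: "state_ok es h" and ok: "updates_ok (es @ [(u, v)])" and v: "var h 0 = u" "var h 1 = v"
  shows "wp w upd_prog (\<lambda>h'. state_ok (es @ [(u, v)]) h' \<and> clk h' \<le> clk h + 200) h"
proof -
  obtain i where i: "i < m" "pred ! i = (u, v)" using ok m by (auto simp: updates_ok_def in_set_conv_nth)
  have uv: "u < n" "v < n" using pred_less[OF i(1)] i(2) by auto
  have p: "pos i = u * n + v" using i(2) by (simp add: pos_def)
  have new: "Suc i \<notin> posns es" using ok i by (simp add: posns_iff updates_ok_def)
  have ins: "posns (es @ [(u, v)]) = insert (Suc i) (posns es)"
  proof -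
    have "pred ! j = (u, v) \<longleftrightarrow> j = i" if "j < m" for j using nth_eq_iff_index_eq[OF pred(1), of j i] that i m by auto
    then show ?thesis using i by (auto simp: posns_def)
  qed
  have lims: "m + 3 < wlim w" "n * n < wlim w" using m_le limn by linarith+
  have s: "dynamic m (posns es) h" "var h vN = n" "arr h bIdx (u * n + v) = Suc i" using st i p by (auto simp: state_ok_def)
  show ?thesis
  proof (rule wp_frame[OF upd_prog_spec[OF s(1) v s(2) uv s(3) _ _ new w lims]], goal_cases)
    case (3 h')
    note f = frm_var[OF 3(2)] frm_arr[OF 3(2)]
    show ?case using 3(1) st unfolding state_ok_def ins by (simp add: f inp_def scales_ok_def)
  qed (use i in auto)
qed

text \<open>The promise on the updates is kept for \<open>es @ updates rs\<close>, the form that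
  passes to the remaining requests. Arguments are passed outside the program, hence the updates of
  registers 0 and 1 at cost 0.\<close>

lemma serves_spec:
  assumes ans: "\<And>es u v h s. updates_ok es \<Longrightarrow> repr w h s \<Longrightarrow> var h 0 = of_bool ((u, v) \<in> (current_graph mode pred es)\<^sup>*) \<Longrightarrow>
      ((u, v) \<in> (current_graph mode pred es)\<^sup>* \<Longrightarrow> distance (current_graph mode pred es) u v \<le> var h 1 \<and>
        q * var h 1 \<le> (q + 1) * distance (current_graph mode pred es) u v) \<Longrightarrow> ans es u v s"
    and ub: "200 \<le> ub" and qb: "\<And>es. updates_ok es \<Longrightarrow> 0 \<le> prediction_error mode pred es \<Longrightarrow>
      1200 * (real KB + 2) * (real_of_int (prediction_error mode pred es) + 2)\<^sup>2 \<le> qb es"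
  shows "repr w h s \<Longrightarrow> state_ok es h \<Longrightarrow> updates_ok (es @ updates rs) \<Longrightarrow> (\<forall>u v. Query u v \<in> set rs \<longrightarrow> u < n \<and> v < n) \<Longrightarrow>
    serves w upd_prog (query_prog mode) ub qb ans es s rs"
proof (induction rs arbitrary: es s h)
  case Nil
  then show ?case by simp
next
  case (Cons r rs)
  have nw: "n < 2 ^ w" using limn by (simp add: wlim_def)
  have pass: "repr w (upd 1 v 0 (upd 0 u 0 h)) (pass_args u v s)" if "u < n" "v < n" for u v
    using Cons.prems(1) that nw by (auto simp: repr_def pass_args_def set_reg_def word_state_def)
  have st: "state_ok es (upd 1 v 0 (upd 0 u 0 h))" for u v using Cons.prems(2) by (simp add: state_ok_def dynamic_def inp_def scales_ok_def)
  show ?case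
  proof (cases r)
    case (Update e)
    obtain u v where e: "e = (u, v)" by (cases e)
    have "e \<in> set pred" using Cons.prems(3) Update by (auto simp: updates_ok_def)
    then have uv: "u < n" "v < n" using pred(2) e by auto
    have ok: "updates_ok (es @ [(u, v)])" using Cons.prems(3) Update e by (auto simp: updates_ok_def)
    have "wp w upd_prog (\<lambda>h'. state_ok (es @ [(u, v)]) h' \<and> clk h' \<le> clk (upd 1 v 0 (upd 0 u 0 h)) + 200) (upd 1 v 0 (upd 0 u 0 h))"
      by (rule update_spec[OF st ok]) auto
    then obtain t s' h' where x: "exec w upd_prog (pass_args u v s) t s'" "repr w h' s'" "clk h' = clk h + t"
      "state_ok (es @ [(u, v)]) h'" "clk h' \<le> clk h + 200" using pass[OF uv] unfolding wp_def by auto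
    have "serves w upd_prog (query_prog mode) ub qb ans (es @ [(u, v)]) s' rs"
      by (rule Cons.IH[OF x(2,4)]) (use Cons.prems Update e in auto)
    moreover have "real t \<le> ub" using x(3,5) ub by simp
    ultimately show ?thesis using x(1) Update e by auto
  next
    case (Query u v)
    have uv: "u < n" "v < n" using Cons.prems(4) Query by auto
    have ok: "updates_ok es" using Cons.prems(3) by (auto simp: updates_ok_def)
    let ?h = "upd 1 v 0 (upd 0 u 0 h)"
    have q: "wp w (query_prog mode) (\<lambda>h'. state_ok es h' \<and>
     int (clk h') \<le> int (clk ?h) + 1200 * (int KB + 2) * (prediction_error mode pred es + 2)\<^sup>2 \<and>
     0 \<le> prediction_error mode pred es \<and> var h' 0 = of_bool ((u, v) \<in> (current_graph mode pred es)\<^sup>*) \<and>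
     ((u, v) \<in> (current_graph mode pred es)\<^sup>* \<longrightarrow> distance (current_graph mode pred es) u v \<le> var h' 1 \<and>
       q * var h' 1 \<le> (q + 1) * distance (current_graph mode pred es) u v)) ?h"
      by (rule query_spec[OF st ok]) (use uv in auto)
    obtain t s' h' where x: "exec w (query_prog mode) (pass_args u v s) t s'" "repr w h' s'" "clk h' = clk h + t"
      "state_ok es h'" "int (clk h') \<le> int (clk h) + 1200 * (int KB + 2) * (prediction_error mode pred es + 2)\<^sup>2"
      "0 \<le> prediction_error mode pred es" "var h' 0 = of_bool ((u, v) \<in> (current_graph mode pred es)\<^sup>*)"
      "(u, v) \<in> (current_graph mode pred es)\<^sup>* \<longrightarrow> distance (current_graph mode pred es) u v \<le> var h' 1 \<and>
       q * var h' 1 \<le> (q + 1) * distance (current_graph mode pred es) u v"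
      using q[unfolded wp_def, rule_format, OF pass[OF uv]] by auto
    have "serves w upd_prog (query_prog mode) ub qb ans es s' rs"
      by (rule Cons.IH[OF x(2,4)]) (use Cons.prems Query in auto)
    moreover have "ans es u v s'" using ans[OF ok x(2,7)] x(8) by blast
    moreover have "real t \<le> qb es"
    proof -
      have "int t \<le> 1200 * (int KB + 2) * (prediction_error mode pred es + 2)\<^sup>2" using x(3,5) by simp
      then have "real_of_int (int t) \<le> real_of_int (1200 * (int KB + 2) * (prediction_error mode pred es + 2)\<^sup>2)" by (simp only: of_int_le_iff)
      then have "real t \<le> 1200 * (real KB + 2) * (real_of_int (prediction_error mode pred es) + 2)\<^sup>2" by simp
      then show ?thesis using qb[OF ok x(6)] by simp
    qed
    ultimately show ?thesis using x(1) Query by auto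
  qed
qed

lemma preprocess_spec:
  assumes mm: "multiplies w n T (mm_prog P)" and M: "budget n T M"
    and v: "var h 0 = n" "var h 1 = m" and i: "inp h"
    and KB: "n * n \<le> scale q KB" "1 \<le> KB"
    and lim: "8 * (n * n * n) * (T + n * n + 2) < wlim w" "KB + 2 * q + 3 < wlim w"
  shows "wp w (preprocess mode q P) (\<lambda>h'. state_ok [] h' \<and>
     clk h' \<le> clk h + KB * (22000 * (n * n + 1 + M) + 200) + 600 * (n * n) + 600) h"
  unfolding preprocess_def
proof (rule vc_sound, rule vc_call[OF pre_prog_spec[OF mm M v _ _ _ KB lim(1) _ lim(2)]], goal_cases)
  case 1
  then show ?case using i by (simp add: inp_def)
next
  case (2 h' i)
  then show ?case using m_le limn by (cases mode) auto
next
  case 3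
  then show ?case by (cases mode) auto
next
  case 4
  then show ?case using limKB by linarith
next
  case (5 h1)
  have lim: "m + 3 < wlim w" using m_le limn by linarith
  show ?case
  proof (rule vc_call_last[OF dyn_init_spec[OF _ w lim]], goal_cases)
    case 1
    then show ?case using 5(1) by blast
  next
    case (2 h2)
    note f = frm_var[OF 2(2)] frm_arr[OF 2(2)]
    have e: "posns [] = {}" by (simp add: posns_def)
    have "state_ok [] h2" using 2(1) 5(1) i unfolding state_ok_def e by (simp add: f inp_def scales_ok_def)
    moreover have "clk h2 \<le> clk h + KB * (22000 * (n * n + 1 + M) + 200) + 600 * (n * n) + 600"
      using 2(1) 5(1)[THEN conjunct1] m_le by linarith
    ultimately show ?case by blast
  qed
qed

end

section \<open>The prediction error is at most \<open>eta_infinity\<close>\<close>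

lemma eta_infinity_ge:
  assumes "i < length es" "j < length pred" "es ! i = pred ! j"
  shows "\<bar>int i - int j\<bar> \<le> eta_infinity pred es"
  unfolding eta_infinity_def
proof (rule Max_ge)
  have "{\<bar>int i - int j\<bar> | i j. i < length es \<and> j < length pred \<and> es ! i = pred ! j}
    \<subseteq> (\<lambda>(i, j). \<bar>int i - int j\<bar>) ` ({..<length es} \<times> {..<length pred})" by auto
  then show "finite (insert 0 {\<bar>int i - int j\<bar> | i j. i < length es \<and> j < length pred \<and> es ! i = pred ! j})"
    by (subst finite_insert, rule finite_subset) simp
qed (use assms in auto)

lemma eta_infinity_nonneg: "0 \<le> eta_infinity pred es"
proof (cases "\<exists>i j. i < length es \<and> j < length pred \<and> es ! i = pred ! j")
  case True
  then show ?thesis using eta_infinity_ge by (meson abs_ge_zero order_trans)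
next
  case False
  then have "{\<bar>int i - int j\<bar> | i j. i < length es \<and> j < length pred \<and> es ! i = pred ! j} = {}" by blast
  then show ?thesis unfolding eta_infinity_def by (simp only: Max_singleton order_refl)
qed

text \<open>One edge realises the error. For insertions it is the first predicted edge still
  missing: it arrives at some time \<open>t \<ge> i\<close>. For deletions it is the last predicted
  edge already deleted, at some time \<open>t < i\<close>.\<close>

lemma prediction_error_le_eta:
  assumes "distinct pred" "valid_updates pred es" "i \<le> length es"
  shows "prediction_error mode pred (take i es) \<le> eta_infinity pred es"
proof -
  have es: "distinct es" "set es = set pred" using assms(2) by (auto simp: valid_updates_def)
  have len: "length es = length pred" using es assms(1) by (metis distinct_card)
  show ?thesis
  proof (cases mode)
    case Incremental
    let ?S = "{j. j \<le> length pred \<and> set (take j pred) \<subseteq> set (take i es)}"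
    define j where "j = Max ?S"
    have fin: "finite ?S" by (rule finite_subset[of _ "{..length pred}"]) auto
    have j: "j \<in> ?S" unfolding j_def by (rule Max_in[OF fin]) (auto intro: exI[of _ 0])
    have pe: "prediction_error mode pred (take i es) = int i - int j" using Incremental assms(3) by (simp add: j_def)
    show ?thesis
    proof (cases "j < length pred")
      case True
      have "pred ! j \<notin> set (take i es)"
      proof
        assume "pred ! j \<in> set (take i es)"
        then have "Suc j \<in> ?S" using j True by (auto simp: take_Suc_conv_app_nth)
        then have "Suc j \<le> j" using Max_ge[OF fin] unfolding j_def by blast
        then show False by simp
      qed
      moreover have "pred ! j \<in> set es" using True es by simp
      then obtain t where t: "t < length es" "es ! t = pred ! j" by (auto simp: in_set_conv_nth)
      have "\<not> t < i"
      proof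
        assume "t < i"
        then have "es ! t \<in> set (take i es)" using t by (auto simp: in_set_conv_nth intro: exI[of _ t])
        then show False using \<open>pred ! j \<notin> set (take i es)\<close> t by simp
      qed
      then show ?thesis using eta_infinity_ge[OF t(1) True t(2)] pe by linarith
    next
      case False
      then show ?thesis using pe len assms(3) eta_infinity_nonneg[of pred es] by linarith
    qed
  next
    case Decremental
    let ?S = "{j. 1 \<le> j \<and> j \<le> length pred + 1 \<and> set (drop (j - 1) pred) \<inter> set (take i es) = {}}"
    define j where "j = Min ?S"
    have fin: "finite ?S" by (rule finite_subset[of _ "{..length pred + 1}"]) auto
    have "length pred + 1 \<in> ?S" by simp
    then have j: "j \<in> ?S" unfolding j_def using Min_in[OF fin] by blast
    have pe: "prediction_error mode pred (take i es) = int j - int i - 1" using Decremental assms(3) by (simp add: j_def)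
    show ?thesis
    proof (cases "j = 1")
      case False
      \<comment> \<open>\<open>j\<close> counts from 1 and starts the first intact suffix; the edge
        before it has index \<open>j - 2\<close> counted from 0 and is already deleted.\<close>
      define k where "k = j - 2"
      have k: "j = k + 2" "k < length pred" using j False unfolding k_def by auto
      have "Suc k \<notin> ?S"
      proof
        assume "Suc k \<in> ?S"
        then have "j \<le> Suc k" unfolding j_def by (rule Min_le[OF fin])
        then show False using k by simp
      qed
      then have "set (drop k pred) \<inter> set (take i es) \<noteq> {}" using k by simp
      moreover have "set (drop (Suc k) pred) \<inter> set (take i es) = {}" using j k by simp
      moreover have "drop k pred = pred ! k # drop (Suc k) pred" using k by (simp add: Cons_nth_drop_Suc)
      ultimately have "pred ! k \<in> set (take i es)" by auto
      then obtain t where t: "t < i" "t < length es" "es ! t = pred ! k" by (auto simp: in_set_conv_nth)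
      show ?thesis using eta_infinity_ge[OF t(2) k(2) t(3)] pe k t(1) by linarith
    next
      case True
      then show ?thesis using pe eta_infinity_nonneg[of pred es] by linarith
    qed
  qed
qed

section \<open>Asymptotic bounds\<close>

lemma log_bounds:
  assumes "1 \<le> n"
  shows "1 \<le> 1 + log 2 (real n)" "1 + log 2 (real n) \<le> real n"
proof -
  show "1 \<le> 1 + log 2 (real n)" using assms by simp
  have "n - 1 < 2 ^ (n - 1)" by (rule less_exp)
  then have "n \<le> 2 ^ (n - 1)" by linarith
  then have "real n \<le> 2 ^ (n - 1)" by (metis of_nat_le_iff of_nat_numeral of_nat_power)
  then have "real n \<le> 2 powr real (n - 1)" by (simp add: powr_realpow)
  then have "log 2 (real n) \<le> real (n - 1)" using assms by (subst log_le_iff) auto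
  then show "1 + log 2 (real n) \<le> real n" using assms by (simp add: of_nat_diff)
qed

text \<open>Passes from the \<open>\<eta> + 2\<close> nodes of a query to the bound
  \<open>1 + \<eta>\<^sup>2\<close>.\<close>

lemma square_plus_two_le: "(x + 2)\<^sup>2 \<le> 8 * (1 + x\<^sup>2)" for x :: real
proof -
  have "0 \<le> (x - 2) * (x - 2)" "0 \<le> x * x" by simp_all
  then show ?thesis unfolding power2_eq_square by (simp only: algebra_simps)
qed

text \<open>With \<open>W = T + n * n\<close> and \<open>r * r = W * n ^ 3\<close>, a count
  \<open>X > 6 * W + 3 * r\<close> would give \<open>X * X > 6 * W * X + 9 * r * r\<close>, more
  than the quadratic inequality admits.\<close>

lemma budget_exists:
  "\<exists>M. budget n T M \<and> real M \<le> 6 * real (T + n * n) + 3 * sqrt (real (T + n * n) * real (n * n * n))"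
proof -
  define N where "N = real (n * n * n)"
  define W where "W = real (T + n * n)"
  define r where "r = sqrt (W * N)"
  have nn: "0 \<le> N" "0 \<le> W" unfolding N_def W_def by simp_all
  then have r: "0 \<le> r" "r * r = W * N" unfolding r_def by (simp_all add: real_sqrt_mult_self)
  define M where "M = nat \<lfloor>6 * W + 3 * r\<rfloor>"
  have b: "0 \<le> 6 * W + 3 * r" using nn r by simp
  have "X \<le> M" if X: "X * X \<le> 4 * (T + n * n) * (n * n * n) + 3 * (T + n * n) * X" for X
  proof -
    define x where "x = real X"
    have "real (X * X) \<le> real (4 * (T + n * n) * (n * n * n) + 3 * (T + n * n) * X)" using X by (simp only: of_nat_le_iff)
    also have "\<dots> = 4 * (W * N) + 3 * (W * x)" unfolding W_def N_def x_def by (simp only: of_nat_add of_nat_mult of_nat_numeral mult.assoc)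
    finally have x2: "x * x \<le> 4 * (r * r) + 3 * (W * x)" unfolding x_def r(2) by simp
    have "x \<le> 6 * W + 3 * r"
    proof (rule ccontr)
      assume "\<not> x \<le> 6 * W + 3 * r"
      then have c: "6 * W + 3 * r < x" by simp
      then have x0: "0 < x" using b by linarith
      have "(6 * W + 3 * r) * x < x * x" using c x0 by (rule mult_strict_right_mono)
      moreover have "r * (3 * r) \<le> r * x" using c nn r by (intro mult_left_mono) auto
      moreover have "0 \<le> W * x" "0 \<le> r * r" using nn x0 by auto
      ultimately show False using x2 by (simp add: algebra_simps)
    qed
    then show ?thesis unfolding M_def x_def using b by (simp add: le_nat_iff le_floor_iff)
  qed
  moreover have "real M \<le> 6 * W + 3 * r" unfolding M_def using b by (simp add: of_nat_floor)
  ultimately show ?thesis unfolding budget_def r_def W_def N_def by blast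
qed

text \<open>The source of the exponent: \<open>(3 + \<tau>) / 2\<close> belongs to the geometric
  mean of \<open>x powr \<tau>\<close> and \<open>x ^ 3\<close>. By \<open>1 \<le> C\<close> the
  root of \<open>C\<close> may be replaced by \<open>C\<close>.\<close>

lemma sqrt_powr_le:
  assumes "W \<le> C * x powr \<tau>" "1 \<le> C" "1 \<le> x" "0 \<le> W"
  shows "sqrt (W * x ^ 3) \<le> C * x powr ((3 + \<tau>) / 2)"
proof (rule real_le_lsqrt)
  show "0 \<le> C * x powr ((3 + \<tau>) / 2)" using assms by simp
  have "W * x ^ 3 \<le> (C * x powr \<tau>) * x ^ 3" using assms by (intro mult_right_mono) auto
  also have "\<dots> = C * x powr (3 + \<tau>)" using assms by (simp add: powr_add powr_numeral)
  also have "\<dots> \<le> (C * C) * x powr (3 + \<tau>)" using assms by (intro mult_right_mono) auto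
  also have "x powr (3 + \<tau>) = x powr ((3 + \<tau>) / 2) * x powr ((3 + \<tau>) / 2)" by (simp add: powr_add[symmetric])
  finally show "W * x ^ 3 \<le> (C * x powr ((3 + \<tau>) / 2))\<^sup>2" by (simp add: power2_eq_square mult_ac)
qed

lemma scales_bound:
  assumes n: "1 \<le> n" and q: "0 < q"
  obtains KB where "n * n \<le> scale q KB" "1 \<le> KB" "real KB \<le> 2 * real q * (1 + log 2 (real n))"
proof -
  define x where "x = nat \<lceil>2 * log 2 (real n)\<rceil>"
  have l0: "0 \<le> log 2 (real n)" using n by simp
  have x1: "2 * log 2 (real n) \<le> real x" "real x \<le> 2 * log 2 (real n) + 1" unfolding x_def using l0 by linarith+
  have "real (n * n) = 2 powr (log 2 (real n) + log 2 (real n))" unfolding powr_add using n by simp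
  also have "\<dots> \<le> 2 powr real x" using x1 by (intro powr_mono) auto
  also have "\<dots> = real (2 ^ x)" by (simp add: powr_realpow)
  finally have "n * n \<le> 2 ^ x" by (simp only: of_nat_le_iff)
  also have "\<dots> \<le> q * 2 ^ x" using q by simp
  finally have "n * n \<le> scale q (q + q * x)" using scale_pow[OF q] by simp
  moreover have "real (q + q * x) \<le> 2 * real q * (1 + log 2 (real n))"
  proof -
    have "real q * real x \<le> real q * (2 * log 2 (real n) + 1)" using x1(2) by (intro mult_left_mono) auto
    then show ?thesis by (simp add: algebra_simps)
  qed
  moreover have "1 \<le> q + q * x" using q by simp
  ultimately show thesis using that by blast
qed

text \<open>Constant factors become powers of two: \<open>B < 2 ^ B\<close> gives
  \<open>B * n ^ j \<le> (2 * n) ^ (B + j)\<close>.\<close>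

lemma below_wlim:
  assumes ok: "word_size_ok \<kappa> n w" and n: "1 \<le> n" and k: "real (B + j) \<le> \<kappa>" and y: "y \<le> B * n ^ j"
  shows "y < wlim w"
proof -
  have "B * n ^ j < 2 ^ B * n ^ j" using less_exp[of B] n by (intro mult_strict_right_mono) auto
  also have "\<dots> \<le> 2 ^ (B + j) * n ^ (B + j)" using n by (intro mult_le_mono power_increasing) auto
  also have "\<dots> = (2 * n) ^ (B + j)" by (rule power_mult_distrib[symmetric])
  also have "\<dots> \<le> wlim w" by (rule word_size_power[OF ok k n])
  finally show ?thesis using y by simp
qed

text \<open>All four problems are instances: they ask for reachability and an estimate within the
  factor \<open>(q + 1) / q\<close>.\<close>

lemma solvable_with_matmul_time:
  assumes mt: "matmul_time \<tau>" and tau: "\<tau> \<le> 3" and q: "0 < q"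
    and ans: "\<And>G u v s. reg s 0 = of_bool ((u, v) \<in> G\<^sup>*) \<Longrightarrow>
      ((u, v) \<in> G\<^sup>* \<Longrightarrow> distance G u v \<le> reg s 1 \<and> q * reg s 1 \<le> (q + 1) * distance G u v) \<Longrightarrow> answer G u v s"
  shows "solvable_with_predictions mode answer ((3 + \<tau>) / 2)"
proof -
  obtain P \<kappa>\<^sub>0 C\<^sub>0 c\<^sub>0 where P: "\<And>n. n \<ge> 1 \<Longrightarrow> \<forall>w. word_size_ok \<kappa>\<^sub>0 n w \<longrightarrow>
        (\<forall>A B s. word_state w s \<and> reg s 0 = n
            \<and> (\<forall>i<n. \<forall>j<n. \<bar>A i j\<bar> \<le> int n ^ 0 \<and> \<bar>B i j\<bar> \<le> int n ^ 0)
            \<and> stores_matrix w n 0 A s \<and> stores_matrix w n 1 B s \<longrightarrow>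
          (\<exists>t s'. exec w P s t s' \<and> real t \<le> soft_O C\<^sub>0 c\<^sub>0 n (real n powr \<tau>)
            \<and> stores_matrix w n 2 (\<lambda>i j. \<Sum>l<n. A i l * B l j) s'))"
    using mt[unfolded matmul_time_def, rule_format, of 0] by blast
  have C0: "1 \<le> C\<^sub>0" using matmul_time_lower[OF P[of 1]] by (simp add: soft_O_def)
  \<comment> \<open>The factor 16 is 2 from \<open>T + n * n \<le> 2 * U\<close> times
    \<open>8 \<ge> 2 powr \<tau>\<close>; the power of two stems from the logarithm of
    \<open>2 * n\<close>.\<close>
  define C\<^sub>1 where "C\<^sub>1 = 16 * C\<^sub>0 * 2 ^ c\<^sub>0"
  have C1: "1 \<le> C\<^sub>1"
  proof -
    have "1 * 1 \<le> (16 * C\<^sub>0) * 2 ^ c\<^sub>0" using C0 by (intro mult_mono) auto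
    then show ?thesis by (simp add: C\<^sub>1_def)
  qed
  define A where "A = nat \<lceil>C\<^sub>1\<rceil>"
  have A: "C\<^sub>1 \<le> real A" unfolding A_def by linarith
  \<comment> \<open>\<open>B\<close> and \<open>j\<close> make \<open>B * n ^ j\<close> exceed every
    number that has to fit into a word; the degree is dictated by
    \<open>8 * (n * n * n) * (T + n * n + 2)\<close>.\<close>
  define B where "B = 24 * A + 17 * q + 22"
  define j where "j = 6 + c\<^sub>0"
  \<comment> \<open>The second argument serves the multiplication program, which runs on matrices of
    order \<open>2 * n\<close>, where
    \<open>1 + log 2 (2 * n) \<le> 2 * (1 + log 2 n)\<close>.\<close>
  define \<kappa> where "\<kappa> = max (real (B + j)) (2 * max \<kappa>\<^sub>0 0)"
  \<comment> \<open>The preprocessing needs \<open>484400 + 1200\<close>, from twice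
    \<open>22000 * 11 + 200\<close> and the terms outside the loop over the levels; the queries need
    38400.\<close>
  define C where "C = 500000 * real q * C\<^sub>1"
  define a where "a = (3 + \<tau>) / 2"
  have main: "\<exists>t s'. exec w (preprocess mode q P) s t s' \<and> real t \<le> soft_O C (c\<^sub>0 + 1) n (real n powr a) \<and>
            (\<forall>rs. valid_requests n pred rs \<longrightarrow>
               serves w upd_prog (query_prog mode) (soft_O C (c\<^sub>0 + 1) n 1)
                 (\<lambda>es. soft_O C (c\<^sub>0 + 1) n (1 + (real_of_int (prediction_error mode pred es))\<^sup>2))
                 (\<lambda>es. answer (current_graph mode pred es)) [] s' rs)"
    if n: "1 \<le> n" and ok: "word_size_ok \<kappa> n w" and vp: "valid_prediction n pred" and ws: "word_state w s"
      and sp: "stores_prediction n pred s" for n w pred s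
  proof -
    define l where "l = 1 + log 2 (real n)"
    have l: "1 \<le> l" "l \<le> real n" using log_bounds[OF n] by (auto simp: l_def)
    have lc: "1 \<le> l ^ c\<^sub>0" using l by simp
    define U where "U = soft_O C\<^sub>0 c\<^sub>0 (2 * n) (real (2 * n) powr \<tau>)"
    \<comment> \<open>Through this lower bound the summand \<open>n * n\<close> in \<open>W\<close>
      costs only a factor 2, whatever \<open>\<tau>\<close> is.\<close>
    have U2: "real (2 * n * (2 * n)) \<le> U" unfolding U_def by (rule matmul_time_lower[OF P]) (use n in auto)
    define T where "T = nat \<lfloor>U\<rfloor>"
    have U0: "0 \<le> U" by (rule order_trans[OF _ U2]) simp
    have T: "real T \<le> U" unfolding T_def using U0 by (simp add: of_nat_floor)
    define Z where "Z = C\<^sub>1 * l ^ c\<^sub>0 * real n powr a"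
    have CL: "1 \<le> C\<^sub>1 * l ^ c\<^sub>0" using mult_mono[OF C1 lc] C1 by simp
    have W: "real (T + n * n) \<le> C\<^sub>1 * l ^ c\<^sub>0 * real n powr \<tau>"
    proof -
      have "real (n * n) \<le> real (2 * n * (2 * n))" by simp
      then have "real (T + n * n) \<le> 2 * U" using T U2 by simp
      also have "\<dots> = 2 * C\<^sub>0 * ((2 powr \<tau> * real n powr \<tau>) * (1 + l) ^ c\<^sub>0)"
        using n by (simp add: U_def soft_O_def powr_mult log_mult l_def)
      also have "\<dots> \<le> 2 * C\<^sub>0 * ((8 * real n powr \<tau>) * (2 * l) ^ c\<^sub>0)"
      proof (intro mult_left_mono mult_mono power_mono)
        have "2 powr \<tau> \<le> (2::real) powr 3" using tau by (intro powr_mono) auto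
        then show "2 powr \<tau> \<le> (8::real)" by simp
      qed (use C0 l in auto)
      finally show ?thesis by (simp add: C\<^sub>1_def power_mult_distrib mult_ac)
    qed
    \<comment> \<open>\<open>\<tau> \<le> 3\<close> means
      \<open>\<tau> \<le> (3 + \<tau>) / 2\<close>, so the linear term of the budget is dominated
      too.\<close>
    have WZ: "real (T + n * n) \<le> Z"
    proof -
      have "C\<^sub>1 * l ^ c\<^sub>0 * real n powr \<tau> \<le> Z" unfolding Z_def a_def using CL tau n by (intro mult_left_mono powr_mono) auto
      then show ?thesis using W by simp
    qed
    have nnZ: "real (n * n) \<le> Z" "1 \<le> Z"
    proof -
      show nz: "real (n * n) \<le> Z" using WZ by simp
      have "1 \<le> n * n" using n by simp
      then have "1 \<le> real (n * n)" by (metis of_nat_1 of_nat_le_iff)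
      then show "1 \<le> Z" using nz by simp
    qed
    obtain M where M: "budget n T M" "real M \<le> 6 * real (T + n * n) + 3 * sqrt (real (T + n * n) * real (n * n * n))"
      using budget_exists by blast
    have MZ: "real M \<le> 9 * Z"
    proof -
      have "sqrt (real (T + n * n) * real n ^ 3) \<le> Z" unfolding Z_def a_def by (rule sqrt_powr_le[OF W CL]) (use n in auto)
      moreover have "real (n * n * n) = real n ^ 3" by (simp add: power3_eq_cube)
      ultimately show ?thesis using M(2) WZ by simp
    qed
    obtain KB where KB: "n * n \<le> scale q KB" "1 \<le> KB" "real KB \<le> 2 * real q * l"
      using scales_bound[OF n q] unfolding l_def by blast
    have KBn: "KB \<le> 2 * q * n"
    proof -
      have "2 * real q * l \<le> 2 * real q * real n" using l by (intro mult_left_mono) auto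
      then have "real KB \<le> real (2 * q * n)" using KB(3) by simp
      then show ?thesis by (simp only: of_nat_le_iff)
    qed
    have kB: "real (B + j) \<le> \<kappa>" by (simp add: \<kappa>_def)
    note lim = below_wlim[OF ok n kB]
    have pw: "n ^ i \<le> n ^ j" if "i \<le> j" for i using that n by (intro power_increasing) auto
    have p: "1 \<le> n ^ j" "n \<le> n ^ j" "n * n \<le> n ^ j" "n * n * n \<le> n ^ j"
      using pw[of 0] pw[of 1] pw[of 2] pw[of 3] by (auto simp: j_def power2_eq_square power3_eq_cube)
    have qp: "q * n ^ i \<le> q * n ^ j" if "i \<le> j" for i using pw[OF that] by (rule mult_le_mono2)
    have Bj: "B * n ^ j = 24 * (A * n ^ j) + 17 * (q * n ^ j) + 22 * n ^ j" by (simp add: B_def algebra_simps)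
    have lim1: "6 * (n * n) + 6 * n + 10 < wlim w" by (rule lim) (use p Bj in linarith)
    have lim2: "(KB + 3) * (n * n) + KB + 10 < wlim w"
    proof (rule lim)
      have "KB * (n * n) \<le> 2 * q * n * (n * n)" using KBn by (rule mult_le_mono1)
      then have "KB * (n * n) \<le> 2 * (q * n ^ 3)" by (simp only: power3_eq_cube mult.assoc)
      moreover have "q * n ^ 3 \<le> q * n ^ j" "q * n ^ 1 \<le> q * n ^ j" using qp[of 3] qp[of 1] by (auto simp: j_def)
      moreover have "KB \<le> 2 * (q * n ^ 1)" using KBn by simp
      ultimately show "(KB + 3) * (n * n) + KB + 10 \<le> B * n ^ j" unfolding add_mult_distrib Bj using p by linarith
    qed
    have lim3: "KB + 2 * q + 3 < wlim w"
    proof (rule lim)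
      have "q * n ^ 0 \<le> q * n ^ j" "q * n ^ 1 \<le> q * n ^ j" using qp[of 0] qp[of 1] by (auto simp: j_def)
      moreover have "KB \<le> 2 * (q * n ^ 1)" using KBn by simp
      moreover have "q * n ^ 0 = q" by simp
      ultimately show "KB + 2 * q + 3 \<le> B * n ^ j" unfolding Bj using p by linarith
    qed
    have lim4: "8 * (n * n * n) * (T + n * n + 2) < wlim w"
    proof (rule lim)
      have "real n powr \<tau> \<le> real n powr 3" using tau n by (intro powr_mono) auto
      also have "\<dots> = real n ^ 3" using n by (simp add: powr_numeral)
      finally have "C\<^sub>1 * l ^ c\<^sub>0 * real n powr \<tau> \<le> real A * real n ^ c\<^sub>0 * real n ^ 3"
        using A C1 l by (intro mult_mono power_mono) auto
      then have "real (T + n * n) \<le> real A * real n ^ c\<^sub>0 * real n ^ 3" using W by (rule order_trans[rotated])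
      also have "\<dots> = real (A * n ^ (c\<^sub>0 + 3))" by (simp add: power_add)
      finally have TA: "T + n * n \<le> A * n ^ (c\<^sub>0 + 3)" by (simp only: of_nat_le_iff)
      have "1 \<le> A" using A C1 by linarith
      then have "1 * 1 \<le> A * n ^ (c\<^sub>0 + 3)" using n by (intro mult_le_mono) auto
      then have "T + n * n + 2 \<le> 3 * (A * n ^ (c\<^sub>0 + 3))" using TA by linarith
      then have "8 * (n * n * n) * (T + n * n + 2) \<le> 8 * (n * n * n) * (3 * (A * n ^ (c\<^sub>0 + 3)))" by (rule mult_le_mono2)
      also have "\<dots> = 24 * (A * (n ^ 3 * n ^ (c\<^sub>0 + 3)))" unfolding power3_eq_cube by (simp only: mult_ac)
      also have "n ^ 3 * n ^ (c\<^sub>0 + 3) = n ^ j" by (simp add: power_add[symmetric] j_def add_ac)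
      finally show "8 * (n * n * n) * (T + n * n + 2) \<le> B * n ^ j" unfolding Bj by linarith
    qed
    have w: "0 < w" using lim1 by (cases w) (auto simp: wlim_def)
    have w2: "2 * n < 2 ^ w" using lim1 by (simp add: wlim_def)
    interpret dyn_alg n "length pred" q w pred mode KB
    proof
      show "distinct pred" "set pred \<subseteq> {..<n} \<times> {..<n}" using vp by (auto simp: valid_prediction_def)
      show "0 < weight mode (length pred) i \<and> weight mode (length pred) i \<le> length pred" if "i < length pred" for i
        using that by (cases mode) auto
    qed (use n q w lim1 lim2 in auto)
    have ok0: "word_size_ok \<kappa>\<^sub>0 (2 * n) w"
    proof -
      have "\<kappa>\<^sub>0 * (1 + log 2 (real (2 * n))) = \<kappa>\<^sub>0 * (1 + l)" using n by (simp add: log_mult l_def)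
      also have "\<dots> \<le> max \<kappa>\<^sub>0 0 * (2 * l)" using l by (intro mult_mono) auto
      also have "\<dots> = (2 * max \<kappa>\<^sub>0 0) * l" by simp
      also have "\<dots> \<le> \<kappa> * l" using l by (intro mult_right_mono) (auto simp: \<kappa>_def)
      finally show ?thesis using ok by (simp add: word_size_ok_def l_def)
    qed
    have mm: "multiplies w n T (mm_prog P)"
    proof (rule mm_prog_multiplies[OF w w2])
      fix A B :: "nat \<Rightarrow> nat \<Rightarrow> int" and s
      assume as: "word_state w s" "reg s 0 = 2 * n" "\<forall>i<2 * n. \<forall>j<2 * n. \<bar>A i j\<bar> \<le> 1 \<and> \<bar>B i j\<bar> \<le> 1"
        "stores_matrix w (2 * n) 0 A s" "stores_matrix w (2 * n) 1 B s"
      have "1 \<le> 2 * n" using n by simp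
      from P[OF this, rule_format, OF ok0, of s A B] as
      obtain t s' where t: "exec w P s t s'" "real t \<le> U" "stores_matrix w (2 * n) 2 (\<lambda>i j. \<Sum>l<2 * n. A i l * B l j) s'"
        unfolding U_def by auto
      have "t \<le> T" unfolding T_def using t(2) U0 by (simp add: le_nat_iff le_floor_iff)
      then show "\<exists>t s'. exec w P s t s' \<and> t \<le> T \<and> stores_matrix w (2 * n) 2 (\<lambda>i j. \<Sum>l<2 * n. A i l * B l j) s'" using t by blast
    qed
    define h where "h = \<lparr>var = reg s, arr = mem s, clk = 0\<rparr>"
    have h: "repr w h s" "var h 0 = n" "var h 1 = length pred" "inp h" "clk h = 0"
      using ws sp by (auto simp: h_def repr_def stores_prediction_def inp_def)
    obtain t s' h' where r: "exec w (preprocess mode q P) s t s'" "repr w h' s'" "clk h' = t" "state_ok [] h'"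
      "clk h' \<le> KB * (22000 * (n * n + 1 + M) + 200) + 600 * (n * n) + 600"
      using preprocess_spec[OF mm M(1) h(2-4) KB(1,2) lim4 lim3, unfolded wp_def, rule_format, OF h(1)] h(5) by auto
    \<comment> \<open>The extra logarithm in \<open>c\<^sub>0 + 1\<close> is the number of levels,
      each costing one product.\<close>
    have "real t \<le> soft_O C (c\<^sub>0 + 1) n (real n powr a)"
    proof -
      have "real t \<le> real (KB * (22000 * (n * n + 1 + M) + 200) + 600 * (n * n) + 600)" using r(3,5) by (simp only: of_nat_le_iff)
      also have "\<dots> = real KB * (22000 * (real (n * n) + 1 + real M) + 200) + 600 * real (n * n) + 600"
        by (simp only: of_nat_add of_nat_mult of_nat_numeral of_nat_1)
      also have "\<dots> \<le> (2 * real q * l) * (242200 * Z) + 1200 * Z"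
      proof -
        have "22000 * (x + 1 + y) + 200 \<le> 242200 * Z" if "x \<le> Z" "y \<le> 9 * Z" for x y using that nnZ(2) by simp
        from this[OF nnZ(1) MZ] have "22000 * (real (n * n) + 1 + real M) + 200 \<le> 242200 * Z" .
        then have "real KB * (22000 * (real (n * n) + 1 + real M) + 200) \<le> (2 * real q * l) * (242200 * Z)"
          using KB(3) l by (intro mult_mono) auto
        then show ?thesis using nnZ by linarith
      qed
      also have "\<dots> \<le> (2 * real q * l) * (242200 * Z) + 1200 * (real q * l * Z)"
      proof -
        have "1 * 1 \<le> real q * l" using q l by (intro mult_mono) auto
        then have "1 * Z \<le> (real q * l) * Z" using nnZ by (intro mult_right_mono) auto
        then show ?thesis by (simp add: mult_ac)
      qed
      also have "\<dots> \<le> 500000 * (real q * l * Z)"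
      proof -
        have "0 \<le> real q * l * Z" using l nnZ by simp
        moreover have "(2 * real q * l) * (242200 * Z) = 484400 * (real q * l * Z)" by simp
        ultimately show ?thesis by linarith
      qed
      finally show ?thesis by (simp add: soft_O_def C_def Z_def l_def mult_ac)
    qed
    moreover have "serves w upd_prog (query_prog mode) (soft_O C (c\<^sub>0 + 1) n 1)
                 (\<lambda>es. soft_O C (c\<^sub>0 + 1) n (1 + (real_of_int (prediction_error mode pred es))\<^sup>2))
                 (\<lambda>es. answer (current_graph mode pred es)) [] s' rs" if rs: "valid_requests n pred rs" for rs
    proof (rule serves_spec[OF _ _ _ r(2,4)])
      fix es u v h and s :: state
      assume "repr w h s" "var h 0 = of_bool ((u, v) \<in> (current_graph mode pred es)\<^sup>*)"
        "(u, v) \<in> (current_graph mode pred es)\<^sup>* \<Longrightarrow> distance (current_graph mode pred es) u v \<le> var h 1 \<and>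
          q * var h 1 \<le> (q + 1) * distance (current_graph mode pred es) u v"
      then show "answer (current_graph mode pred es) u v s" by (intro ans) (auto simp: repr_def)
    next
      have L: "l \<le> l ^ (c\<^sub>0 + 1)" using mult_right_mono[OF lc, of l] l by (simp add: mult_ac)
      have qC: "real q * 500000 \<le> C" using C1 q by (simp add: C_def)
      have qlC: "500000 * (real q * l) \<le> C * l ^ (c\<^sub>0 + 1)" using mult_mono[OF qC L] l C1 q by (simp add: C_def mult_ac)
      have ql: "1 \<le> real q * l" using mult_mono[of 1 "real q" 1 l] q l by simp
      show "200 \<le> soft_O C (c\<^sub>0 + 1) n 1" using qlC ql by (simp add: soft_O_def l_def)
      fix es
      define \<eta> where "\<eta> = real_of_int (prediction_error mode pred es)"
      assume "0 \<le> prediction_error mode pred es"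
      then have e0: "0 \<le> \<eta>" by (simp add: \<eta>_def)
      have e: "(\<eta> + 2)\<^sup>2 \<le> 8 * (1 + \<eta>\<^sup>2)" by (rule square_plus_two_le)
      have "1200 * (real KB + 2) * (\<eta> + 2)\<^sup>2 \<le> (1200 * (4 * (real q * l))) * (8 * (1 + \<eta>\<^sup>2))"
        using KB(3) ql e by (intro mult_mono) auto
      also have "\<dots> = 38400 * (real q * l) * (1 + \<eta>\<^sup>2)" by simp
      also have "\<dots> \<le> (C * l ^ (c\<^sub>0 + 1)) * (1 + \<eta>\<^sup>2)" using qlC ql by (intro mult_right_mono) auto
      finally show "1200 * (real KB + 2) * (real_of_int (prediction_error mode pred es) + 2)\<^sup>2
          \<le> soft_O C (c\<^sub>0 + 1) n (1 + (real_of_int (prediction_error mode pred es))\<^sup>2)"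
        by (simp add: soft_O_def l_def \<eta>_def mult_ac)
    next
      show "updates_ok ([] @ updates rs)" "\<forall>u v. Query u v \<in> set rs \<longrightarrow> u < n \<and> v < n"
        using rs by (auto simp: valid_requests_def valid_updates_def updates_ok_def)
    qed
    ultimately show ?thesis using r(1) by blast
  qed
  show ?thesis unfolding solvable_with_predictions_def a_def[symmetric]
    by (rule exI[of _ "preprocess mode q P"], rule exI[of _ upd_prog], rule exI[of _ "query_prog mode"], rule exI[of _ \<kappa>],
        rule exI[of _ C], rule exI[of _ "c\<^sub>0 + 1"], intro allI impI, elim conjE) (rule main)
qed

lemma solvable_mono:
  assumes "solvable_with_predictions mode answer a" "a \<le> b"
  shows "solvable_with_predictions mode answer b"
proof -
  obtain P U Q \<kappa> C c where S: "\<And>n w pred s. n \<ge> 1 \<Longrightarrow> word_size_ok \<kappa> n w \<Longrightarrow>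
        valid_prediction n pred \<and> word_state w s \<and> stores_prediction n pred s \<Longrightarrow>
          (\<exists>t s'. exec w P s t s' \<and> real t \<le> soft_O C c n (real n powr a) \<and>
            (\<forall>rs. valid_requests n pred rs \<longrightarrow>
               serves w U Q (soft_O C c n 1)
                 (\<lambda>es. soft_O C c n (1 + (real_of_int (prediction_error mode pred es))\<^sup>2))
                 (\<lambda>es. answer (current_graph mode pred es)) [] s' rs))"
    using assms(1)[unfolded solvable_with_predictions_def] by blast
  have le: "x \<le> soft_O C c n (real n powr b)" if x: "x \<le> soft_O C c n (real n powr a)" "0 \<le> x" and n: "1 \<le> n" for x n
  proof -
    have l: "0 < (1 + log 2 (real n)) ^ c" using log_bounds(1)[OF n] by (intro zero_less_power) linarith
    \<comment> \<open>The sign of \<open>C\<close> is read off from the bound itself, which is at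
      least a nonnegative running time.\<close>
    have "0 \<le> (C * real n powr a) * (1 + log 2 (real n)) ^ c" using x by (simp add: soft_O_def)
    then have "0 \<le> C * real n powr a" using l by (simp add: zero_le_mult_iff)
    then have "0 \<le> C" using n by (simp add: zero_le_mult_iff)
    then have "soft_O C c n (real n powr a) \<le> soft_O C c n (real n powr b)"
      using n assms(2) by (intro soft_O_mono powr_mono) auto
    then show ?thesis using x by linarith
  qed
  show ?thesis unfolding solvable_with_predictions_def
  proof (rule exI[of _ P], rule exI[of _ U], rule exI[of _ Q], rule exI[of _ \<kappa>], rule exI[of _ C], rule exI[of _ c], intro allI impI)
    fix n :: nat and w pred s
    assume n: "1 \<le> n" and "word_size_ok \<kappa> n w" "valid_prediction n pred \<and> word_state w s \<and> stores_prediction n pred s"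
    from S[OF this] le[OF _ _ n] show "\<exists>t s'. exec w P s t s' \<and> real t \<le> soft_O C c n (real n powr b) \<and>
            (\<forall>rs. valid_requests n pred rs \<longrightarrow>
               serves w U Q (soft_O C c n 1)
                 (\<lambda>es. soft_O C c n (1 + (real_of_int (prediction_error mode pred es))\<^sup>2))
                 (\<lambda>es. answer (current_graph mode pred es)) [] s' rs)" by (meson of_nat_0_le_iff)
  qed
qed

theorem theorem1p2:
  fixes \<epsilon> \<tau> :: real
  assumes "0 < \<epsilon>"
    and "matmul_time \<tau> \<or> matmul_exponent < \<tau>"
  shows "solvable_with_predictions Incremental transitive_closure_answer ((3 + \<tau>) / 2)
       \<and> solvable_with_predictions Decremental transitive_closure_answer ((3 + \<tau>) / 2)
       \<and> solvable_with_predictions Incremental (approx_apsp_answer \<epsilon>) ((3 + \<tau>) / 2)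
       \<and> solvable_with_predictions Decremental (approx_apsp_answer \<epsilon>) ((3 + \<tau>) / 2)
       \<and> (\<forall>mode pred es i. distinct pred \<and> valid_updates pred es \<and> i \<le> length es \<longrightarrow>
            prediction_error mode pred (take i es) \<le> eta_infinity pred es)"
proof -
  obtain \<sigma> where s: "matmul_time \<sigma>" "\<sigma> \<le> \<tau>"
  proof (cases "matmul_time \<tau>")
    case False
    then have lt: "Inf {\<tau>. matmul_time \<tau>} < \<tau>" using assms(2) by (simp add: matmul_exponent_def)
    have "{\<tau>. matmul_time \<tau>} \<noteq> {}" using matmul_time_3 by blast
    from cInf_lessD[OF this lt] show thesis using that by auto
  qed (use that in auto)
  \<comment> \<open>Capping the exponent at 3 meets the hypothesis of
    \<open>solvable_with_matmul_time\<close>; \<open>solvable_mono\<close> leads back to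
    \<open>\<tau>\<close>.\<close>
  obtain \<rho> where r: "matmul_time \<rho>" "\<rho> \<le> \<tau>" "\<rho> \<le> 3"
  proof (cases "\<sigma> \<le> 3")
    case False
    then show thesis using that[of 3] matmul_time_3 s by simp
  qed (use s that in auto)
  have up: "solvable_with_predictions mode answer ((3 + \<tau>) / 2)" if "solvable_with_predictions mode answer ((3 + \<rho>) / 2)" for mode answer
    by (rule solvable_mono[OF that]) (use r in auto)
  \<comment> \<open>Reachability is answered exactly for every \<open>q\<close>, so the coarsest
    choice \<open>q = 1\<close> is taken.\<close>
  have tc: "solvable_with_predictions mode transitive_closure_answer ((3 + \<tau>) / 2)" for mode
    by (intro up solvable_with_matmul_time[OF r(1,3), of 1]) (auto simp: transitive_closure_answer_def)
  \<comment> \<open>The least natural number with \<open>1 / q \<le> \<epsilon>\<close>.\<close>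
  define q where "q = nat \<lceil>1 / \<epsilon>\<rceil>"
  have q: "1 \<le> real q * \<epsilon>" "0 < q"
  proof -
    have "1 / \<epsilon> \<le> real q" unfolding q_def by linarith
    then show "1 \<le> real q * \<epsilon>" using assms(1) by (simp add: field_simps)
    then show "0 < q" by (cases q) auto
  qed
  have apsp: "solvable_with_predictions mode (approx_apsp_answer \<epsilon>) ((3 + \<tau>) / 2)" for mode
  proof (intro up solvable_with_matmul_time[OF r(1,3) q(2)])
    fix G u v and s :: state
    assume a: "reg s 0 = of_bool ((u, v) \<in> G\<^sup>*)"
      and d: "(u, v) \<in> G\<^sup>* \<Longrightarrow> distance G u v \<le> reg s 1 \<and> q * reg s 1 \<le> (q + 1) * distance G u v"
    have "real (reg s 1) \<le> (1 + \<epsilon>) * real (distance G u v)" if uv: "(u, v) \<in> G\<^sup>*"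
    proof -
      have "real (q * reg s 1) \<le> real ((q + 1) * distance G u v)" using d[OF uv] by (simp only: of_nat_le_iff)
      then have "real q * real (reg s 1) \<le> (real q + 1) * real (distance G u v)" by (simp add: algebra_simps)
      also have "\<dots> \<le> (real q + real q * \<epsilon>) * real (distance G u v)" using q(1) by (intro mult_right_mono) auto
      also have "\<dots> = real q * ((1 + \<epsilon>) * real (distance G u v))" by (simp add: algebra_simps)
      finally show ?thesis using q(2) by simp
    qed
    then show "approx_apsp_answer \<epsilon> G u v s" using a d by (auto simp: approx_apsp_answer_def)
  qed
  show ?thesis using tc apsp prediction_error_le_eta by blast
qed

end
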